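(* Let $(E,\overline{\partial}_E,K)$ be a stable Hermitian holomorphic vector bundle on $\mathbb{C}$ (with its standard Euclidean metric) with $|F_K|\in L^1(\mathbb{C})$, and let $H_1,H_2$ be two Hermitian-Einstein metrics on $(E,\overline{\partial}_E)$ compatible with $K$. Then $H_1=H_2$.
   Context: Let $N=\mathbb{C}$ with metric $g$ and fundamental form $\omega_g=g(J\cdot,\cdot)$; $\Lambda$ is the adjoint of multiplication by $\omega_g$. A Hermitian holomorphic vector bundle $(E,\overline{\partial}_E,K)$ is a holomorphic vector bundle with a Hermitian metric $K$. For a Hermitian metric $H$ on $E$, $D_H$ is the Chern connection, $F_H=D_H^2$ its curvature, and $\Lambda F_H^\perp=\Lambda F_H-\frac{\mathrm{tr}\,\Lambda F_H}{\mathrm{rank}(E)}\mathrm{id}_E$. $H$ is a Hermitian-Einstein metric if $\Lambda F_H^\perp=0$. Norms without subscript are taken with respect to $K$ and $g$. Compatibility: with $h=K^{-1}H\in C^\infty(N,\mathrm{End}(E))$ defined by $H(\cdot,\cdot)=K(h(\cdot),\cdot)$, $H$ is compatible with $K$ if $\det K=\det H$, $|h|\in L^\infty(N)$ and $|\overline{\partial}_E h|\in L^2(N)$. Stability: $\deg(E,K)=\int_N \mathrm{tr}\sqrt{-1}\Lambda F_K\,\mathrm{dvol}_g$. A saturated subsheaf $\mathcal{S}\subset\mathcal{O}_N(E)$ (coherent, torsion-free quotient) is a holomorphic sub-bundle outside a closed analytic subset $Z(\mathcal{S})$ of complex codimension at least two (so $Z(\mathcal{S})=\emptyset$ here), and $\deg(\mathcal{S},K)$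 is the integral over $N\setminus Z(\mathcal{S})$ of $\mathrm{tr}\sqrt{-1}\Lambda F_{K|_{\mathcal{S}}}$, where $K|_{\mathcal{S}}$ is the induced metric; equivalently (Chern-Weil formula) $\deg(\mathcal{S},K)=\int_{N\setminus Z(\mathcal{S})}(\mathrm{tr}(\sqrt{-1}\pi_K\circ\Lambda F_K)-|\overline{\partial}_E\pi_K|^2)\,\mathrm{dvol}_g$, with $\pi_K$ the $K$-orthogonal projection onto $\mathcal{S}$ (the value $-\infty$ is allowed). $(E,\overline{\partial}_E,K)$ is stable if $\frac{\deg(\mathcal{S},K)}{\mathrm{rank}(\mathcal{S})}<\frac{\deg(E,K)}{\mathrm{rank}(E)}$ for every nontrivial saturated subsheaf $\mathcal{S}$ (i.e. $0<\mathrm{rank}(\mathcal{S})<\mathrm{rank}(E)$). *)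

theory Defs
  imports "HOL-Complex_Analysis.Complex_Analysis" "Jordan_Normal_Form.Determinant"
begin

section \<open>Smooth functions on the plane and Wirtinger derivatives\<close>

primrec C_k_on :: "nat \<Rightarrow> complex set \<Rightarrow> (complex \<Rightarrow> complex) \<Rightarrow> bool" where
  "C_k_on 0 U f = continuous_on U f"
| "C_k_on (Suc k) U f =
     ((\<forall>z\<in>U. f differentiable (at z)) \<and>
      C_k_on k U (\<lambda>z. frechet_derivative f (at z) 1) \<and>
      C_k_on k U (\<lambda>z. frechet_derivative f (at z) \<i>))"

definition smooth_on :: "complex set \<Rightarrow> (complex \<Rightarrow> complex) \<Rightarrow> bool" where
  "smooth_on U f \<longleftrightarrow> (\<forall>k. C_k_on k U f)"

definition d_z :: "(complex \<Rightarrow> complex) \<Rightarrow> complex \<Rightarrow> complex" where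
  "d_z f z = (frechet_derivative f (at z) 1 - \<i> * frechet_derivative f (at z) \<i>) / 2"

definition d_zbar :: "(complex \<Rightarrow> complex) \<Rightarrow> complex \<Rightarrow> complex" where
  "d_zbar f z = (frechet_derivative f (at z) 1 + \<i> * frechet_derivative f (at z) \<i>) / 2"


section \<open>Holomorphic vector bundles over the complex plane\<close>

text \<open>The fibres are complex subspaces of one complex vector space, the type of vectors with
  scalar multiplication \<open>scl\<close>; since that space is arbitrary and carries no topology, this
  only provides a set of vectors for the fibres to live in.  The holomorphic structure is
  an atlas of local trivializations, each given as its holomorphic frame: \<open>(U, e)\<close> is an
  open set together with the list of sections forming the frame.\<close>

record 'v hol_bundle =
  scl :: "complex \<Rightarrow> 'v \<Rightarrow> 'v"
  fibre :: "complex \<Rightarrow> 'v set"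
  frames :: "(complex set \<times> (complex \<Rightarrow> 'v) list) set"

definition fibre_basis ::
  "('v::ab_group_add) hol_bundle \<Rightarrow> (complex \<Rightarrow> 'v) list \<Rightarrow> complex \<Rightarrow> bool" where
  "fibre_basis E e z \<longleftrightarrow>
     distinct (map (\<lambda>s. s z) e) \<and>
     \<not> module.dependent (scl E) ((\<lambda>s. s z) ` set e) \<and>
     module.span (scl E) ((\<lambda>s. s z) ` set e) = fibre E z"

definition coord ::
  "('v::ab_group_add) hol_bundle \<Rightarrow> (complex \<Rightarrow> 'v) list \<Rightarrow> nat \<Rightarrow> complex \<Rightarrow> 'v \<Rightarrow> complex" where
  "coord E e i z v = module.representation (scl E) ((\<lambda>s. s z) ` set e) v ((e ! i) z)"

definition bundle_base :: "'v hol_bundle \<Rightarrow> complex set" where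
  "bundle_base E = (\<Union>(U, e)\<in>frames E. U)"

definition hol_vector_bundle :: "('v::ab_group_add) hol_bundle \<Rightarrow> bool" where
  "hol_vector_bundle E \<longleftrightarrow>
     vector_space (scl E) \<and>
     (\<forall>z. module.subspace (scl E) (fibre E z)) \<and>
     (\<exists>r. \<forall>z. vector_space.dim (scl E) (fibre E z) = r) \<and>
     bundle_base E = UNIV \<and>
     (\<forall>(U, e)\<in>frames E. open U \<and> (\<forall>z\<in>U. fibre_basis E e z)) \<and>
     (\<forall>(U, e)\<in>frames E. \<forall>(V, f)\<in>frames E. \<forall>i<length e. \<forall>j<length f.
        (\<lambda>z. coord E e i z ((f ! j) z)) holomorphic_on (U \<inter> V))"

text \<open>The restriction to \<open>bundle_base E\<close> matters only for the bundles \<open>subbundle E S\<close> below.\<close>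

definition bundle_rank :: "('v::ab_group_add) hol_bundle \<Rightarrow> nat" where
  "bundle_rank E = (THE r. \<forall>z\<in>bundle_base E. vector_space.dim (scl E) (fibre E z) = r)"

definition hol_section ::
  "('v::ab_group_add) hol_bundle \<Rightarrow> complex set \<Rightarrow> (complex \<Rightarrow> 'v) \<Rightarrow> bool" where
  "hol_section E W s \<longleftrightarrow>
     open W \<and> (\<forall>z\<in>W. s z \<in> fibre E z) \<and>
     (\<forall>(U, e)\<in>frames E. \<forall>i<length e. (\<lambda>z. coord E e i z (s z)) holomorphic_on (U \<inter> W))"

definition smooth_section ::
  "('v::ab_group_add) hol_bundle \<Rightarrow> complex set \<Rightarrow> (complex \<Rightarrow> 'v) \<Rightarrow> bool" where
  "smooth_section E W s \<longleftrightarrow>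
     open W \<and> (\<forall>z\<in>W. s z \<in> fibre E z) \<and>
     (\<forall>(U, e)\<in>frames E. \<forall>i<length e. smooth_on (U \<inter> W) (\<lambda>z. coord E e i z (s z)))"

text \<open>The objects defined from \<open>frame_at\<close> do not depend on the choice of the frame.\<close>

definition frame_at :: "'v hol_bundle \<Rightarrow> complex \<Rightarrow> (complex \<Rightarrow> 'v) list" where
  "frame_at E z = (SOME e. \<exists>U. (U, e) \<in> frames E \<and> z \<in> U)"

text \<open>The section near \<open>z\<close> through \<open>v\<close> with constant coordinates in the frame at \<open>z\<close>.\<close>

definition local_extension ::
  "('v::ab_group_add) hol_bundle \<Rightarrow> complex \<Rightarrow> 'v \<Rightarrow> complex \<Rightarrow> 'v" where
  "local_extension E z v w =
     (let e = frame_at E z in \<Sum>i<length e. scl E (coord E e i z v) ((e ! i) w))"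

text \<open>The component of the Cauchy-Riemann operator of \<open>E\<close> along \<open>d/dzbar\<close>, i.e. the
  Cauchy-Riemann operator applied to \<open>s\<close> is \<open>dbar E s\<close> times the form \<open>dzbar\<close>.\<close>

definition dbar ::
  "('v::ab_group_add) hol_bundle \<Rightarrow> (complex \<Rightarrow> 'v) \<Rightarrow> complex \<Rightarrow> 'v" where
  "dbar E s z =
     (let e = frame_at E z in
      \<Sum>i<length e. scl E (d_zbar (\<lambda>w. coord E e i w (s w)) z) ((e ! i) z))"

text \<open>The induced operator on endomorphisms; its \<open>dzbar\<close> component at \<open>z\<close>, applied to \<open>v\<close>.\<close>

definition dbar_end ::
  "('v::ab_group_add) hol_bundle \<Rightarrow> (complex \<Rightarrow> 'v \<Rightarrow> 'v) \<Rightarrow> complex \<Rightarrow> 'v \<Rightarrow> 'v" where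
  "dbar_end E h z v =
     dbar E (\<lambda>w. h w (local_extension E z v w)) z - h z (dbar E (local_extension E z v) z)"


section \<open>Hermitian metrics, Chern connection and curvature\<close>

text \<open>Metrics are linear in the first and conjugate-linear in the second argument.  Their
  values off the fibres are irrelevant; in particular a metric on \<open>E\<close>, read on a
  subbundle, is the induced metric.\<close>

type_synonym 'v metric = "complex \<Rightarrow> 'v \<Rightarrow> 'v \<Rightarrow> complex"

definition hermitian_metric :: "('v::ab_group_add) hol_bundle \<Rightarrow> 'v metric \<Rightarrow> bool" where
  "hermitian_metric E H \<longleftrightarrow>
     (\<forall>z. \<forall>u\<in>fibre E z. \<forall>v\<in>fibre E z. \<forall>w\<in>fibre E z. \<forall>a b.
        H z (scl E a u + scl E b v) w = a * H z u w + b * H z v w) \<and>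
     (\<forall>z. \<forall>u\<in>fibre E z. \<forall>v\<in>fibre E z. H z v u = cnj (H z u v)) \<and>
     (\<forall>z. \<forall>u\<in>fibre E z. u \<noteq> 0 \<longrightarrow> Re (H z u u) > 0) \<and>
     (\<forall>(U, e)\<in>frames E. \<forall>i<length e. \<forall>j<length e.
        smooth_on U (\<lambda>z. H z ((e ! i) z) ((e ! j) z)))"

definition end_adjoint ::
  "'v hol_bundle \<Rightarrow> 'v metric \<Rightarrow> complex \<Rightarrow> ('v \<Rightarrow> 'v) \<Rightarrow> 'v \<Rightarrow> 'v" where
  "end_adjoint E K z \<phi> v = (THE u. u \<in> fibre E z \<and> (\<forall>w\<in>fibre E z. K z (\<phi> w) v = K z w u))"

definition end_trace ::
  "('v::ab_group_add) hol_bundle \<Rightarrow> complex \<Rightarrow> ('v \<Rightarrow> 'v) \<Rightarrow> complex" where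
  "end_trace E z \<phi> =
     (let e = frame_at E z in \<Sum>i<length e. coord E e i z (\<phi> ((e ! i) z)))"

definition end_norm ::
  "('v::ab_group_add) hol_bundle \<Rightarrow> 'v metric \<Rightarrow> complex \<Rightarrow> ('v \<Rightarrow> 'v) \<Rightarrow> real" where
  "end_norm E K z \<phi> = sqrt (Re (end_trace E z (\<phi> \<circ> end_adjoint E K z \<phi>)))"

text \<open>The Chern connection \<open>D\<close> of \<open>H\<close> is the connection with (0,1)-part \<open>dbar\<close> that
  preserves \<open>H\<close>.  Its (1,0)-part, evaluated on \<open>d/dz\<close>, is therefore determined by
  \<open>d_z (H(s,t)) = H(D\<^sub>z s, t) + H(s, dbar t)\<close> for all local smooth sections \<open>t\<close>.\<close>

definition chern_dz ::
  "('v::ab_group_add) hol_bundle \<Rightarrow> 'v metric \<Rightarrow> (complex \<Rightarrow> 'v) \<Rightarrow> complex \<Rightarrow> 'v" where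
  "chern_dz E H s z =
     (THE u. u \<in> fibre E z \<and>
        (\<forall>W t. smooth_section E W t \<and> z \<in> W \<longrightarrow>
           d_z (\<lambda>w. H w (s w) (t w)) z = H z u (t z) + H z (s z) (dbar E t z)))"

text \<open>The curvature \<open>F = D\<^sup>2\<close> is \<open>curvature_dzdzbar\<close> times the form \<open>dz \<and> dzbar\<close>.\<close>

definition curvature_dzdzbar ::
  "('v::ab_group_add) hol_bundle \<Rightarrow> 'v metric \<Rightarrow> complex \<Rightarrow> 'v \<Rightarrow> 'v" where
  "curvature_dzdzbar E H z v =
     (let s = local_extension E z v
      in chern_dz E H (dbar E s) z - dbar E (chern_dz E H s) z)"

text \<open>For the Euclidean metric \<open>\<omega> = dx \<and> dy\<close>, so \<open>dz \<and> dzbar = -2\<i> \<omega>\<close> and \<open>\<Lambda>(dz \<and> dzbar) = -2\<i>\<close>.\<close>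

definition Lambda_F ::
  "('v::ab_group_add) hol_bundle \<Rightarrow> 'v metric \<Rightarrow> complex \<Rightarrow> 'v \<Rightarrow> 'v" where
  "Lambda_F E H z v = scl E (- 2 * \<i>) (curvature_dzdzbar E H z v)"

definition Lambda_F_perp ::
  "('v::ab_group_add) hol_bundle \<Rightarrow> 'v metric \<Rightarrow> complex \<Rightarrow> 'v \<Rightarrow> 'v" where
  "Lambda_F_perp E H z v =
     Lambda_F E H z v - scl E (end_trace E z (Lambda_F E H z) / of_nat (bundle_rank E)) v"

definition hermitian_einstein :: "('v::ab_group_add) hol_bundle \<Rightarrow> 'v metric \<Rightarrow> bool" where
  "hermitian_einstein E H \<longleftrightarrow>
     hermitian_metric E H \<and> (\<forall>z. \<forall>v\<in>fibre E z. Lambda_F_perp E H z v = 0)"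

text \<open>The factors are the Euclidean norms \<open>|dz \<and> dzbar| = 2\<close> here and \<open>|dzbar| = sqrt 2\<close>
  in \<open>norm_dbar_end\<close>.\<close>

definition norm_F :: "('v::ab_group_add) hol_bundle \<Rightarrow> 'v metric \<Rightarrow> complex \<Rightarrow> real" where
  "norm_F E K z = 2 * end_norm E K z (curvature_dzdzbar E K z)"

definition norm_dbar_end ::
  "('v::ab_group_add) hol_bundle \<Rightarrow> 'v metric \<Rightarrow> (complex \<Rightarrow> 'v \<Rightarrow> 'v) \<Rightarrow> complex \<Rightarrow> real" where
  "norm_dbar_end E K h z = sqrt 2 * end_norm E K z (dbar_end E h z)"


section \<open>Compatible metrics\<close>

definition metric_quotient ::
  "'v hol_bundle \<Rightarrow> 'v metric \<Rightarrow> 'v metric \<Rightarrow> complex \<Rightarrow> 'v \<Rightarrow> 'v" where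
  "metric_quotient E K H z u =
     (THE w. w \<in> fibre E z \<and> (\<forall>v\<in>fibre E z. H z u v = K z w v))"

text \<open>The squared length of \<open>e\<^sub>1 \<and> \<dots> \<and> e\<^sub>r\<close> in the metric \<open>det H\<close> on the determinant line bundle.\<close>

definition gram_det :: "'v metric \<Rightarrow> (complex \<Rightarrow> 'v) list \<Rightarrow> complex \<Rightarrow> complex" where
  "gram_det H e z =
     Determinant.det
       (Matrix.mat (length e) (length e) (\<lambda>(i, j). H z ((e ! i) z) ((e ! j) z)))"

definition compatible ::
  "('v::ab_group_add) hol_bundle \<Rightarrow> 'v metric \<Rightarrow> 'v metric \<Rightarrow> bool" where
  "compatible E K H \<longleftrightarrow>
     (\<forall>(U, e)\<in>frames E. \<forall>z\<in>U. gram_det K e z = gram_det H e z) \<and>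
     (let h = metric_quotient E K H in
        (\<lambda>z. end_norm E K z (h z)) \<in> borel_measurable lborel \<and>
        (\<exists>C. AE z in lborel. \<bar>end_norm E K z (h z)\<bar> \<le> C) \<and>
        integrable lborel (\<lambda>z. (norm_dbar_end E K h z)\<^sup>2))"


section \<open>Saturated subsheaves\<close>

text \<open>\<open>S W\<close> is the module of sections of the subsheaf over the open set \<open>W\<close>.  Sections are
  total functions of which only the values on \<open>W\<close> count.\<close>

definition subsheaf ::
  "('v::ab_group_add) hol_bundle \<Rightarrow> (complex set \<Rightarrow> (complex \<Rightarrow> 'v) set) \<Rightarrow> bool" where
  "subsheaf E S \<longleftrightarrow>
     (\<forall>W. open W \<longrightarrow>
        (\<forall>s\<in>S W. hol_section E W s) \<and>
        (\<forall>s\<in>S W. \<forall>t. (\<forall>z\<in>W. t z = s z) \<longrightarrow> t \<in> S W) \<and>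
        (\<lambda>z. 0) \<in> S W \<and>
        (\<forall>s\<in>S W. \<forall>t\<in>S W. (\<lambda>z. s z + t z) \<in> S W) \<and>
        (\<forall>s\<in>S W. \<forall>f. f holomorphic_on W \<longrightarrow> (\<lambda>z. scl E (f z) (s z)) \<in> S W) \<and>
        (\<forall>V s. open V \<and> V \<subseteq> W \<and> s \<in> S W \<longrightarrow> s \<in> S V) \<and>
        (\<forall>s. (\<forall>z\<in>W. \<exists>V. open V \<and> z \<in> V \<and> V \<subseteq> W \<and> s \<in> S V) \<longrightarrow> s \<in> S W))"

text \<open>A subsheaf of the coherent sheaf of holomorphic sections of \<open>E\<close> is coherent iff it is
  of finite type (Oka), i.e. locally generated by finitely many sections.\<close>

definition coherent_subsheaf ::
  "('v::ab_group_add) hol_bundle \<Rightarrow> (complex set \<Rightarrow> (complex \<Rightarrow> 'v) set) \<Rightarrow> bool" where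
  "coherent_subsheaf E S \<longleftrightarrow>
     subsheaf E S \<and>
     (\<forall>z. \<exists>W G. open W \<and> z \<in> W \<and> finite G \<and> G \<subseteq> S W \<and>
        (\<forall>V s. open V \<and> V \<subseteq> W \<and> s \<in> S V \<longrightarrow>
           (\<forall>w\<in>V. \<exists>V' f. open V' \<and> w \<in> V' \<and> V' \<subseteq> V \<and>
              (\<forall>g\<in>G. f g holomorphic_on V') \<and>
              (\<forall>y\<in>V'. s y = (\<Sum>g\<in>G. scl E (f g y) (g y))))))"

definition torsion_free_quotient ::
  "('v::ab_group_add) hol_bundle \<Rightarrow> (complex set \<Rightarrow> (complex \<Rightarrow> 'v) set) \<Rightarrow> bool" where
  "torsion_free_quotient E S \<longleftrightarrow>
     (\<forall>W f s. open W \<and> connected W \<and> f holomorphic_on W \<and> (\<exists>w\<in>W. f w \<noteq> 0) \<and>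
        hol_section E W s \<and> (\<lambda>z. scl E (f z) (s z)) \<in> S W \<longrightarrow> s \<in> S W)"

definition saturated_subsheaf ::
  "('v::ab_group_add) hol_bundle \<Rightarrow> (complex set \<Rightarrow> (complex \<Rightarrow> 'v) set) \<Rightarrow> bool" where
  "saturated_subsheaf E S \<longleftrightarrow> coherent_subsheaf E S \<and> torsion_free_quotient E S"

text \<open>The holomorphic subbundle of \<open>E\<close> defined by \<open>S\<close>, with all its holomorphic frames.  It is
  a bundle over its \<open>bundle_base\<close>, the complement of the singular set \<open>Z(S)\<close>; for saturated
  \<open>S\<close> over the plane, \<open>Z(S)\<close> is empty.\<close>

definition subbundle ::
  "('v::ab_group_add) hol_bundle \<Rightarrow> (complex set \<Rightarrow> (complex \<Rightarrow> 'v) set) \<Rightarrow> 'v hol_bundle" where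
  "subbundle E S =
     (let Fb = (\<lambda>z. {s z | s W. open W \<and> z \<in> W \<and> s \<in> S W}) in
      \<lparr>scl = scl E, fibre = Fb,
       frames = {(U, e). open U \<and> set e \<subseteq> S U \<and>
         (\<forall>z\<in>U. fibre_basis \<lparr>scl = scl E, fibre = Fb, frames = {}\<rparr> e z)}\<rparr>)"


section \<open>Degree and stability\<close>

text \<open>The degree is an integral with values in the extended reals, as the degree of a
  subsheaf may be minus infinity.\<close>

definition degree_density ::
  "('v::ab_group_add) hol_bundle \<Rightarrow> 'v metric \<Rightarrow> complex \<Rightarrow> real" where
  "degree_density E K z = Re (\<i> * end_trace E z (Lambda_F E K z))"

definition bundle_degree :: "('v::ab_group_add) hol_bundle \<Rightarrow> 'v metric \<Rightarrow> ereal" where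
  "bundle_degree E K =
     enn2ereal (\<integral>\<^sup>+z\<in>bundle_base E. ennreal (degree_density E K z) \<partial>lborel) -
     enn2ereal (\<integral>\<^sup>+z\<in>bundle_base E. ennreal (- degree_density E K z) \<partial>lborel)"

definition slope :: "('v::ab_group_add) hol_bundle \<Rightarrow> 'v metric \<Rightarrow> ereal" where
  "slope E K = bundle_degree E K / ereal (real (bundle_rank E))"

definition stable_bundle :: "('v::ab_group_add) hol_bundle \<Rightarrow> 'v metric \<Rightarrow> bool" where
  "stable_bundle E K \<longleftrightarrow>
     (\<forall>S. saturated_subsheaf E S \<and>
        0 < bundle_rank (subbundle E S) \<and> bundle_rank (subbundle E S) < bundle_rank E \<longrightarrow>
        slope (subbundle E S) K < slope E K)"

end

theory Submission
  imports Defs "HOL-Computational_Algebra.Fundamental_Theorem_Algebra"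
begin

text \<open>Write \<open>H\<^sub>2 = H\<^sub>1 h\<close>.  Since both metrics are Hermitian-Einstein with the same determinant,
  \<open>\<Delta> tr h\<close> is nonnegative and vanishes only where \<open>dbar h = 0\<close>.  Compatibility bounds \<open>tr h\<close>, so
  the parabolicity of the plane makes \<open>h\<close> holomorphic.  For every polynomial \<open>p\<close> the trace of
  \<open>p(h) p(h)\<^sup>*\<close> is then holomorphic and real, hence constant, so polynomial identities satisfied by
  \<open>h\<close> at one point hold everywhere.  If \<open>h\<close> is a scalar, it is 1 by the equality of determinants.
  Otherwise a spectral projection of \<open>h\<close> is holomorphic and splits \<open>E\<close> into two subbundles that are
  orthogonal for \<open>H\<^sub>1\<close>.  Their degree densities for \<open>K\<close> add up to that of \<open>E\<close> minus a multiple of the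
  Laplacian of the logarithm of the ratio of \<open>K\<close> and \<open>H\<^sub>1\<close> on the two determinant lines.  This
  logarithm is bounded, as \<open>K\<close> and \<open>H\<^sub>1\<close> are mutually bounded, so by parabolicity the two degrees
  add up to at least the degree of \<open>E\<close>, against stability.\<close>

section \<open>Smooth functions\<close>

text \<open>The trace of the curvature depends only on the determinant of the metric, and the
  Hermitian-Einstein equation makes the curvature a multiple of the identity. Two such metrics with
  equal determinants thus have equal curvature, so their connection forms differ by a holomorphic
  matrix, and the Laplacian of \<open>tr h\<close> becomes a weighted squared norm of that matrix
  with no curvature term. Compatibility bounds the metrics by \<open>K\<close> from above only, and
  almost everywhere; the bounds from below are extracted from the equality of determinants. On the
  two summands the determinants of \<open>H1\<close> multiply to that of \<open>K\<close> times the
  squared modulus of a holomorphic function, whose logarithm is harmonic; this is why the defect of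
  the degree densities is the Laplacian of a bounded logarithm. A priori the degrees of the summands
  may be minus infinity and this Laplacian need not be integrable, so parabolicity is formulated as
  an inequality between the integrals of the positive and the negative part, in the extended
  reals.\<close>

lemma frechet_derivative_eqI: "(f has_derivative f') (at z) \<Longrightarrow> frechet_derivative f (at z) = f'"
  using frechet_derivative_at by metis

lemma frechet_derivative_cong_open:
  fixes f g :: "complex \<Rightarrow> complex"
  assumes "open U" "z \<in> U" "\<And>w. w \<in> U \<Longrightarrow> f w = g w"
  shows "frechet_derivative f (at z) = frechet_derivative g (at z)"
    and "f differentiable (at z) \<longleftrightarrow> g differentiable (at z)"
proof -
  have iff: "(f has_derivative D) (at z) \<longleftrightarrow> (g has_derivative D) (at z)" for D
    using assms by (metis has_derivative_transform_within_open)
  then show "frechet_derivative f (at z) = frechet_derivative g (at z)"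
    unfolding frechet_derivative_def by simp
  show "f differentiable (at z) \<longleftrightarrow> g differentiable (at z)"
    unfolding differentiable_def using iff by simp
qed

lemma C_k_on_cong:
  assumes "open U" "\<And>z. z \<in> U \<Longrightarrow> f z = g z"
  shows "C_k_on k U f \<longleftrightarrow> C_k_on k U g"
  using assms(2)
proof (induction k arbitrary: f g)
  case 0
  then show ?case using continuous_on_cong by auto
next
  case (Suc k)
  have eq: "frechet_derivative f (at z) = frechet_derivative g (at z)"
     "f differentiable (at z) \<longleftrightarrow> g differentiable (at z)" if "z \<in> U" for z
    using frechet_derivative_cong_open[OF assms(1) that Suc.prems] by auto
  have "C_k_on k U (\<lambda>z. frechet_derivative f (at z) v) \<longleftrightarrow> C_k_on k U (\<lambda>z. frechet_derivative g (at z) v)" for v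
    by (rule Suc.IH) (simp add: eq)
  then show ?case using eq by simp
qed

lemma C_k_on_subset: "C_k_on k U f \<Longrightarrow> V \<subseteq> U \<Longrightarrow> C_k_on k V f"
  by (induction k arbitrary: f) (auto intro: continuous_on_subset)

text \<open>Differentiability supplies the continuity that order 0 asks for. The product and chain
  rules need this, because they mix an undifferentiated factor with derivatives that have lost one
  order.\<close>

lemma C_k_on_SucD: "C_k_on (Suc k) U f \<Longrightarrow> C_k_on k U f"
proof (induction k arbitrary: f)
  case 0
  then show ?case
    by (metis C_k_on.simps differentiable_at_imp_differentiable_on differentiable_imp_continuous_on)
next
  case (Suc k)
  show ?case
    using Suc.prems Suc.IH[of "\<lambda>z. frechet_derivative f (at z) 1"]
      Suc.IH[of "\<lambda>z. frechet_derivative f (at z) \<i>"]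
    unfolding C_k_on.simps(2)[of "Suc k"] C_k_on.simps(2)[of k U f] by blast
qed

text \<open>The derivative at a point depends only on the germ there. Functions coming from a bundle
  are known only frame by frame, and this is how they are seen to be smooth on the whole
  plane.\<close>

lemma C_k_on_local:
  assumes "\<And>z. z \<in> U \<Longrightarrow> \<exists>V. open V \<and> z \<in> V \<and> C_k_on k V f"
  shows "C_k_on k U f"
  using assms
proof (induction k arbitrary: f)
  case 0
  then show ?case
    by (metis C_k_on.simps(1) continuous_at_imp_continuous_on continuous_on_eq_continuous_at)
next
  case (Suc k)
  have "C_k_on k U (\<lambda>z. frechet_derivative f (at z) 1)"
    by (rule Suc.IH) (use Suc.prems in fastforce)
  moreover have "C_k_on k U (\<lambda>z. frechet_derivative f (at z) \<i>)"
    by (rule Suc.IH) (use Suc.prems in fastforce)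
  moreover have "f differentiable (at z)" if "z \<in> U" for z
    using Suc.prems[OF that] by auto
  ultimately show ?case by auto
qed

lemma C_k_on_const: "C_k_on k U (\<lambda>z. c)"
  by (induction k arbitrary: c) auto

lemma C_k_on_add:
  assumes "open U" "C_k_on k U f" "C_k_on k U g"
  shows "C_k_on k U (\<lambda>z. f z + g z)"
  using assms(2,3)
proof (induction k arbitrary: f g)
  case (Suc k)
  have d: "frechet_derivative (\<lambda>z. f z + g z) (at z) v =
      frechet_derivative f (at z) v + frechet_derivative g (at z) v" if "z \<in> U" for z v
    using Suc.prems that
    by (subst frechet_derivative_eqI[OF has_derivative_add])
       (auto simp: frechet_derivative_works[symmetric])
  have "C_k_on k U (\<lambda>z. frechet_derivative (\<lambda>z. f z + g z) (at z) v)" if "v = 1 \<or> v = \<i>" for v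
    by (subst C_k_on_cong[OF assms(1) d]) (use that Suc in auto)
  then show ?case using Suc.prems by auto
qed (auto intro: continuous_intros)

lemma C_k_on_mult:
  assumes "open U" "C_k_on k U f" "C_k_on k U g"
  shows "C_k_on k U (\<lambda>z. f z * g z)"
  using assms(2,3)
proof (induction k arbitrary: f g)
  case (Suc k)
  have d: "frechet_derivative (\<lambda>z. f z * g z) (at z) v =
      f z * frechet_derivative g (at z) v + frechet_derivative f (at z) v * g z" if "z \<in> U" for z v
    using Suc.prems that
    by (subst frechet_derivative_eqI[OF has_derivative_mult])
       (auto simp: frechet_derivative_works[symmetric])
  have "C_k_on k U (\<lambda>z. frechet_derivative (\<lambda>z. f z * g z) (at z) v)" if "v = 1 \<or> v = \<i>" for v
    by (subst C_k_on_cong[OF assms(1) d])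
       (use that Suc.prems C_k_on_SucD[OF Suc.prems(1)] C_k_on_SucD[OF Suc.prems(2)] in
         \<open>auto intro!: C_k_on_add[OF assms(1)] Suc.IH\<close>)
  then show ?case using Suc.prems by (auto intro: differentiable_mult)
qed (auto intro: continuous_intros)

lemma C_k_on_cnj:
  assumes "open U" "C_k_on k U f"
  shows "C_k_on k U (\<lambda>z. cnj (f z))"
  using assms(2)
proof (induction k arbitrary: f)
  case (Suc k)
  have h: "((\<lambda>z. cnj (f z)) has_derivative (\<lambda>v. cnj (frechet_derivative f (at z) v))) (at z)"
    if "z \<in> U" for z
    using Suc.prems that by (intro has_derivative_cnj) (auto simp: frechet_derivative_works[symmetric])
  have d: "frechet_derivative (\<lambda>z. cnj (f z)) (at z) v = cnj (frechet_derivative f (at z) v)"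
    if "z \<in> U" for z v
    using frechet_derivative_eqI[OF h[OF that]] by simp
  have "C_k_on k U (\<lambda>z. frechet_derivative (\<lambda>z. cnj (f z)) (at z) v)" if "v = 1 \<or> v = \<i>" for v
    by (subst C_k_on_cong[OF assms(1) d]) (use that Suc in auto)
  then show ?case using h by (auto simp: differentiable_def)
qed (auto intro: continuous_intros)

text \<open>The induction runs over all \<open>g\<close> at once: differentiating the composite
  produces \<open>deriv g\<close> composed with \<open>f\<close>, and \<open>deriv g\<close> is
  again holomorphic. Inverses, logarithms and holomorphic functions themselves are all obtained from
  here.\<close>

lemma C_k_on_compose_holomorphic:
  assumes "open U" "open V" "C_k_on k U f" "f ` U \<subseteq> V" "g holomorphic_on V"
  shows "C_k_on k U (\<lambda>z. g (f z))"
  using assms(3-5)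
proof (induction k arbitrary: f g)
  case 0
  then show ?case
    by (metis C_k_on.simps(1) continuous_on_compose2 holomorphic_on_imp_continuous_on)
next
  case (Suc k)
  have h: "((\<lambda>z. g (f z)) has_derivative (\<lambda>v. deriv g (f z) * frechet_derivative f (at z) v)) (at z)"
    if "z \<in> U" for z
  proof -
    have "(g has_field_derivative deriv g (f z)) (at (f z))"
      using Suc.prems that assms(2) by (meson holomorphic_derivI image_subset_iff)
    moreover have "(f has_derivative frechet_derivative f (at z)) (at z)"
      using Suc.prems that by (auto simp: frechet_derivative_works[symmetric])
    ultimately show ?thesis
      using has_derivative_compose[of f _ z UNIV g "(*) (deriv g (f z))"]
      by (simp add: has_field_derivative_def)
  qed
  have d: "frechet_derivative (\<lambda>z. g (f z)) (at z) v = deriv g (f z) * frechet_derivative f (at z) v"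
    if "z \<in> U" for z v
    using frechet_derivative_eqI[OF h[OF that]] by simp
  have dg: "deriv g holomorphic_on V" using Suc.prems assms(2) holomorphic_deriv by blast
  have g': "C_k_on k U (\<lambda>z. deriv g (f z))"
    by (rule Suc.IH[OF C_k_on_SucD[OF Suc.prems(1)] Suc.prems(2) dg])
  have "C_k_on k U (\<lambda>z. frechet_derivative (\<lambda>z. g (f z)) (at z) v)" if "v = 1 \<or> v = \<i>" for v
    by (subst C_k_on_cong[OF assms(1) d])
      (use that Suc.prems in \<open>auto intro!: C_k_on_mult[OF assms(1) g']\<close>)
  then show ?case using h by (auto simp: differentiable_def)
qed

lemma smooth_on_Suc: "smooth_on U f \<Longrightarrow> C_k_on (Suc k) U f"
  unfolding smooth_on_def by blast

lemma smooth_on_imp_differentiable: "smooth_on U f \<Longrightarrow> z \<in> U \<Longrightarrow> f differentiable (at z)"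
  using smooth_on_Suc[of U f 0] by simp

lemma smooth_on_imp_continuous_on: "smooth_on U f \<Longrightarrow> continuous_on U f"
  unfolding smooth_on_def by (metis C_k_on.simps(1))

lemma smooth_on_frechet:
  assumes "smooth_on U f"
  shows "smooth_on U (\<lambda>z. frechet_derivative f (at z) 1)"
    "smooth_on U (\<lambda>z. frechet_derivative f (at z) \<i>)"
  using smooth_on_Suc[OF assms] by (simp_all add: smooth_on_def)

lemma smooth_on_cong:
  "open U \<Longrightarrow> (\<And>z. z \<in> U \<Longrightarrow> f z = g z) \<Longrightarrow> smooth_on U f \<longleftrightarrow> smooth_on U g"
  unfolding smooth_on_def using C_k_on_cong by blast

lemma smooth_on_subset: "smooth_on U f \<Longrightarrow> V \<subseteq> U \<Longrightarrow> smooth_on V f"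
  unfolding smooth_on_def using C_k_on_subset by blast

lemma smooth_on_local:
  "(\<And>z. z \<in> U \<Longrightarrow> \<exists>V. open V \<and> z \<in> V \<and> smooth_on V f) \<Longrightarrow> smooth_on U f"
  unfolding smooth_on_def using C_k_on_local by meson

lemma smooth_on_const [intro, simp]: "smooth_on U (\<lambda>z. c)"
  unfolding smooth_on_def using C_k_on_const by blast

lemma smooth_on_add: "open U \<Longrightarrow> smooth_on U f \<Longrightarrow> smooth_on U g \<Longrightarrow> smooth_on U (\<lambda>z. f z + g z)"
  unfolding smooth_on_def using C_k_on_add by blast

lemma smooth_on_mult: "open U \<Longrightarrow> smooth_on U f \<Longrightarrow> smooth_on U g \<Longrightarrow> smooth_on U (\<lambda>z. f z * g z)"
  unfolding smooth_on_def using C_k_on_mult by blast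

lemma smooth_on_cnj: "open U \<Longrightarrow> smooth_on U f \<Longrightarrow> smooth_on U (\<lambda>z. cnj (f z))"
  unfolding smooth_on_def using C_k_on_cnj by blast

lemma smooth_on_compose_holomorphic:
  "open U \<Longrightarrow> open V \<Longrightarrow> smooth_on U f \<Longrightarrow> f ` U \<subseteq> V \<Longrightarrow> g holomorphic_on V \<Longrightarrow> smooth_on U (\<lambda>z. g (f z))"
  unfolding smooth_on_def using C_k_on_compose_holomorphic by blast

lemma C_k_on_ident: "C_k_on k U (\<lambda>z. z)"
  by (cases k) (auto simp: C_k_on_const intro: continuous_intros)

lemma holomorphic_imp_smooth_on: "open U \<Longrightarrow> f holomorphic_on U \<Longrightarrow> smooth_on U f"
  using smooth_on_compose_holomorphic[of U U "\<lambda>z. z" f] C_k_on_ident by (auto simp: smooth_on_def)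

lemma smooth_on_minus: "open U \<Longrightarrow> smooth_on U f \<Longrightarrow> smooth_on U (\<lambda>z. - f z)"
  using smooth_on_mult[of U "\<lambda>_. -1" f] by simp

lemma smooth_on_diff: "open U \<Longrightarrow> smooth_on U f \<Longrightarrow> smooth_on U g \<Longrightarrow> smooth_on U (\<lambda>z. f z - g z)"
  using smooth_on_add[of U f "\<lambda>z. - g z"] smooth_on_minus by simp

lemma smooth_on_inverse:
  "open U \<Longrightarrow> smooth_on U f \<Longrightarrow> (\<And>z. z \<in> U \<Longrightarrow> f z \<noteq> 0) \<Longrightarrow> smooth_on U (\<lambda>z. inverse (f z))"
  by (rule smooth_on_compose_holomorphic[where V = "- {0}"]) (auto intro!: holomorphic_intros)

lemma smooth_on_divide:
  "open U \<Longrightarrow> smooth_on U f \<Longrightarrow> smooth_on U g \<Longrightarrow> (\<And>z. z \<in> U \<Longrightarrow> g z \<noteq> 0) \<Longrightarrow> smooth_on U (\<lambda>z. f z / g z)"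
  unfolding divide_inverse by (intro smooth_on_mult smooth_on_inverse)

lemma smooth_on_sum:
  assumes "open U" "\<And>i. i \<in> I \<Longrightarrow> smooth_on U (f i)"
  shows "smooth_on U (\<lambda>z. \<Sum>i\<in>I. f i z)"
  using assms(2) by (induction I rule: infinite_finite_induct) (auto intro: smooth_on_add assms(1))

lemma smooth_on_prod:
  assumes "open U" "\<And>i. i \<in> I \<Longrightarrow> smooth_on U (f i)"
  shows "smooth_on U (\<lambda>z. \<Prod>i\<in>I. f i z)"
  using assms(2) by (induction I rule: infinite_finite_induct) (auto intro: smooth_on_mult assms(1))

lemma smooth_on_d_z: "open U \<Longrightarrow> smooth_on U f \<Longrightarrow> smooth_on U (d_z f)"
  and smooth_on_d_zbar: "open U \<Longrightarrow> smooth_on U f \<Longrightarrow> smooth_on U (d_zbar f)"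
  unfolding d_z_def[abs_def] d_zbar_def[abs_def]
  by (auto intro!: smooth_on_divide smooth_on_diff smooth_on_add smooth_on_mult smooth_on_frechet)

section \<open>Wirtinger calculus\<close>

lemma has_derivative_d_z:
  "(f has_derivative D) (at z) \<Longrightarrow> d_z f z = (D 1 - \<i> * D \<i>) / 2"
  "(f has_derivative D) (at z) \<Longrightarrow> d_zbar f z = (D 1 + \<i> * D \<i>) / 2"
  by (simp_all add: d_z_def d_zbar_def frechet_derivative_eqI)

lemma d_z_cong:
  assumes "open U" "z \<in> U" "\<And>w. w \<in> U \<Longrightarrow> f w = g w"
  shows "d_z f z = d_z g z" "d_zbar f z = d_zbar g z"
  using frechet_derivative_cong_open(1)[OF assms] by (simp_all add: d_z_def d_zbar_def)

lemma d_z_const [simp]: "d_z (\<lambda>w. c) z = 0" "d_zbar (\<lambda>w. c) z = 0"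
  by (simp_all add: d_z_def d_zbar_def)

lemma d_z_add:
  assumes "f differentiable (at z)" "g differentiable (at z)"
  shows "d_z (\<lambda>w. f w + g w) z = d_z f z + d_z g z"
    "d_zbar (\<lambda>w. f w + g w) z = d_zbar f z + d_zbar g z"
  by (simp_all add: has_derivative_d_z[OF has_derivative_add[OF assms[unfolded frechet_derivative_works]]]
      d_z_def[of f] d_z_def[of g] d_zbar_def[of f] d_zbar_def[of g] field_simps)

lemma d_z_mult:
  assumes "f differentiable (at z)" "g differentiable (at z)"
  shows "d_z (\<lambda>w. f w * g w) z = d_z f z * g z + f z * d_z g z"
    "d_zbar (\<lambda>w. f w * g w) z = d_zbar f z * g z + f z * d_zbar g z"
  by (simp_all add: has_derivative_d_z[OF has_derivative_mult[OF assms[unfolded frechet_derivative_works]]]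
      d_z_def[of f] d_z_def[of g] d_zbar_def[of f] d_zbar_def[of g] field_simps)

lemma d_z_cnj:
  assumes "f differentiable (at z)"
  shows "d_z (\<lambda>w. cnj (f w)) z = cnj (d_zbar f z)" "d_zbar (\<lambda>w. cnj (f w)) z = cnj (d_z f z)"
  by (simp_all add: has_derivative_d_z[OF has_derivative_cnj[OF assms[unfolded frechet_derivative_works]]]
      d_z_def[of f] d_zbar_def[of f])

lemma d_z_compose:
  assumes "(g has_field_derivative g') (at (f z))" "f differentiable (at z)"
  shows "d_z (\<lambda>w. g (f w)) z = g' * d_z f z" "d_zbar (\<lambda>w. g (f w)) z = g' * d_zbar f z"
  by (simp_all add: has_derivative_d_z[OF has_derivative_compose[OF
        assms(2)[unfolded frechet_derivative_works] assms(1)[unfolded has_field_derivative_def]]]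
      d_z_def[of f] d_zbar_def[of f] field_simps)

lemma d_z_field_derivative:
  assumes "(g has_field_derivative g') (at z)"
  shows "d_z g z = g'" "d_zbar g z = 0"
  using has_derivative_d_z[of g "(*) g'" z] assms
  by (simp_all add: has_field_derivative_def field_simps)

lemma d_z_sum:
  assumes "finite I" "\<And>i. i \<in> I \<Longrightarrow> f i differentiable (at z)"
  shows "d_z (\<lambda>w. \<Sum>i\<in>I. f i w) z = (\<Sum>i\<in>I. d_z (f i) z)"
    "d_zbar (\<lambda>w. \<Sum>i\<in>I. f i w) z = (\<Sum>i\<in>I. d_zbar (f i) z)"
  using assms by (induction I) (auto simp: d_z_add differentiable_sum)

text \<open>The equation says that the real-linear derivative sends \<open>\<i>\<close> to
  \<open>\<i>\<close> times its value at 1; hence it is multiplication by that value, which is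
  complex differentiability.\<close>

lemma d_zbar_eq_0_imp_holomorphic:
  assumes "open U" "\<And>z. z \<in> U \<Longrightarrow> f differentiable (at z)" "\<And>z. z \<in> U \<Longrightarrow> d_zbar f z = 0"
  shows "f holomorphic_on U"
proof -
  have "(f has_field_derivative frechet_derivative f (at z) 1) (at z)" if "z \<in> U" for z
  proof -
    let ?D = "frechet_derivative f (at z)"
    have D: "(f has_derivative ?D) (at z)" using assms(2)[OF that] frechet_derivative_works by blast
    interpret D: bounded_linear ?D using D has_derivative_bounded_linear by blast
    have "?D 1 + \<i> * ?D \<i> = 0" using assms(3)[OF that] by (simp add: d_zbar_def)
    then have "\<i> * (?D 1 + \<i> * ?D \<i>) = 0" by simp
    then have i: "?D \<i> = \<i> * ?D 1" by (simp add: distrib_left mult.assoc[symmetric])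
    have "?D v = ?D 1 * v" for v
    proof -
      have v: "v = Re v *\<^sub>R 1 + Im v *\<^sub>R \<i>" by (simp add: complex_eq_iff)
      have "?D v = ?D (Re v *\<^sub>R 1 + Im v *\<^sub>R \<i>)" by (rule arg_cong[OF v])
      also have "\<dots> = ?D 1 * (Re v *\<^sub>R 1 + Im v *\<^sub>R \<i>)"
        unfolding D.add D.scaleR i by (simp add: algebra_simps)
      also have "\<dots> = ?D 1 * v" by (rule arg_cong[OF v[symmetric]])
      finally show ?thesis .
    qed
    then have "?D = (*) (?D 1)" by (rule ext)
    then show ?thesis using D by (metis has_field_derivative_def)
  qed
  then show ?thesis using assms(1) by (auto simp: holomorphic_on_open)
qed

lemma holomorphic_d_zbar: "open U \<Longrightarrow> f holomorphic_on U \<Longrightarrow> z \<in> U \<Longrightarrow> d_zbar f z = 0"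
  and holomorphic_d_z: "open U \<Longrightarrow> f holomorphic_on U \<Longrightarrow> z \<in> U \<Longrightarrow> d_z f z = deriv f z"
  using d_z_field_derivative[OF holomorphic_derivI] by simp_all

section \<open>Parabolicity of the plane\<close>

lemma integral_translate:
  fixes f :: "complex \<Rightarrow> real"
  assumes "integrable lborel f"
  shows "integrable lborel (\<lambda>z. f (c + z))" "integral\<^sup>L lborel (\<lambda>z. f (c + z)) = integral\<^sup>L lborel f"
proof -
  have "integrable (distr lborel borel ((+) c)) f" using assms lborel_distr_plus[of c] by simp
  then show "integrable lborel (\<lambda>z. f (c + z))"
    using assms by (subst (asm) integrable_distr_eq) auto
  have "integral\<^sup>L (distr lborel borel ((+) c)) f = integral\<^sup>L lborel (\<lambda>z. f (c + z))"
    by (rule integral_distr) (use assms in auto)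
  then show "integral\<^sup>L lborel (\<lambda>z. f (c + z)) = integral\<^sup>L lborel f"
    using lborel_distr_plus[of c] by simp
qed

lemma integrable_compact_support:
  fixes f :: "complex \<Rightarrow> real"
  assumes "continuous_on UNIV f" "\<And>z. norm z > R \<Longrightarrow> f z = 0"
  shows "integrable lborel f"
proof -
  have "integrable lborel (\<lambda>z. indicator (cball 0 R) z *\<^sub>R f z)"
    using borel_integrable_compact[of "cball 0 R" f] assms(1)
    by (auto intro: continuous_on_subset)
  moreover have "(\<lambda>z. indicator (cball 0 R) z *\<^sub>R f z) = f"
    using assms(2) by (auto simp: indicator_def fun_eq_iff)
  ultimately show ?thesis by simp
qed

text \<open>A derivative of one real variable along each line, so that the mean value theorem and
  the one-dimensional chain rule apply directly; no Frechet derivative of the cutoff functions has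
  to be computed.\<close>

definition has_dir_deriv :: "(complex \<Rightarrow> real) \<Rightarrow> complex \<Rightarrow> (complex \<Rightarrow> real) \<Rightarrow> bool" where
  "has_dir_deriv g v g' \<longleftrightarrow>
     (\<forall>z. ((\<lambda>t::real. g (z + of_real t * v)) has_real_derivative g' z) (at 0))"

lemma has_dir_derivD:
  assumes "has_dir_deriv g v g'"
  shows "((\<lambda>t::real. g (z + of_real t * v)) has_real_derivative g' (z + of_real t * v)) (at t)"
proof -
  have "((\<lambda>s::real. g (z + of_real t * v + of_real s * v)) has_real_derivative g' (z + of_real t * v)) (at 0)"
    using assms unfolding has_dir_deriv_def by blast
  then show ?thesis
    using DERIV_shift[of "\<lambda>s. g (z + of_real s * v)" "g' (z + of_real t * v)" 0 t]
    by (simp add: algebra_simps)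
qed

text \<open>By translation invariance every difference quotient of \<open>g\<close> has integral 0,
  and these quotients converge to \<open>g'\<close>. The mean value theorem bounds them by the
  maximum of \<open>g'\<close>, and they vanish outside a ball enlarged by the length of
  \<open>v\<close>, so dominated convergence applies.\<close>

lemma integral_dir_deriv_eq_0:
  assumes d: "has_dir_deriv g v g'"
    and c: "continuous_on UNIV g" "continuous_on UNIV g'"
    and supp: "\<And>z. norm z > R \<Longrightarrow> g z = 0" "\<And>z. norm z > R \<Longrightarrow> g' z = 0"
  shows "integral\<^sup>L lborel g' = 0"
proof -
  have "compact (g' ` cball 0 R)"
    using c(2) by (intro compact_continuous_image) (auto intro: continuous_on_subset)
  then obtain M0 where M0: "\<And>z. norm z \<le> R \<Longrightarrow> \<bar>g' z\<bar> \<le> M0"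
    using compact_imp_bounded bounded_iff by (metis image_eqI mem_cball_0 real_norm_def)
  \<comment> \<open>The maximum with 0 keeps the bound valid outside the ball, where
    \<open>g'\<close> vanishes, even if the ball is empty and \<open>M0\<close> is
    arbitrary.\<close>
  define M where "M = max M0 0"
  have M: "\<bar>g' z\<bar> \<le> M" for z
    by (cases "norm z \<le> R") (use M0[of z] supp(2)[of z] in \<open>auto simp: M_def\<close>)
  have [simp]: "integrable lborel g" by (rule integrable_compact_support[OF c(1) supp(1)])
  define q where "q n z = (g (v / of_nat (Suc n) + z) - g z) * real (Suc n)" for n z
  have q0: "integral\<^sup>L lborel (q n) = 0" for n
    unfolding q_def using integral_translate[of g "v / of_nat (Suc n)"]
    by simp
  have lim: "(\<lambda>n. q n z) \<longlonglongrightarrow> g' z" for z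
  proof -
    have "((\<lambda>t::real. (g (z + of_real t * v) - g z) / t) \<longlongrightarrow> g' z) (at 0)"
      using d[unfolded has_dir_deriv_def, rule_format, of z] by (simp add: DERIV_def)
    moreover have "filterlim (\<lambda>n. 1 / real (Suc n)) (at 0) sequentially"
      unfolding filterlim_at using LIMSEQ_inverse_real_of_nat by (auto simp: divide_inverse)
    ultimately have "(\<lambda>n. (g (z + of_real (1 / real (Suc n)) * v) - g z) / (1 / real (Suc n))) \<longlonglongrightarrow> g' z"
      by (rule filterlim_compose)
    moreover have "(\<lambda>n. (g (z + of_real (1 / real (Suc n)) * v) - g z) / (1 / real (Suc n))) = (\<lambda>n. q n z)"
      by (simp add: q_def fun_eq_iff add.commute mult.commute del: of_nat_Suc)
    ultimately show ?thesis by simp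
  qed
  have bd: "norm (q n z) \<le> indicator (cball 0 (R + norm v)) z *\<^sub>R M" for n z
  proof (cases "norm z > R + norm v")
    case True
    have "norm (v / of_nat (Suc n)) \<le> norm v"
      by (simp add: norm_divide divide_le_eq mult_le_cancel_left1 del: of_nat_Suc)
    moreover have "norm z \<le> norm (v / of_nat (Suc n) + z) + norm (v / of_nat (Suc n))"
      using norm_triangle_ineq4[of "v / of_nat (Suc n) + z" "v / of_nat (Suc n)"]
      by (simp only: add_diff_cancel_left')
    ultimately have "norm (v / of_nat (Suc n) + z) > R" "norm z > R"
      using True norm_ge_zero[of v] by linarith+
    then show ?thesis using supp(1) by (simp add: q_def M_def)
  next
    case False
    obtain t where t: "0 < t" "t < 1 / real (Suc n)"
      "g (z + of_real (1 / real (Suc n)) * v) - g (z + of_real 0 * v) =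
         (1 / real (Suc n) - 0) * g' (z + of_real t * v)"
      using MVT2[of 0 "1 / real (Suc n)" "\<lambda>t. g (z + of_real t * v)" "\<lambda>t. g' (z + of_real t * v)"]
        has_dir_derivD[OF d] by auto
    have "q n z = g' (z + of_real t * v)"
      using t(3) by (simp add: q_def field_simps del: of_nat_Suc)
    then show ?thesis using M False by (auto simp: indicator_def)
  qed
  have "(\<lambda>n. integral\<^sup>L lborel (q n)) \<longlonglongrightarrow> integral\<^sup>L lborel g'"
  proof (rule integral_dominated_convergence[where w = "\<lambda>z. indicator (cball 0 (R + norm v)) z *\<^sub>R M"])
    show "integrable lborel (\<lambda>z::complex. indicator (cball 0 (R + norm v)) z *\<^sub>R M)"
      by (rule borel_integrable_compact) auto
    show "g' \<in> borel_measurable lborel" using c(2) borel_measurable_continuous_onI by auto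
    have "g \<in> borel_measurable borel" using c(1) borel_measurable_continuous_onI by auto
    then show "q n \<in> borel_measurable lborel" for n unfolding q_def by measurable
    show "AE z in lborel. (\<lambda>n. q n z) \<longlonglongrightarrow> g' z" using lim by simp
    show "AE z in lborel. norm (q n z) \<le> indicator (cball 0 (R + norm v)) z *\<^sub>R M" for n
      using bd by simp
  qed
  then show ?thesis by (simp add: q0 LIMSEQ_const_iff)
qed

lemma has_dir_deriv_mult:
  assumes "has_dir_deriv f v f'" "has_dir_deriv g v g'"
  shows "has_dir_deriv (\<lambda>z. f z * g z) v (\<lambda>z. f' z * g z + f z * g' z)"
  unfolding has_dir_deriv_def
proof
  fix z
  show "((\<lambda>t. f (z + of_real t * v) * g (z + of_real t * v)) has_real_derivative f' z * g z + f z * g' z) (at 0)"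
    using DERIV_mult[of "\<lambda>t. f (z + of_real t * v)" "f' z" 0 UNIV "\<lambda>t. g (z + of_real t * v)" "g' z"]
      assms by (auto simp: has_dir_deriv_def algebra_simps)
qed

lemma has_dir_deriv_diff:
  "has_dir_deriv f v f' \<Longrightarrow> has_dir_deriv g v g' \<Longrightarrow> has_dir_deriv (\<lambda>z. f z - g z) v (\<lambda>z. f' z - g' z)"
  unfolding has_dir_deriv_def by (auto intro: derivative_intros)

lemma has_dir_deriv_compose:
  assumes "has_dir_deriv f v f'" "\<And>z. (h has_real_derivative h' (f z)) (at (f z))"
  shows "has_dir_deriv (\<lambda>z. h (f z)) v (\<lambda>z. h' (f z) * f' z)"
  unfolding has_dir_deriv_def
proof
  fix z
  show "((\<lambda>t. h (f (z + of_real t * v))) has_real_derivative h' (f z) * f' z) (at 0)"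
    using DERIV_chain2[of h "h' (f z)" "\<lambda>t. f (z + of_real t * v)" 0 "f' z" UNIV] assms
    by (auto simp: has_dir_deriv_def)
qed

text \<open>Green's second identity in one direction: the derivative of \<open>c f1 - c1 f\<close>
  is \<open>c f2 - c2 f\<close>, because the mixed terms cancel.\<close>

lemma integral_by_parts_twice:
  assumes f: "has_dir_deriv f v f1" "has_dir_deriv f1 v f2"
    and c: "has_dir_deriv c v c1" "has_dir_deriv c1 v c2"
    and cont: "continuous_on UNIV f" "continuous_on UNIV f1" "continuous_on UNIV f2"
      "continuous_on UNIV c" "continuous_on UNIV c1" "continuous_on UNIV c2"
    and supp: "\<And>z. norm z > R \<Longrightarrow> c z = 0" "\<And>z. norm z > R \<Longrightarrow> c1 z = 0" "\<And>z. norm z > R \<Longrightarrow> c2 z = 0"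
  shows "integral\<^sup>L lborel (\<lambda>z. c z * f2 z) = integral\<^sup>L lborel (\<lambda>z. c2 z * f z)"
proof -
  have "has_dir_deriv (\<lambda>z. c z * f1 z - c1 z * f z) v
      (\<lambda>z. (c1 z * f1 z + c z * f2 z) - (c2 z * f z + c1 z * f1 z))"
    by (intro has_dir_deriv_diff has_dir_deriv_mult f c)
  then have "integral\<^sup>L lborel (\<lambda>z. (c1 z * f1 z + c z * f2 z) - (c2 z * f z + c1 z * f1 z)) = 0"
    by (rule integral_dir_deriv_eq_0[where R = R]) (auto intro!: continuous_intros cont simp: supp)
  then have "integral\<^sup>L lborel (\<lambda>z. c z * f2 z - c2 z * f z) = 0" by simp
  moreover have "integrable lborel (\<lambda>z. c z * f2 z)" "integrable lborel (\<lambda>z. c2 z * f z)"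
    by (rule integrable_compact_support[where R = R]; auto intro!: continuous_intros cont simp: supp)+
  ultimately show ?thesis by (simp add: Bochner_Integration.integral_diff)
qed

text \<open>Comparison with dyadic balls: on the shell with outer radius \<open>2^k\<close> the
  function is of order \<open>16^-k\<close>, while the ball has area \<open>pi * 4^k\<close>, so the
  integrals form a geometric series of ratio 1/4.\<close>

lemma integrable_inverse_square_square:
  "integrable lborel (\<lambda>z::complex. 1 / (1 + (norm z)\<^sup>2)\<^sup>2)"
proof -
  \<comment> \<open>For the least \<open>k\<close> with \<open>|z| < 2^k\<close> only
    \<open>2^(k-1) \<le> |z|\<close> is known; the factor 16 makes up for this shift by one, and it
    also covers \<open>k = 0\<close>, where the function is at most 1.\<close>
  let ?B = "\<lambda>k (z::complex). indicator (ball 0 (2 ^ k)) z * ennreal (16 * (1/16) ^ k)"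
  have le: "ennreal (1 / (1 + (norm z)\<^sup>2)\<^sup>2) \<le> (\<Sum>k. ?B k z)" for z :: complex
  proof -
    obtain m where m: "norm z < 2 ^ m" using real_arch_pow[of 2 "norm z"] by auto
    define k where "k = (LEAST k. norm z < 2 ^ k)"
    have k: "norm z < 2 ^ k" unfolding k_def using m by (rule LeastI)
    have "1 / (1 + (norm z)\<^sup>2)\<^sup>2 \<le> 16 * (1/16) ^ k"
    proof (cases k)
      case 0
      have "1 \<le> (1 + (norm z)\<^sup>2)\<^sup>2" by (simp add: one_le_power)
      then have "1 / (1 + (norm z)\<^sup>2)\<^sup>2 \<le> 1" using divide_le_eq_1 by fastforce
      then show ?thesis using 0 by simp
    next
      case (Suc j)
      then have "2 ^ j \<le> norm z" using not_less_Least[of j "\<lambda>k. norm z < 2 ^ k"] unfolding k_def by simp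
      then have "(2 ^ j) ^ 4 \<le> norm z ^ 4" by (intro power_mono) auto
      also have "\<dots> \<le> (1 + (norm z)\<^sup>2)\<^sup>2" by (simp add: power2_eq_square power4_eq_xxxx algebra_simps)
      finally have "16 ^ j \<le> (1 + (norm z)\<^sup>2)\<^sup>2"
        using power_mult[of "2::real" 4 j] power_mult[of "2::real" j 4] by (simp add: mult.commute)
      then show ?thesis using Suc by (simp add: power_one_over frac_le)
    qed
    then have "ennreal (1 / (1 + (norm z)\<^sup>2)\<^sup>2) \<le> ?B k z" using k by (simp add: ennreal_leI)
    also have "\<dots> \<le> (\<Sum>k. ?B k z)"
    proof -
      have "(\<Sum>j\<in>{k}. ?B j z) \<le> (\<Sum>k. ?B k z)" by (rule sum_le_suminf) auto
      moreover have "(\<Sum>j\<in>{k}. ?B j z) = ?B k z"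
        by (simp only: sum.insert sum.empty finite.emptyI empty_iff not_False_eq_True add_0_right)
      ultimately show ?thesis by (simp only:)
    qed
    finally show ?thesis .
  qed
  have "(\<integral>\<^sup>+z. ennreal (1 / (1 + (norm z)\<^sup>2)\<^sup>2) \<partial>(lborel::complex measure)) \<le> (\<integral>\<^sup>+z. (\<Sum>k. ?B k z) \<partial>lborel)"
    by (intro nn_integral_mono le)
  also have "\<dots> = (\<Sum>k. \<integral>\<^sup>+z. ?B k z \<partial>lborel)"
    by (rule nn_integral_suminf) (intro borel_measurable_times_ennreal borel_measurable_indicator
      borel_measurable_const; simp add: borel_open)
  also have "\<dots> = (\<Sum>k. ennreal (16 * pi * (1/4) ^ k))"
  proof -
    have "(\<integral>\<^sup>+z. ?B k z \<partial>lborel) = ennreal (16 * pi * (1/4) ^ k)" for k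
    proof -
      have "(\<integral>\<^sup>+z. ?B k z \<partial>lborel) = ennreal (16 * (1/16) ^ k) * emeasure lborel (ball (0::complex) (2 ^ k))"
        by (subst nn_integral_multc)
          (simp_all add: mult.commute borel_open nn_integral_indicator borel_measurable_indicator)
      also have "\<dots> = ennreal (16 * (1/16) ^ k) * ennreal (pi * (2 ^ k)\<^sup>2)"
        by (simp add: emeasure_ball unit_ball_vol_2)
      also have "\<dots> = ennreal (16 * pi * (1/4) ^ k)"
      proof -
        have "16 * (1/16) ^ k * (pi * (2 ^ k)\<^sup>2) = 16 * pi * ((1/16) ^ k * (2 ^ k * 2 ^ k))"
          by (simp add: power2_eq_square)
        also have "\<dots> = 16 * pi * (1/4) ^ k" unfolding power_mult_distrib[symmetric] by simp
        finally show ?thesis by (simp flip: ennreal_mult)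
      qed
      finally show ?thesis .
    qed
    then show ?thesis by simp
  qed
  also have "\<dots> = ennreal (\<Sum>k. 16 * pi * (1/4) ^ k)"
    by (rule suminf_ennreal2) (use summable_mult[OF summable_geometric[of "1/4::real"], of "16 * pi"] in auto)
  also have "\<dots> < \<infinity>" by simp
  finally have "(\<integral>\<^sup>+z. ennreal (1 / (1 + (norm z)\<^sup>2)\<^sup>2) \<partial>(lborel::complex measure)) < \<infinity>" .
  then show ?thesis by (intro integrableI_nonneg) auto
qed

text \<open>The exponent 3 is the smallest integer one for which the function is twice continuously
  differentiable, as two integrations by parts require.\<close>

definition cutoff :: "real \<Rightarrow> real" where "cutoff t = (max 0 (1 - t)) ^ 3"

lemma has_real_derivative_max_power:
  "((\<lambda>t::real. (max 0 (1 - t)) ^ Suc (Suc n)) has_real_derivative - real (Suc (Suc n)) * (max 0 (1 - t)) ^ Suc n) (at t)"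
proof -
  have m: "((\<lambda>t::real. (max 0 t) ^ Suc (Suc n)) has_real_derivative real (Suc (Suc n)) * (max 0 t) ^ Suc n) (at t)" for t
  proof -
    consider "t < 0" | "t > 0" | "t = 0" by linarith
    then show ?thesis
    proof cases
      case 1
      have "((\<lambda>t::real. 0) has_real_derivative 0) (at t)" by simp
      then have "((\<lambda>t::real. (max 0 t) ^ Suc (Suc n)) has_real_derivative 0) (at t)"
        by (rule has_field_derivative_transform_within_open[of _ _ _ "{..<0}"]) (use 1 in auto)
      then show ?thesis using 1 by simp
    next
      case 2
      have "((\<lambda>t::real. t ^ Suc (Suc n)) has_real_derivative real (Suc (Suc n)) * t ^ Suc n) (at t)"
        using DERIV_pow[of "Suc (Suc n)" t UNIV] by simp
      then have "((\<lambda>t::real. (max 0 t) ^ Suc (Suc n)) has_real_derivative real (Suc (Suc n)) * t ^ Suc n) (at t)"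
        by (rule has_field_derivative_transform_within_open[of _ _ _ "{0<..}"]) (use 2 in auto)
      then show ?thesis using 2 by simp
    next
      case 3
      have "((\<lambda>h::real. (max 0 h) ^ Suc n) \<longlongrightarrow> (max 0 0) ^ Suc n) (at 0)"
        by (intro tendsto_power tendsto_max tendsto_const tendsto_ident_at)
      then have l: "((\<lambda>h::real. (max 0 h) ^ Suc n) \<longlongrightarrow> 0) (at 0)" by simp
      \<comment> \<open>At the kink the difference quotient is the next lower power, which still has
        a positive exponent and therefore tends to 0.\<close>
      have "((\<lambda>h::real. ((max 0 h) ^ Suc (Suc n)) / h) \<longlongrightarrow> 0) (at 0)"
      proof (rule tendsto_cong[THEN iffD1, OF _ l])
        have "(max 0 h) ^ Suc n = (max 0 h) ^ Suc (Suc n) / h" if "h \<noteq> 0" for h :: real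
          using that by (cases "h > 0") (simp_all add: max_def)
        then show "\<forall>\<^sub>F h in at 0. (max 0 h) ^ Suc n = (max 0 h) ^ Suc (Suc n) / (h::real)"
          by (simp add: eventually_at_filter)
      qed
      then show ?thesis using 3 by (simp add: DERIV_def)
    qed
  qed
  have "((\<lambda>t::real. 1 - t) has_real_derivative -1) (at t)" by (auto intro!: derivative_eq_intros)
  from DERIV_chain2[OF m this] show ?thesis by (simp del: of_nat_Suc power_Suc)
qed

text \<open>The logarithmic cutoff functions tend to 1 while the \<open>L\<^sup>1\<close> norms of their Laplacians tend to 0;
  this is how the parabolicity of the plane enters.\<close>

definition log_cutoff :: "real \<Rightarrow> complex \<Rightarrow> real" where
  "log_cutoff l z = cutoff (ln (1 + (norm z)\<^sup>2) / l)"

section \<open>Derivatives of the logarithmic cutoff functions\<close>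

definition "cutoff1 t = - 3 * (max 0 (1 - t :: real)) ^ 2"
definition "cutoff2 t = 6 * max 0 (1 - t :: real)"

lemma cutoff_deriv: "(cutoff has_real_derivative cutoff1 t) (at t)"
  "(cutoff1 has_real_derivative cutoff2 t) (at t)"
proof -
  have e: "Suc (Suc 1) = 3" "Suc 2 = 3" "Suc 1 = 2" "Suc (Suc 0) = 2" by simp_all
  have "((\<lambda>t. (max 0 (1 - t)) ^ 3) has_real_derivative - real 3 * (max 0 (1 - t)) ^ 2) (at t)"
    using has_real_derivative_max_power[of 1 t] unfolding e .
  then show "(cutoff has_real_derivative cutoff1 t) (at t)"
    unfolding cutoff_def[abs_def] cutoff1_def by (simp only: of_nat_numeral)
  have "((\<lambda>t. -3 * (max 0 (1 - t)) ^ 2) has_real_derivative -3 * (- real 2 * (max 0 (1 - t)) ^ Suc 0)) (at t)"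
    using DERIV_cmult[OF has_real_derivative_max_power[of 0 t], of "-3"] unfolding e .
  moreover have "-3 * (- real 2 * (max 0 (1 - t)) ^ Suc 0) = 6 * max 0 (1 - t)" by simp
  ultimately show "(cutoff1 has_real_derivative cutoff2 t) (at t)"
    unfolding cutoff1_def[abs_def] cutoff2_def by (simp only:)
qed

text \<open>These are the first and second derivatives of \<open>ln (1 + |z|^2)\<close> in the
  direction \<open>v\<close>.\<close>

definition "log_deriv1 v z = 2 * (v \<bullet> z) / (1 + (norm z)\<^sup>2)" for v z :: complex
definition "log_deriv2 v z = 2 * (v \<bullet> v) / (1 + (norm z)\<^sup>2) - 4 * (v \<bullet> z)\<^sup>2 / (1 + (norm z)\<^sup>2)\<^sup>2" for v z :: complex

lemma one_plus_norm_pos: "1 + (norm z)\<^sup>2 > 0" "1 + (norm z)\<^sup>2 \<noteq> 0" for z :: complex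
  by (simp_all add: add_pos_nonneg add_nonneg_eq_0_iff)

lemma dir_deriv_norm: "has_dir_deriv (\<lambda>z. 1 + (norm z)\<^sup>2) v (\<lambda>z. 2 * (v \<bullet> z))"
  unfolding has_dir_deriv_def
proof
  fix z
  have lin: "((\<lambda>t. a + t * b) has_real_derivative b) (at 0)" for a b :: real
    using DERIV_add[OF DERIV_const DERIV_cmult_right[OF DERIV_ident]] by simp
  have sq: "((\<lambda>t. (a + t * b)\<^sup>2) has_real_derivative 2 * (b * a)) (at 0)" for a b :: real
    using DERIV_mult[OF lin[of a b] lin[of a b]] by (simp add: power2_eq_square mult.commute)
  have "((\<lambda>t. 1 + (a + t * b)\<^sup>2 + (c + t * d)\<^sup>2) has_real_derivative 2 * (b * a + d * c)) (at 0)"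
    for a b c d :: real
    using DERIV_add[OF DERIV_add[OF DERIV_const sq[of a b]] sq[of c d]] by simp
  from this[of "Re z" "Re v" "Im z" "Im v"]
  show "((\<lambda>t. 1 + (norm (z + of_real t * v))\<^sup>2) has_real_derivative 2 * (v \<bullet> z)) (at 0)"
    by (simp add: cmod_power2 inner_complex_def add.assoc)
qed

lemma dir_deriv_inner: "has_dir_deriv (\<lambda>z. 2 * (v \<bullet> z)) v (\<lambda>z. 2 * (v \<bullet> v))"
  unfolding has_dir_deriv_def
proof
  fix z
  have "((\<lambda>t. 2 * (v \<bullet> z) + t * (2 * (v \<bullet> v))) has_real_derivative 2 * (v \<bullet> v)) (at 0)"
    using DERIV_add[OF DERIV_const DERIV_cmult_right[OF DERIV_ident]] by simp
  moreover have "2 * (v \<bullet> z) + t * (2 * (v \<bullet> v)) = 2 * (v \<bullet> (z + of_real t * v))" for t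
    by (simp add: inner_complex_def algebra_simps)
  ultimately show "((\<lambda>t. 2 * (v \<bullet> (z + of_real t * v))) has_real_derivative 2 * (v \<bullet> v)) (at 0)"
    by (simp only:)
qed

lemma dir_deriv_log: "has_dir_deriv (\<lambda>z. ln (1 + (norm z)\<^sup>2)) v (log_deriv1 v)"
  using has_dir_deriv_compose[OF dir_deriv_norm, of ln inverse v] one_plus_norm_pos
  by (auto simp: log_deriv1_def[abs_def] divide_inverse mult.commute intro!: DERIV_ln)

lemma dir_deriv_log1: "has_dir_deriv (log_deriv1 v) v (log_deriv2 v)"
proof -
  have "has_dir_deriv (\<lambda>z. inverse (1 + (norm z)\<^sup>2)) v (\<lambda>z. - (inverse (1 + (norm z)\<^sup>2) ^ Suc (Suc 0)) * (2 * (v \<bullet> z)))"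
    by (rule has_dir_deriv_compose[OF dir_deriv_norm]) (rule DERIV_inverse, rule one_plus_norm_pos)
  from has_dir_deriv_mult[OF dir_deriv_inner this]
  have "has_dir_deriv (\<lambda>z. 2 * (v \<bullet> z) * inverse (1 + (norm z)\<^sup>2)) v
    (\<lambda>z. 2 * (v \<bullet> v) * inverse (1 + (norm z)\<^sup>2) +
          2 * (v \<bullet> z) * (- (inverse (1 + (norm z)\<^sup>2) ^ Suc (Suc 0)) * (2 * (v \<bullet> z))))" .
  moreover have "(\<lambda>z. 2 * (v \<bullet> z) * inverse (1 + (norm z)\<^sup>2)) = log_deriv1 v"
    unfolding log_deriv1_def[abs_def] divide_inverse ..
  moreover have "(\<lambda>z. 2 * (v \<bullet> v) * inverse (1 + (norm z)\<^sup>2) +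
          2 * (v \<bullet> z) * (- (inverse (1 + (norm z)\<^sup>2) ^ Suc (Suc 0)) * (2 * (v \<bullet> z)))) = log_deriv2 v"
  proof
    fix z
    have eq: "a * i + 2 * c * (- (i ^ Suc (Suc 0)) * (2 * c)) = a * i - 4 * c\<^sup>2 * i\<^sup>2" for a i c :: real
      by (simp add: power2_eq_square)
    show "2 * (v \<bullet> v) * inverse (1 + (norm z)\<^sup>2) +
          2 * (v \<bullet> z) * (- (inverse (1 + (norm z)\<^sup>2) ^ Suc (Suc 0)) * (2 * (v \<bullet> z))) = log_deriv2 v z"
      unfolding log_deriv2_def divide_inverse power_inverse[symmetric] by (rule eq)
  qed
  ultimately show ?thesis by (simp only:)
qed

definition "log_cutoff1 l v z = cutoff1 (ln (1 + (norm z)\<^sup>2) / l) * (log_deriv1 v z / l)"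
definition "log_cutoff2 l v z = cutoff2 (ln (1 + (norm z)\<^sup>2) / l) * (log_deriv1 v z / l) * (log_deriv1 v z / l)
  + cutoff1 (ln (1 + (norm z)\<^sup>2) / l) * (log_deriv2 v z / l)"

lemma dir_deriv_divide: "has_dir_deriv f v f' \<Longrightarrow> has_dir_deriv (\<lambda>z. f z / l) v (\<lambda>z. f' z / l)"
  unfolding has_dir_deriv_def by (auto intro: DERIV_cdivide)

lemma dir_deriv_log_cutoff:
  shows "has_dir_deriv (log_cutoff l) v (log_cutoff1 l v)"
    "has_dir_deriv (log_cutoff1 l v) v (log_cutoff2 l v)"
proof -
  show "has_dir_deriv (log_cutoff l) v (log_cutoff1 l v)"
    unfolding log_cutoff_def[abs_def] log_cutoff1_def[abs_def]
    by (rule has_dir_deriv_compose[OF dir_deriv_divide[OF dir_deriv_log]]) (rule cutoff_deriv)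
  show "has_dir_deriv (log_cutoff1 l v) v (log_cutoff2 l v)"
    unfolding log_cutoff1_def[abs_def] log_cutoff2_def[abs_def]
    by (rule has_dir_deriv_mult[OF has_dir_deriv_compose[OF dir_deriv_divide[OF dir_deriv_log]]
          dir_deriv_divide[OF dir_deriv_log1]]) (rule cutoff_deriv)
qed

lemma continuous_log_cutoff:
  assumes "l > 0"
  shows "continuous_on UNIV (log_cutoff l)" "continuous_on UNIV (log_cutoff1 l v)"
    "continuous_on UNIV (log_cutoff2 l v)"
proof -
  have 1: "continuous_on UNIV (\<lambda>z::complex. ln (1 + (norm z)\<^sup>2) / l)"
    using assms one_plus_norm_pos by (auto intro!: continuous_intros)
  have 2: "continuous_on UNIV (\<lambda>z. log_deriv1 v z / l)" "continuous_on UNIV (\<lambda>z. log_deriv2 v z / l)"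
    unfolding log_deriv1_def log_deriv2_def
    using assms one_plus_norm_pos by (auto intro!: continuous_intros)
  show "continuous_on UNIV (log_cutoff l)" "continuous_on UNIV (log_cutoff1 l v)"
    "continuous_on UNIV (log_cutoff2 l v)"
    unfolding log_cutoff_def[abs_def] log_cutoff1_def[abs_def] log_cutoff2_def[abs_def]
      cutoff_def cutoff1_def cutoff2_def
    by (intro continuous_intros 1 2)+
qed

lemma log_cutoff_eq_0:
  assumes "l > 0" "norm z > exp l"
  shows "log_cutoff l z = 0" "log_cutoff1 l v z = 0" "log_cutoff2 l v z = 0"
proof -
  \<comment> \<open>The support really lies in the disc of radius \<open>exp (l / 2)\<close>; the
    radius \<open>exp l\<close> is cruder but spares the square root, since
    \<open>exp l \<le> (exp l)^2\<close> for positive \<open>l\<close>.\<close>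
  have "exp l \<le> exp l * exp l" using assms(1) by simp
  also have "\<dots> \<le> (norm z)\<^sup>2" unfolding power2_eq_square using assms(2) by (intro mult_mono) auto
  finally have "exp l \<le> 1 + (norm z)\<^sup>2" by simp
  then have "l \<le> ln (1 + (norm z)\<^sup>2)" by (simp add: ln_ge_iff one_plus_norm_pos)
  then have "1 - ln (1 + (norm z)\<^sup>2) / l \<le> 0" using assms(1) by (simp add: field_simps)
  then show "log_cutoff l z = 0" "log_cutoff1 l v z = 0" "log_cutoff2 l v z = 0"
    by (auto simp: log_cutoff_def log_cutoff1_def log_cutoff2_def cutoff_def cutoff1_def cutoff2_def)
qed

lemma log_cutoff_bounds: "l > 0 \<Longrightarrow> 0 \<le> log_cutoff l z" "l > 0 \<Longrightarrow> log_cutoff l z \<le> 1"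
proof -
  assume l: "l > 0"
  have "0 \<le> ln (1 + (norm z)\<^sup>2)" by (intro ln_ge_zero) simp
  then have "max 0 (1 - ln (1 + (norm z)\<^sup>2) / l) \<le> 1" using l by simp
  then show "log_cutoff l z \<le> 1" unfolding log_cutoff_def cutoff_def by (intro power_le_one) auto
qed (simp add: log_cutoff_def cutoff_def)

text \<open>The Laplacian is \<open>P - Q\<close> with both parts nonnegative: \<open>P\<close>
  comes from the squared gradient of the logarithm, \<open>Q\<close> from its Laplacian
  \<open>4 / (1 + |z|^2)^2\<close>. A sum of derivatives of compactly supported functions has
  integral 0, so \<open>P\<close> and \<open>Q\<close> have the same integral, and the
  \<open>L^1\<close> norm is at most twice that of \<open>Q\<close>. The slope of the cutoff is at
  most 3, whence 24 = 2 * 3 * 4.\<close>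

lemma log_cutoff_laplacian_bound:
  assumes "l > 0"
  shows "integral\<^sup>L lborel (\<lambda>z. \<bar>log_cutoff2 l 1 z + log_cutoff2 l \<i> z\<bar>)
    \<le> 24 / l * integral\<^sup>L lborel (\<lambda>z::complex. 1 / (1 + (norm z)\<^sup>2)\<^sup>2)"
proof -
  let ?t = "\<lambda>z::complex. ln (1 + (norm z)\<^sup>2) / l"
  define P where "P z = cutoff2 (?t z) * ((log_deriv1 1 z / l)\<^sup>2 + (log_deriv1 \<i> z / l)\<^sup>2)" for z
  define Q where "Q z = - cutoff1 (?t z) * (4 / (1 + (norm z)\<^sup>2)\<^sup>2 / l)" for z :: complex
  let ?L = "\<lambda>z. log_cutoff2 l 1 z + log_cutoff2 l \<i> z"
  have L: "?L z = P z - Q z" for z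
  proof -
    have n: "Re z ^ 2 + Im z ^ 2 = (norm z)\<^sup>2" by (simp add: cmod_power2)
    have "log_deriv2 1 z + log_deriv2 \<i> z = 4 / (1 + (norm z)\<^sup>2) - 4 * (Re z ^ 2 + Im z ^ 2) / (1 + (norm z)\<^sup>2)\<^sup>2"
      by (simp add: log_deriv2_def inner_complex_def add_divide_distrib)
    also have "\<dots> = 4 / (1 + (norm z)\<^sup>2)\<^sup>2"
    proof -
      have "4 / a - 4 * (a - 1) / a\<^sup>2 = 4 / a\<^sup>2" if "a \<noteq> 0" for a :: real
        using that by (simp add: field_simps power2_eq_square)
      from this[OF one_plus_norm_pos(2)[of z]] show ?thesis unfolding n by simp
    qed
    finally have "cutoff1 (?t z) * ((log_deriv2 1 z + log_deriv2 \<i> z) / l) = - Q z" by (simp add: Q_def)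
    then show ?thesis
      by (simp add: log_cutoff2_def P_def power2_eq_square algebra_simps add_divide_distrib)
  qed
  have P: "P z \<ge> 0" for z by (simp add: P_def cutoff2_def)
  have Q: "Q z \<ge> 0" for z using assms by (simp add: Q_def cutoff1_def)
  have Q': "Q z \<le> 12 / l * (1 / (1 + (norm z)\<^sup>2)\<^sup>2)" for z
  proof -
    have "0 \<le> ?t z" using assms by (intro divide_nonneg_pos ln_ge_zero) auto
    then have "(max 0 (1 - ?t z))\<^sup>2 \<le> 1" by (intro power_le_one) auto
    then have "- cutoff1 (?t z) \<le> 3" by (simp add: cutoff1_def)
    then have "Q z \<le> 3 * (4 / (1 + (norm z)\<^sup>2)\<^sup>2 / l)"
      unfolding Q_def using assms by (intro mult_right_mono) auto
    then show ?thesis by (simp add: mult.commute)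
  qed
  have cQ: "continuous_on UNIV Q"
    unfolding Q_def cutoff1_def using assms one_plus_norm_pos by (auto intro!: continuous_intros)
  have Q0: "norm z > exp l \<Longrightarrow> Q z = 0" for z
    using log_cutoff_eq_0(1)[OF assms] by (simp add: Q_def cutoff1_def log_cutoff_def cutoff_def)
  have [simp]: "integrable lborel Q" by (rule integrable_compact_support[OF cQ Q0])
  have i2: "integrable lborel (log_cutoff2 l v)" for v
    by (rule integrable_compact_support[OF continuous_log_cutoff(3)[OF assms] log_cutoff_eq_0(3)[OF assms]])
  then have iL: "integrable lborel ?L" by simp
  have "P = (\<lambda>z. ?L z + Q z)" using L by (simp add: fun_eq_iff)
  then have iP: "integrable lborel P" using iL by simp
  have "integral\<^sup>L lborel (log_cutoff2 l v) = 0" for v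
    by (rule integral_dir_deriv_eq_0[OF dir_deriv_log_cutoff(2) continuous_log_cutoff(2,3)[OF assms]
          log_cutoff_eq_0(2,3)[OF assms]])
  then have "integral\<^sup>L lborel ?L = 0" using i2 by simp
  then have PQ: "integral\<^sup>L lborel P = integral\<^sup>L lborel Q"
    using iP by (simp add: L Bochner_Integration.integral_diff)
  have "integral\<^sup>L lborel (\<lambda>z. \<bar>?L z\<bar>) \<le> integral\<^sup>L lborel (\<lambda>z. P z + Q z)"
    using iL iP P Q L by (intro integral_mono) (auto simp: abs_le_iff)
  also have "\<dots> = 2 * integral\<^sup>L lborel Q" using iP PQ by simp
  also have "integral\<^sup>L lborel Q \<le> integral\<^sup>L lborel (\<lambda>z::complex. 12 / l * (1 / (1 + (norm z)\<^sup>2)\<^sup>2))"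
    using Q' integrable_inverse_square_square
    by (intro integral_mono integrable_mult_right) auto
  also have "\<dots> = 12 / l * integral\<^sup>L lborel (\<lambda>z::complex. 1 / (1 + (norm z)\<^sup>2)\<^sup>2)"
    by (rule integral_mult_right_zero)
  finally show ?thesis by simp
qed

text \<open>Testing against a cutoff moves the Laplacian from the bounded \<open>f\<close> to the
  cutoff, at a cost of \<open>|C|\<close> times its \<open>L^1\<close> norm, which tends to 0. Hence
  the cut-off positive part has at most the integral of the negative part plus an error tending to
  0, and Fatou's lemma removes the cutoff. As an inequality the result serves twice: for a
  subharmonic function the right side is 0, and for the degrees it yields integrability.\<close>

theorem parabolic_plane:
  fixes f :: "complex \<Rightarrow> real"
  assumes d: "has_dir_deriv f 1 fx" "has_dir_deriv fx 1 fxx" "has_dir_deriv f \<i> fy" "has_dir_deriv fy \<i> fyy"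
    and cont: "continuous_on UNIV f" "continuous_on UNIV fx" "continuous_on UNIV fxx"
      "continuous_on UNIV fy" "continuous_on UNIV fyy"
    and bdd: "AE z in lborel. \<bar>f z\<bar> \<le> C"
    and neg: "(\<integral>\<^sup>+z. ennreal (- (fxx z + fyy z)) \<partial>lborel) < \<infinity>"
  shows "(\<integral>\<^sup>+z. ennreal (fxx z + fyy z) \<partial>lborel) \<le> (\<integral>\<^sup>+z. ennreal (- (fxx z + fyy z)) \<partial>lborel)"
proof -
  define w where "w z = fxx z + fyy z" for z
  define B where "B = (\<integral>\<^sup>+z. ennreal (- w z) \<partial>lborel)"
  define J where "J = 24 * integral\<^sup>L lborel (\<lambda>z::complex. 1 / (1 + (norm z)\<^sup>2)\<^sup>2)"
  \<comment> \<open>The parameter starts at 1 because the cutoff divides by it.\<close>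
  define c where "c n = log_cutoff (real (Suc n))" for n
  have cw: "continuous_on UNIV w" unfolding w_def by (intro continuous_intros cont)
  have [measurable]: "w \<in> borel_measurable borel" using cw by (rule borel_measurable_continuous_onI)
  have [measurable]: "f \<in> borel_measurable borel" using cont(1) by (rule borel_measurable_continuous_onI)
  have cc: "continuous_on UNIV (c n)" for n unfolding c_def by (intro continuous_log_cutoff) simp
  have [measurable]: "c n \<in> borel_measurable borel" for n using cc by (rule borel_measurable_continuous_onI)
  have cb: "0 \<le> c n z" "c n z \<le> 1" for n z unfolding c_def by (auto intro!: log_cutoff_bounds)
  have c0: "norm z > exp (real (Suc n)) \<Longrightarrow> c n z = 0" for n z unfolding c_def by (rule log_cutoff_eq_0) auto
  \<comment> \<open>\<open>ennreal\<close> sends negative numbers to 0, so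
    \<open>ennreal (w z)\<close> is already the positive part of \<open>w z\<close>.\<close>
  have max0: "ennreal (max 0 x) = ennreal x" for x
    by (cases "x \<ge> 0") (auto simp: ennreal_neg max_def)
  have main: "(\<integral>\<^sup>+z. ennreal (c n z * max 0 (w z)) \<partial>lborel) \<le> B + ennreal (\<bar>C\<bar> * (J / real (Suc n)))" for n
  proof -
    let ?l = "real (Suc n)"
    let ?L = "\<lambda>z. log_cutoff2 ?l 1 z + log_cutoff2 ?l \<i> z"
    have l: "?l > 0" by simp
    note parts = integral_by_parts_twice[OF _ _ dir_deriv_log_cutoff _ _ _ continuous_log_cutoff[OF l]
        log_cutoff_eq_0[OF l]]
    have i: "integrable lborel (\<lambda>z. c n z * fxx z)" "integrable lborel (\<lambda>z. c n z * fyy z)"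
      "integrable lborel (\<lambda>z. log_cutoff2 ?l 1 z * f z)" "integrable lborel (\<lambda>z. log_cutoff2 ?l \<i> z * f z)"
      "integrable lborel (\<lambda>z. c n z * max 0 (w z))" "integrable lborel (\<lambda>z. c n z * max 0 (- w z))"
      by (rule integrable_compact_support[where R = "exp ?l"];
          simp add: c0 log_cutoff_eq_0[OF l] continuous_on_mult cont cc cw continuous_on_max
            continuous_on_minus continuous_on_const continuous_log_cutoff[OF l] del: of_nat_Suc)+
    have i2: "integrable lborel (log_cutoff2 ?l v)" for v
      by (rule integrable_compact_support[OF continuous_log_cutoff(3)[OF l] log_cutoff_eq_0(3)[OF l]])
    have "integral\<^sup>L lborel (\<lambda>z. c n z * w z) =
        integral\<^sup>L lborel (\<lambda>z. c n z * fxx z) + integral\<^sup>L lborel (\<lambda>z. c n z * fyy z)"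
      using i by (simp add: w_def distrib_left)
    also have "\<dots> = integral\<^sup>L lborel (\<lambda>z. log_cutoff2 ?l 1 z * f z) + integral\<^sup>L lborel (\<lambda>z. log_cutoff2 ?l \<i> z * f z)"
      unfolding c_def using parts[OF d(1,2) cont(1,2,3)] parts[OF d(3,4) cont(1,4,5)] by simp
    also have "\<dots> = integral\<^sup>L lborel (\<lambda>z. ?L z * f z)"
      using i by (simp add: distrib_right)
    also have "\<dots> \<le> integral\<^sup>L lborel (\<lambda>z. \<bar>C\<bar> * \<bar>?L z\<bar>)"
    proof (rule integral_mono_AE)
      show "integrable lborel (\<lambda>z. ?L z * f z)" using i by (simp add: distrib_right)
      show "integrable lborel (\<lambda>z. \<bar>C\<bar> * \<bar>?L z\<bar>)" using i2 by simp
      show "AE z in lborel. ?L z * f z \<le> \<bar>C\<bar> * \<bar>?L z\<bar>"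
        using bdd
      proof eventually_elim
        case (elim z)
        have "?L z * f z \<le> \<bar>?L z\<bar> * \<bar>f z\<bar>" by (simp flip: abs_mult)
        also have "\<dots> \<le> \<bar>?L z\<bar> * \<bar>C\<bar>" using elim by (intro mult_left_mono) auto
        finally show ?case by (simp add: mult.commute)
      qed
    qed
    also have "\<dots> \<le> \<bar>C\<bar> * (J / ?l)"
    proof -
      have "integral\<^sup>L lborel (\<lambda>z. \<bar>?L z\<bar>) \<le> J / ?l"
        using log_cutoff_laplacian_bound[OF l] by (simp add: J_def del: of_nat_Suc)
      then show ?thesis by (simp only: integral_mult_right_zero mult_left_mono abs_ge_zero)
    qed
    finally have "integral\<^sup>L lborel (\<lambda>z. c n z * w z) \<le> \<bar>C\<bar> * (J / ?l)" .
    moreover have "(\<lambda>z. c n z * w z) = (\<lambda>z. c n z * max 0 (w z) - c n z * max 0 (- w z))"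
      by (auto simp: max_def fun_eq_iff algebra_simps)
    ultimately have le: "integral\<^sup>L lborel (\<lambda>z. c n z * max 0 (w z)) \<le>
        integral\<^sup>L lborel (\<lambda>z. c n z * max 0 (- w z)) + \<bar>C\<bar> * (J / ?l)"
      using i by (simp add: Bochner_Integration.integral_diff)
    have J: "J \<ge> 0" unfolding J_def by (intro mult_nonneg_nonneg integral_nonneg_AE) auto
    have "(\<integral>\<^sup>+z. ennreal (c n z * max 0 (w z)) \<partial>lborel) = ennreal (integral\<^sup>L lborel (\<lambda>z. c n z * max 0 (w z)))"
      using i(5) cb by (intro nn_integral_eq_integral) auto
    also have "\<dots> \<le> ennreal (integral\<^sup>L lborel (\<lambda>z. c n z * max 0 (- w z)) + \<bar>C\<bar> * (J / ?l))"
      using le by (rule ennreal_leI)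
    also have "\<dots> = ennreal (integral\<^sup>L lborel (\<lambda>z. c n z * max 0 (- w z))) + ennreal (\<bar>C\<bar> * (J / ?l))"
      using J cb by (intro ennreal_plus integral_nonneg_AE) auto
    also have "ennreal (integral\<^sup>L lborel (\<lambda>z. c n z * max 0 (- w z))) = (\<integral>\<^sup>+z. ennreal (c n z * max 0 (- w z)) \<partial>lborel)"
      using i(6) cb by (intro nn_integral_eq_integral[symmetric]) auto
    also have "\<dots> \<le> B"
      unfolding B_def
    proof (rule nn_integral_mono)
      fix z
      have "c n z * max 0 (- w z) \<le> 1 * max 0 (- w z)" by (intro mult_right_mono cb) auto
      then have "ennreal (c n z * max 0 (- w z)) \<le> ennreal (max 0 (- w z))" by (simp add: ennreal_leI)
      then show "ennreal (c n z * max 0 (- w z)) \<le> ennreal (- w z)" by (simp only: max0)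
    qed
    finally show ?thesis by (simp add: add_right_mono)
  qed
  have lim: "(\<lambda>n. c n z) \<longlonglongrightarrow> 1" for z
  proof -
    have "(\<lambda>n. ln (1 + (norm z)\<^sup>2) / real (Suc n)) \<longlonglongrightarrow> 0"
      using tendsto_mult_right_zero[OF LIMSEQ_inverse_real_of_nat, of "ln (1 + (norm z)\<^sup>2)"]
      by (simp only: divide_inverse)
    then have "(\<lambda>n. (max 0 (1 - ln (1 + (norm z)\<^sup>2) / real (Suc n))) ^ 3) \<longlonglongrightarrow> (max 0 (1 - 0)) ^ 3"
      by (intro tendsto_power tendsto_max tendsto_diff tendsto_const)
    then show ?thesis by (simp add: c_def log_cutoff_def cutoff_def)
  qed
  have limw: "(\<lambda>n. ennreal (c n z * max 0 (w z))) \<longlonglongrightarrow> ennreal (w z)" for z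
    using tendsto_ennrealI[OF tendsto_mult[OF lim[of z] tendsto_const[of "max 0 (w z)"]]] by (simp add: max0)
  have "(\<integral>\<^sup>+z. ennreal (w z) \<partial>lborel) = (\<integral>\<^sup>+z. liminf (\<lambda>n. ennreal (c n z * max 0 (w z))) \<partial>lborel)"
    using lim_imp_Liminf[OF _ limw] by simp
  also have "\<dots> \<le> liminf (\<lambda>n. \<integral>\<^sup>+z. ennreal (c n z * max 0 (w z)) \<partial>lborel)"
    by (rule nn_integral_liminf) measurable
  also have "\<dots> \<le> liminf (\<lambda>n. B + ennreal (\<bar>C\<bar> * (J / real (Suc n))))"
    by (intro Liminf_mono always_eventually allI main)
  also have "\<dots> = B"
  proof (rule lim_imp_Liminf)
    have "(\<lambda>n. \<bar>C\<bar> * (J / real (Suc n))) \<longlonglongrightarrow> \<bar>C\<bar> * 0"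
      by (intro tendsto_mult tendsto_const)
        (use tendsto_mult_right_zero[OF LIMSEQ_inverse_real_of_nat, of J] in \<open>simp only: divide_inverse\<close>)
    from tendsto_ennrealI[OF this]
    have "(\<lambda>n. B + ennreal (\<bar>C\<bar> * (J / real (Suc n)))) \<longlonglongrightarrow> B + ennreal (\<bar>C\<bar> * 0)"
      by (intro tendsto_add tendsto_const)
    then show "(\<lambda>n. B + ennreal (\<bar>C\<bar> * (J / real (Suc n)))) \<longlonglongrightarrow> B" by simp
  qed simp
  finally show ?thesis unfolding w_def B_def .
qed

section \<open>Bases and Hermitian forms on subspaces\<close>

locale cvs = vector_space scale
  for scale :: "complex \<Rightarrow> 'v::ab_group_add \<Rightarrow> 'v" (infixr \<open>*c\<close> 75)
begin

definition basis_list :: "'v set \<Rightarrow> 'v list \<Rightarrow> bool" where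
  "basis_list V b \<longleftrightarrow> distinct b \<and> independent (set b) \<and> span (set b) = V"

text \<open>The pointwise form of \<open>coord\<close>: the \<open>i\<close>-th coordinate once a
  frame has been evaluated at a point. Lists are used throughout because matrices and determinants
  need the basis ordered.\<close>

definition cf :: "'v list \<Rightarrow> nat \<Rightarrow> 'v \<Rightarrow> complex" where
  "cf b i v = representation (set b) v (b ! i)"

definition comb :: "(nat \<Rightarrow> complex) \<Rightarrow> 'v list \<Rightarrow> 'v" where
  "comb c b = (\<Sum>i<length b. c i *c b ! i)"

lemma sum_set_nth:
  assumes "distinct b" shows "(\<Sum>x\<in>set b. f x) = (\<Sum>i<length b. f (b ! i))"
  using sum.reindex_bij_betw[OF bij_betw_nth[OF assms refl refl], of f] by simp

lemma basis_list_subspace: "basis_list V b \<Longrightarrow> subspace V"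
  unfolding basis_list_def using subspace_span by blast

lemma basis_list_set: "basis_list V b \<Longrightarrow> set b \<subseteq> V"
  unfolding basis_list_def using span_superset by blast

lemma basis_list_nth: "basis_list V b \<Longrightarrow> i < length b \<Longrightarrow> b ! i \<in> V"
  using basis_list_set nth_mem by blast

lemma comb_in: "subspace V \<Longrightarrow> set b \<subseteq> V \<Longrightarrow> comb c b \<in> V"
  unfolding comb_def by (intro subspace_sum subspace_scale) auto

lemma comb_cf:
  assumes "basis_list V b" "v \<in> V"
  shows "comb (\<lambda>i. cf b i v) b = v"
  using sum_representation_eq[of "set b" v "set b"] sum_set_nth[of b "\<lambda>x. representation (set b) v x *c x"] assms
  by (simp add: basis_list_def comb_def cf_def)

lemma cf_linear:
  assumes "basis_list V b" "u \<in> V" "v \<in> V"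
  shows "cf b i (x *c u + y *c v) = x * cf b i u + y * cf b i v"
  using assms by (auto simp: basis_list_def cf_def representation_add representation_scale span_scale)

lemma cf_zero [simp]: "cf b i 0 = 0"
  by (simp add: cf_def representation_zero)

lemma cf_add: "basis_list V b \<Longrightarrow> u \<in> V \<Longrightarrow> v \<in> V \<Longrightarrow> cf b i (u + v) = cf b i u + cf b i v"
  and cf_scale: "basis_list V b \<Longrightarrow> u \<in> V \<Longrightarrow> cf b i (x *c u) = x * cf b i u"
  using cf_linear[of V b u v i 1 1] cf_linear[of V b u u i x 0] by simp_all

lemma cf_sum:
  assumes "basis_list V b" "\<And>k. k \<in> A \<Longrightarrow> f k \<in> V"
  shows "cf b i (\<Sum>k\<in>A. f k) = (\<Sum>k\<in>A. cf b i (f k))"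
  using assms(2)
proof (induction A rule: infinite_finite_induct)
  case (insert x F)
  then show ?case using basis_list_subspace[OF assms(1)]
    by (simp add: cf_add[OF assms(1)] subspace_sum)
qed auto

lemma cf_nth: "basis_list V b \<Longrightarrow> i < length b \<Longrightarrow> j < length b \<Longrightarrow> cf b i (b ! j) = (if i = j then 1 else 0)"
  by (auto simp: basis_list_def cf_def representation_basis nth_eq_iff_index_eq)

lemma cf_comb: assumes "basis_list V b" "i < length b" shows "cf b i (comb c b) = c i"
proof -
  have V: "b ! k \<in> V" if "k < length b" for k using basis_list_nth[OF assms(1) that] .
  have "cf b i (comb c b) = (\<Sum>k<length b. cf b i (c k *c b ! k))"
    unfolding comb_def using V basis_list_subspace[OF assms(1)] subspace_scale
    by (intro cf_sum[OF assms(1)]) auto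
  also have "\<dots> = (\<Sum>k<length b. if i = k then c k else 0)"
    using V assms by (intro sum.cong) (auto simp: cf_scale[OF assms(1)] cf_nth)
  finally show ?thesis using assms(2) by simp
qed

lemma cf_eqI: "basis_list V b \<Longrightarrow> u \<in> V \<Longrightarrow> v \<in> V \<Longrightarrow> (\<And>i. i < length b \<Longrightarrow> cf b i u = cf b i v) \<Longrightarrow> u = v"
  using comb_cf[of V b u] comb_cf[of V b v] by (simp add: comb_def)

lemma dim_basis_list: "basis_list V b \<Longrightarrow> dim V = length b"
  unfolding basis_list_def by (metis dim_eq_card distinct_card span_span)

lemma independent_list:
  assumes "\<And>c. comb c b = 0 \<Longrightarrow> \<forall>i<length b. c i = 0"
  shows "distinct b" "independent (set b)"
proof -
  show d: "distinct b"
    unfolding distinct_conv_nth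
  proof (intro allI impI notI)
    fix i j assume ij: "i < length b" "j < length b" "i \<noteq> j" "b ! i = b ! j"
    \<comment> \<open>Equal entries at two positions would satisfy this nontrivial relation.\<close>
    let ?c = "\<lambda>k. if k = i then 1 else if k = j then -1 else 0 :: complex"
    have "comb ?c b = (\<Sum>k<length b. (if k = i then b ! i else 0) + (if k = j then - (b ! j) else 0))"
      unfolding comb_def using ij(3) by (intro sum.cong) auto
    also have "\<dots> = 0" using ij by (simp add: sum.distrib)
    finally have "?c i = 0" using assms ij(1) by blast
    then show False by simp
  qed
  show "independent (set b)"
  proof (rule independent_if_scalars_zero)
    fix f x assume f: "(\<Sum>x\<in>set b. f x *c x) = 0" "x \<in> set b"
    then have "comb (\<lambda>i. f (b ! i)) b = 0" using sum_set_nth[OF d, of "\<lambda>x. f x *c x"] by (simp add: comb_def)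
    then show "f x = 0" using assms f(2) by (metis in_set_conv_nth)
  qed simp
qed

text \<open>A vector outside the span could be adjoined, giving an independent set with more
  elements than the basis \<open>b\<close>.\<close>

lemma basis_list_of_independent:
  assumes b: "basis_list V b" and s: "set b' \<subseteq> V" and l: "length b' = length b"
    and i: "distinct b'" "independent (set b')"
  shows "basis_list V b'"
proof -
  have "v \<in> span (set b')" if v: "v \<in> V" for v
  proof (rule ccontr)
    assume n: "v \<notin> span (set b')"
    then have "independent (insert v (set b'))" using i(2) by (rule independent_insertI)
    moreover have "insert v (set b') \<subseteq> span (set b)" using b s v by (auto simp: basis_list_def)
    ultimately have "card (insert v (set b')) \<le> card (set b)"
      using independent_span_bound[of "set b" "insert v (set b')"] by auto
    moreover have "v \<notin> set b'" using n span_base by blast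
    ultimately show False
      using i(1) b l by (simp add: basis_list_def distinct_card)
  qed
  moreover have "span (set b') \<subseteq> V" using s basis_list_subspace[OF b] by (simp add: span_minimal)
  ultimately show ?thesis using i by (auto simp: basis_list_def)
qed

text \<open>Linearity is required only on \<open>V\<close>: endomorphisms of a bundle have no
  meaning off the fibres.\<close>

definition endo :: "'v set \<Rightarrow> ('v \<Rightarrow> 'v) \<Rightarrow> bool" where
  "endo V T \<longleftrightarrow> (\<forall>u\<in>V. T u \<in> V) \<and> (\<forall>u\<in>V. \<forall>v\<in>V. \<forall>x y. T (x *c u + y *c v) = x *c T u + y *c T v)"

lemma endo_in: "endo V T \<Longrightarrow> u \<in> V \<Longrightarrow> T u \<in> V"
  by (simp add: endo_def)

lemma endo_zero: "endo V T \<Longrightarrow> subspace V \<Longrightarrow> T 0 = 0"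
  unfolding endo_def by (metis scale_zero_left add.right_neutral subspace_0)

lemma endo_add: "endo V T \<Longrightarrow> u \<in> V \<Longrightarrow> v \<in> V \<Longrightarrow> T (u + v) = T u + T v"
  and endo_scale: "endo V T \<Longrightarrow> u \<in> V \<Longrightarrow> T (x *c u) = x *c T u"
  unfolding endo_def by (metis scale_one) (metis scale_zero_left add.right_neutral)

lemma endo_sum:
  assumes "endo V T" "subspace V" "\<And>k. k \<in> A \<Longrightarrow> f k \<in> V"
  shows "T (\<Sum>k\<in>A. f k) = (\<Sum>k\<in>A. T (f k))"
  using assms(3)
proof (induction A rule: infinite_finite_induct)
  case (insert x F)
  then show ?case using assms by (simp add: endo_add[OF assms(1)] subspace_sum)
qed (auto intro: endo_zero assms)

lemma endo_comb:
  assumes "endo V T" "subspace V" "set b \<subseteq> V"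
  shows "T (comb c b) = (\<Sum>i<length b. c i *c T (b ! i))"
proof -
  have "b ! i \<in> V" if "i < length b" for i using assms(3) that by auto
  then show ?thesis unfolding comb_def using assms
    by (subst endo_sum[OF assms(1,2)]) (auto simp: endo_scale[OF assms(1)] subspace_scale)
qed

definition tr :: "'v list \<Rightarrow> ('v \<Rightarrow> 'v) \<Rightarrow> complex" where
  "tr b T = (\<Sum>i<length b. cf b i (T (b ! i)))"

text \<open>Expanding in both bases gives the same double sum in the two orders of summation. This
  frees \<open>end_trace\<close> from its chosen frame and permits orthonormal bases, which do not
  come from holomorphic frames.\<close>

lemma tr_basis_indep:
  assumes b: "basis_list V b" "basis_list V b'" and T: "endo V T"
  shows "tr b T = tr b' T"
proof -
  let ?n = "length b" and ?m = "length b'"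
  note sub = basis_list_subspace[OF b(1)]
  have nth: "b ! i \<in> V" if "i < ?n" for i using b(1) that by (rule basis_list_nth)
  have nth': "b' ! i \<in> V" if "i < ?m" for i using b(2) that by (rule basis_list_nth)
  have "tr b' T = (\<Sum>j<?m. cf b' j (T (comb (\<lambda>i. cf b i (b' ! j)) b)))"
    unfolding tr_def using nth' by (intro sum.cong refl) (simp add: comb_cf[OF b(1)])
  also have "\<dots> = (\<Sum>j<?m. \<Sum>i<?n. cf b i (b' ! j) * cf b' j (T (b ! i)))"
    unfolding endo_comb[OF T sub basis_list_set[OF b(1)]]
    using nth by (intro sum.cong refl)
      (subst cf_sum[OF b(2)]; simp add: cf_scale[OF b(2)] endo_in[OF T] subspace_scale[OF sub])
  also have "\<dots> = (\<Sum>i<?n. \<Sum>j<?m. cf b' j (T (b ! i)) * cf b i (b' ! j))"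
    by (subst sum.swap) (simp add: mult.commute)
  also have "\<dots> = (\<Sum>i<?n. cf b i (comb (\<lambda>j. cf b' j (T (b ! i))) b'))"
    unfolding comb_def using nth'
    by (intro sum.cong refl) (subst cf_sum[OF b(1)]; simp add: cf_scale[OF b(1)] subspace_scale[OF sub])
  also have "\<dots> = tr b T"
    unfolding tr_def using nth T by (intro sum.cong refl) (simp add: comb_cf[OF b(2)] endo_in)
  finally show ?thesis by simp
qed

section \<open>Hermitian forms and orthonormal bases\<close>

definition herm_on :: "'v set \<Rightarrow> ('v \<Rightarrow> 'v \<Rightarrow> complex) \<Rightarrow> bool" where
  "herm_on V H \<longleftrightarrow>
     (\<forall>u\<in>V. \<forall>v\<in>V. \<forall>w\<in>V. \<forall>a b. H (a *c u + b *c v) w = a * H u w + b * H v w) \<and>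
     (\<forall>u\<in>V. \<forall>v\<in>V. H v u = cnj (H u v)) \<and>
     (\<forall>u\<in>V. u \<noteq> 0 \<longrightarrow> Re (H u u) > 0)"

lemma herm_on_subset:
  assumes "herm_on V H" "W \<subseteq> V" shows "herm_on W H"
proof -
  note h = assms(1)[unfolded herm_on_def]
  show ?thesis
    unfolding herm_on_def
  proof (intro conjI ballI allI impI)
    show "H (a *c u + b *c v) w = a * H u w + b * H v w" if "u \<in> W" "v \<in> W" "w \<in> W" for u v w a b
      by (rule h[THEN conjunct1, rule_format]) (use that assms(2) in auto)
    show "H v u = cnj (H u v)" if "u \<in> W" "v \<in> W" for u v
      by (rule h[THEN conjunct2, THEN conjunct1, rule_format]) (use that assms(2) in auto)
    show "Re (H u u) > 0" if "u \<in> W" "u \<noteq> 0" for u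
      by (rule h[THEN conjunct2, THEN conjunct2, rule_format]) (use that assms(2) in auto)
  qed
qed

context
  fixes V H assumes sub: "subspace V" and herm: "herm_on V H"
begin

lemma herm_lin: "u \<in> V \<Longrightarrow> v \<in> V \<Longrightarrow> w \<in> V \<Longrightarrow> H (x *c u + y *c v) w = x * H u w + y * H v w"
  by (rule herm[unfolded herm_on_def, THEN conjunct1, rule_format])

lemma herm_cnj: "u \<in> V \<Longrightarrow> v \<in> V \<Longrightarrow> H v u = cnj (H u v)"
  by (rule herm[unfolded herm_on_def, THEN conjunct2, THEN conjunct1, rule_format])

lemma herm_pos: "u \<in> V \<Longrightarrow> u \<noteq> 0 \<Longrightarrow> Re (H u u) > 0"
  by (rule herm[unfolded herm_on_def, THEN conjunct2, THEN conjunct2, rule_format])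

lemma herm_zero: assumes "w \<in> V" shows "H 0 w = 0" "H w 0 = 0"
proof -
  show 0: "H 0 w = 0" using herm_lin[of 0 0 w 0 0] subspace_0[OF sub] assms by simp
  show "H w 0 = 0" using herm_cnj[OF subspace_0[OF sub] assms] 0 by simp
qed

lemma herm_add: "u \<in> V \<Longrightarrow> v \<in> V \<Longrightarrow> w \<in> V \<Longrightarrow> H (u + v) w = H u w + H v w"
  and herm_scale: "u \<in> V \<Longrightarrow> w \<in> V \<Longrightarrow> H (x *c u) w = x * H u w"
  and herm_diff: "u \<in> V \<Longrightarrow> v \<in> V \<Longrightarrow> w \<in> V \<Longrightarrow> H (u - v) w = H u w - H v w"
  using herm_lin[of u v w 1 1] herm_lin[of u u w x 0] herm_lin[of u v w 1 "-1"] by simp_all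

lemma herm_add_right:
  assumes "u \<in> V" "v \<in> V" "w \<in> V" shows "H w (u + v) = H w u + H w v"
  using assms
  by (simp add: herm_cnj[of _ w] herm_add subspace_add[OF sub])

lemma herm_scale_right:
  assumes "u \<in> V" "w \<in> V" shows "H w (x *c u) = cnj x * H w u"
  using assms
  by (simp add: herm_cnj[of _ w] herm_scale subspace_scale[OF sub])

lemma herm_diff_right:
  assumes "u \<in> V" "v \<in> V" "w \<in> V" shows "H w (u - v) = H w u - H w v"
  using assms
  by (simp add: herm_cnj[of _ w] herm_diff subspace_diff[OF sub])

lemma herm_sum:
  assumes "\<And>k. k \<in> A \<Longrightarrow> f k \<in> V" "w \<in> V"
  shows "H (\<Sum>k\<in>A. f k) w = (\<Sum>k\<in>A. H (f k) w)" "H w (\<Sum>k\<in>A. f k) = (\<Sum>k\<in>A. H w (f k))"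
proof -
  have "H (\<Sum>k\<in>A. f k) w = (\<Sum>k\<in>A. H (f k) w) \<and> H w (\<Sum>k\<in>A. f k) = (\<Sum>k\<in>A. H w (f k))"
    using assms(1)
  proof (induction A rule: infinite_finite_induct)
    case (insert x F)
    have "(\<Sum>k\<in>F. f k) \<in> V" "f x \<in> V" using insert.prems subspace_sum[OF sub, of F f] by auto
    then show ?case using insert by (simp add: herm_add herm_add_right assms(2))
  qed (auto simp: herm_zero[OF assms(2)])
  then show "H (\<Sum>k\<in>A. f k) w = (\<Sum>k\<in>A. H (f k) w)" "H w (\<Sum>k\<in>A. f k) = (\<Sum>k\<in>A. H w (f k))" by auto
qed

lemma herm_comb:
  assumes "set b \<subseteq> V" "w \<in> V"
  shows "H (comb c b) w = (\<Sum>i<length b. c i * H (b ! i) w)"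
    "H w (comb c b) = (\<Sum>i<length b. cnj (c i) * H w (b ! i))"
proof -
  have nth: "b ! i \<in> V" if "i < length b" for i using assms(1) that by auto
  show "H (comb c b) w = (\<Sum>i<length b. c i * H (b ! i) w)"
    unfolding comb_def
    by (subst herm_sum(1)) (auto simp: assms(2) nth herm_scale subspace_scale[OF sub])
  show "H w (comb c b) = (\<Sum>i<length b. cnj (c i) * H w (b ! i))"
    unfolding comb_def
    by (subst herm_sum(2)) (auto simp: assms(2) nth herm_scale_right subspace_scale[OF sub])
qed

lemma herm_self: "u \<in> V \<Longrightarrow> H u u = of_real (Re (H u u))" "u \<in> V \<Longrightarrow> Re (H u u) \<ge> 0"
  "u \<in> V \<Longrightarrow> H u u = 0 \<longleftrightarrow> u = 0"
proof -
  assume u: "u \<in> V"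
  have "Im (H u u) = 0" using herm_cnj[OF u u] by (metis Reals_cnj_iff complex_is_Real_iff)
  then show "H u u = of_real (Re (H u u))" by (simp add: complex_eq_iff)
  show "Re (H u u) \<ge> 0" using herm_pos[OF u] herm_zero[OF u] by (cases "u = 0") auto
  have "u = 0 \<Longrightarrow> H u u = 0" using herm_zero(1)[OF u] by simp
  then show "H u u = 0 \<longleftrightarrow> u = 0" using herm_pos[OF u] by force
qed

lemma herm_eqI: "u \<in> V \<Longrightarrow> v \<in> V \<Longrightarrow> (\<And>w. w \<in> V \<Longrightarrow> H u w = H v w) \<Longrightarrow> u = v"
  using herm_self(3)[of "u - v"] herm_diff[of u v "u - v"] subspace_diff[OF sub] by auto

lemma herm_cauchy_schwarz:
  assumes "u \<in> V" "v \<in> V" shows "(norm (H u v))\<^sup>2 \<le> Re (H u u) * Re (H v v)"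
proof (cases "v = 0")
  case False
  define a where "a = H u v"
  define p where "p = Re (H v v)"
  have p: "p > 0" using herm_pos[OF assms(2) False] by (simp add: p_def)
  have vv: "H v v = of_real p" using herm_self(1)[OF assms(2)] by (simp add: p_def)
  have vu: "H v u = cnj a" using herm_cnj[OF assms] by (simp add: a_def)
  \<comment> \<open>A multiple of the component of \<open>u\<close> orthogonal to \<open>v\<close>,
    scaled by \<open>p\<close> to avoid a division; its square is
    \<open>p (p H(u,u) - |a|^2)\<close>.\<close>
  let ?w = "of_real p *c u - a *c v"
  have in_V: "of_real p *c u \<in> V" "a *c v \<in> V" using assms subspace_scale[OF sub] by auto
  then have w: "?w \<in> V" using subspace_diff[OF sub] by auto
  have "H ?w ?w = of_real p * (of_real p * H u u - a * cnj a)"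
    using in_V w assms
    by (simp add: herm_diff herm_diff_right herm_scale herm_scale_right vv vu algebra_simps flip: a_def)
  then have "0 \<le> p * (p * Re (H u u) - Re (a * cnj a))"
    using herm_self(2)[OF w] by simp
  then have "Re (a * cnj a) \<le> p * Re (H u u)" using p by (simp add: zero_le_mult_iff)
  then show ?thesis by (simp add: a_def p_def complex_mult_cnj cmod_power2 mult.commute)
qed (simp add: herm_zero assms subspace_0[OF sub])

definition onl :: "'v list \<Rightarrow> bool" where
  "onl b \<longleftrightarrow> set b \<subseteq> V \<and> (\<forall>i<length b. \<forall>j<length b. H (b ! i) (b ! j) = (if i = j then 1 else 0))"

lemma onl_comb: "onl b \<Longrightarrow> i < length b \<Longrightarrow> H (comb c b) (b ! i) = c i"
proof -
  assume b: "onl b" and i: "i < length b"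
  have "b ! i \<in> V" using b i by (auto simp: onl_def)
  then have "H (comb c b) (b ! i) = (\<Sum>k<length b. c k * H (b ! k) (b ! i))"
    using b by (intro herm_comb) (auto simp: onl_def)
  also have "\<dots> = (\<Sum>k<length b. if k = i then c k else 0)"
    using b i by (intro sum.cong) (auto simp: onl_def)
  finally show ?thesis using i by simp
qed

lemma onl_independent: "onl b \<Longrightarrow> distinct b" "onl b \<Longrightarrow> independent (set b)"
proof -
  assume b: "onl b"
  have "\<forall>i<length b. c i = 0" if "comb c b = 0" for c
  proof (intro allI impI)
    fix i assume i: "i < length b"
    then have "b ! i \<in> V" using b by (auto simp: onl_def)
    then show "c i = 0" using onl_comb[OF b i, of c] that herm_zero by simp
  qed
  then show "distinct b" "independent (set b)" using independent_list[of b] by blast+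
qed

text \<open>Gram-Schmidt, by induction on the number of missing vectors. Starting from a nonempty
  list matters later, where a prescribed unit vector has to become the first basis vector.\<close>

lemma onl_extend:
  assumes b0: "basis_list V b0" and b: "onl b"
  shows "\<exists>b'. length (b @ b') = length b0 \<and> onl (b @ b')"
  using b
proof (induction "length b0 - length b" arbitrary: b)
  case 0
  have "length b \<le> length b0"
    using independent_span_bound[of "set b0" "set b"] b0 0(2) onl_independent[OF 0(2)]
    by (auto simp: basis_list_def onl_def distinct_card)
  then show ?case using 0 by (intro exI[of _ "[]"]) simp
next
  case (Suc k)
  have "span (set b) \<noteq> V"
  proof
    assume "span (set b) = V"
    then have "basis_list V b" using onl_independent[OF Suc.prems] by (simp add: basis_list_def)
    then show False using dim_basis_list[of V b] dim_basis_list[OF b0] Suc(2) by simp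
  qed
  moreover have sV: "span (set b) \<subseteq> V" using Suc.prems sub by (simp add: onl_def span_minimal)
  ultimately obtain v where v: "v \<in> V" "v \<notin> span (set b)" by blast
  define c where "c = comb (\<lambda>i. H v (b ! i)) b"
  have c: "c \<in> span (set b)" unfolding c_def comb_def
    by (intro span_sum span_scale span_base) auto
  define w where "w = v - c"
  have w: "w \<in> V" "w \<noteq> 0" using v c sV subspace_diff[OF sub] by (auto simp: w_def)
  have bV: "b ! i \<in> V" if "i < length b" for i using Suc.prems that by (auto simp: onl_def)
  have wb: "H w (b ! i) = 0" if "i < length b" for i
    unfolding w_def using v c sV bV[OF that] onl_comb[OF Suc.prems that, of "\<lambda>i. H v (b ! i)"]
    by (simp add: herm_diff subsetD c_def[symmetric])
  define p where "p = sqrt (Re (H w w))"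
  have p: "p > 0" using herm_pos[OF w] by (simp add: p_def)
  define x where "x = of_real (1 / p) *c w"
  have x: "x \<in> V" using w subspace_scale[OF sub] by (simp add: x_def)
  have "H w w = of_real (p * p)" using herm_self(1)[OF w(1)] herm_self(2)[OF w(1)] by (simp add: p_def)
  then have xx: "H x x = 1" using w p x by (simp add: x_def herm_scale herm_scale_right)
  have xb: "H x (b ! i) = 0" "H (b ! i) x = 0" if "i < length b" for i
    using wb[OF that] herm_cnj[OF x bV[OF that]] w bV[OF that] by (simp_all add: x_def herm_scale)
  have "onl (b @ [x])"
    using Suc.prems x xx xb unfolding onl_def
    by (auto simp: nth_append less_Suc_eq)
  moreover have "k = length b0 - length (b @ [x])" using Suc(2) by simp
  ultimately obtain b' where "length ((b @ [x]) @ b') = length b0" "onl ((b @ [x]) @ b')"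
    using Suc(1)[of "b @ [x]"] by blast
  then show ?case by (intro exI[of _ "x # b'"]) simp
qed

definition onb :: "'v list \<Rightarrow> bool" where "onb b \<longleftrightarrow> basis_list V b \<and> onl b"

lemma onl_imp_onb: "basis_list V b0 \<Longrightarrow> onl b \<Longrightarrow> length b = length b0 \<Longrightarrow> onb b"
  using basis_list_of_independent[of V b0 b] onl_independent[of b] unfolding onb_def onl_def by blast

lemma onb_ex:
  assumes "basis_list V b0" shows "\<exists>b. length b = length b0 \<and> onb b"
proof -
  have "onl []" by (simp add: onl_def)
  from onl_extend[OF assms this] obtain b where "length b = length b0" "onl b" by auto
  then show ?thesis using onl_imp_onb[OF assms] by blast
qed

lemma onb_cf: "onb b \<Longrightarrow> i < length b \<Longrightarrow> v \<in> V \<Longrightarrow> cf b i v = H v (b ! i)"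
  using comb_cf[of V b v] onl_comb[of b i "\<lambda>i. cf b i v"] by (simp add: onb_def)

lemma onb_expand: "onb b \<Longrightarrow> v \<in> V \<Longrightarrow> comb (\<lambda>i. H v (b ! i)) b = v"
  using comb_cf[of V b v] onb_cf[of b _ v] by (simp add: comb_def onb_def)

lemma onb_parseval:
  assumes "onb b" "u \<in> V" "v \<in> V"
  shows "H u v = (\<Sum>i<length b. H u (b ! i) * cnj (H v (b ! i)))"
proof -
  have s: "set b \<subseteq> V" using assms(1) by (simp add: onb_def onl_def)
  have "H u (comb (\<lambda>i. H v (b ! i)) b) = (\<Sum>i<length b. cnj (H v (b ! i)) * H u (b ! i))"
    using assms s by (intro herm_comb) auto
  then show ?thesis using onb_expand[OF assms(1,3)] by (simp add: mult.commute)
qed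

text \<open>The vector with coordinates \<open>F (b ! i)\<close> represents the conjugate-linear
  functional \<open>F\<close>. Quotients and adjoints are given by definite descriptions, and this
  is what makes them well defined.\<close>

lemma herm_riesz:
  assumes b: "onb b" and F: "\<And>c. F (comb c b) = (\<Sum>i<length b. cnj (c i) * F (b ! i))"
  shows "\<exists>!u. u \<in> V \<and> (\<forall>w\<in>V. F w = H u w)"
proof (rule ex_ex1I)
  let ?u = "comb (\<lambda>i. F (b ! i)) b"
  have s: "set b \<subseteq> V" using b by (simp add: onb_def onl_def)
  have u: "?u \<in> V" using comb_in[OF sub s] .
  have "F w = H ?u w" if w: "w \<in> V" for w
  proof -
    have "H ?u w = (\<Sum>i<length b. F (b ! i) * cnj (H w (b ! i)))"
    proof -
      have "H ?u (b ! i) = F (b ! i)" if "i < length b" for i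
        using onl_comb[OF _ that, of "\<lambda>i. F (b ! i)"] b by (simp add: onb_def)
      then show ?thesis unfolding onb_parseval[OF b u w] by (intro sum.cong) auto
    qed
    also have "\<dots> = F (comb (\<lambda>i. H w (b ! i)) b)" by (subst F) (simp add: mult.commute)
    also have "\<dots> = F w" by (rule arg_cong[OF onb_expand[OF b w]])
    finally show ?thesis ..
  qed
  then show "\<exists>u. u \<in> V \<and> (\<forall>w\<in>V. F w = H u w)" by (intro exI[of _ ?u] conjI ballI u)
  fix u v assume u: "u \<in> V \<and> (\<forall>w\<in>V. F w = H u w)" and v: "v \<in> V \<and> (\<forall>w\<in>V. F w = H v w)"
  show "u = v"
  proof (rule herm_eqI)
    show "u \<in> V" "v \<in> V" using u v by simp_all
    fix w assume w: "w \<in> V"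
    have "F w = H u w" "F w = H v w" using u v w by blast+
    then show "H u w = H v w" by (rule trans[OF sym])
  qed
qed

end

end

text \<open>Each of the \<open>n!\<close> terms of the Leibniz expansion takes one entry from every
  row. The bound is kept separate for each row because later a single row is small.\<close>

lemma det_norm_le:
  fixes A :: "complex mat"
  assumes A: "A \<in> carrier_mat n n" and le: "\<And>i j. i < n \<Longrightarrow> j < n \<Longrightarrow> norm (A $$ (i, j)) \<le> r i"
  shows "norm (Determinant.det A) \<le> fact n * (\<Prod>i<n. r i)"
proof -
  have "Determinant.det A = (\<Sum>p\<in>{p. p permutes {0..<n}}. signof p * (\<Prod>i = 0..<n. A $$ (i, p i)))"
    using A by (rule det_def')
  then have "norm (Determinant.det A) \<le> (\<Sum>p\<in>{p. p permutes {0..<n}}. norm (signof p * (\<Prod>i = 0..<n. A $$ (i, p i))))"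
    by (simp add: norm_sum)
  also have "\<dots> \<le> (\<Sum>p\<in>{p. p permutes {0..<n}}. \<Prod>i<n. r i)"
  proof (rule sum_mono)
    fix p assume "p \<in> {p. p permutes {0..<n}}"
    then have p: "p permutes {0..<n}" by simp
    have "norm (\<Prod>i = 0..<n. A $$ (i, p i)) \<le> (\<Prod>i = 0..<n. r i)"
      unfolding prod_norm[symmetric]
    proof (rule prod_mono)
      fix i assume i: "i \<in> {0..<n}"
      then have "p i < n" using permutes_in_image[OF p, of i] by auto
      then show "0 \<le> norm (A $$ (i, p i)) \<and> norm (A $$ (i, p i)) \<le> r i" using le i by auto
    qed
    moreover have "norm (signof p :: complex) = 1" by (simp add: sign_def)
    ultimately show "norm (signof p * (\<Prod>i = 0..<n. A $$ (i, p i))) \<le> (\<Prod>i<n. r i)"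
      by (simp add: norm_mult atLeast0LessThan)
  qed
  also have "\<dots> = fact n * (\<Prod>i<n. r i)"
    by (simp add: card_permutations[OF refl])
  finally show ?thesis .
qed

section \<open>Gram matrices and change of basis\<close>

interpretation cnj_hom: comm_ring_hom cnj
  by unfold_locales auto

definition ctranspose :: "complex mat \<Rightarrow> complex mat" where
  "ctranspose A = transpose_mat (map_mat cnj A)"

lemma ctranspose_carrier [simp, intro]: "A \<in> carrier_mat n m \<Longrightarrow> ctranspose A \<in> carrier_mat m n"
  by (auto simp: ctranspose_def)

lemma ctranspose_index: "A \<in> carrier_mat n m \<Longrightarrow> i < m \<Longrightarrow> j < n \<Longrightarrow> ctranspose A $$ (i, j) = cnj (A $$ (j, i))"
  by (auto simp: ctranspose_def)

lemma det_ctranspose: "A \<in> carrier_mat n n \<Longrightarrow> Determinant.det (ctranspose A) = cnj (Determinant.det A)"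
  unfolding ctranspose_def by (subst det_transpose[of _ n]) (auto simp: cnj_hom.hom_det)

lemma mat_mult_index:
  assumes "A \<in> carrier_mat n m" "B \<in> carrier_mat m k" "i < n" "j < k"
  shows "(A * B) $$ (i, j) = (\<Sum>l<m. A $$ (i, l) * B $$ (l, j))"
  using assms by (auto simp: scalar_prod_def atLeast0LessThan intro!: sum.cong)

context cvs begin

definition gram :: "('v \<Rightarrow> 'v \<Rightarrow> complex) \<Rightarrow> 'v list \<Rightarrow> complex mat" where
  "gram H b = Matrix.mat (length b) (length b) (\<lambda>(i, j). H (b ! i) (b ! j))"

lemma gram_carrier [simp]: "gram H b \<in> carrier_mat (length b) (length b)"
  by (simp add: gram_def)

text \<open>Row \<open>i\<close> holds the coordinates of the \<open>i\<close>-th vector of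
  \<open>b'\<close> in \<open>b\<close>. With forms linear in the first argument, Gram matrices then
  transform by this matrix on the left and its conjugate transpose on the right.\<close>

definition trans_mat :: "'v list \<Rightarrow> 'v list \<Rightarrow> complex mat" where
  "trans_mat b b' = Matrix.mat (length b') (length b) (\<lambda>(i, j). cf b j (b' ! i))"

lemma gram_change:
  assumes H: "herm_on V H" and b: "basis_list V b" and b': "set b' \<subseteq> V" "length b' = length b"
  shows "gram H b' = trans_mat b b' * gram H b * ctranspose (trans_mat b b')"
proof (rule eq_matI)
  let ?n = "length b" let ?G = "trans_mat b b'"
  note sub = basis_list_subspace[OF b]
  have G: "?G \<in> carrier_mat ?n ?n" using b' by (simp add: trans_mat_def)
  have C: "?G * gram H b * ctranspose ?G \<in> carrier_mat ?n ?n"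
    by (rule mult_carrier_mat[OF mult_carrier_mat[OF G gram_carrier] ctranspose_carrier[OF G]])
  fix i j assume "i < dim_row (?G * gram H b * ctranspose ?G)" "j < dim_col (?G * gram H b * ctranspose ?G)"
  then have ij: "i < ?n" "j < ?n" unfolding carrier_matD[OF C] .
  have bV: "b' ! k \<in> V" if "k < ?n" for k using b' that by (simp add: subset_iff)
  have "H (b' ! i) (b' ! j) = H (comb (\<lambda>k. cf b k (b' ! i)) b) (comb (\<lambda>k. cf b k (b' ! j)) b)"
    using comb_cf[OF b bV] ij by simp
  also have "\<dots> = (\<Sum>l<?n. cnj (cf b l (b' ! j)) * H (comb (\<lambda>k. cf b k (b' ! i)) b) (b ! l))"
    by (rule herm_comb(2)[OF sub H basis_list_set[OF b] comb_in[OF sub basis_list_set[OF b]]])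
  also have "\<dots> = (\<Sum>l<?n. (\<Sum>k<?n. cf b k (b' ! i) * H (b ! k) (b ! l)) * cnj (cf b l (b' ! j)))"
    using herm_comb(1)[OF sub H basis_list_set[OF b] basis_list_nth[OF b]]
    by (intro sum.cong) (auto simp: mult.commute[of "cnj x" for x])
  also have "\<dots> = (\<Sum>l<?n. (?G * gram H b) $$ (i, l) * ctranspose ?G $$ (l, j))"
  proof (rule sum.cong)
    fix l assume "l \<in> {..<?n}"
    then have l: "l < ?n" by simp
    have "(?G * gram H b) $$ (i, l) = (\<Sum>k<?n. cf b k (b' ! i) * H (b ! k) (b ! l))"
      using ij l b' by (simp add: trans_mat_def gram_def scalar_prod_def atLeast0LessThan)
    then show "(\<Sum>k<?n. cf b k (b' ! i) * H (b ! k) (b ! l)) * cnj (cf b l (b' ! j)) =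
        (?G * gram H b) $$ (i, l) * ctranspose ?G $$ (l, j)"
      using ctranspose_index[OF G l ij(2)] ij l b' by (simp add: trans_mat_def)
  qed simp
  also have "\<dots> = (?G * gram H b * ctranspose ?G) $$ (i, j)"
    by (rule mat_mult_index[symmetric, OF mult_carrier_mat[OF G gram_carrier] ctranspose_carrier[OF G] ij])
  finally show "gram H b' $$ (i, j) = (?G * gram H b * ctranspose ?G) $$ (i, j)"
    using ij b' by (simp add: gram_def)
next
  show "dim_row (gram H b') = dim_row (trans_mat b b' * gram H b * ctranspose (trans_mat b b'))"
    "dim_col (gram H b') = dim_col (trans_mat b b' * gram H b * ctranspose (trans_mat b b'))"
    by (simp_all add: gram_def trans_mat_def ctranspose_def)
qed

lemma det_gram_change:
  assumes H: "herm_on V H" and b: "basis_list V b" and b': "set b' \<subseteq> V" "length b' = length b"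
  shows "Determinant.det (gram H b') =
    of_real ((norm (Determinant.det (trans_mat b b')))\<^sup>2) * Determinant.det (gram H b)"
proof -
  have G: "trans_mat b b' \<in> carrier_mat (length b) (length b)" using b' by (simp add: trans_mat_def)
  have "Determinant.det (gram H b') =
      Determinant.det (trans_mat b b') * Determinant.det (gram H b) * cnj (Determinant.det (trans_mat b b'))"
    unfolding gram_change[OF assms] det_mult[OF mult_carrier_mat[OF G gram_carrier] ctranspose_carrier[OF G]]
      det_mult[OF G gram_carrier] det_ctranspose[OF G] ..
  also have "\<dots> = (Determinant.det (trans_mat b b') * cnj (Determinant.det (trans_mat b b'))) * Determinant.det (gram H b)"
    by (simp only: mult_ac)
  finally show ?thesis by (simp only: complex_norm_square)
qed

lemma gram_onb: "onb V H b \<Longrightarrow> subspace V \<Longrightarrow> herm_on V H \<Longrightarrow> gram H b = 1\<^sub>m (length b)"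
  by (rule eq_matI) (auto simp: gram_def onb_def onl_def)

text \<open>The factor is the squared modulus of the determinant of the transition matrix, so one
  \<open>c\<close> works for all forms \<open>H\<close>. This is what makes quotients of Gram
  determinants of two forms independent of the basis.\<close>

lemma det_gram_ratio:
  assumes b: "basis_list V b" "basis_list V b'"
  shows "\<exists>c>0. \<forall>H. herm_on V H \<longrightarrow> Determinant.det (gram H b') = of_real c * Determinant.det (gram H b)"
\<comment> \<open>A form \<open>K\<close> shows that the factor is not 0: in a
  \<open>K\<close>-orthonormal basis the Gram determinant is 1, and it is a multiple of the one in
  \<open>b'\<close>. If there is no form at all, the claim is vacuous and \<open>c = 1\<close>
  serves.\<close>
proof (cases "\<exists>K. herm_on V K")
  case True
  then obtain K where K: "herm_on V K" by blast
  note sub = basis_list_subspace[OF b(1)]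
  have l: "length b' = length b" using b dim_basis_list by metis
  have eq: "Determinant.det (gram H b') =
      of_real ((norm (Determinant.det (trans_mat b b')))\<^sup>2) * Determinant.det (gram H b)"
    if "herm_on V H" for H
    by (rule det_gram_change[OF that b(1) basis_list_set[OF b(2)] l])
  obtain o' where o': "length o' = length b'" "onb V K o'" using onb_ex[OF sub K b(2)] by blast
  then have "basis_list V o'" using sub K by (simp add: onb_def)
  then have "Determinant.det (gram K o') = of_real ((norm (Determinant.det (trans_mat b' o')))\<^sup>2) * Determinant.det (gram K b')"
    using det_gram_change[OF K b(2)] o'(1) basis_list_set by blast
  then have "Determinant.det (gram K b') \<noteq> 0" using gram_onb[OF o'(2) sub K] by auto
  then have "norm (Determinant.det (trans_mat b b')) \<noteq> 0" using eq[OF K] by auto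
  then show ?thesis using eq by (intro exI[of _ "(norm (Determinant.det (trans_mat b b')))\<^sup>2"]) auto
qed (auto intro: exI[of _ 1])

lemma det_gram_pos:
  assumes H: "herm_on V H" and b: "basis_list V b"
  shows "\<exists>d>0. Determinant.det (gram H b) = of_real d"
proof -
  note sub = basis_list_subspace[OF b]
  obtain b' where b': "onb V H b'" using onb_ex[OF sub H b] by blast
  then have "basis_list V b'" using sub H by (simp add: onb_def)
  from det_gram_ratio[OF this b] obtain c where c: "c > 0"
    "Determinant.det (gram H b) = of_real c * Determinant.det (gram H b')" using H by blast
  then show ?thesis using gram_onb[OF b' sub H] by (intro exI[of _ c]) auto
qed

text \<open>In a \<open>K\<close>-orthonormal basis the Gram determinant of \<open>K\<close> is 1,
  and by Cauchy-Schwarz every entry of that of \<open>H\<close> is at most \<open>c\<close>, so the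
  Leibniz bound applies. Returning to \<open>b\<close> multiplies both sides by the same positive
  factor.\<close>

lemma det_gram_le:
  assumes H: "herm_on V H" and K: "herm_on V K" and b: "basis_list V b"
    and le: "\<And>v. v \<in> V \<Longrightarrow> Re (H v v) \<le> c * Re (K v v)" and c: "c \<ge> 0"
  shows "Re (Determinant.det (gram H b)) \<le> fact (length b) * c ^ length b * Re (Determinant.det (gram K b))"
proof -
  note sub = basis_list_subspace[OF b]
  obtain o' where l: "length o' = length b" and o': "onb V K o'" using onb_ex[OF sub K b] by blast
  then have bo: "basis_list V o'" using sub K by (simp add: onb_def)
  from det_gram_ratio[OF bo b] obtain d where d: "d > 0"
    "\<And>H. herm_on V H \<Longrightarrow> Determinant.det (gram H b) = of_real d * Determinant.det (gram H o')" by blast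
  have "norm (gram H o' $$ (i, j)) \<le> c" if ij: "i < length b" "j < length b" for i j
  proof -
    have V: "o' ! i \<in> V" "o' ! j \<in> V" using basis_list_nth[OF bo] ij l by auto
    have "Re (H (o' ! k) (o' ! k)) \<le> c" if "k < length b" for k
      using le[of "o' ! k"] basis_list_nth[OF bo, of k] that l o' by (simp add: onb_def[OF sub K] onl_def[OF sub K])
    then have "Re (H (o' ! i) (o' ! i)) * Re (H (o' ! j) (o' ! j)) \<le> c * c"
      using ij c V by (intro mult_mono) (auto simp: herm_self(2)[OF sub H])
    then have "(norm (H (o' ! i) (o' ! j)))\<^sup>2 \<le> c\<^sup>2"
      using herm_cauchy_schwarz[OF sub H V] by (simp add: power2_eq_square)
    then have "norm (H (o' ! i) (o' ! j)) \<le> c" using c power2_le_imp_le by blast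
    then show ?thesis using ij l by (simp add: gram_def)
  qed
  then have "norm (Determinant.det (gram H o')) \<le> fact (length b) * (\<Prod>i<length b. c)"
    using gram_carrier[of H o'] l by (intro det_norm_le) auto
  then have "Re (Determinant.det (gram H o')) \<le> fact (length b) * c ^ length b"
    using complex_Re_le_cmod order_trans by fastforce
  then have "d * Re (Determinant.det (gram H o')) \<le> d * (fact (length b) * c ^ length b)"
    using d(1) by simp
  moreover have "Re (Determinant.det (gram K o')) = 1" using gram_onb[OF o' sub K] by simp
  ultimately show ?thesis by (simp add: d(2)[OF H] d(2)[OF K] mult.commute)
qed

text \<open>Since the determinants agree, an upper bound for \<open>H\<close> also yields a lower one: every term of
  the Leibniz expansion contains an entry of the first row.\<close>

lemma herm_reverse_bound:
  assumes H: "herm_on V H" and K: "herm_on V K" and b: "basis_list V b"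
    and le: "\<And>v. v \<in> V \<Longrightarrow> Re (H v v) \<le> c * Re (K v v)" and c: "c \<ge> 1"
    and det: "Determinant.det (gram H b) = Determinant.det (gram K b)" and v: "v \<in> V"
  shows "Re (K v v) \<le> (fact (length b) * c ^ length b)\<^sup>2 * Re (H v v)"
proof (cases "v = 0")
  case True
  then have "K v v = 0" "H v v = 0"
    using herm_zero(1)[OF basis_list_subspace[OF b] K v] herm_zero(1)[OF basis_list_subspace[OF b] H v]
    by (simp_all only:)
  then show ?thesis by (simp only:) simp
next
  case False
  note sub = basis_list_subspace[OF b]
  define p where "p = sqrt (Re (K v v))"
  have p: "p > 0" using herm_pos[OF sub K v False] by (simp add: p_def)
  have Kvv: "K v v = of_real (p * p)" using herm_self(1,2)[OF sub K v] by (simp add: p_def)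
  define x where "x = of_real (1 / p) *c v"
  have x: "x \<in> V" using v subspace_scale[OF sub] by (simp add: x_def)
  have xx: "K x x = 1" using v x p Kvv by (simp add: x_def herm_scale[OF sub K] herm_scale_right[OF sub K])
  have Hxx: "H x x = H v v / of_real (p * p)"
    using v x p by (simp add: x_def herm_scale[OF sub H] herm_scale_right[OF sub H])
  have "onl V K [x]" using x xx by (simp add: onl_def[OF sub K])
  from onl_extend[OF sub K b this] obtain b' where b': "length (x # b') = length b" "onl V K (x # b')" by auto
  let ?o = "x # b'"
  have o': "onb V K ?o" using onl_imp_onb[OF sub K b b'(2,1)] .
  then have bo: "basis_list V ?o" using sub K by (simp add: onb_def)
  from det_gram_ratio[OF bo b] obtain d where d: "d > 0"
    "\<And>H. herm_on V H \<Longrightarrow> Determinant.det (gram H b) = of_real d * Determinant.det (gram H ?o)" by blast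
  then have "Determinant.det (gram H ?o) = Determinant.det (gram K ?o)"
    using d(2)[OF H] d(2)[OF K] det by simp
  also have "\<dots> = 1" using gram_onb[OF o' sub K] by simp
  finally have det1: "Determinant.det (gram H ?o) = 1" .
  \<comment> \<open>By Cauchy-Schwarz an entry is at most a product of two square roots. In row 0,
    which belongs to \<open>x\<close>, one root is kept and the other is at most
    \<open>sqrt c \<le> c\<close>, which uses \<open>c \<ge> 1\<close>; in the other rows both are
    at most \<open>sqrt c\<close>.\<close>
  let ?r = "\<lambda>i. if i = 0 then sqrt (Re (H x x)) * c else c"
  have self: "Re (H (?o ! k) (?o ! k)) \<le> c" "Re (H (?o ! k) (?o ! k)) \<ge> 0" "?o ! k \<in> V" if "k < length b" for k
  proof -
    show kV: "?o ! k \<in> V" using basis_list_nth[OF bo, of k] that b' by simp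
    have "K (?o ! k) (?o ! k) = 1" using that b' o' by (auto simp: onb_def[OF sub K] onl_def[OF sub K])
    then show "Re (H (?o ! k) (?o ! k)) \<le> c" using le[OF kV] by simp
    show "Re (H (?o ! k) (?o ! k)) \<ge> 0" using herm_self(2)[OF sub H kV] .
  qed
  have entry: "norm (gram H ?o $$ (i, j)) \<le> ?r i" if ij: "i < length b" "j < length b" for i j
  proof -
    let ?s = "\<lambda>k. sqrt (Re (H (?o ! k) (?o ! k)))"
    have 1: "norm (H (?o ! i) (?o ! j)) \<le> ?s i * ?s j"
      using real_le_rsqrt[OF herm_cauchy_schwarz[OF sub H self(3)[OF ij(1)] self(3)[OF ij(2)]]]
      unfolding real_sqrt_mult .
    have sq: "?s k \<le> sqrt c" "?s k \<ge> 0" if "k < length b" for k using self[OF that] by auto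
    have sc: "sqrt c \<le> c"
    proof -
      have "sqrt c * 1 \<le> sqrt c * sqrt c" using c by (intro mult_left_mono) auto
      then show ?thesis using c by simp
    qed
    show ?thesis
    proof (cases "i = 0")
      case True
      have "?s i * ?s j \<le> ?s i * c" using order_trans[OF sq(1)[OF ij(2)] sc] sq(2)[OF ij(1)] by (rule mult_left_mono)
      then show ?thesis using 1 True ij b' by (simp add: gram_def)
    next
      case False
      have "?s i * ?s j \<le> sqrt c * sqrt c" using sq[OF ij(1)] sq[OF ij(2)] c by (intro mult_mono) auto
      then show ?thesis using 1 False ij b' c by (simp add: gram_def)
    qed
  qed
  have "norm (Determinant.det (gram H ?o)) \<le> fact (length b) * (\<Prod>i<length b. ?r i)"
    using b'(1) entry by (intro det_norm_le) (auto simp: gram_def)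
  also have "(\<Prod>i<length b. ?r i) = sqrt (Re (H x x)) * c ^ length b"
    using b'(1) by (simp flip: b'(1) add: prod.lessThan_Suc_shift del: prod.lessThan_Suc)
  \<comment> \<open>The determinant is 1 in this basis, so the square root of \<open>H x x\<close>
    cannot be small; squaring gives the constant of the claim.\<close>
  finally have "1 \<le> fact (length b) * c ^ length b * sqrt (Re (H x x))"
    by (simp add: det1 mult_ac)
  then have "1\<^sup>2 \<le> (fact (length b) * c ^ length b * sqrt (Re (H x x)))\<^sup>2" by (intro power_mono) auto
  then have "1 \<le> (fact (length b) * c ^ length b)\<^sup>2 * Re (H x x)"
    using herm_self(2)[OF sub H x] by (simp add: power_mult_distrib)
  then have "p * p * 1 \<le> p * p * ((fact (length b) * c ^ length b)\<^sup>2 * Re (H x x))"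
    using p by (intro mult_left_mono) auto
  also have "Re (H x x) = Re (H v v) / (p * p)" by (simp add: Hxx del: of_real_mult)
  finally show ?thesis using p Kvv by simp
qed

end

section \<open>Quotients of Hermitian forms, adjoints and Hilbert-Schmidt norms\<close>

context cvs begin

definition quot :: "'v set \<Rightarrow> ('v \<Rightarrow> 'v \<Rightarrow> complex) \<Rightarrow> ('v \<Rightarrow> 'v \<Rightarrow> complex) \<Rightarrow> 'v \<Rightarrow> 'v" where
  "quot V K H u = (THE w. w \<in> V \<and> (\<forall>v\<in>V. H u v = K w v))"

definition adj :: "'v set \<Rightarrow> ('v \<Rightarrow> 'v \<Rightarrow> complex) \<Rightarrow> ('v \<Rightarrow> 'v) \<Rightarrow> 'v \<Rightarrow> 'v" where
  "adj V K \<phi> v = (THE u. u \<in> V \<and> (\<forall>w\<in>V. K (\<phi> w) v = K w u))"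

context
  fixes V K b0 assumes b0: "basis_list V b0" and K: "herm_on V K"
begin

lemma sub: "subspace V" using b0 by (rule basis_list_subspace)

lemma quot:
  assumes H: "herm_on V H" and u: "u \<in> V"
  shows "quot V K H u \<in> V" "v \<in> V \<Longrightarrow> H u v = K (quot V K H u) v"
proof -
  obtain b where b: "onb V K b" using onb_ex[OF sub K b0] by blast
  then have s: "set b \<subseteq> V" by (simp add: onb_def[OF sub K] onl_def[OF sub K])
  have "\<exists>!w. w \<in> V \<and> (\<forall>v\<in>V. H u v = K w v)"
    by (rule herm_riesz[OF sub K b]) (rule herm_comb(2)[OF sub H s u])
  from theI'[OF this] show "quot V K H u \<in> V" "v \<in> V \<Longrightarrow> H u v = K (quot V K H u) v"
    unfolding quot_def by blast+
qed

lemma quot_eqI: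
  assumes H: "herm_on V H" and u: "u \<in> V" and w: "w \<in> V" "\<And>v. v \<in> V \<Longrightarrow> H u v = K w v"
  shows "quot V K H u = w"
proof (rule herm_eqI[OF sub K quot(1)[OF H u] w(1)])
  fix v assume "v \<in> V"
  then show "K (quot V K H u) v = K w v" using quot(2)[OF H u] w(2) by (metis (full_types))
qed

lemma endo_quot: assumes H: "herm_on V H" shows "endo V (quot V K H)"
  unfolding endo_def
proof (intro conjI ballI allI)
  fix u v x y assume u: "u \<in> V" and v: "v \<in> V"
  note q = quot(1)[OF H u] quot(1)[OF H v]
  have S: "x *c a + y *c b \<in> V" if "a \<in> V" "b \<in> V" for a b
    using that sub subspace_add subspace_scale by blast
  show "quot V K H (x *c u + y *c v) = x *c quot V K H u + y *c quot V K H v"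
  proof (rule quot_eqI[OF H S[OF u v] S[OF q]])
    fix w assume w: "w \<in> V"
    show "H (x *c u + y *c v) w = K (x *c quot V K H u + y *c quot V K H v) w"
      unfolding herm_lin[OF sub H u v w] herm_lin[OF sub K q w] quot(2)[OF H u w] quot(2)[OF H v w] ..
  qed
qed (rule quot(1)[OF H])

lemma quot_self_adjoint:
  assumes H: "herm_on V H" and u: "u \<in> V" and v: "v \<in> V"
  shows "K (quot V K H u) v = K u (quot V K H v)"
proof -
  have "K (quot V K H u) v = H u v" using quot(2)[OF H u v] by simp
  also have "\<dots> = cnj (H v u)" by (rule herm_cnj[OF sub H v u])
  also have "H v u = K (quot V K H v) u" using quot(2)[OF H v u] .
  also have "cnj \<dots> = K u (quot V K H v)" using herm_cnj[OF sub K quot(1)[OF H v] u] by simp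
  finally show ?thesis .
qed

lemma adj:
  assumes T: "endo V T" and v: "v \<in> V"
  shows "adj V K T v \<in> V" "w \<in> V \<Longrightarrow> K (T w) v = K w (adj V K T v)"
proof -
  obtain b where b: "onb V K b" using onb_ex[OF sub K b0] by blast
  then have s: "set b \<subseteq> V" by (simp add: onb_def[OF sub K] onl_def[OF sub K])
  then have bi: "b ! i \<in> V" if "i < length b" for i using that by auto
  \<comment> \<open>The representation lemma expects a functional of the form \<open>K u w\<close>,
    conjugate-linear in \<open>w\<close>; \<open>K (T w) v\<close> is linear in \<open>w\<close>,
    hence the conjugate.\<close>
  let ?F = "\<lambda>w. cnj (K (T w) v)"
  have ex: "\<exists>!u. u \<in> V \<and> (\<forall>w\<in>V. ?F w = K u w)"
  proof (rule herm_riesz[OF sub K b])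
    fix c
    have "K (T (comb c b)) v = (\<Sum>i<length b. K (c i *c T (b ! i)) v)"
      unfolding endo_comb[OF T sub s]
      by (rule herm_sum(1)[OF sub K _ v]) (auto intro!: subspace_scale[OF sub] endo_in[OF T] bi)
    also have "\<dots> = (\<Sum>i<length b. c i * K (T (b ! i)) v)"
      using herm_scale[OF sub K endo_in[OF T bi] v] by (intro sum.cong) auto
    finally show "?F (comb c b) = (\<Sum>i<length b. cnj (c i) * ?F (b ! i))" by simp
  qed
  have "(w \<in> V \<longrightarrow> ?F w = K u w) = (w \<in> V \<longrightarrow> K (T w) v = K w u)" if u: "u \<in> V" for u w
    using herm_cnj[OF sub K u, of w] by (metis complex_cnj_cnj)
  then have eq: "(u \<in> V \<and> (\<forall>w\<in>V. ?F w = K u w)) = (u \<in> V \<and> (\<forall>w\<in>V. K (T w) v = K w u))" for u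
    by blast
  have "adj V K T v \<in> V \<and> (\<forall>w\<in>V. K (T w) v = K w (adj V K T v))"
    unfolding adj_def using ex unfolding eq by (rule theI')
  then show "adj V K T v \<in> V" "w \<in> V \<Longrightarrow> K (T w) v = K w (adj V K T v)" by blast+
qed

lemma tr_onb:
  assumes b: "onb V K b" and T: "endo V T"
  shows "tr b T = (\<Sum>i<length b. K (T (b ! i)) (b ! i))"
proof -
  have "b ! i \<in> V" if "i < length b" for i using b that by (auto simp: onb_def[OF sub K] onl_def[OF sub K])
  then show ?thesis unfolding tr_def using onb_cf[OF sub K b] endo_in[OF T] by (intro sum.cong) auto
qed

lemma endo_adj: assumes T: "endo V T" shows "endo V (adj V K T)"
  unfolding endo_def
proof (intro conjI ballI allI)
  fix u v x y assume u: "u \<in> V" and v: "v \<in> V"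
  note a = adj(1)[OF T u] adj(1)[OF T v]
  have S: "x *c a + y *c b \<in> V" if "a \<in> V" "b \<in> V" for a b
    using that sub subspace_add subspace_scale by blast
  show "adj V K T (x *c u + y *c v) = x *c adj V K T u + y *c adj V K T v"
  proof (rule herm_eqI[OF sub K adj(1)[OF T S[OF u v]] S[OF a]])
    fix w assume w: "w \<in> V"
    have "K w (adj V K T (x *c u + y *c v)) = K (T w) (x *c u + y *c v)"
      using adj(2)[OF T S[OF u v] w] by simp
    also have "\<dots> = cnj x * K (T w) u + cnj y * K (T w) v"
      using herm_add_right[OF sub K subspace_scale[OF sub u] subspace_scale[OF sub v] endo_in[OF T w]]
        herm_scale_right[OF sub K u endo_in[OF T w]] herm_scale_right[OF sub K v endo_in[OF T w]] by simp
    also have "\<dots> = cnj x * K w (adj V K T u) + cnj y * K w (adj V K T v)"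
      using adj(2)[OF T u w] adj(2)[OF T v w] by simp
    also have "\<dots> = K w (x *c adj V K T u + y *c adj V K T v)"
      using herm_add_right[OF sub K subspace_scale[OF sub a(1)] subspace_scale[OF sub a(2)] w]
        herm_scale_right[OF sub K a(1) w] herm_scale_right[OF sub K a(2) w] by simp
    finally show "K (adj V K T (x *c u + y *c v)) w = K (x *c adj V K T u + y *c adj V K T v) w"
      using herm_cnj[OF sub K w adj(1)[OF T S[OF u v]]] herm_cnj[OF sub K w S[OF a]] by simp
  qed
qed (rule adj(1)[OF T])

lemma endo_comp: "endo V T \<Longrightarrow> endo V S \<Longrightarrow> endo V (T \<circ> S)"
  unfolding endo_def by simp

text \<open>This is the squared Hilbert-Schmidt norm, in the form in which \<^const>\<open>end_norm\<close> expresses it.\<close>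

lemma tr_comp_adj:
  assumes b: "onb V K b" and T: "endo V T"
  shows "tr b (T \<circ> adj V K T) = of_real (\<Sum>i<length b. \<Sum>j<length b. (norm (K (T (b ! j)) (b ! i)))\<^sup>2)"
proof -
  have bi: "b ! i \<in> V" if "i < length b" for i using b that by (auto simp: onb_def[OF sub K] onl_def[OF sub K])
  have "tr b (T \<circ> adj V K T) = (\<Sum>i<length b. K (T (adj V K T (b ! i))) (b ! i))"
    using tr_onb[OF b endo_comp[OF T endo_adj[OF T]]] by simp
  also have "\<dots> = (\<Sum>i<length b. \<Sum>j<length b. of_real ((norm (K (T (b ! j)) (b ! i)))\<^sup>2))"
  proof (rule sum.cong)
    fix i assume "i \<in> {..<length b}"
    then have i: "b ! i \<in> V" using bi by simp
    note a = adj(1)[OF T i]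
    have "K (T (adj V K T (b ! i))) (b ! i) = K (adj V K T (b ! i)) (adj V K T (b ! i))"
      by (rule adj(2)[OF T i a])
    also have "\<dots> = (\<Sum>j<length b. K (adj V K T (b ! i)) (b ! j) * cnj (K (adj V K T (b ! i)) (b ! j)))"
      by (rule onb_parseval[OF sub K b a a])
    also have "\<dots> = (\<Sum>j<length b. of_real ((norm (K (T (b ! j)) (b ! i)))\<^sup>2))"
    proof (rule sum.cong)
      fix j assume "j \<in> {..<length b}"
      then have j: "b ! j \<in> V" using bi by simp
      have "K (adj V K T (b ! i)) (b ! j) = cnj (K (T (b ! j)) (b ! i))"
        using adj(2)[OF T i j] herm_cnj[OF sub K j a] by simp
      then show "K (adj V K T (b ! i)) (b ! j) * cnj (K (adj V K T (b ! i)) (b ! j)) =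
          of_real ((norm (K (T (b ! j)) (b ! i)))\<^sup>2)"
        unfolding complex_norm_square by (simp add: mult.commute)
    qed simp
    finally show "K (T (adj V K T (b ! i))) (b ! i) =
      (\<Sum>j<length b. of_real ((norm (K (T (b ! j)) (b ! i)))\<^sup>2))" .
  qed simp
  finally show ?thesis by simp
qed

text \<open>In an orthonormal basis each diagonal entry is bounded by the Hilbert-Schmidt norm. This
  later bounds the degree density by the norm of the curvature.\<close>

lemma norm_tr_le:
  assumes T: "endo V T"
  shows "norm (tr b0 T) \<le> real (length b0) * sqrt (Re (tr b0 (T \<circ> adj V K T)))"
proof -
  obtain b where l: "length b = length b0" and b: "onb V K b" using onb_ex[OF sub K b0] by blast
  then have bb: "basis_list V b" by (simp add: onb_def[OF sub K])
  let ?S = "\<Sum>i<length b. \<Sum>j<length b. (norm (K (T (b ! j)) (b ! i)))\<^sup>2"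
  have eq: "tr b0 (T \<circ> adj V K T) = of_real ?S"
    using tr_basis_indep[OF b0 bb endo_comp[OF T endo_adj[OF T]]] tr_comp_adj[OF b T] by simp
  have "norm (K (T (b ! i)) (b ! i)) \<le> sqrt ?S" if i: "i < length b" for i
  proof (rule real_le_rsqrt)
    have "(norm (K (T (b ! i)) (b ! i)))\<^sup>2 \<le> (\<Sum>j<length b. (norm (K (T (b ! j)) (b ! i)))\<^sup>2)"
      using i by (intro member_le_sum) auto
    also have "\<dots> \<le> ?S"
      using i by (intro member_le_sum) (auto intro: sum_nonneg)
    finally show "(norm (K (T (b ! i)) (b ! i)))\<^sup>2 \<le> ?S" .
  qed
  then have "norm (tr b T) \<le> (\<Sum>i<length b. sqrt ?S)"
    unfolding tr_onb[OF b T] by (intro sum_norm_le) auto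
  then show ?thesis using tr_basis_indep[OF b0 bb T] eq l by simp
qed

text \<open>The Hilbert-Schmidt norm of the quotient bounds every entry of \<open>H\<close> in a
  \<open>K\<close>-orthonormal basis. In the double sum for \<open>H v v\<close> the inequality
  \<open>2 x y \<le> x^2 + y^2\<close> separates the coordinates, at the price of the factor
  \<open>length b0\<close>.\<close>

lemma herm_le_of_quot_norm:
  assumes H: "herm_on V H" and C: "C \<ge> 0"
    and le: "sqrt (Re (tr b0 (quot V K H \<circ> adj V K (quot V K H)))) \<le> C" and v: "v \<in> V"
  shows "Re (H v v) \<le> (C * real (length b0)) * Re (K v v)"
proof -
  obtain b where l: "length b = length b0" and b: "onb V K b" using onb_ex[OF sub K b0] by blast
  then have bb: "basis_list V b" by (simp add: onb_def[OF sub K])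
  have bi: "b ! i \<in> V" if "i < length b" for i using bb that by (rule basis_list_nth)
  let ?T = "quot V K H"
  note T = endo_quot[OF H]
  let ?S = "\<Sum>i<length b. \<Sum>j<length b. (norm (K (?T (b ! j)) (b ! i)))\<^sup>2"
  have "tr b0 (?T \<circ> adj V K ?T) = of_real ?S"
    using tr_basis_indep[OF b0 bb endo_comp[OF T endo_adj[OF T]]] tr_comp_adj[OF b T] by simp
  then have S: "sqrt ?S \<le> C" using le by simp
  have ent: "norm (H (b ! j) (b ! i)) \<le> C" if ij: "i < length b" "j < length b" for i j
  proof -
    have "(norm (K (?T (b ! j)) (b ! i)))\<^sup>2 \<le> (\<Sum>j<length b. (norm (K (?T (b ! j)) (b ! i)))\<^sup>2)"
      using ij by (intro member_le_sum) auto
    also have "\<dots> \<le> ?S"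
      using ij by (intro member_le_sum) (auto intro: sum_nonneg)
    finally have "norm (K (?T (b ! j)) (b ! i)) \<le> sqrt ?S" by (rule real_le_rsqrt)
    then show ?thesis using S quot(2)[OF H bi bi, OF ij(2,1)] by simp
  qed
  let ?c = "\<lambda>i. K v (b ! i)" let ?n = "length b"
  have bs: "set b \<subseteq> V" using bb by (rule basis_list_set)
  have "H v v = H (comb ?c b) (comb ?c b)" using onb_expand[OF sub K b v] by simp
  also have "\<dots> = (\<Sum>i<?n. cnj (?c i) * H (comb ?c b) (b ! i))"
    by (rule herm_comb(2)[OF sub H bs comb_in[OF sub bs]])
  also have "\<dots> = (\<Sum>i<?n. \<Sum>j<?n. cnj (?c i) * (?c j * H (b ! j) (b ! i)))"
    using herm_comb(1)[OF sub H bs bi, of _ ?c] by (intro sum.cong) (auto simp: sum_distrib_left)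
  finally have eq: "H v v = (\<Sum>i<?n. \<Sum>j<?n. cnj (?c i) * (?c j * H (b ! j) (b ! i)))" .
  have "Re (H v v) \<le> norm (H v v)" by (rule complex_Re_le_cmod)
  also have "\<dots> \<le> (\<Sum>i<?n. \<Sum>j<?n. C * (((norm (?c i))\<^sup>2 + (norm (?c j))\<^sup>2) / 2))"
    unfolding eq
  proof (intro sum_norm_le)
    fix i j assume ij: "i \<in> {..<?n}" "j \<in> {..<?n}"
    have "norm (?c i) * norm (?c j) \<le> ((norm (?c i))\<^sup>2 + (norm (?c j))\<^sup>2) / 2"
      using sum_squares_bound[of "norm (?c i)" "norm (?c j)"] by simp
    then have "norm (H (b ! j) (b ! i)) * (norm (?c i) * norm (?c j)) \<le> C * (((norm (?c i))\<^sup>2 + (norm (?c j))\<^sup>2) / 2)"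
      using ent ij C by (intro mult_mono) auto
    then show "norm (cnj (?c i) * (?c j * H (b ! j) (b ! i))) \<le> C * (((norm (?c i))\<^sup>2 + (norm (?c j))\<^sup>2) / 2)"
      by (simp add: norm_mult mult_ac)
  qed
  also have "\<dots> = C * (real ?n * (\<Sum>i<?n. (norm (?c i))\<^sup>2))"
    by (simp add: sum_distrib_left[symmetric] sum.distrib sum_divide_distrib[symmetric])
  also have "(\<Sum>i<?n. (norm (?c i))\<^sup>2) = Re (K v v)"
  proof -
    have "K v v = of_real (\<Sum>i<?n. (norm (?c i))\<^sup>2)"
      unfolding onb_parseval[OF sub K b v v] of_real_sum complex_norm_square ..
    then show ?thesis by simp
  qed
  finally show ?thesis using l by (simp add: mult_ac)
qed

text \<open>In a \<open>K\<close>-orthonormal basis the trace is the sum of the numbers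
  \<open>H (b ! i) (b ! i)\<close>.\<close>

lemma tr_quot_le:
  assumes H: "herm_on V H" and le: "\<And>v. v \<in> V \<Longrightarrow> Re (H v v) \<le> c * Re (K v v)"
  shows "tr b0 (quot V K H) \<in> \<real>" "0 \<le> Re (tr b0 (quot V K H))"
    "Re (tr b0 (quot V K H)) \<le> real (length b0) * c"
proof -
  obtain b where l: "length b = length b0" and b: "onb V K b" using onb_ex[OF sub K b0] by blast
  then have bb: "basis_list V b" by (simp add: onb_def[OF sub K])
  have bi: "b ! i \<in> V" if "i < length b" for i using bb that by (rule basis_list_nth)
  have eq: "tr b0 (quot V K H) = (\<Sum>i<length b. H (b ! i) (b ! i))"
    using tr_basis_indep[OF b0 bb endo_quot[OF H]] tr_onb[OF b endo_quot[OF H]] quot(2)[OF H bi bi] by simp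
  have r: "H (b ! i) (b ! i) \<in> \<real>" if "i < length b" for i
    using herm_self(1)[OF sub H bi[OF that]] by (metis Reals_of_real)
  show "tr b0 (quot V K H) \<in> \<real>" unfolding eq using r by (intro sum_in_Reals) auto
  show "0 \<le> Re (tr b0 (quot V K H))"
    unfolding eq Re_sum using herm_self(2)[OF sub H bi] by (intro sum_nonneg) auto
  have "Re (H (b ! i) (b ! i)) \<le> c" if "i < length b" for i
    using le[OF bi[OF that]] b that by (simp add: onb_def[OF sub K] onl_def[OF sub K])
  then have "(\<Sum>i<length b. Re (H (b ! i) (b ! i))) \<le> (\<Sum>i<length b. c)" by (intro sum_mono) auto
  then show "Re (tr b0 (quot V K H)) \<le> real (length b0) * c" unfolding eq Re_sum using l by simp
qed

end

end

section \<open>Calculus of matrix-valued functions\<close>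

lemma smooth_on_transform:
  assumes "open U" "smooth_on U f" "\<And>z. z \<in> U \<Longrightarrow> g z = f z" shows "smooth_on U g"
  using smooth_on_cong[OF assms(1,3)] assms(2) by simp

text \<open>Covers \<open>d_z\<close> and \<open>d_zbar\<close> at once, so that each rule for
  matrix-valued functions is proved a single time.\<close>

definition wirtinger :: "((complex \<Rightarrow> complex) \<Rightarrow> complex \<Rightarrow> complex) \<Rightarrow> bool" where
  "wirtinger D \<longleftrightarrow> D = d_z \<or> D = d_zbar"

lemma wirtinger [simp]: "wirtinger d_z" "wirtinger d_zbar"
  by (simp_all add: wirtinger_def)

context
  fixes D assumes D: "wirtinger D"
begin

lemma D_cong: "open U \<Longrightarrow> z \<in> U \<Longrightarrow> (\<And>w. w \<in> U \<Longrightarrow> f w = g w) \<Longrightarrow> D f z = D g z"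
  using D d_z_cong[of U z f g] by (auto simp: wirtinger_def)

lemma D_const [simp]: "D (\<lambda>w. c) z = 0"
  using D by (auto simp: wirtinger_def)

lemma D_add: "f differentiable (at z) \<Longrightarrow> g differentiable (at z) \<Longrightarrow> D (\<lambda>w. f w + g w) z = D f z + D g z"
  using D d_z_add[of f z g] by (auto simp: wirtinger_def)

lemma D_mult: "f differentiable (at z) \<Longrightarrow> g differentiable (at z) \<Longrightarrow>
    D (\<lambda>w. f w * g w) z = D f z * g z + f z * D g z"
  using D d_z_mult[of f z g] by (auto simp: wirtinger_def)

lemma D_cmult: "f differentiable (at z) \<Longrightarrow> D (\<lambda>w. c * f w) z = c * D f z"
  using D_mult[of "\<lambda>_. c" z f] by simp

lemma D_diff:
  assumes "f differentiable (at z)" "g differentiable (at z)"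
  shows "D (\<lambda>w. f w - g w) z = D f z - D g z"
  using D_add[OF assms(1) differentiable_mult[OF differentiable_const[of "-1"] assms(2)]] D_cmult[OF assms(2), of "-1"]
  by simp

lemma D_sum:
  "finite I \<Longrightarrow> (\<And>i. i \<in> I \<Longrightarrow> f i differentiable (at z)) \<Longrightarrow> D (\<lambda>w. \<Sum>i\<in>I. f i w) z = (\<Sum>i\<in>I. D (f i) z)"
  using D d_z_sum[of I f z] by (auto simp: wirtinger_def)

end

section \<open>Smooth matrix-valued functions, traces and inverses\<close>

definition smooth_mat :: "nat \<Rightarrow> complex set \<Rightarrow> (complex \<Rightarrow> complex mat) \<Rightarrow> bool" where
  "smooth_mat n U M \<longleftrightarrow> (\<forall>z\<in>U. M z \<in> carrier_mat n n) \<and> (\<forall>i<n. \<forall>j<n. smooth_on U (\<lambda>z. M z $$ (i, j)))"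

definition dmat :: "((complex \<Rightarrow> complex) \<Rightarrow> complex \<Rightarrow> complex) \<Rightarrow> nat \<Rightarrow> (complex \<Rightarrow> complex mat) \<Rightarrow> complex \<Rightarrow> complex mat" where
  "dmat D n M z = Matrix.mat n n (\<lambda>(i, j). D (\<lambda>w. M w $$ (i, j)) z)"

definition mtrace :: "complex mat \<Rightarrow> complex" where
  "mtrace A = (\<Sum>i<dim_row A. A $$ (i, i))"

text \<open>Cramer's formula makes the entries polynomials in those of \<open>A\<close> divided by
  the determinant, from which smoothness can be read off.\<close>

definition minv :: "complex mat \<Rightarrow> complex mat" where
  "minv A = inverse (Determinant.det A) \<cdot>\<^sub>m adj_mat A"

lemma dmat_carrier [simp]: "dmat D n M z \<in> carrier_mat n n"
  by (simp add: dmat_def)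

lemma dmat_index: "i < n \<Longrightarrow> j < n \<Longrightarrow> dmat D n M z $$ (i, j) = D (\<lambda>w. M w $$ (i, j)) z"
  by (simp add: dmat_def)

lemma smooth_matD:
  "smooth_mat n U M \<Longrightarrow> z \<in> U \<Longrightarrow> M z \<in> carrier_mat n n"
  "smooth_mat n U M \<Longrightarrow> i < n \<Longrightarrow> j < n \<Longrightarrow> smooth_on U (\<lambda>z. M z $$ (i, j))"
  "smooth_mat n U M \<Longrightarrow> i < n \<Longrightarrow> j < n \<Longrightarrow> z \<in> U \<Longrightarrow> (\<lambda>z. M z $$ (i, j)) differentiable (at z)"
  unfolding smooth_mat_def using smooth_on_imp_differentiable by blast+

lemma mtrace_mult_commute:
  assumes "A \<in> carrier_mat n m" "B \<in> carrier_mat m n"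
  shows "mtrace (A * B) = mtrace (B * A)"
proof -
  have "mtrace (A * B) = (\<Sum>i<n. \<Sum>j<m. A $$ (i, j) * B $$ (j, i))"
    unfolding mtrace_def using assms mat_mult_index[OF assms] by simp
  also have "\<dots> = (\<Sum>j<m. \<Sum>i<n. B $$ (j, i) * A $$ (i, j))"
    by (subst sum.swap) (simp only: mult.commute)
  also have "\<dots> = mtrace (B * A)"
    unfolding mtrace_def using assms mat_mult_index[OF assms(2,1)] by simp
  finally show ?thesis .
qed

lemma mtrace_diff: "A \<in> carrier_mat n n \<Longrightarrow> B \<in> carrier_mat n n \<Longrightarrow> mtrace (A - B) = mtrace A - mtrace B"
  by (auto simp: mtrace_def sum_subtractf)

lemma minv_carrier [simp]: "A \<in> carrier_mat n n \<Longrightarrow> minv A \<in> carrier_mat n n"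
  unfolding minv_def by (rule smult_carrier_mat[OF adj_mat(1)])

lemma minv_mult:
  assumes "A \<in> carrier_mat n n" "Determinant.det A \<noteq> 0"
  shows "A * minv A = 1\<^sub>m n" "minv A * A = 1\<^sub>m n"
proof -
  have "A * minv A = inverse (Determinant.det A) \<cdot>\<^sub>m (Determinant.det A \<cdot>\<^sub>m 1\<^sub>m n)"
    unfolding minv_def using adj_mat[OF assms(1)] mult_smult_distrib[OF assms(1) adj_mat(1)[OF assms(1)]] by simp
  also have "\<dots> = 1\<^sub>m n" using assms(2) by (intro eq_matI) auto
  finally show "A * minv A = 1\<^sub>m n" .
  then show "minv A * A = 1\<^sub>m n" using mat_mult_left_right_inverse[OF assms(1)] assms(1) by auto
qed

lemma ctranspose_mult:
  assumes "X \<in> carrier_mat n n" "Y \<in> carrier_mat n n"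
  shows "ctranspose (X * Y) = ctranspose Y * ctranspose X"
proof (rule eq_matI)
  note C1 = ctranspose_carrier[OF mult_carrier_mat[OF assms]]
  note C2 = mult_carrier_mat[OF ctranspose_carrier[OF assms(2)] ctranspose_carrier[OF assms(1)]]
  show "dim_row (ctranspose (X * Y)) = dim_row (ctranspose Y * ctranspose X)"
    "dim_col (ctranspose (X * Y)) = dim_col (ctranspose Y * ctranspose X)"
    by (simp_all only: carrier_matD[OF C1] carrier_matD[OF C2])
  fix i j assume "i < dim_row (ctranspose Y * ctranspose X)" "j < dim_col (ctranspose Y * ctranspose X)"
  then have ij: "i < n" "j < n" unfolding carrier_matD[OF C2] .
  show "ctranspose (X * Y) $$ (i, j) = (ctranspose Y * ctranspose X) $$ (i, j)"
    unfolding mat_mult_index[OF ctranspose_carrier[OF assms(2)] ctranspose_carrier[OF assms(1)] ij]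
      ctranspose_index[OF mult_carrier_mat[OF assms] ij] mat_mult_index[OF assms ij(2,1)]
    using ij ctranspose_index[OF assms(1)] ctranspose_index[OF assms(2)]
    by (simp add: mult.commute)
qed

lemma ctranspose_minv:
  assumes "C \<in> carrier_mat n n" "Determinant.det C \<noteq> 0" "ctranspose C = C"
  shows "ctranspose (minv C) = minv C"
proof -
  note i = minv_carrier[OF assms(1)]
  have one: "ctranspose (1\<^sub>m n) = 1\<^sub>m n" by (intro eq_matI) (auto simp: ctranspose_def)
  have "ctranspose (minv C) * C = ctranspose (minv C) * ctranspose C" using assms(3) by simp
  also have "\<dots> = ctranspose (C * minv C)" using ctranspose_mult[OF assms(1) i] by simp
  also have "\<dots> = 1\<^sub>m n" using minv_mult(1)[OF assms(1,2)] one by simp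
  finally have "ctranspose (minv C) * C = 1\<^sub>m n" .
  then have "(ctranspose (minv C) * C) * minv C = 1\<^sub>m n * minv C" by simp
  then have "ctranspose (minv C) * (C * minv C) = minv C"
    using assoc_mult_mat[OF ctranspose_carrier[OF i] assms(1) i] left_mult_one_mat[OF i] by simp
  then show ?thesis
    using minv_mult(1)[OF assms(1,2)] right_mult_one_mat[OF ctranspose_carrier[OF i]] by simp
qed

text \<open>\<open>theta n M\<close> is the \<open>dzbar\<close> derivative of the connection form \<open>conn n M\<close> of the Chern
  connection of the metric with Gram matrix \<open>M\<close> in a holomorphic frame.\<close>

definition conn :: "nat \<Rightarrow> (complex \<Rightarrow> complex mat) \<Rightarrow> complex \<Rightarrow> complex mat" where
  "conn n M z = dmat d_z n M z * minv (M z)"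

definition theta :: "nat \<Rightarrow> (complex \<Rightarrow> complex mat) \<Rightarrow> complex \<Rightarrow> complex mat" where
  "theta n M = dmat d_zbar n (conn n M)"

definition conn_diff :: "nat \<Rightarrow> (complex \<Rightarrow> complex mat) \<Rightarrow> (complex \<Rightarrow> complex mat) \<Rightarrow> complex \<Rightarrow> complex mat" where
  "conn_diff n A B z = conn n B z - conn n A z"

text \<open>For Gram matrices \<open>A\<close> of \<open>H1\<close> and \<open>B\<close> of
  \<open>H2\<close>, row \<open>i\<close> lists the coordinates of the image of the
  \<open>i\<close>-th frame vector under the quotient of \<open>H2\<close> by \<open>H1\<close>;
  this row convention fixes the order of the factors.\<close>

definition quot_mat :: "(complex \<Rightarrow> complex mat) \<Rightarrow> (complex \<Rightarrow> complex mat) \<Rightarrow> complex \<Rightarrow> complex mat" where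
  "quot_mat A B z = B z * minv (A z)"

context
  fixes U :: "complex set" assumes U: "open U"
begin

lemma smooth_mat_mult:
  assumes "smooth_mat n U M" "smooth_mat n U N"
  shows "smooth_mat n U (\<lambda>z. M z * N z)"
  unfolding smooth_mat_def
proof (intro conjI ballI allI impI)
  show "M z * N z \<in> carrier_mat n n" if "z \<in> U" for z
    using smooth_matD(1)[OF assms(1) that] smooth_matD(1)[OF assms(2) that] by (rule mult_carrier_mat)
  fix i j assume ij: "i < n" "j < n"
  have "smooth_on U (\<lambda>z. \<Sum>l<n. M z $$ (i, l) * N z $$ (l, j))"
    using ij by (intro smooth_on_sum smooth_on_mult U smooth_matD(2)[OF assms(1)] smooth_matD(2)[OF assms(2)]) auto
  then show "smooth_on U (\<lambda>z. (M z * N z) $$ (i, j))"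
    by (rule smooth_on_transform[OF U])
      (rule mat_mult_index[OF smooth_matD(1)[OF assms(1)] smooth_matD(1)[OF assms(2)] ij])
qed

lemma dmat_mult:
  assumes "smooth_mat n U M" "smooth_mat n U N" "z \<in> U" and D: "wirtinger D"
  shows "dmat D n (\<lambda>w. M w * N w) z = dmat D n M z * N z + M z * dmat D n N z"
proof (rule eq_matI)
  note c = smooth_matD(1)[OF assms(1)] smooth_matD(1)[OF assms(2)]
  have C: "dmat D n M z * N z \<in> carrier_mat n n" "M z * dmat D n N z \<in> carrier_mat n n"
    by (rule mult_carrier_mat[OF dmat_carrier c(2)[OF assms(3)]] mult_carrier_mat[OF c(1)[OF assms(3)] dmat_carrier])+
  then have C': "dmat D n M z * N z + M z * dmat D n N z \<in> carrier_mat n n" by (intro add_carrier_mat)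
  show "dim_row (dmat D n (\<lambda>w. M w * N w) z) = dim_row (dmat D n M z * N z + M z * dmat D n N z)"
    "dim_col (dmat D n (\<lambda>w. M w * N w) z) = dim_col (dmat D n M z * N z + M z * dmat D n N z)"
    unfolding carrier_matD[OF C'] carrier_matD[OF dmat_carrier] by auto
  fix i j assume "i < dim_row (dmat D n M z * N z + M z * dmat D n N z)"
    "j < dim_col (dmat D n M z * N z + M z * dmat D n N z)"
  then have ij: "i < n" "j < n" unfolding carrier_matD[OF C'] .
  have "D (\<lambda>w. (M w * N w) $$ (i, j)) z = D (\<lambda>w. \<Sum>l<n. M w $$ (i, l) * N w $$ (l, j)) z"
    by (rule D_cong[OF D U assms(3)]) (rule mat_mult_index[OF c ij])
  also have "\<dots> = (\<Sum>l<n. D (\<lambda>w. M w $$ (i, l) * N w $$ (l, j)) z)"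
    using assms(3) ij by (intro D_sum[OF D] differentiable_mult smooth_matD(3)[OF assms(1)] smooth_matD(3)[OF assms(2)]) auto
  also have "\<dots> = (\<Sum>l<n. D (\<lambda>w. M w $$ (i, l)) z * N z $$ (l, j) + M z $$ (i, l) * D (\<lambda>w. N w $$ (l, j)) z)"
    using assms(3) ij by (intro sum.cong D_mult[OF D] smooth_matD(3)[OF assms(1)] smooth_matD(3)[OF assms(2)]) auto
  also have "\<dots> = (dmat D n M z * N z + M z * dmat D n N z) $$ (i, j)"
  proof -
    have "(dmat D n M z * N z + M z * dmat D n N z) $$ (i, j) =
        (dmat D n M z * N z) $$ (i, j) + (M z * dmat D n N z) $$ (i, j)"
      by (rule index_add_mat(1)) (simp_all only: ij carrier_matD[OF C(2)])
    then show ?thesis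
      using mat_mult_index[OF dmat_carrier c(2)[OF assms(3)] ij, of D M z]
        mat_mult_index[OF c(1)[OF assms(3)] dmat_carrier ij, of D N z] ij
      by (simp add: sum.distrib dmat_index)
  qed
  finally show "dmat D n (\<lambda>w. M w * N w) z $$ (i, j) = (dmat D n M z * N z + M z * dmat D n N z) $$ (i, j)"
    using ij by (simp add: dmat_index)
qed

lemma smooth_mat_dmat:
  assumes "smooth_mat n U M" shows "smooth_mat n U (dmat d_z n M)" "smooth_mat n U (dmat d_zbar n M)"
proof -
  have "smooth_on U (\<lambda>z. dmat D n M z $$ (i, j))" if "i < n" "j < n" "D = d_z \<or> D = d_zbar" for i j D
  proof -
    have "smooth_on U (D (\<lambda>w. M w $$ (i, j)))"
      using smooth_on_d_z[OF U smooth_matD(2)[OF assms that(1,2)]]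
        smooth_on_d_zbar[OF U smooth_matD(2)[OF assms that(1,2)]] that(3) by (elim disjE) (simp_all only:)
    then show ?thesis using that by (simp add: dmat_index)
  qed
  then show "smooth_mat n U (dmat d_z n M)" "smooth_mat n U (dmat d_zbar n M)"
    unfolding smooth_mat_def by simp_all
qed

lemma dmat_cong:
  assumes "z \<in> U" "\<And>w. w \<in> U \<Longrightarrow> M w = N w" and D: "wirtinger D"
  shows "dmat D n M z = dmat D n N z"
proof (rule eq_matI)
  fix i j assume "i < dim_row (dmat D n N z)" "j < dim_col (dmat D n N z)"
  then have "i < n" "j < n" by (auto simp: dmat_def)
  then show "dmat D n M z $$ (i, j) = dmat D n N z $$ (i, j)"
    using D_cong[OF D U assms(1), of "\<lambda>w. M w $$ (i, j)" "\<lambda>w. N w $$ (i, j)"] assms(2)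
    by (simp add: dmat_index)
qed (auto simp: dmat_def)

lemma dmat_const:
  assumes "z \<in> U" "\<And>w. w \<in> U \<Longrightarrow> M w = C" and D: "wirtinger D"
  shows "dmat D n M z = 0\<^sub>m n n"
proof -
  have "dmat D n M z = dmat D n (\<lambda>_. C) z" using assms by (rule dmat_cong)
  also have "\<dots> = 0\<^sub>m n n" by (intro eq_matI) (auto simp: dmat_def D_const[OF D])
  finally show ?thesis .
qed

lemma smooth_on_det:
  assumes "smooth_mat n U M" shows "smooth_on U (\<lambda>z. Determinant.det (M z))"
proof -
  have "smooth_on U (\<lambda>z. \<Sum>p\<in>{p. p permutes {0..<n}}. signof p * (\<Prod>i = 0..<n. M z $$ (i, p i)))"
    by (intro smooth_on_sum smooth_on_mult smooth_on_prod U smooth_on_const smooth_matD(2)[OF assms])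
      (auto dest: permutes_in_image)
  then show ?thesis
    by (rule smooth_on_transform[OF U]) (rule det_def'[OF smooth_matD(1)[OF assms]])
qed

lemma smooth_mat_minv:
  assumes "smooth_mat n U M" "\<forall>z\<in>U. Determinant.det (M z) \<noteq> 0"
  shows "smooth_mat n U (\<lambda>z. minv (M z))"
  unfolding smooth_mat_def
proof (intro conjI ballI allI impI)
  show "minv (M z) \<in> carrier_mat n n" if "z \<in> U" for z using smooth_matD(1)[OF assms(1) that] by simp
  fix i j assume ij: "i < n" "j < n"
  have cf: "smooth_on U (\<lambda>z. cofactor (M z) j i)"
    unfolding cofactor_def
  proof (intro smooth_on_mult U smooth_on_const smooth_on_det[where n = "n - 1"])
    show "smooth_mat (n - 1) U (\<lambda>z. mat_delete (M z) j i)"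
      unfolding smooth_mat_def
    proof (intro conjI ballI allI impI)
      show "mat_delete (M z) j i \<in> carrier_mat (n - 1) (n - 1)" if "z \<in> U" for z
        by (rule mat_delete_carrier[OF smooth_matD(1)[OF assms(1) that]])
      fix k l assume kl: "k < n - 1" "l < n - 1"
      let ?k = "if k < j then k else Suc k" and ?l = "if l < i then l else Suc l"
      have "smooth_on U (\<lambda>z. M z $$ (?k, ?l))" using kl by (intro smooth_matD(2)[OF assms(1)]) auto
      moreover have "mat_delete (M z) j i $$ (k, l) = M z $$ (?k, ?l)" if "z \<in> U" for z
        using smooth_matD(1)[OF assms(1) that] kl by (simp add: mat_delete_def)
      ultimately show "smooth_on U (\<lambda>z. mat_delete (M z) j i $$ (k, l))"
        by (rule smooth_on_transform[OF U])
    qed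
  qed
  have "smooth_on U (\<lambda>z. inverse (Determinant.det (M z)) * cofactor (M z) j i)"
    by (intro smooth_on_mult smooth_on_inverse U cf smooth_on_det[OF assms(1)] assms(2)[rule_format])
  moreover have "minv (M z) $$ (i, j) = inverse (Determinant.det (M z)) * cofactor (M z) j i" if "z \<in> U" for z
    using smooth_matD(1)[OF assms(1) that] ij by (simp add: minv_def adj_mat_def)
  ultimately show "smooth_on U (\<lambda>z. minv (M z) $$ (i, j))"
    by (rule smooth_on_transform[OF U])
qed

lemma dmat_diff:
  assumes "smooth_mat n U M" "smooth_mat n U N" "z \<in> U" and D: "wirtinger D"
  shows "dmat D n (\<lambda>w. M w - N w) z = dmat D n M z - dmat D n N z"
proof (rule eq_matI)
  fix i j assume "i < dim_row (dmat D n M z - dmat D n N z)" "j < dim_col (dmat D n M z - dmat D n N z)"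
  then have ij: "i < n" "j < n" by (auto simp: dmat_def)
  have "D (\<lambda>w. (M w - N w) $$ (i, j)) z = D (\<lambda>w. M w $$ (i, j) - N w $$ (i, j)) z"
    using smooth_matD(1)[OF assms(2)] ij by (intro D_cong[OF D U assms(3)]) fastforce
  also have "\<dots> = D (\<lambda>w. M w $$ (i, j)) z - D (\<lambda>w. N w $$ (i, j)) z"
    by (rule D_diff[OF D smooth_matD(3)[OF assms(1) ij assms(3)] smooth_matD(3)[OF assms(2) ij assms(3)]])
  finally show "dmat D n (\<lambda>w. M w - N w) z $$ (i, j) = (dmat D n M z - dmat D n N z) $$ (i, j)"
    using ij by (simp add: dmat_index) (simp add: dmat_def)
qed (auto simp: dmat_def)

lemma smooth_mat_diff:
  assumes "smooth_mat n U M" "smooth_mat n U N"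
  shows "smooth_mat n U (\<lambda>z. M z - N z)"
  unfolding smooth_mat_def
proof (intro conjI ballI allI impI)
  show "M z - N z \<in> carrier_mat n n" if "z \<in> U" for z
    using smooth_matD(1)[OF assms(2) that] by (rule minus_carrier_mat)
  fix i j assume ij: "i < n" "j < n"
  have "smooth_on U (\<lambda>z. M z $$ (i, j) - N z $$ (i, j))"
    by (intro smooth_on_diff U smooth_matD(2)[OF assms(1) ij] smooth_matD(2)[OF assms(2) ij])
  moreover have "(M z - N z) $$ (i, j) = M z $$ (i, j) - N z $$ (i, j)" if "z \<in> U" for z
    using smooth_matD(1)[OF assms(2) that] ij by auto
  ultimately show "smooth_on U (\<lambda>z. (M z - N z) $$ (i, j))"
    by (rule smooth_on_transform[OF U])
qed

lemma mtrace_smooth: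
  assumes "smooth_mat n U M" shows "smooth_on U (\<lambda>z. mtrace (M z))"
proof -
  have "smooth_on U (\<lambda>z. \<Sum>i<n. M z $$ (i, i))"
    by (intro smooth_on_sum U smooth_matD(2)[OF assms]) auto
  moreover have "mtrace (M z) = (\<Sum>i<n. M z $$ (i, i))" if "z \<in> U" for z
    using smooth_matD(1)[OF assms that] by (simp add: mtrace_def)
  ultimately show ?thesis by (rule smooth_on_transform[OF U])
qed

lemma d_mtrace:
  assumes "smooth_mat n U M" "z \<in> U" and D: "wirtinger D"
  shows "D (\<lambda>w. mtrace (M w)) z = mtrace (dmat D n M z)"
proof -
  have "mtrace (M w) = (\<Sum>i<n. M w $$ (i, i))" if "w \<in> U" for w
    using smooth_matD(1)[OF assms(1) that] by (simp add: mtrace_def)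
  then have "D (\<lambda>w. mtrace (M w)) z = D (\<lambda>w. \<Sum>i<n. M w $$ (i, i)) z"
    by (rule D_cong[OF D U assms(2)])
  also have "\<dots> = (\<Sum>i<n. D (\<lambda>w. M w $$ (i, i)) z)"
    using assms(2) by (intro D_sum[OF D] smooth_matD(3)[OF assms(1)]) auto
  finally show ?thesis by (simp add: mtrace_def dmat_def)
qed

lemma dmat_ctranspose:
  assumes "smooth_mat n U M" "z \<in> U"
  shows "dmat d_zbar n (\<lambda>w. ctranspose (M w)) z = ctranspose (dmat d_z n M z)"
proof (rule eq_matI)
  have C: "ctranspose (dmat d_z n M z) \<in> carrier_mat n n" by simp
  fix i j assume "i < dim_row (ctranspose (dmat d_z n M z))" "j < dim_col (ctranspose (dmat d_z n M z))"
  then have ij: "i < n" "j < n" unfolding carrier_matD[OF C] .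
  have "d_zbar (\<lambda>w. ctranspose (M w) $$ (i, j)) z = d_zbar (\<lambda>w. cnj (M w $$ (j, i))) z"
    using ctranspose_index[OF smooth_matD(1)[OF assms(1)] ij] by (intro d_z_cong(2)[OF U assms(2)]) auto
  also have "\<dots> = cnj (d_z (\<lambda>w. M w $$ (j, i)) z)"
    by (rule d_z_cnj(2)[OF smooth_matD(3)[OF assms(1) ij(2,1) assms(2)]])
  finally show "dmat d_zbar n (\<lambda>w. ctranspose (M w)) z $$ (i, j) = ctranspose (dmat d_z n M z) $$ (i, j)"
    using ij by (simp add: dmat_index ctranspose_index[OF dmat_carrier])
qed (auto simp: dmat_def ctranspose_def)

text \<open>The derivative is written with one factor replaced under the product sign, the shape in
  which the Leibniz expansion of a determinant is differentiated row by row.\<close>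

lemma d_prod:
  assumes "finite I" "\<And>k. k \<in> I \<Longrightarrow> f k differentiable (at z)" and D: "wirtinger D"
  shows "D (\<lambda>w. \<Prod>k\<in>I. f k w) z = (\<Sum>i\<in>I. \<Prod>k\<in>I. if k = i then D (f i) z else f k z)"
    and "(\<lambda>w. \<Prod>k\<in>I. f k w) differentiable (at z)"
  using assms(1,2)
proof (induction I)
  case empty
  { case 1 then show ?case by (simp add: D_const[OF D]) }
  { case 2 then show ?case by simp }
next
  case (insert x I)
  { case 1
    have "D (\<lambda>w. f x w * (\<Prod>k\<in>I. f k w)) z = D (f x) z * (\<Prod>k\<in>I. f k z) + f x z * D (\<lambda>w. \<Prod>k\<in>I. f k w) z"
      using 1 insert by (intro D_mult[OF D]) auto
    also have "D (\<lambda>w. \<Prod>k\<in>I. f k w) z = (\<Sum>i\<in>I. \<Prod>k\<in>I. if k = i then D (f i) z else f k z)"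
      using insert 1 by auto
    also have "(\<Prod>k\<in>I. f k z) = (\<Prod>k\<in>I. if k = x then D (f x) z else f k z)"
      using insert by (intro prod.cong) auto
    finally have "D (\<lambda>w. f x w * (\<Prod>k\<in>I. f k w)) z =
        D (f x) z * (\<Prod>k\<in>I. if k = x then D (f x) z else f k z) +
        (\<Sum>i\<in>I. f x z * (\<Prod>k\<in>I. if k = i then D (f i) z else f k z))" by (simp add: sum_distrib_left)
    also have "(\<Sum>i\<in>I. f x z * (\<Prod>k\<in>I. if k = i then D (f i) z else f k z)) =
        (\<Sum>i\<in>I. (if x = i then D (f i) z else f x z) * (\<Prod>k\<in>I. if k = i then D (f i) z else f k z))"
      using insert by (intro sum.cong) auto
    finally show ?case using insert by (simp add: sum_distrib_left) }
  { case 2 then show ?case using insert by (simp add: differentiable_mult) }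
qed

text \<open>Jacobi's formula: the Leibniz expansion differentiates the rows one after the other.\<close>

lemma d_det:
  assumes M: "smooth_mat n U M" and z: "z \<in> U" and det: "Determinant.det (M z) \<noteq> 0"
    and D: "wirtinger D"
  shows "D (\<lambda>w. Determinant.det (M w)) z = mtrace (dmat D n M z * minv (M z)) * Determinant.det (M z)"
proof -
  let ?P = "{p. p permutes {0..<n}}"
  have Mz: "M z \<in> carrier_mat n n" using smooth_matD(1)[OF M z] .
  have p: "p i < n" if "p \<in> ?P" "i < n" for p i using that permutes_in_image[of p "{0..<n}" i] by auto
  \<comment> \<open>\<open>M z\<close> with row \<open>i\<close> differentiated. Expanding its
    determinant along that row involves only cofactors of \<open>M z\<close> itself, hence the
    inverse of \<open>M z\<close>.\<close>
  define R where "R i = Matrix.mat n n (\<lambda>(k, j). if k = i then D (\<lambda>w. M w $$ (i, j)) z else M z $$ (k, j))" for i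
  have diff: "(\<lambda>w. M w $$ (k, p k)) differentiable (at z)" if "p \<in> ?P" "k < n" for p k
    using that p[OF that] smooth_matD(3)[OF M _ _ z] by blast
  have diff': "(\<lambda>w. M w $$ (k, p k)) differentiable (at z)" if "p \<in> ?P" "k \<in> {0..<n}" for p k
    using diff that by simp
  note dp = d_prod[OF finite_atLeastLessThan diff' D]
  have "D (\<lambda>w. Determinant.det (M w)) z = D (\<lambda>w. \<Sum>p\<in>?P. signof p * (\<Prod>i = 0..<n. M w $$ (i, p i))) z"
    by (rule D_cong[OF D U z]) (rule det_def'[OF smooth_matD(1)[OF M]])
  also have "\<dots> = (\<Sum>p\<in>?P. D (\<lambda>w. signof p * (\<Prod>i = 0..<n. M w $$ (i, p i))) z)"
  proof (rule D_sum[OF D])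
    show "finite ?P" by (rule finite_permutations) simp
    fix q assume q: "q \<in> ?P"
    have "(\<lambda>w. \<Prod>i = 0..<n. M w $$ (i, q i)) differentiable (at z)"
      by (rule dp(2)[OF q])
    then show "(\<lambda>w. signof q * (\<Prod>i = 0..<n. M w $$ (i, q i))) differentiable (at z)"
      by (rule differentiable_mult[OF differentiable_const])
  qed
  also have "\<dots> = (\<Sum>p\<in>?P. \<Sum>i = 0..<n. signof p * (\<Prod>k = 0..<n. R i $$ (k, p k)))"
  proof (rule sum.cong)
    fix q assume q: "q \<in> ?P"
    have "D (\<lambda>w. signof q * (\<Prod>i = 0..<n. M w $$ (i, q i))) z = signof q * D (\<lambda>w. \<Prod>i = 0..<n. M w $$ (i, q i)) z"
      by (rule D_cmult[OF D dp(2)[OF q]])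
    also have "D (\<lambda>w. \<Prod>i = 0..<n. M w $$ (i, q i)) z =
        (\<Sum>i = 0..<n. \<Prod>k = 0..<n. if k = i then D (\<lambda>w. M w $$ (i, q i)) z else M z $$ (k, q k))"
      by (rule dp(1)[OF q])
    also have "\<dots> = (\<Sum>i = 0..<n. \<Prod>k = 0..<n. R i $$ (k, q k))"
      using p[OF q] by (intro sum.cong prod.cong) (auto simp: R_def)
    finally show "D (\<lambda>w. signof q * (\<Prod>i = 0..<n. M w $$ (i, q i))) z =
        (\<Sum>i = 0..<n. signof q * (\<Prod>k = 0..<n. R i $$ (k, q k)))" by (simp add: sum_distrib_left)
  qed simp
  also have "\<dots> = (\<Sum>i = 0..<n. Determinant.det (R i))"
  proof -
    have "R i \<in> carrier_mat n n" for i by (simp add: R_def)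
    from det_def'[OF this] show ?thesis by (subst sum.swap) simp
  qed
  also have "\<dots> = (\<Sum>i<n. \<Sum>j<n. dmat D n M z $$ (i, j) * (minv (M z) $$ (j, i) * Determinant.det (M z)))"
    unfolding atLeast0LessThan
  proof (rule sum.cong)
    fix i assume "i \<in> {..<n}"
    then have i: "i < n" by simp
    have R: "R i \<in> carrier_mat n n" by (simp add: R_def)
    have "cofactor (R i) i j = minv (M z) $$ (j, i) * Determinant.det (M z)" if j: "j < n" for j
    proof -
      have "mat_delete (R i) i j = mat_delete (M z) i j"
        using Mz i j by (intro eq_matI) (auto simp: mat_delete_def R_def)
      then show ?thesis using Mz i j det by (simp add: minv_def adj_mat_def cofactor_def)
    qed
    then show "Determinant.det (R i) = (\<Sum>j<n. dmat D n M z $$ (i, j) * (minv (M z) $$ (j, i) * Determinant.det (M z)))"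
      unfolding laplace_expansion_row[OF R i] using i
      by (intro sum.cong) (auto simp: R_def dmat_index)
  qed simp
  also have "\<dots> = mtrace (dmat D n M z * minv (M z)) * Determinant.det (M z)"
    using mat_mult_index[OF dmat_carrier minv_carrier[OF Mz], of _ _ D M z]
    unfolding mtrace_def index_mult_mat(2) carrier_matD[OF dmat_carrier]
    by (simp add: sum_distrib_right mult.assoc)
  finally show ?thesis .
qed

lemma smooth_mat_conn:
  assumes "smooth_mat n U M" "\<forall>z\<in>U. Determinant.det (M z) \<noteq> 0"
  shows "smooth_mat n U (conn n M)"
  unfolding conn_def[abs_def] by (intro smooth_mat_mult smooth_mat_dmat smooth_mat_minv assms)

text \<open>By Jacobi's formula the trace of the connection form is the logarithmic
  \<open>d_z\<close> derivative of the determinant. The trace of the curvature is therefore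
  determined by the determinant of the metric.\<close>

lemma mtrace_theta:
  assumes M: "smooth_mat n U M" "\<forall>z\<in>U. Determinant.det (M z) \<noteq> 0" and z: "z \<in> U"
  shows "mtrace (theta n M z) = d_zbar (\<lambda>w. d_z (\<lambda>w. Determinant.det (M w)) w / Determinant.det (M w)) z"
proof -
  have "mtrace (theta n M z) = d_zbar (\<lambda>w. mtrace (conn n M w)) z"
    unfolding theta_def by (rule d_mtrace[OF smooth_mat_conn[OF M] z wirtinger(2), symmetric])
  also have "\<dots> = d_zbar (\<lambda>w. d_z (\<lambda>w. Determinant.det (M w)) w / Determinant.det (M w)) z"
  proof (rule D_cong[OF wirtinger(2) U z])
    fix w assume w: "w \<in> U"
    show "mtrace (conn n M w) = d_z (\<lambda>w. Determinant.det (M w)) w / Determinant.det (M w)"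
      unfolding d_det[OF M(1) w M(2)[rule_format, OF w] wirtinger(1)] conn_def using M(2)[rule_format, OF w] by simp
  qed
  finally show ?thesis .
qed

text \<open>Differentiate the constant product of \<open>M\<close> and its inverse, then multiply by
  the inverse from the left.\<close>

lemma dmat_minv:
  assumes M: "smooth_mat n U M" "\<forall>z\<in>U. Determinant.det (M z) \<noteq> 0" and z: "z \<in> U" and D: "wirtinger D"
  shows "dmat D n (\<lambda>w. minv (M w)) z = - (minv (M z) * dmat D n M z * minv (M z))"
proof -
  note c = smooth_matD(1)[OF M(1) z]
  note i = minv_carrier[OF c]
  define N where "N = dmat D n (\<lambda>w. minv (M w)) z"
  define P where "P = dmat D n M z"
  have N: "N \<in> carrier_mat n n" "P \<in> carrier_mat n n" unfolding N_def P_def by simp_all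
  have zero: "dmat D n (\<lambda>w. M w * minv (M w)) z = 0\<^sub>m n n"
    by (rule dmat_const[OF z _ D]) (rule minv_mult(1)[OF smooth_matD(1)[OF M(1)] M(2)[rule_format]])
  have "P * minv (M z) + M z * N = 0\<^sub>m n n"
    unfolding P_def N_def by (rule trans[OF dmat_mult[OF M(1) smooth_mat_minv[OF M] z D, symmetric] zero])
  then have "minv (M z) * (P * minv (M z) + M z * N) = 0\<^sub>m n n" by (simp only: right_mult_zero_mat[OF i])
  then have "minv (M z) * (P * minv (M z)) + minv (M z) * (M z * N) = 0\<^sub>m n n"
    by (simp only: mult_add_distrib_mat[OF i mult_carrier_mat[OF N(2) i] mult_carrier_mat[OF c N(1)]])
  also have "minv (M z) * (M z * N) = N"
    using assoc_mult_mat[OF i c N(1)] minv_mult(2)[OF c M(2)[rule_format, OF z]] N by simp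
  also have "minv (M z) * (P * minv (M z)) = minv (M z) * P * minv (M z)"
    using assoc_mult_mat[OF i N(2) i] by simp
  finally have 0: "minv (M z) * P * minv (M z) + N = 0\<^sub>m n n" .
  have C: "minv (M z) * P * minv (M z) \<in> carrier_mat n n" using i N by (intro mult_carrier_mat)
  have "N = - (minv (M z) * P * minv (M z))"
  proof (rule eq_matI)
    fix k l assume "k < dim_row (- (minv (M z) * P * minv (M z)))" "l < dim_col (- (minv (M z) * P * minv (M z)))"
    then have kl: "k < n" "l < n" unfolding index_uminus_mat carrier_matD[OF C] .
    have "(minv (M z) * P * minv (M z) + N) $$ (k, l) = 0" unfolding 0 using kl by simp
    moreover have "(minv (M z) * P * minv (M z) + N) $$ (k, l) = (minv (M z) * P * minv (M z)) $$ (k, l) + N $$ (k, l)"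
      by (rule index_add_mat(1)) (simp_all only: kl carrier_matD[OF N(1)])
    moreover have "(- (minv (M z) * P * minv (M z))) $$ (k, l) = - ((minv (M z) * P * minv (M z)) $$ (k, l))"
      by (rule index_uminus_mat(1)) (simp_all only: kl carrier_matD[OF C])
    ultimately show "N $$ (k, l) = (- (minv (M z) * P * minv (M z))) $$ (k, l)"
      by (simp only: add_eq_0_iff)
  qed (simp_all only: index_uminus_mat carrier_matD[OF C] carrier_matD[OF N(1)])
  then show ?thesis by (simp only: N_def P_def)
qed

lemma dbar_ctranspose:
  assumes M: "smooth_mat n U M" "\<forall>z\<in>U. ctranspose (M z) = M z" and z: "z \<in> U"
  shows "ctranspose (dmat d_z n M z) = dmat d_zbar n M z"
  unfolding dmat_ctranspose[OF M(1) z, symmetric]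
  by (rule dmat_cong[OF z M(2)[rule_format] wirtinger(2)])

lemma ctranspose_conn:
  assumes M: "smooth_mat n U M" "\<forall>z\<in>U. Determinant.det (M z) \<noteq> 0"
    "\<forall>z\<in>U. ctranspose (M z) = M z" and z: "z \<in> U"
  shows "ctranspose (conn n M z) = minv (M z) * dmat d_zbar n M z"
  unfolding conn_def ctranspose_mult[OF dmat_carrier minv_carrier[OF smooth_matD(1)[OF M(1) z]]]
    ctranspose_minv[OF smooth_matD(1)[OF M(1) z] M(2)[rule_format, OF z] M(3)[rule_format, OF z]] dbar_ctranspose[OF M(1,3) z] ..

lemma conn_mult:
  assumes M: "smooth_mat n U M" "\<forall>z\<in>U. Determinant.det (M z) \<noteq> 0" and z: "z \<in> U"
  shows "conn n M z * M z = dmat d_z n M z"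
  unfolding conn_def assoc_mult_mat[OF dmat_carrier minv_carrier[OF smooth_matD(1)[OF M(1) z]] smooth_matD(1)[OF M(1) z]]
    minv_mult(2)[OF smooth_matD(1)[OF M(1) z] M(2)[rule_format, OF z]] by (rule right_mult_one_mat[OF dmat_carrier])

text \<open>If two metrics have the same \<open>theta\<close>, the
  difference \<open>X\<close> of their connection forms is holomorphic, and the endomorphism \<open>B A\<^sup>-\<^sup>1\<close> relating
  them has \<open>dzbar\<close> derivative \<open>B X\<^sup>* A\<^sup>-\<^sup>1\<close>.\<close>

context
  fixes n A B
  assumes A: "smooth_mat n U A" "\<forall>z\<in>U. Determinant.det (A z) \<noteq> 0" "\<forall>z\<in>U. ctranspose (A z) = A z"
    and B: "smooth_mat n U B" "\<forall>z\<in>U. Determinant.det (B z) \<noteq> 0" "\<forall>z\<in>U. ctranspose (B z) = B z"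
begin

lemma smooth_quot_mat: "smooth_mat n U (quot_mat A B)"
  unfolding quot_mat_def[abs_def] by (intro smooth_mat_mult smooth_mat_minv A B)

lemma smooth_conn_diff: "smooth_mat n U (conn_diff n A B)"
  unfolding conn_diff_def[abs_def] by (intro smooth_mat_diff smooth_mat_conn A B)

lemma dmat_quot_mat:
  assumes z: "z \<in> U" and D: "wirtinger D"
  shows "dmat D n (quot_mat A B) z = dmat D n B z * minv (A z) - B z * (minv (A z) * (dmat D n A z * minv (A z)))"
proof -
  note a = smooth_matD(1)[OF A(1) z] and b = smooth_matD(1)[OF B(1) z]
  note ai = minv_carrier[OF a]
  have "dmat D n (quot_mat A B) z = dmat D n B z * minv (A z) + B z * (- (minv (A z) * dmat D n A z * minv (A z)))"
    unfolding quot_mat_def[abs_def] dmat_mult[OF B(1) smooth_mat_minv[OF A(1,2)] z D] dmat_minv[OF A(1,2) z D] ..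
  also have "\<dots> = dmat D n B z * minv (A z) + - (B z * (minv (A z) * dmat D n A z * minv (A z)))"
    by (subst uminus_mult_right_mat)
      (simp_all only: carrier_matD[OF b] carrier_matD[OF mult_carrier_mat[OF mult_carrier_mat[OF ai dmat_carrier] ai]])
  also have "\<dots> = dmat D n B z * minv (A z) - B z * (minv (A z) * dmat D n A z * minv (A z))"
    by (rule add_uminus_minus_mat[OF mult_carrier_mat[OF dmat_carrier ai]
          mult_carrier_mat[OF b mult_carrier_mat[OF mult_carrier_mat[OF ai dmat_carrier] ai]]])
  also have "minv (A z) * dmat D n A z * minv (A z) = minv (A z) * (dmat D n A z * minv (A z))"
    by (rule assoc_mult_mat[OF ai dmat_carrier ai])
  finally show ?thesis .
qed

lemma dzbar_quot_mat:
  assumes z: "z \<in> U"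
  shows "dmat d_zbar n (quot_mat A B) z = B z * ctranspose ((conn_diff n A B) z) * minv (A z)"
proof -
  note a = smooth_matD(1)[OF A(1) z] and b = smooth_matD(1)[OF B(1) z]
  note ai = minv_carrier[OF a] and bi = minv_carrier[OF b]
  let ?dA = "dmat d_zbar n A z" and ?dB = "dmat d_zbar n B z"
  have d: "?dA \<in> carrier_mat n n" "?dB \<in> carrier_mat n n" by simp_all
  note cc = smooth_matD(1)[OF smooth_mat_conn[OF A(1,2)] z] smooth_matD(1)[OF smooth_mat_conn[OF B(1,2)] z]
  have "ctranspose ((conn_diff n A B) z) = ctranspose (conn n B z) - ctranspose (conn n A z)"
    using cc unfolding conn_diff_def by (intro eq_matI) (auto simp: ctranspose_def)
  also have "\<dots> = minv (B z) * ?dB - minv (A z) * ?dA"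
    unfolding ctranspose_conn[OF A z] ctranspose_conn[OF B z] ..
  finally have "B z * ctranspose ((conn_diff n A B) z) = B z * (minv (B z) * ?dB) - B z * (minv (A z) * ?dA)"
    using mult_minus_distrib_mat[OF b mult_carrier_mat[OF bi d(2)] mult_carrier_mat[OF ai d(1)]] by simp
  also have "B z * (minv (B z) * ?dB) = ?dB"
    using assoc_mult_mat[OF b bi d(2)] minv_mult(1)[OF b B(2)[rule_format, OF z]] left_mult_one_mat[OF d(2)] by simp
  finally have "B z * ctranspose ((conn_diff n A B) z) * minv (A z) = (?dB - B z * (minv (A z) * ?dA)) * minv (A z)" by simp
  also have "\<dots> = ?dB * minv (A z) - B z * (minv (A z) * ?dA) * minv (A z)"
    by (rule minus_mult_distrib_mat[OF d(2) mult_carrier_mat[OF b mult_carrier_mat[OF ai d(1)]] ai])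
  also have "B z * (minv (A z) * ?dA) * minv (A z) = B z * (minv (A z) * (?dA * minv (A z)))"
    unfolding assoc_mult_mat[OF b mult_carrier_mat[OF ai d(1)] ai] assoc_mult_mat[OF ai d(1) ai] ..
  finally show ?thesis unfolding dmat_quot_mat[OF z wirtinger(2)] by simp
qed

text \<open>The \<open>d_z\<close> derivative of the quotient \<open>q\<close> is
  \<open>conn B q - q conn A\<close>; under the trace the factors of the second term may be
  exchanged, and only the difference of the connection forms remains.\<close>

lemma dz_trace_quot_mat:
  assumes z: "z \<in> U"
  shows "d_z (\<lambda>w. mtrace ((quot_mat A B) w)) z = mtrace ((conn_diff n A B) z * (quot_mat A B) z)"
proof -
  note a = smooth_matD(1)[OF A(1) z] and b = smooth_matD(1)[OF B(1) z]
  note ai = minv_carrier[OF a]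
  note q = smooth_matD(1)[OF smooth_quot_mat z]
  note cc = smooth_matD(1)[OF smooth_mat_conn[OF A(1,2)] z] smooth_matD(1)[OF smooth_mat_conn[OF B(1,2)] z]
  have "dmat d_z n B z * minv (A z) = conn n B z * (quot_mat A B) z"
    unfolding conn_mult[OF B(1,2) z, symmetric] quot_mat_def by (rule assoc_mult_mat[OF cc(2) b ai])
  moreover have "B z * (minv (A z) * (dmat d_z n A z * minv (A z))) = (quot_mat A B) z * conn n A z"
    unfolding quot_mat_def conn_def by (rule assoc_mult_mat[OF b ai mult_carrier_mat[OF dmat_carrier ai], symmetric])
  ultimately have "dmat d_z n (quot_mat A B) z = conn n B z * (quot_mat A B) z - (quot_mat A B) z * conn n A z"
    unfolding dmat_quot_mat[OF z wirtinger(1)] by simp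
  then have "mtrace (dmat d_z n (quot_mat A B) z) = mtrace (conn n B z * (quot_mat A B) z) - mtrace (conn n A z * (quot_mat A B) z)"
    using mtrace_diff[OF mult_carrier_mat[OF cc(2) q] mult_carrier_mat[OF q cc(1)]] mtrace_mult_commute[OF q cc(1)] by simp
  also have "\<dots> = mtrace ((conn_diff n A B) z * (quot_mat A B) z)"
    unfolding conn_diff_def minus_mult_distrib_mat[OF cc(2,1) q]
    by (rule mtrace_diff[OF mult_carrier_mat[OF cc(2) q] mult_carrier_mat[OF cc(1) q], symmetric])
  finally show ?thesis unfolding d_mtrace[OF smooth_quot_mat z wirtinger(1)] .
qed

text \<open>Equal curvatures make \<open>conn_diff\<close> holomorphic, so in the trace of its
  product with the quotient the second derivative falls on the quotient alone.\<close>

lemma laplacian_trace_quot_mat: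
  assumes th: "\<And>z. z \<in> U \<Longrightarrow> theta n A z = theta n B z" and z: "z \<in> U"
  shows "d_zbar (d_z (\<lambda>w. mtrace ((quot_mat A B) w))) z =
    mtrace ((conn_diff n A B) z * (B z * ctranspose ((conn_diff n A B) z) * minv (A z)))"
proof -
  note X = smooth_matD(1)[OF smooth_conn_diff z] and q = smooth_matD(1)[OF smooth_quot_mat z]
  have "dmat d_zbar n (conn_diff n A B) z = theta n B z - theta n A z"
    unfolding theta_def conn_diff_def[abs_def]
    by (rule dmat_diff[OF smooth_mat_conn[OF B(1,2)] smooth_mat_conn[OF A(1,2)] z wirtinger(2)])
  then have 0: "dmat d_zbar n (conn_diff n A B) z = 0\<^sub>m n n"
    using th[OF z] by (simp add: theta_def)
  have "d_zbar (d_z (\<lambda>w. mtrace ((quot_mat A B) w))) z = d_zbar (\<lambda>w. mtrace ((conn_diff n A B) w * (quot_mat A B) w)) z"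
    by (rule D_cong[OF wirtinger(2) U z]) (rule dz_trace_quot_mat)
  also have "\<dots> = mtrace (dmat d_zbar n (\<lambda>w. (conn_diff n A B) w * (quot_mat A B) w) z)"
    by (rule d_mtrace[OF smooth_mat_mult[OF smooth_conn_diff smooth_quot_mat] z wirtinger(2)])
  also have "dmat d_zbar n (\<lambda>w. (conn_diff n A B) w * (quot_mat A B) w) z = 0\<^sub>m n n * (quot_mat A B) z + (conn_diff n A B) z * dmat d_zbar n (quot_mat A B) z"
    unfolding dmat_mult[OF smooth_conn_diff smooth_quot_mat z wirtinger(2)] 0 ..
  also have "\<dots> = (conn_diff n A B) z * dmat d_zbar n (quot_mat A B) z"
    using left_mult_zero_mat[OF q] left_add_zero_mat[OF mult_carrier_mat[OF X dmat_carrier]] by simp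
  finally show ?thesis unfolding dzbar_quot_mat[OF z] .
qed

end

end

context cvs begin

text \<open>For an \<open>H1\<close>-orthonormal basis with transition matrix \<open>P\<close>, the
  inverse Gram matrix of \<open>H1\<close> is the conjugate transpose of \<open>P\<close> times
  \<open>P\<close>. With \<open>Y = P X\<close> the cyclic property turns \<open>T\<close> into the
  sum of \<open>H2 y y\<close> over the vectors \<open>y\<close> whose coordinates are the rows of
  \<open>Y\<close>. If this vanishes, so does \<open>Y\<close>, and with it \<open>X\<close>, since
  \<open>P\<close> is invertible.\<close>

lemma mtrace_positive:
  assumes b: "basis_list V b" and H1: "herm_on V H1" and H2: "herm_on V H2" and X: "X \<in> carrier_mat (length b) (length b)"
  defines "T \<equiv> mtrace (X * (gram H2 b * ctranspose X * minv (gram H1 b)))"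
  shows "Re T \<ge> 0" "Re T = 0 \<Longrightarrow> X = 0\<^sub>m (length b) (length b)"
proof -
  let ?n = "length b" let ?A = "gram H1 b" and ?B = "gram H2 b"
  note sub = basis_list_subspace[OF b]
  obtain o' where l: "length o' = ?n" and o': "onb V H1 o'" using onb_ex[OF sub H1 b] by blast
  define P where "P = trans_mat b o'"
  have P: "P \<in> carrier_mat ?n ?n" using l by (simp add: P_def trans_mat_def)
  note Pt = ctranspose_carrier[OF P] and Xt = ctranspose_carrier[OF X]
  have "set o' \<subseteq> V" using o' by (simp add: onb_def[OF sub H1] onl_def[OF sub H1])
  from gram_change[OF H1 b this l] have "P * ?A * ctranspose P = 1\<^sub>m ?n"
    unfolding P_def gram_onb[OF o' sub H1] l by simp
  then have PAP: "P * (?A * ctranspose P) = 1\<^sub>m ?n" using assoc_mult_mat[OF P gram_carrier Pt] by simp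
  then have APP: "?A * ctranspose P * P = 1\<^sub>m ?n"
    by (rule mat_mult_left_right_inverse[OF P mult_carrier_mat[OF gram_carrier Pt]])
  obtain d where "d > 0" "Determinant.det ?A = of_real d" using det_gram_pos[OF H1 b] by blast
  then have det: "Determinant.det ?A \<noteq> 0" by simp
  note Ai = minv_carrier[OF gram_carrier[of H1 b]]
  have "minv ?A = minv ?A * (?A * ctranspose P * P)" unfolding APP using right_mult_one_mat[OF Ai] by simp
  also have "\<dots> = minv ?A * ?A * (ctranspose P * P)"
    unfolding assoc_mult_mat[OF gram_carrier Pt P] assoc_mult_mat[OF Ai gram_carrier mult_carrier_mat[OF Pt P]] ..
  also have "\<dots> = ctranspose P * P"
    unfolding minv_mult(2)[OF gram_carrier det] by (rule left_mult_one_mat[OF mult_carrier_mat[OF Pt P]])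
  finally have Ai_eq: "minv ?A = ctranspose P * P" .
  define Y where "Y = P * X"
  have Y: "Y \<in> carrier_mat ?n ?n" unfolding Y_def by (rule mult_carrier_mat[OF P X])
  note BX = mult_carrier_mat[OF gram_carrier[of H2 b] Xt]
  have "T = mtrace (X * (?B * ctranspose X * ctranspose P * P))"
    unfolding T_def Ai_eq assoc_mult_mat[OF BX Pt P] ..
  also have "\<dots> = mtrace (X * (?B * ctranspose X * ctranspose P) * P)"
    unfolding assoc_mult_mat[OF X mult_carrier_mat[OF BX Pt] P] ..
  also have "\<dots> = mtrace (P * (X * (?B * ctranspose X * ctranspose P)))"
    by (rule mtrace_mult_commute[OF mult_carrier_mat[OF X mult_carrier_mat[OF BX Pt]] P])
  also have "P * (X * (?B * ctranspose X * ctranspose P)) = Y * (?B * (ctranspose X * ctranspose P))"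
    unfolding Y_def assoc_mult_mat[OF gram_carrier Xt Pt]
    by (rule assoc_mult_mat[OF P X mult_carrier_mat[OF gram_carrier mult_carrier_mat[OF Xt Pt]], symmetric])
  also have "ctranspose X * ctranspose P = ctranspose Y"
    unfolding Y_def by (rule ctranspose_mult[OF P X, symmetric])
  finally have T: "T = mtrace (Y * (?B * ctranspose Y))" .
  let ?y = "\<lambda>k. comb (\<lambda>i. Y $$ (k, i)) b"
  note bs = basis_list_set[OF b] and bn = basis_list_nth[OF b]
  have y: "?y k \<in> V" for k by (rule comb_in[OF sub bs])
  have "T = (\<Sum>k<?n. H2 (?y k) (?y k))"
    unfolding T mtrace_def index_mult_mat(2) carrier_matD(1)[OF Y]
  proof (rule sum.cong)
    fix k assume "k \<in> {..<?n}"
    then have k: "k < ?n" by simp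
    have "(Y * (?B * ctranspose Y)) $$ (k, k) = (\<Sum>i<?n. Y $$ (k, i) * (?B * ctranspose Y) $$ (i, k))"
      by (rule mat_mult_index[OF Y mult_carrier_mat[OF gram_carrier ctranspose_carrier[OF Y]] k k])
    also have "\<dots> = (\<Sum>i<?n. Y $$ (k, i) * H2 (b ! i) (?y k))"
    proof (rule sum.cong)
      fix i assume "i \<in> {..<?n}"
      then have i: "i < ?n" by simp
      have "(?B * ctranspose Y) $$ (i, k) = (\<Sum>j<?n. ?B $$ (i, j) * ctranspose Y $$ (j, k))"
        by (rule mat_mult_index[OF gram_carrier ctranspose_carrier[OF Y] i k])
      also have "\<dots> = (\<Sum>j<?n. cnj (Y $$ (k, j)) * H2 (b ! i) (b ! j))"
        using i k ctranspose_index[OF Y _ k] by (intro sum.cong) (auto simp: gram_def)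
      also have "\<dots> = H2 (b ! i) (?y k)" by (rule herm_comb(2)[OF sub H2 bs bn[OF i], symmetric])
      finally show "Y $$ (k, i) * (?B * ctranspose Y) $$ (i, k) = Y $$ (k, i) * H2 (b ! i) (?y k)" by simp
    qed simp
    also have "\<dots> = H2 (?y k) (?y k)" by (rule herm_comb(1)[OF sub H2 bs y, symmetric])
    finally show "(Y * (?B * ctranspose Y)) $$ (k, k) = H2 (?y k) (?y k)" .
  qed simp
  then have Re_T: "Re T = (\<Sum>k<?n. Re (H2 (?y k) (?y k)))" by simp
  then show "Re T \<ge> 0" using herm_self(2)[OF sub H2 y] by (simp add: sum_nonneg)
  assume "Re T = 0"
  then have "\<forall>k\<in>{..<?n}. Re (H2 (?y k) (?y k)) = 0"
    unfolding Re_T using herm_self(2)[OF sub H2 y] by (subst (asm) sum_nonneg_eq_0_iff) auto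
  then have "?y k = 0" if "k < ?n" for k using herm_pos[OF sub H2 y[of k]] that by fastforce
  then have Y0: "Y $$ (k, i) = 0" if "k < ?n" "i < ?n" for k i
    using cf_comb[OF b that(2), of "\<lambda>i. Y $$ (k, i)"] that by simp
  have "Y = 0\<^sub>m ?n ?n" using Y Y0 by (intro eq_matI) auto
  then have "?A * ctranspose P * Y = 0\<^sub>m ?n ?n" using right_mult_zero_mat[OF mult_carrier_mat[OF gram_carrier Pt]] by simp
  moreover have "?A * ctranspose P * Y = X"
    unfolding Y_def assoc_mult_mat[OF mult_carrier_mat[OF gram_carrier Pt] P X, symmetric] APP
    by (rule left_mult_one_mat[OF X])
  ultimately show "X = 0\<^sub>m (length b) (length b)" by simp
qed

end

lemma holomorphic_imp_smooth_mat:
  assumes "open U" "\<forall>z\<in>U. M z \<in> carrier_mat n n" "\<forall>i<n. \<forall>j<n. (\<lambda>z. M z $$ (i, j)) holomorphic_on U"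
  shows "smooth_mat n U M"
  using assms holomorphic_imp_smooth_on unfolding smooth_mat_def by simp

text \<open>The formula of \<open>dmat_minv\<close> contains the \<open>d_zbar\<close> derivative of
  \<open>M\<close> as a factor, and that is 0.\<close>

lemma holomorphic_minv:
  assumes U: "open U" and M: "\<forall>z\<in>U. M z \<in> carrier_mat n n"
    and hol: "\<forall>i<n. \<forall>j<n. (\<lambda>z. M z $$ (i, j)) holomorphic_on U"
    and det: "\<forall>z\<in>U. Determinant.det (M z) \<noteq> 0" and ij: "i < n" "j < n"
  shows "(\<lambda>z. minv (M z) $$ (i, j)) holomorphic_on U"
proof -
  note sm = holomorphic_imp_smooth_mat[OF U M hol]
  note si = smooth_mat_minv[OF U sm det]
  show ?thesis
  proof (rule d_zbar_eq_0_imp_holomorphic[OF U])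
    show "(\<lambda>z. minv (M z) $$ (i, j)) differentiable at z" if "z \<in> U" for z
      by (rule smooth_matD(3)[OF si ij that])
    fix z assume z: "z \<in> U"
    note c = minv_carrier[OF smooth_matD(1)[OF sm z]]
    have "dmat d_zbar n M z = 0\<^sub>m n n"
      using hol holomorphic_d_zbar[OF U _ z] by (intro eq_matI) (auto simp: dmat_def)
    then have "dmat d_zbar n (\<lambda>w. minv (M w)) z = - (minv (M z) * 0\<^sub>m n n * minv (M z))"
      using dmat_minv[OF U sm det z wirtinger(2)] by simp
    also have "minv (M z) * 0\<^sub>m n n * minv (M z) = 0\<^sub>m n n"
      unfolding right_mult_zero_mat[OF c] by (rule left_mult_zero_mat[OF c])
    finally have "dmat d_zbar n (\<lambda>w. minv (M w)) z $$ (i, j) = 0" using ij by simp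
    then show "d_zbar (\<lambda>z. minv (M z) $$ (i, j)) z = 0" using ij by (simp add: dmat_index)
  qed
qed

lemma holomorphic_det:
  assumes M: "\<forall>z\<in>U. M z \<in> carrier_mat n n"
    and hol: "\<forall>i<n. \<forall>j<n. (\<lambda>z. M z $$ (i, j)) holomorphic_on U"
  shows "(\<lambda>z. Determinant.det (M z)) holomorphic_on U"
proof -
  have "(\<lambda>z. \<Sum>p\<in>{p. p permutes {0..<n}}. signof p * (\<Prod>i = 0..<n. M z $$ (i, p i))) holomorphic_on U"
    by (intro holomorphic_on_sum holomorphic_on_mult holomorphic_on_const holomorphic_on_prod hol[rule_format])
      (auto dest: permutes_in_image)
  then show ?thesis
    by (rule holomorphic_transform) (rule det_def'[symmetric, OF bspec[OF M]])
qed

section \<open>Holomorphic bundles in local frames\<close>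

definition ev :: "(complex \<Rightarrow> 'v) list \<Rightarrow> complex \<Rightarrow> 'v list" where
  "ev e z = map (\<lambda>s. s z) e"

lemma ev_simps [simp]: "length (ev e z) = length e" "i < length e \<Longrightarrow> ev e z ! i = (e ! i) z"
  "set (ev e z) = (\<lambda>s. s z) ` set e"
  by (auto simp: ev_def)

locale hvb =
  fixes E :: "('v::ab_group_add) hol_bundle"
  assumes hol_vb: "hol_vector_bundle E"
begin

sublocale cvs "scl E"
proof -
  have "vector_space (scl E)" using hol_vb by (simp add: hol_vector_bundle_def)
  then show "cvs (scl E)" by (simp add: cvs_def)
qed

lemma fibre_basis_iff: "fibre_basis E e z \<longleftrightarrow> basis_list (fibre E z) (ev e z)"
  by (simp add: fibre_basis_def basis_list_def ev_def)

lemma coord_eq: "i < length e \<Longrightarrow> coord E e i z v = cf (ev e z) i v"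
  by (simp add: coord_def cf_def)

lemma subspace_fibre: "subspace (fibre E z)"
  using hol_vb by (simp add: hol_vector_bundle_def)

lemma framesD:
  assumes "(U, e) \<in> frames E"
  shows "open U" "z \<in> U \<Longrightarrow> basis_list (fibre E z) (ev e z)"
  using assms hol_vb unfolding hol_vector_bundle_def fibre_basis_iff by blast+

lemma frame_ex: "\<exists>U e. (U, e) \<in> frames E \<and> z \<in> U"
  using hol_vb unfolding hol_vector_bundle_def bundle_base_def by (auto 4 4 simp: set_eq_iff)

lemma frame_at_frame: "\<exists>U. (U, frame_at E z) \<in> frames E \<and> z \<in> U"
  unfolding frame_at_def by (rule someI_ex) (use frame_ex in blast)

definition "rk = bundle_rank E"

lemma dim_fibre: "dim (fibre E z) = rk"
proof -
  obtain r where r: "\<forall>z. dim (fibre E z) = r" using hol_vb by (auto simp: hol_vector_bundle_def)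
  have "bundle_base E = UNIV" using hol_vb by (simp add: hol_vector_bundle_def)
  then have "bundle_rank E = r" unfolding bundle_rank_def using r by (auto intro!: the_equality)
  then show ?thesis using r by (simp add: rk_def)
qed

lemma length_frame: "basis_list (fibre E z) b \<Longrightarrow> length b = rk"
  using dim_basis_list dim_fibre by metis

text \<open>Admits frames outside the given atlas, such as those adapted to a splitting.\<close>

definition hol_frame :: "complex set \<Rightarrow> (complex \<Rightarrow> 'v) list \<Rightarrow> bool" where
  "hol_frame U e \<longleftrightarrow> open U \<and> length e = rk \<and> (\<forall>s\<in>set e. hol_section E U s) \<and>
     (\<forall>z\<in>U. basis_list (fibre E z) (ev e z))"

lemma hol_frameD:
  assumes "hol_frame U e"
  shows "open U" "length e = rk" "i < rk \<Longrightarrow> hol_section E U (e ! i)" "z \<in> U \<Longrightarrow> basis_list (fibre E z) (ev e z)"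
  using assms by (auto simp: hol_frame_def)

lemma hol_sectionD:
  assumes "hol_section E W s"
  shows "open W" "z \<in> W \<Longrightarrow> s z \<in> fibre E z"
    "(U, e) \<in> frames E \<Longrightarrow> i < length e \<Longrightarrow> (\<lambda>z. cf (ev e z) i (s z)) holomorphic_on (U \<inter> W)"
  using assms coord_eq unfolding hol_section_def by fastforce+

lemma frames_hol_frame:
  assumes U: "(U, e) \<in> frames E" "z \<in> U"
  shows "hol_frame U e"
proof -
  have "hol_section E U s" if s: "s \<in> set e" for s
    unfolding hol_section_def
  proof (intro conjI ballI)
    obtain j where j: "j < length e" "s = e ! j" using s by (metis in_set_conv_nth)
    show "open U" by (rule framesD(1)[OF U(1)])
    show "s w \<in> fibre E w" if "w \<in> U" for w
      using basis_list_nth[OF framesD(2)[OF U(1) that]] j by fastforce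
    fix x assume x: "x \<in> frames E"
    have "(\<lambda>z. coord E f i z ((e ! j) z)) holomorphic_on V \<inter> U" if "(V, f) \<in> frames E" "i < length f" for V f i
      using hol_vb that U(1) j(1) unfolding hol_vector_bundle_def by fast
    then show "case x of (V, f) \<Rightarrow> \<forall>i<length f. (\<lambda>z. coord E f i z (s z)) holomorphic_on V \<inter> U"
      using x j(2) by (cases x) simp
  qed
  moreover have "length e = rk" using length_frame[OF framesD(2)[OF U]] by simp
  ultimately show ?thesis using framesD[OF U(1)] by (simp add: hol_frame_def)
qed

lemma local_frame: obtains U e where "(U, e) \<in> frames E" "z \<in> U" "hol_frame U e"
  using frame_ex[of z] frames_hol_frame by blast

lemma hol_section_local:
  assumes W: "open W" and loc: "\<And>z. z \<in> W \<Longrightarrow> \<exists>V. z \<in> V \<and> V \<subseteq> W \<and> hol_section E V s"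
  shows "hol_section E W s"
  unfolding hol_section_def
proof (intro conjI ballI)
  show "open W" by (rule W)
  show "s z \<in> fibre E z" if "z \<in> W" for z using loc[OF that] hol_sectionD(2) by blast
  fix x assume x: "x \<in> frames E"
  obtain U e where Ue: "x = (U, e)" by (cases x)
  have "(\<lambda>z. coord E e i z (s z)) holomorphic_on U \<inter> W" if i: "i < length e" for i
  proof (rule holomorphic_onI)
    fix z assume z: "z \<in> U \<inter> W"
    then obtain V where V: "z \<in> V" "V \<subseteq> W" "hol_section E V s" using loc by blast
    have "(\<lambda>z. cf (ev e z) i (s z)) holomorphic_on U \<inter> V" using hol_sectionD(3)[OF V(3)] x Ue i by blast
    moreover have "open (U \<inter> V)" using framesD(1) x Ue hol_sectionD(1)[OF V(3)] by blast
    ultimately have "(\<lambda>z. cf (ev e z) i (s z)) field_differentiable at z"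
      using z V(1) holomorphic_on_imp_differentiable_at by blast
    then show "(\<lambda>z. coord E e i z (s z)) field_differentiable at z within U \<inter> W"
      unfolding coord_eq[OF i] by (rule field_differentiable_at_within)
  qed
  then show "case x of (U, e) \<Rightarrow> \<forall>i<length e. (\<lambda>z. coord E e i z (s z)) holomorphic_on U \<inter> W"
    by (simp add: Ue)
qed

definition trm :: "(complex \<Rightarrow> 'v) list \<Rightarrow> (complex \<Rightarrow> 'v) list \<Rightarrow> complex \<Rightarrow> complex mat" where
  "trm f e z = trans_mat (ev f z) (ev e z)"

lemma trm_index: "i < length e \<Longrightarrow> j < length f \<Longrightarrow> trm f e z $$ (i, j) = cf (ev f z) j ((e ! i) z)"
  by (simp add: trm_def trans_mat_def)

lemma trm_carrier: "length e = n \<Longrightarrow> length f = n \<Longrightarrow> trm f e z \<in> carrier_mat n n"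
  by (simp add: trm_def trans_mat_def)

lemma det_trm:
  assumes "basis_list (fibre E z) (ev f z)" "basis_list (fibre E z) (ev e z)"
  shows "Determinant.det (trm f e z) \<noteq> 0"
proof -
  have l: "length e = rk" "length f = rk" using length_frame[OF assms(1)] length_frame[OF assms(2)] by simp_all
  note c = trm_carrier[OF l] trm_carrier[OF l(2,1)]
  have "trm f e z * trm e f z = 1\<^sub>m rk"
  proof (rule eq_matI)
    fix i k assume "i < dim_row (1\<^sub>m rk)" "k < dim_col (1\<^sub>m rk)"
    then have ik: "i < rk" "k < rk" by auto
    have "(trm f e z * trm e f z) $$ (i, k) = (\<Sum>j<rk. cf (ev f z) j ((e ! i) z) * cf (ev e z) k ((f ! j) z))"
      unfolding mat_mult_index[OF c ik] using ik l by (intro sum.cong) (auto simp: trm_index)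
    also have "\<dots> = cf (ev e z) k (\<Sum>j<rk. scl E (cf (ev f z) j ((e ! i) z)) ((f ! j) z))"
      using basis_list_nth[OF assms(1)] l subspace_scale[OF subspace_fibre]
      by (subst cf_sum[OF assms(2)]) (auto simp: cf_scale[OF assms(2)])
    also have "(\<Sum>j<rk. scl E (cf (ev f z) j ((e ! i) z)) ((f ! j) z)) = (e ! i) z"
      using comb_cf[OF assms(1) basis_list_nth[OF assms(2), of i]] ik l by (simp add: comb_def)
    also have "cf (ev e z) k ((e ! i) z) = (if k = i then 1 else 0)"
      using cf_nth[OF assms(2), of k i] ik l by simp
    finally show "(trm f e z * trm e f z) $$ (i, k) = 1\<^sub>m rk $$ (i, k)" using ik by auto
  qed (use c in auto)
  moreover have "Determinant.det (trm f e z * trm e f z) = Determinant.det (trm f e z) * Determinant.det (trm e f z)"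
    by (rule det_mult[OF c])
  ultimately have "Determinant.det (trm f e z) * Determinant.det (trm e f z) = 1" by simp
  then show ?thesis by auto
qed

text \<open>The definition of a holomorphic section tests coordinates in frames of the atlas only.
  Coordinates in another holomorphic frame arise from these by the inverse of the transition matrix,
  whose entries are again holomorphic.\<close>

lemma hol_section_coord:
  assumes e: "hol_frame U e" and s: "hol_section E W s" and i: "i < rk"
  shows "(\<lambda>z. cf (ev e z) i (s z)) holomorphic_on (U \<inter> W)"
proof (rule holomorphic_onI)
  fix z0 assume z0: "z0 \<in> U \<inter> W"
  obtain V f where f: "(V, f) \<in> frames E" "z0 \<in> V" "hol_frame V f" by (rule local_frame)
  define N where "N = V \<inter> (U \<inter> W)"
  have N: "open N" "z0 \<in> N" using z0 f hol_frameD(1)[OF e] hol_frameD(1)[OF f(3)] hol_sectionD(1)[OF s] by (auto simp: N_def)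
  note le = hol_frameD(2)[OF e] and lf = hol_frameD(2)[OF f(3)]
  note be = hol_frameD(4)[OF e] and bf = hol_frameD(4)[OF f(3)]
  have M: "\<forall>z\<in>N. trm f e z \<in> carrier_mat rk rk" using le lf trm_carrier by blast
  have hol: "\<forall>i<rk. \<forall>j<rk. (\<lambda>z. trm f e z $$ (i, j)) holomorphic_on N"
  proof (intro allI impI)
    fix i j assume ij: "i < rk" "j < rk"
    have "(\<lambda>z. cf (ev f z) j ((e ! i) z)) holomorphic_on V \<inter> U"
      using hol_sectionD(3)[OF hol_frameD(3)[OF e ij(1)] f(1)] ij lf by simp
    then have "(\<lambda>z. cf (ev f z) j ((e ! i) z)) holomorphic_on N" by (rule holomorphic_on_subset) (auto simp: N_def)
    then show "(\<lambda>z. trm f e z $$ (i, j)) holomorphic_on N" using ij le lf by (simp add: trm_index)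
  qed
  have det: "\<forall>z\<in>N. Determinant.det (trm f e z) \<noteq> 0" using det_trm be bf by (simp add: N_def)
  have "(\<lambda>z. \<Sum>j<rk. cf (ev f z) j (s z) * minv (trm f e z) $$ (j, i)) holomorphic_on N"
  proof (intro holomorphic_intros)
    fix j assume "j \<in> {..<rk}"
    then have j: "j < rk" by simp
    show "(\<lambda>z. minv (trm f e z) $$ (j, i)) holomorphic_on N" by (rule holomorphic_minv[OF N(1) M hol det j i])
    have "(\<lambda>z. cf (ev f z) j (s z)) holomorphic_on V \<inter> W" using hol_sectionD(3)[OF s f(1)] j lf by simp
    then show "(\<lambda>z. cf (ev f z) j (s z)) holomorphic_on N" by (rule holomorphic_on_subset) (auto simp: N_def)
  qed
  moreover have "(\<Sum>j<rk. cf (ev f z) j (s z) * minv (trm f e z) $$ (j, i)) = cf (ev e z) i (s z)" if z: "z \<in> N" for z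
  proof -
    have zz: "z \<in> U" "z \<in> V" "z \<in> W" using z by (auto simp: N_def)
    let ?c = "\<lambda>k. cf (ev e z) k (s z)"
    note sz = hol_sectionD(2)[OF s zz(3)]
    have T: "trm f e z \<in> carrier_mat rk rk" using M z by blast
    have "cf (ev f z) j (s z) = (\<Sum>k<rk. ?c k * trm f e z $$ (k, j))" if j: "j < rk" for j
    proof -
      have "cf (ev f z) j (s z) = cf (ev f z) j (comb ?c (ev e z))" using comb_cf[OF be[OF zz(1)] sz] by simp
      also have "\<dots> = (\<Sum>k<rk. ?c k * cf (ev f z) j ((e ! k) z))"
        unfolding comb_def using basis_list_nth[OF be[OF zz(1)]] le subspace_scale[OF subspace_fibre]
        by (subst cf_sum[OF bf[OF zz(2)]]) (auto simp: cf_scale[OF bf[OF zz(2)]])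
      finally show ?thesis using j le lf by (simp add: trm_index)
    qed
    then have "(\<Sum>j<rk. cf (ev f z) j (s z) * minv (trm f e z) $$ (j, i)) =
        (\<Sum>j<rk. \<Sum>k<rk. ?c k * (trm f e z $$ (k, j) * minv (trm f e z) $$ (j, i)))"
      by (intro sum.cong) (auto simp: sum_distrib_right mult.assoc)
    also have "\<dots> = (\<Sum>k<rk. ?c k * (trm f e z * minv (trm f e z)) $$ (k, i))"
      using mat_mult_index[OF T minv_carrier[OF T] _ i]
      by (subst sum.swap) (simp add: sum_distrib_left)
    also have "\<dots> = (\<Sum>k<rk. if k = i then ?c k else 0)"
      unfolding minv_mult(1)[OF T bspec[OF det z]] using i by (intro sum.cong) auto
    also have "\<dots> = ?c i" using i by simp
    finally show ?thesis .
  qed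
  ultimately have "(\<lambda>z. cf (ev e z) i (s z)) holomorphic_on N" by (rule holomorphic_transform)
  then show "(\<lambda>z. cf (ev e z) i (s z)) field_differentiable at z0 within U \<inter> W"
    using N holomorphic_on_imp_differentiable_at field_differentiable_at_within by blast
qed

end

context hvb begin

lemma comb_eq: "comb c (ev e z) = (\<Sum>i<length e. scl E (c i) ((e ! i) z))"
  by (simp add: comb_def)

lemma cf_change:
  assumes e: "basis_list (fibre E z) (ev e z)" and f: "basis_list (fibre E z) (ev f z)" and v: "v \<in> fibre E z"
  shows "cf (ev f z) j v = (\<Sum>i<rk. cf (ev e z) i v * cf (ev f z) j ((e ! i) z))"
proof -
  have l: "length e = rk" using length_frame[OF e] by simp
  have "cf (ev f z) j v = cf (ev f z) j (comb (\<lambda>i. cf (ev e z) i v) (ev e z))" using comb_cf[OF e v] by simp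
  also have "\<dots> = (\<Sum>i<rk. cf (ev e z) i v * cf (ev f z) j ((e ! i) z))"
    unfolding comb_def using basis_list_nth[OF e] l subspace_scale[OF subspace_fibre]
    by (subst cf_sum[OF f]) (auto simp: cf_scale[OF f])
  finally show ?thesis .
qed

lemma hol_frame_nth: "hol_frame U e \<Longrightarrow> z \<in> U \<Longrightarrow> i < rk \<Longrightarrow> (e ! i) z \<in> fibre E z"
  using hol_sectionD(2)[OF hol_frameD(3)] by blast

lemma hol_frame_trans:
  assumes "hol_frame U e" "hol_frame V f" "i < rk" "j < rk"
  shows "(\<lambda>z. cf (ev f z) j ((e ! i) z)) holomorphic_on (V \<inter> U)"
  by (rule hol_section_coord[OF assms(2) hol_frameD(3)[OF assms(1,3)] assms(4)])

text \<open>\<open>dbar\<close> is defined in an arbitrarily chosen frame. Transition functions are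
  holomorphic, so \<open>d_zbar\<close> passes over them and any holomorphic frame gives the same
  vector.\<close>

lemma dbar_frame:
  assumes e: "hol_frame U e" and z: "z \<in> U" and W: "open W" "z \<in> W" "\<forall>w\<in>W. s w \<in> fibre E w"
    and d: "\<forall>i<rk. (\<lambda>w. cf (ev e w) i (s w)) differentiable (at z)"
  shows "dbar E s z = comb (\<lambda>i. d_zbar (\<lambda>w. cf (ev e w) i (s w)) z) (ev e z)"
proof -
  define f where "f = frame_at E z"
  obtain V where V: "(V, f) \<in> frames E" "z \<in> V" using frame_at_frame f_def by blast
  have f: "hol_frame V f" by (rule frames_hol_frame[OF V])
  note lf = hol_frameD(2)[OF f] and le = hol_frameD(2)[OF e]
  let ?c = "\<lambda>i w. cf (ev e w) i (s w)"
  let ?g = "\<lambda>i j w. cf (ev f w) j ((e ! i) w)"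
  have N: "open (V \<inter> U \<inter> W)" "z \<in> V \<inter> U \<inter> W"
    using hol_frameD(1)[OF e] hol_frameD(1)[OF f] W z V by auto
  have VU: "open (V \<inter> U)" "z \<in> V \<inter> U" using hol_frameD(1)[OF e] hol_frameD(1)[OF f] z V by auto
  have gd: "(?g i j) differentiable (at z)" "d_zbar (?g i j) z = 0" if "i < rk" "j < rk" for i j
  proof -
    note h = hol_frame_trans[OF e f that]
    show "d_zbar (?g i j) z = 0" by (rule holomorphic_d_zbar[OF VU(1) h VU(2)])
    show "(?g i j) differentiable (at z)"
      by (rule smooth_on_imp_differentiable[OF holomorphic_imp_smooth_on[OF VU(1) h] VU(2)])
  qed
  have dj: "d_zbar (\<lambda>w. cf (ev f w) j (s w)) z = (\<Sum>i<rk. d_zbar (?c i) z * ?g i j z)" if j: "j < rk" for j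
  proof -
    have "d_zbar (\<lambda>w. cf (ev f w) j (s w)) z = d_zbar (\<lambda>w. \<Sum>i<rk. ?c i w * ?g i j w) z"
    proof (rule D_cong[OF wirtinger(2) N])
      fix w assume "w \<in> V \<inter> U \<inter> W"
      then show "cf (ev f w) j (s w) = (\<Sum>i<rk. ?c i w * ?g i j w)"
        using cf_change[OF hol_frameD(4)[OF e] hol_frameD(4)[OF f]] W(3) by simp
    qed
    also have "\<dots> = (\<Sum>i<rk. d_zbar (\<lambda>w. ?c i w * ?g i j w) z)"
      using d gd j by (intro D_sum[OF wirtinger(2)] differentiable_mult) auto
    also have "\<dots> = (\<Sum>i<rk. d_zbar (?c i) z * ?g i j z)"
    proof (rule sum.cong)
      fix i assume "i \<in> {..<rk}"
      then have i: "i < rk" by simp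
      show "d_zbar (\<lambda>w. ?c i w * ?g i j w) z = d_zbar (?c i) z * ?g i j z"
        unfolding D_mult[OF wirtinger(2) d[rule_format, OF i] gd(1)[OF i j]] gd(2)[OF i j] by simp
    qed simp
    finally show ?thesis .
  qed
  have be: "basis_list (fibre E z) (ev e z)" and bf: "basis_list (fibre E z) (ev f z)"
    using hol_frameD(4)[OF e z] hol_frameD(4)[OF f V(2)] by auto
  have "dbar E s z = (\<Sum>j<length f. scl E (d_zbar (\<lambda>w. cf (ev f w) j (s w)) z) ((f ! j) z))"
    unfolding dbar_def f_def[symmetric] Let_def by (simp add: coord_eq)
  also have "\<dots> = (\<Sum>j<rk. scl E (\<Sum>i<rk. d_zbar (?c i) z * ?g i j z) ((f ! j) z))"
    using dj lf by simp
  also have "\<dots> = (\<Sum>j<rk. \<Sum>i<rk. scl E (d_zbar (?c i) z) (scl E (?g i j z) ((f ! j) z)))"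
    by (simp add: scale_sum_left)
  also have "\<dots> = (\<Sum>i<rk. scl E (d_zbar (?c i) z) (comb (\<lambda>j. ?g i j z) (ev f z)))"
    unfolding comb_eq lf by (subst sum.swap) (simp add: scale_sum_right)
  also have "\<dots> = (\<Sum>i<rk. scl E (d_zbar (?c i) z) ((e ! i) z))"
    using comb_cf[OF bf hol_frame_nth[OF e z]] by (intro sum.cong) auto
  also have "\<dots> = comb (\<lambda>i. d_zbar (?c i) z) (ev e z)" unfolding comb_eq le ..
  finally show ?thesis .
qed

text \<open>Provides the test sections in the characterization of the Chern connection.\<close>

lemma comb_smooth_section:
  assumes e: "hol_frame U e" and c: "\<forall>i<rk. smooth_on U (\<lambda>w. c w i)"
  shows "smooth_section E U (\<lambda>w. comb (c w) (ev e w))"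
  unfolding smooth_section_def
proof (intro conjI ballI)
  show U: "open U" by (rule hol_frameD(1)[OF e])
  note le = hol_frameD(2)[OF e]
  show cin: "comb (c w) (ev e w) \<in> fibre E w" if "w \<in> U" for w
    by (rule comb_in[OF subspace_fibre basis_list_set[OF hol_frameD(4)[OF e that]]])
  fix x assume x: "x \<in> frames E"
  obtain V f where Vf: "x = (V, f)" by (cases x)
  have V: "open V" using framesD(1) x Vf by blast
  have "smooth_on (V \<inter> U) (\<lambda>z. coord E f j z (comb (c z) (ev e z)))" if j: "j < length f" for j
  \<comment> \<open>A frame of the atlas over the empty set may have any length, so its length is
    known to be \<open>rk\<close> only when \<open>V\<close> has a point.\<close>
  proof (cases "V = {}")
    case True then show ?thesis by (simp add: smooth_on_def) (metis C_k_on_local empty_iff)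
  next
    case False
    then obtain z0 where "z0 \<in> V" by blast
    then have f: "hol_frame V f" using frames_hol_frame x Vf by blast
    have jr: "j < rk" using j hol_frameD(2)[OF f] by simp
    have VU: "open (V \<inter> U)" using U V by auto
    have "smooth_on (V \<inter> U) (\<lambda>w. \<Sum>i<rk. c w i * cf (ev f w) j ((e ! i) w))"
    proof (intro smooth_on_sum smooth_on_mult VU)
      fix i assume "i \<in> {..<rk}"
      then have i: "i < rk" by simp
      show "smooth_on (V \<inter> U) (\<lambda>w. c w i)" by (rule smooth_on_subset[OF c[rule_format, OF i]]) auto
      show "smooth_on (V \<inter> U) (\<lambda>w. cf (ev f w) j ((e ! i) w))"
        by (rule holomorphic_imp_smooth_on[OF VU hol_frame_trans[OF e f i jr]])
    qed
    then show ?thesis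
    proof (rule smooth_on_transform[OF VU])
      fix w assume w: "w \<in> V \<inter> U"
      note be = hol_frameD(4)[OF e, of w] and bf = hol_frameD(4)[OF f, of w]
      have "cf (ev f w) j (comb (c w) (ev e w)) =
          (\<Sum>i<rk. cf (ev e w) i (comb (c w) (ev e w)) * cf (ev f w) j ((e ! i) w))"
        using w cin by (intro cf_change be bf) auto
      also have "\<dots> = (\<Sum>i<rk. c w i * cf (ev f w) j ((e ! i) w))"
        using w cf_comb[OF be] le by (intro sum.cong) auto
      finally show "coord E f j w (comb (c w) (ev e w)) = (\<Sum>i<rk. c w i * cf (ev f w) j ((e ! i) w))"
        by (simp add: coord_eq[OF j])
    qed
  qed
  then show "case x of (V, f) \<Rightarrow> \<forall>j<length f. smooth_on (V \<inter> U) (\<lambda>z. coord E f j z (comb (c z) (ev e z)))"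
    by (simp add: Vf)
qed

lemma smooth_section_coord:
  assumes "smooth_section E W t" "(U, e) \<in> frames E" "i < length e"
  shows "smooth_on (U \<inter> W) (\<lambda>z. cf (ev e z) i (t z))"
  using assms coord_eq[OF assms(3)] unfolding smooth_section_def by fastforce

definition GM :: "'v metric \<Rightarrow> (complex \<Rightarrow> 'v) list \<Rightarrow> complex \<Rightarrow> complex mat" where
  "GM H e z = gram (H z) (ev e z)"

lemma gram_det_eq: "gram_det H e z = Determinant.det (GM H e z)"
proof -
  have "Matrix.mat (length e) (length e) (\<lambda>(i, j). H z ((e ! i) z) ((e ! j) z)) = GM H e z"
    unfolding GM_def gram_def by (intro eq_matI) auto
  then show ?thesis by (simp add: gram_det_def)
qed

end

section \<open>Metrics, Chern connection and curvature in local frames\<close>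

locale hvb_metric = hvb E for E :: "('v::ab_group_add) hol_bundle" +
  fixes H :: "'v metric"
  assumes herm: "hermitian_metric E H"
begin

lemma herm_fibre: "herm_on (fibre E z) (H z)"
proof -
  note h = herm[unfolded hermitian_metric_def]
  show ?thesis
    unfolding herm_on_def
  proof (intro conjI ballI allI impI)
    show "H z (scl E a u + scl E b v) w = a * H z u w + b * H z v w"
      if "u \<in> fibre E z" "v \<in> fibre E z" "w \<in> fibre E z" for u v w a b
      by (rule h[THEN conjunct1, rule_format, OF that])
    show "H z v u = cnj (H z u v)" if "u \<in> fibre E z" "v \<in> fibre E z" for u v
      by (rule h[THEN conjunct2, THEN conjunct1, rule_format, OF that])
    show "Re (H z u u) > 0" if "u \<in> fibre E z" "u \<noteq> 0" for u
      by (rule h[THEN conjunct2, THEN conjunct2, THEN conjunct1, rule_format, OF that])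
  qed
qed

lemma smooth_GM:
  assumes U: "(U, e) \<in> frames E" and ne: "U \<noteq> {}"
  shows "smooth_mat rk U (GM H e)"
proof -
  obtain z0 where "z0 \<in> U" using ne by blast
  then have le: "length e = rk" using hol_frameD(2)[OF frames_hol_frame[OF U]] by blast
  have "smooth_on U (\<lambda>z. H z ((e ! i) z) ((e ! j) z))" if "i < rk" "j < rk" for i j
    using herm[unfolded hermitian_metric_def, THEN conjunct2, THEN conjunct2, THEN conjunct2, rule_format, OF U]
      that le by simp
  then show ?thesis using le by (simp add: smooth_mat_def GM_def gram_def)
qed

lemma det_GM:
  assumes "basis_list (fibre E z) (ev e z)"
  shows "Determinant.det (GM H e z) \<noteq> 0" "Determinant.det (GM H e z) \<in> \<real>" "Re (Determinant.det (GM H e z)) > 0"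
  using det_gram_pos[OF herm_fibre assms] by (auto simp: GM_def)

lemma ctranspose_GM:
  assumes b: "basis_list (fibre E z) (ev e z)"
  shows "ctranspose (GM H e z) = GM H e z"
proof (rule eq_matI)
  fix i j assume "i < dim_row (GM H e z)" "j < dim_col (GM H e z)"
  then have ij: "i < length e" "j < length e" by (auto simp: GM_def gram_def)
  then have "(e ! i) z \<in> fibre E z" "(e ! j) z \<in> fibre E z"
    using basis_list_nth[OF b, of i] basis_list_nth[OF b, of j] by simp_all
  then have "H z ((e ! i) z) ((e ! j) z) = cnj (H z ((e ! j) z) ((e ! i) z))"
    by (intro herm_cnj[OF subspace_fibre herm_fibre])
  then show "ctranspose (GM H e z) $$ (i, j) = GM H e z $$ (i, j)"
    using ij by (simp add: ctranspose_def GM_def gram_def)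
qed (auto simp: ctranspose_def GM_def gram_def)

lemma frame_GM:
  assumes U: "(U, e) \<in> frames E" and ne: "U \<noteq> {}"
  shows "open U" "smooth_mat rk U (GM H e)" "\<forall>z\<in>U. Determinant.det (GM H e z) \<noteq> 0"
    "\<forall>z\<in>U. ctranspose (GM H e z) = GM H e z"
  by (rule framesD(1)[OF U], rule smooth_GM[OF assms], rule ballI, rule det_GM(1)[OF framesD(2)[OF U]], assumption,
      rule ballI, rule ctranspose_GM[OF framesD(2)[OF U]], assumption)

end

context cvs begin

lemma herm_comb2:
  assumes sub: "subspace V" and H: "herm_on V H" and b: "set b \<subseteq> V"
  shows "H (comb x b) (comb y b) = (\<Sum>i<length b. \<Sum>j<length b. x i * cnj (y j) * H (b ! i) (b ! j))"
proof -
  have "H (comb x b) (comb y b) = (\<Sum>i<length b. x i * H (b ! i) (comb y b))"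
    by (rule herm_comb(1)[OF sub H b comb_in[OF sub b]])
  also have "\<dots> = (\<Sum>i<length b. x i * (\<Sum>j<length b. cnj (y j) * H (b ! i) (b ! j)))"
  proof (rule sum.cong)
    fix i assume "i \<in> {..<length b}"
    then have "b ! i \<in> V" using b by auto
    from herm_comb(2)[OF sub H b this, of y]
    show "x i * H (b ! i) (comb y b) = x i * (\<Sum>j<length b. cnj (y j) * H (b ! i) (b ! j))" by (simp only:)
  qed simp
  finally show ?thesis by (simp add: sum_distrib_left mult.assoc)
qed

lemma endo_matrix:
  assumes b: "basis_list V b"
  shows "endo V (\<lambda>v. comb (\<lambda>j. \<Sum>i<length b. cf b i v * M i j) b)"
  unfolding endo_def
proof (intro conjI ballI allI)
  fix u v x y assume u: "u \<in> V" and v: "v \<in> V"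
  show "comb (\<lambda>j. \<Sum>i<length b. cf b i (x *c u + y *c v) * M i j) b =
    x *c comb (\<lambda>j. \<Sum>i<length b. cf b i u * M i j) b + y *c comb (\<lambda>j. \<Sum>i<length b. cf b i v * M i j) b"
    unfolding cf_linear[OF b u v] comb_def
    by (simp add: scale_sum_right sum.distrib distrib_right sum_distrib_left mult.assoc scale_left_distrib)
qed (rule comb_in[OF basis_list_subspace[OF b] basis_list_set[OF b]])

lemma tr_matrix:
  assumes b: "basis_list V b"
  shows "tr b (\<lambda>v. comb (\<lambda>j. \<Sum>i<length b. cf b i v * M i j) b) = (\<Sum>i<length b. M i i)"
proof -
  have "cf b k (comb (\<lambda>j. \<Sum>i<length b. cf b i (b ! k) * M i j) b) = M k k" if k: "k < length b" for k
  proof -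
    have "(\<Sum>i<length b. cf b i (b ! k) * M i k) = (\<Sum>i<length b. if i = k then M i k else 0)"
      using cf_nth[OF b _ k] by (intro sum.cong) auto
    then show ?thesis using cf_comb[OF b k] k by simp
  qed
  then show ?thesis by (simp add: tr_def)
qed

lemma tr_cong: assumes "basis_list V b" "\<And>v. v \<in> V \<Longrightarrow> T v = S v" shows "tr b T = tr b S"
  unfolding tr_def using assms basis_list_nth by (intro sum.cong) auto

end

context hvb begin

lemma end_trace_eq: "end_trace E z \<phi> = tr (ev (frame_at E z) z) \<phi>"
  by (simp add: end_trace_def tr_def Let_def coord_eq)

lemma basis_frame_at: "basis_list (fibre E z) (ev (frame_at E z) z)"
  using frame_at_frame framesD(2) by blast

lemma end_trace_frame:
  "endo (fibre E z) \<phi> \<Longrightarrow> basis_list (fibre E z) b \<Longrightarrow> end_trace E z \<phi> = tr b \<phi>"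
  unfolding end_trace_eq by (rule tr_basis_indep[OF basis_frame_at])

lemma end_norm_eq:
  "end_norm E K z \<phi> = sqrt (Re (tr (ev (frame_at E z) z) (\<phi> \<circ> adj (fibre E z) (K z) \<phi>)))"
  by (simp add: end_norm_def end_trace_eq end_adjoint_def[abs_def] adj_def[abs_def])

lemma metric_quotient_eq: "metric_quotient E K H z = quot (fibre E z) (K z) (H z)"
  by (simp add: metric_quotient_def[abs_def] quot_def[abs_def] fun_eq_iff)

end

context hvb_metric begin

text \<open>\<open>chern_dz\<close> is a definite description, so both parts are needed. Existence:
  expand \<open>H\<close> in the frame, differentiate the threefold products, and write the
  derivative of the Gram matrix as connection form times Gram matrix. Uniqueness: test sections
  realize every vector of the fibre.\<close>

lemma chern_frame:
  assumes U: "(U, e) \<in> frames E" and z: "z \<in> U" and W: "open W" "z \<in> W" "\<forall>w\<in>W. s w \<in> fibre E w"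
    and d: "\<forall>i<rk. (\<lambda>w. cf (ev e w) i (s w)) differentiable (at z)"
  shows "chern_dz E H s z = comb (\<lambda>j. d_z (\<lambda>w. cf (ev e w) j (s w)) z +
      (\<Sum>i<rk. cf (ev e z) i (s z) * conn rk (GM H e) z $$ (i, j))) (ev e z)"
    (is "_ = comb ?u _")
  unfolding chern_dz_def
proof (rule the_equality)
  let ?c = "\<lambda>i w. cf (ev e w) i (s w)"
  let ?G = "\<lambda>i j w. H w ((e ! i) w) ((e ! j) w)"
  have ne: "U \<noteq> {}" using z by blast
  note e = frames_hol_frame[OF U z]
  note le = hol_frameD(2)[OF e] and be = hol_frameD(4)[OF e]
  note G = frame_GM[OF U ne]
  have gi: "GM H e w $$ (i, j) = ?G i j w" if "i < rk" "j < rk" for i j w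
    using that le by (simp add: GM_def gram_def)
  have gd: "(?G i j) differentiable (at z)" if "i < rk" "j < rk" for i j
    using smooth_matD(3)[OF G(2) that z] by (simp add: gi[OF that])
  have ub: "comb ?u (ev e z) \<in> fibre E z" by (rule comb_in[OF subspace_fibre basis_list_set[OF be[OF z]]])
  have expand: "H w (comb x (ev e w)) (comb y (ev e w)) = (\<Sum>i<rk. \<Sum>j<rk. x i * cnj (y j) * ?G i j w)"
    if "w \<in> U" for w x y
    using herm_comb2[OF subspace_fibre herm_fibre basis_list_set[OF be[OF that]], of x y] le by simp
  have main: "d_z (\<lambda>w. H w (s w) (t w)) z = H z (comb ?u (ev e z)) (t z) + H z (s z) (dbar E t z)"
    if t: "smooth_section E W' t" and zW': "z \<in> W'" for W' t
  proof -
    have W': "open W'" and tin: "\<forall>w\<in>W'. t w \<in> fibre E w" using t by (auto simp: smooth_section_def)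
    let ?t = "\<lambda>j w. cf (ev e w) j (t w)"
    have UW: "z \<in> U \<inter> W'" using z zW' by blast
    have td: "\<forall>j<rk. (?t j) differentiable (at z)"
      using smooth_on_imp_differentiable[OF smooth_section_coord[OF t U] UW] le by simp
    then have ctd: "(\<lambda>w. cnj (?t j w)) differentiable (at z)" if "j < rk" for j
      using that has_derivative_cnj unfolding differentiable_def by blast
    have N: "open (U \<inter> W \<inter> W')" "z \<in> U \<inter> W \<inter> W'" using G(1) W W' z zW' by auto
    have "d_z (\<lambda>w. H w (s w) (t w)) z = d_z (\<lambda>w. \<Sum>i<rk. \<Sum>j<rk. ?c i w * cnj (?t j w) * ?G i j w) z"
    proof (rule D_cong[OF wirtinger(1) N])
      fix w assume w: "w \<in> U \<inter> W \<inter> W'"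
      then have "s w = comb (\<lambda>i. ?c i w) (ev e w)" "t w = comb (\<lambda>i. ?t i w) (ev e w)"
        using comb_cf[OF be] W(3) tin by auto
      then show "H w (s w) (t w) = (\<Sum>i<rk. \<Sum>j<rk. ?c i w * cnj (?t j w) * ?G i j w)"
        using expand[of w "\<lambda>i. ?c i w" "\<lambda>i. ?t i w"] w by simp
    qed
    also have "\<dots> = (\<Sum>i<rk. \<Sum>j<rk. d_z (\<lambda>w. ?c i w * cnj (?t j w) * ?G i j w) z)"
    proof -
      have dd: "(\<lambda>w. ?c i w * cnj (?t j w) * ?G i j w) differentiable (at z)" if "i < rk" "j < rk" for i j
        using that d by (intro differentiable_mult ctd gd) auto
      then have "(\<lambda>w. \<Sum>j<rk. ?c i w * cnj (?t j w) * ?G i j w) differentiable (at z)" if "i < rk" for i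
        using that by (intro differentiable_sum) auto
      then have "d_z (\<lambda>w. \<Sum>i<rk. \<Sum>j<rk. ?c i w * cnj (?t j w) * ?G i j w) z =
          (\<Sum>i<rk. d_z (\<lambda>w. \<Sum>j<rk. ?c i w * cnj (?t j w) * ?G i j w) z)"
        by (intro D_sum[OF wirtinger(1)]) auto
      also have "\<dots> = (\<Sum>i<rk. \<Sum>j<rk. d_z (\<lambda>w. ?c i w * cnj (?t j w) * ?G i j w) z)"
        using dd by (intro sum.cong D_sum[OF wirtinger(1)]) auto
      finally show ?thesis .
    qed
    also have "\<dots> = (\<Sum>i<rk. \<Sum>j<rk. d_z (?c i) z * cnj (?t j z) * ?G i j z +
        ?c i z * cnj (?t j z) * d_z (?G i j) z + ?c i z * cnj (d_zbar (?t j) z) * ?G i j z)"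
    proof (intro sum.cong refl)
      fix i j assume "i \<in> {..<rk}" "j \<in> {..<rk}"
      then have ij: "i < rk" "j < rk" by auto
      note dc = d[rule_format, OF ij(1)] and dt = td[rule_format, OF ij(2)]
      show "d_z (\<lambda>w. ?c i w * cnj (?t j w) * ?G i j w) z = d_z (?c i) z * cnj (?t j z) * ?G i j z +
        ?c i z * cnj (?t j z) * d_z (?G i j) z + ?c i z * cnj (d_zbar (?t j) z) * ?G i j z"
        unfolding D_mult[OF wirtinger(1) differentiable_mult[OF dc ctd[OF ij(2)]] gd[OF ij]]
          D_mult[OF wirtinger(1) dc ctd[OF ij(2)]] d_z_cnj(1)[OF dt]
        by (simp add: algebra_simps)
    qed
    also have "\<dots> = (\<Sum>i<rk. \<Sum>j<rk. d_z (?c i) z * cnj (?t j z) * ?G i j z) +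
        (\<Sum>i<rk. \<Sum>j<rk. ?c i z * cnj (?t j z) * d_z (?G i j) z) +
        (\<Sum>i<rk. \<Sum>j<rk. ?c i z * cnj (d_zbar (?t j) z) * ?G i j z)"
      by (simp add: sum.distrib)
    also have "(\<Sum>i<rk. \<Sum>j<rk. ?c i z * cnj (?t j z) * d_z (?G i j) z) =
        (\<Sum>k<rk. \<Sum>j<rk. (\<Sum>i<rk. ?c i z * conn rk (GM H e) z $$ (i, k)) * cnj (?t j z) * ?G k j z)"
    proof -
      have dG: "d_z (?G i j) z = (\<Sum>k<rk. conn rk (GM H e) z $$ (i, k) * ?G k j z)" if ij: "i < rk" "j < rk" for i j
      proof -
        have "d_z (?G i j) z = dmat d_z rk (GM H e) z $$ (i, j)" by (simp add: dmat_index ij gi)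
        also have "\<dots> = (conn rk (GM H e) z * GM H e z) $$ (i, j)"
          by (simp only: conn_mult[OF G(1,2,3) z])
        also have "\<dots> = (\<Sum>k<rk. conn rk (GM H e) z $$ (i, k) * GM H e z $$ (k, j))"
          by (rule mat_mult_index[OF smooth_matD(1)[OF smooth_mat_conn[OF G(1,2,3)] z] smooth_matD(1)[OF G(2) z] ij])
        finally show ?thesis using ij by (simp add: gi)
      qed
      have "(\<Sum>i<rk. \<Sum>j<rk. ?c i z * cnj (?t j z) * d_z (?G i j) z) =
          (\<Sum>i<rk. \<Sum>j<rk. \<Sum>k<rk. ?c i z * conn rk (GM H e) z $$ (i, k) * (cnj (?t j z) * ?G k j z))"
        by (intro sum.cong refl) (simp add: dG sum_distrib_left mult_ac)
      also have "\<dots> = (\<Sum>i<rk. \<Sum>k<rk. \<Sum>j<rk. ?c i z * conn rk (GM H e) z $$ (i, k) * (cnj (?t j z) * ?G k j z))"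
        by (intro sum.cong refl sum.swap)
      also have "\<dots> = (\<Sum>k<rk. \<Sum>i<rk. \<Sum>j<rk. ?c i z * conn rk (GM H e) z $$ (i, k) * (cnj (?t j z) * ?G k j z))"
        by (rule sum.swap)
      also have "\<dots> = (\<Sum>k<rk. \<Sum>j<rk. \<Sum>i<rk. ?c i z * conn rk (GM H e) z $$ (i, k) * (cnj (?t j z) * ?G k j z))"
        by (intro sum.cong refl sum.swap)
      finally show ?thesis by (simp only: sum_distrib_right mult.assoc)
    qed
    also have "(\<Sum>i<rk. \<Sum>j<rk. d_z (?c i) z * cnj (?t j z) * ?G i j z) +
        (\<Sum>k<rk. \<Sum>j<rk. (\<Sum>i<rk. ?c i z * conn rk (GM H e) z $$ (i, k)) * cnj (?t j z) * ?G k j z) =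
        (\<Sum>k<rk. \<Sum>j<rk. ?u k * cnj (?t j z) * ?G k j z)"
      by (simp add: sum.distrib[symmetric] distrib_right)
    also have "\<dots> = H z (comb ?u (ev e z)) (comb (\<lambda>j. ?t j z) (ev e z))" by (rule expand[OF z, symmetric])
    also have "comb (\<lambda>j. ?t j z) (ev e z) = t z" using comb_cf[OF be[OF z]] tin zW' by simp
    also have "(\<Sum>i<rk. \<Sum>j<rk. ?c i z * cnj (d_zbar (?t j) z) * ?G i j z) =
        H z (comb (\<lambda>i. ?c i z) (ev e z)) (comb (\<lambda>j. d_zbar (?t j) z) (ev e z))" by (rule expand[OF z, symmetric])
    also have "comb (\<lambda>i. ?c i z) (ev e z) = s z" using comb_cf[OF be[OF z]] W by simp
    also have "comb (\<lambda>j. d_zbar (?t j) z) (ev e z) = dbar E t z"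
      by (rule dbar_frame[OF e z W' zW' tin td, symmetric])
    finally show ?thesis .
  qed
  then show "comb ?u (ev e z) \<in> fibre E z \<and> (\<forall>W t. smooth_section E W t \<and> z \<in> W \<longrightarrow>
      d_z (\<lambda>w. H w (s w) (t w)) z = H z (comb ?u (ev e z)) (t z) + H z (s z) (dbar E t z))"
    using ub by (intro conjI allI impI) (simp_all only:, blast)
  fix u' assume u': "u' \<in> fibre E z \<and> (\<forall>W t. smooth_section E W t \<and> z \<in> W \<longrightarrow>
      d_z (\<lambda>w. H w (s w) (t w)) z = H z u' (t z) + H z (s z) (dbar E t z))"
  show "u' = comb ?u (ev e z)"
  proof (rule herm_eqI[OF subspace_fibre herm_fibre conjunct1[OF u'] ub])
    fix v assume v: "v \<in> fibre E z"
    \<comment> \<open>The section with the constant coordinates of \<open>v\<close>, which passes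
      through \<open>v\<close> at \<open>z\<close>.\<close>
    let ?v = "\<lambda>w. comb (\<lambda>i. cf (ev e z) i v) (ev e w)"
    have t: "smooth_section E U ?v" by (rule comb_smooth_section[OF e]) simp
    have "H z u' (?v z) + H z (s z) (dbar E ?v z) = H z (comb ?u (ev e z)) (?v z) + H z (s z) (dbar E ?v z)"
      using u'[THEN conjunct2, rule_format, OF conjI[OF t z]] main[OF t z] by simp
    then show "H z u' v = H z (comb ?u (ev e z)) v" using comb_cf[OF be[OF z] v] by simp
  qed
qed

text \<open>The local extension of \<open>v\<close> has constant coordinates in the frame chosen by
  \<open>frame_at\<close>, hence holomorphic ones in \<open>e\<close>. Thus \<open>dbar\<close>
  kills it and the first term of the commutator vanishes; in the second, \<open>d_zbar\<close> sees
  only the connection form, which gives \<open>theta\<close> with a minus sign.\<close>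

lemma curvature_frame:
  assumes U: "(U, e) \<in> frames E" and z: "z \<in> U" and v: "v \<in> fibre E z"
  shows "curvature_dzdzbar E H z v =
    comb (\<lambda>j. \<Sum>i<rk. cf (ev e z) i v * - theta rk (GM H e) z $$ (i, j)) (ev e z)"
proof -
  define f where "f = frame_at E z"
  obtain V where V: "(V, f) \<in> frames E" "z \<in> V" using frame_at_frame f_def by blast
  note f = frames_hol_frame[OF V] and e = frames_hol_frame[OF U z]
  note le = hol_frameD(2)[OF e] and be = hol_frameD(4)[OF e]
  note lf = hol_frameD(2)[OF f] and bf = hol_frameD(4)[OF f]
  have ne: "U \<noteq> {}" using z by blast
  note G = frame_GM[OF U ne]
  define a where "a i = cf (ev f z) i v" for i
  define s where "s w = comb a (ev f w)" for w
  have s_eq: "local_extension E z v = s"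
    unfolding local_extension_def f_def[symmetric] Let_def s_def[abs_def] comb_eq a_def
    by (auto simp: coord_eq fun_eq_iff)
  let ?c = "\<lambda>i w. cf (ev e w) i (s w)"
  let ?N = "U \<inter> V"
  have N: "open ?N" "z \<in> ?N" using hol_frameD(1)[OF e] hol_frameD(1)[OF f] z V by auto
  have sin: "\<forall>w\<in>?N. s w \<in> fibre E w"
    using comb_in[OF subspace_fibre basis_list_set[OF bf]] by (simp add: s_def)
  have chol: "?c j holomorphic_on ?N" if j: "j < rk" for j
  proof -
    have "(\<lambda>w. \<Sum>i<rk. a i * cf (ev e w) j ((f ! i) w)) holomorphic_on ?N"
      by (intro holomorphic_on_sum holomorphic_on_mult holomorphic_on_const hol_frame_trans[OF f e _ j]) auto
    moreover have "(\<Sum>i<rk. a i * cf (ev e w) j ((f ! i) w)) = ?c j w" if w: "w \<in> ?N" for w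
    proof -
      have "?c j w = (\<Sum>i<rk. cf (ev f w) i (s w) * cf (ev e w) j ((f ! i) w))"
        using w sin by (intro cf_change be bf) auto
      also have "\<dots> = (\<Sum>i<rk. a i * cf (ev e w) j ((f ! i) w))"
        using w lf cf_comb[OF bf, of w _ a] by (intro sum.cong) (auto simp: s_def)
      finally show ?thesis ..
    qed
    ultimately show ?thesis by (rule holomorphic_transform)
  qed
  have csm: "smooth_on ?N (?c j)" if "j < rk" for j by (rule holomorphic_imp_smooth_on[OF N(1) chol[OF that]])
  have cd: "\<forall>i<rk. (?c i) differentiable (at w)" if "w \<in> ?N" for w
    using smooth_on_imp_differentiable[OF csm that] by blast
  have dbar0: "dbar E s w = 0" if w: "w \<in> ?N" for w
  proof -
    have "dbar E s w = comb (\<lambda>i. d_zbar (?c i) w) (ev e w)"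
      using w by (intro dbar_frame[OF e _ N(1) w sin cd[OF w]]) auto
    also have "\<dots> = 0"
      unfolding comb_def using holomorphic_d_zbar[OF N(1) chol w] le by (intro sum.neutral) auto
    finally show ?thesis .
  qed
  have "chern_dz E H (dbar E s) z = comb (\<lambda>j. d_z (\<lambda>w. cf (ev e w) j (dbar E s w)) z +
      (\<Sum>i<rk. cf (ev e z) i (dbar E s z) * conn rk (GM H e) z $$ (i, j))) (ev e z)"
  proof (rule chern_frame[OF U z N])
    show "\<forall>w\<in>?N. dbar E s w \<in> fibre E w" using dbar0 subspace_0[OF subspace_fibre] by simp
    show "\<forall>i<rk. (\<lambda>w. cf (ev e w) i (dbar E s w)) differentiable (at z)"
    proof (intro allI impI)
      fix i
      have "(\<lambda>w. cf (ev e w) i (dbar E s w)) differentiable (at z) \<longleftrightarrow> (\<lambda>w. 0::complex) differentiable (at z)"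
        by (rule frechet_derivative_cong_open(2)[OF N]) (simp add: dbar0)
      then show "(\<lambda>w. cf (ev e w) i (dbar E s w)) differentiable (at z)" by simp
    qed
  qed
  also have "\<dots> = 0"
  proof -
    have "d_z (\<lambda>w. cf (ev e w) j (dbar E s w)) z = 0" for j
      using D_cong[OF wirtinger(1) N, of "\<lambda>w. cf (ev e w) j (dbar E s w)" "\<lambda>_. 0"] dbar0
      by (simp add: D_const[OF wirtinger(1)])
    then show ?thesis using dbar0[OF N(2)] by (simp add: comb_def)
  qed
  finally have c1: "chern_dz E H (dbar E s) z = 0" .
  let ?u = "\<lambda>j w. d_z (?c j) w + (\<Sum>i<rk. ?c i w * conn rk (GM H e) w $$ (i, j))"
  have ch: "chern_dz E H s w = comb (\<lambda>j. ?u j w) (ev e w)" if w: "w \<in> ?N" for w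
    using w by (intro chern_frame[OF U _ N(1) w sin cd[OF w]]) auto
  note sc = smooth_mat_conn[OF G(1,2,3)]
  have dcsm: "smooth_on ?N (d_z (?c j))" if "j < rk" for j by (rule smooth_on_d_z[OF N(1) csm[OF that]])
  have connd: "(\<lambda>w. conn rk (GM H e) w $$ (i, j)) differentiable (at z)" if "i < rk" "j < rk" for i j
    by (rule smooth_matD(3)[OF sc that z])
  have cz: "(?c i) differentiable (at z)" if "i < rk" for i using cd[OF N(2)] that by blast
  have pd: "(\<lambda>w. ?c i w * conn rk (GM H e) w $$ (i, j)) differentiable (at z)" if "i < rk" "j < rk" for i j
    by (rule differentiable_mult[OF cz[OF that(1)] connd[OF that]])
  have ud: "(?u j) differentiable (at z)" if j: "j < rk" for j
    using smooth_on_imp_differentiable[OF dcsm[OF j] N(2)] j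
    by (intro differentiable_add differentiable_sum) (auto intro: pd)
  have cfu: "cf (ev e w) j (chern_dz E H s w) = ?u j w" if "w \<in> ?N" "j < rk" for w j
    unfolding ch[OF that(1)] using that le by (intro cf_comb[OF be]) auto
  have du: "d_zbar (?u j) z = (\<Sum>i<rk. ?c i z * theta rk (GM H e) z $$ (i, j))" if j: "j < rk" for j
  proof -
    have "d_zbar (d_z (?c j)) z = d_zbar (deriv (?c j)) z"
      by (rule D_cong[OF wirtinger(2) N]) (rule holomorphic_d_z[OF N(1) chol[OF j]])
    also have "\<dots> = 0" by (rule holomorphic_d_zbar[OF N(1) holomorphic_deriv[OF chol[OF j] N(1)] N(2)])
    finally have 0: "d_zbar (d_z (?c j)) z = 0" .
    have "d_zbar (?u j) z = d_zbar (d_z (?c j)) z + d_zbar (\<lambda>w. \<Sum>i<rk. ?c i w * conn rk (GM H e) w $$ (i, j)) z"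
      using smooth_on_imp_differentiable[OF dcsm[OF j] N(2)] j
      by (intro D_add[OF wirtinger(2)] differentiable_sum) (auto intro: pd)
    also have "d_zbar (\<lambda>w. \<Sum>i<rk. ?c i w * conn rk (GM H e) w $$ (i, j)) z =
        (\<Sum>i<rk. d_zbar (\<lambda>w. ?c i w * conn rk (GM H e) w $$ (i, j)) z)"
      using j by (intro D_sum[OF wirtinger(2)]) (auto intro: pd)
    also have "\<dots> = (\<Sum>i<rk. ?c i z * theta rk (GM H e) z $$ (i, j))"
    proof (rule sum.cong)
      fix i assume "i \<in> {..<rk}"
      then have i: "i < rk" by simp
      show "d_zbar (\<lambda>w. ?c i w * conn rk (GM H e) w $$ (i, j)) z = ?c i z * theta rk (GM H e) z $$ (i, j)"
        unfolding D_mult[OF wirtinger(2) cz[OF i] connd[OF i j]] holomorphic_d_zbar[OF N(1) chol[OF i] N(2)]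
        by (simp add: theta_def dmat_index i j)
    qed simp
    finally show ?thesis using 0 by simp
  qed
  have "dbar E (chern_dz E H s) z = comb (\<lambda>j. d_zbar (\<lambda>w. cf (ev e w) j (chern_dz E H s w)) z) (ev e z)"
  proof (rule dbar_frame[OF e z N])
    show "\<forall>w\<in>?N. chern_dz E H s w \<in> fibre E w"
      using ch comb_in[OF subspace_fibre basis_list_set[OF be]] by simp
    show "\<forall>j<rk. (\<lambda>w. cf (ev e w) j (chern_dz E H s w)) differentiable (at z)"
    proof (intro allI impI)
      fix j assume j: "j < rk"
      have "(\<lambda>w. cf (ev e w) j (chern_dz E H s w)) differentiable (at z) \<longleftrightarrow> (?u j) differentiable (at z)"
        by (rule frechet_derivative_cong_open(2)[OF N]) (rule cfu[OF _ j])
      then show "(\<lambda>w. cf (ev e w) j (chern_dz E H s w)) differentiable (at z)" using ud[OF j] by simp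
    qed
  qed
  also have "\<dots> = comb (\<lambda>j. \<Sum>i<rk. ?c i z * theta rk (GM H e) z $$ (i, j)) (ev e z)"
  proof -
    have "d_zbar (\<lambda>w. cf (ev e w) j (chern_dz E H s w)) z = (\<Sum>i<rk. ?c i z * theta rk (GM H e) z $$ (i, j))"
      if j: "j < rk" for j
      by (rule trans[OF D_cong[OF wirtinger(2) N cfu[OF _ j]] du[OF j]])
    then show ?thesis unfolding comb_eq le by (intro sum.cong) auto
  qed
  finally have c2: "dbar E (chern_dz E H s) z = comb (\<lambda>j. \<Sum>i<rk. ?c i z * theta rk (GM H e) z $$ (i, j)) (ev e z)" .
  have sz: "s z = v" unfolding s_def a_def by (rule comb_cf[OF bf[OF V(2)] v])
  show ?thesis
    unfolding curvature_dzdzbar_def s_eq Let_def c1 c2 sz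
    by (simp add: comb_def sum_negf scale_minus_left)
qed

lemma endo_curvature: "endo (fibre E z) (curvature_dzdzbar E H z)"
  and tr_curvature: "(U, e) \<in> frames E \<Longrightarrow> z \<in> U \<Longrightarrow>
      end_trace E z (curvature_dzdzbar E H z) = - mtrace (theta rk (GM H e) z)"
proof -
  have *: "endo (fibre E z) (curvature_dzdzbar E H z) \<and>
      end_trace E z (curvature_dzdzbar E H z) = - mtrace (theta rk (GM H e) z)"
    if U: "(U, e) \<in> frames E" and z: "z \<in> U" for U e
  proof -
    note e = frames_hol_frame[OF U z]
    note b = hol_frameD(4)[OF e z] and l = hol_frameD(2)[OF e]
    let ?T = "\<lambda>v. comb (\<lambda>j. \<Sum>i<length (ev e z). cf (ev e z) i v * - theta rk (GM H e) z $$ (i, j)) (ev e z)"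
    have eq: "curvature_dzdzbar E H z v = ?T v" if "v \<in> fibre E z" for v
      using curvature_frame[OF U z that] l by simp
    have "endo (fibre E z) ?T" by (rule endo_matrix[OF b])
    then have endo: "endo (fibre E z) (curvature_dzdzbar E H z)"
      unfolding endo_def using eq subspace_add[OF subspace_fibre] subspace_scale[OF subspace_fibre] by simp
    have "end_trace E z (curvature_dzdzbar E H z) = tr (ev e z) (curvature_dzdzbar E H z)"
      by (rule end_trace_frame[OF endo b])
    also have "\<dots> = tr (ev e z) ?T" by (rule tr_cong[OF b eq])
    also have "\<dots> = (\<Sum>i<length (ev e z). - theta rk (GM H e) z $$ (i, i))" by (rule tr_matrix[OF b])
    also have "\<dots> = - mtrace (theta rk (GM H e) z)" using l by (simp add: mtrace_def theta_def dmat_def sum_negf)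
    finally show ?thesis using endo by simp
  qed
  show "endo (fibre E z) (curvature_dzdzbar E H z)" using * frame_ex[of z] by blast
  show "(U, e) \<in> frames E \<Longrightarrow> z \<in> U \<Longrightarrow> end_trace E z (curvature_dzdzbar E H z) = - mtrace (theta rk (GM H e) z)"
    using * by blast
qed

lemma end_trace_Lambda_F:
  "end_trace E z (Lambda_F E H z) = - 2 * \<i> * end_trace E z (curvature_dzdzbar E H z)"
proof -
  note b = basis_frame_at[of z]
  have "cf (ev (frame_at E z) z) i (scl E (- 2 * \<i>) (curvature_dzdzbar E H z (ev (frame_at E z) z ! i))) =
      - 2 * \<i> * cf (ev (frame_at E z) z) i (curvature_dzdzbar E H z (ev (frame_at E z) z ! i))"
    if "i < length (ev (frame_at E z) z)" for i
    by (rule cf_scale[OF b endo_in[OF endo_curvature basis_list_nth[OF b that]]])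
  then show ?thesis
    unfolding end_trace_eq tr_def Lambda_F_def[abs_def] sum_distrib_left by (intro sum.cong) auto
qed

lemma degree_density_frame:
  assumes "(U, e) \<in> frames E" "z \<in> U"
  shows "degree_density E H z = - 2 * Re (mtrace (theta rk (GM H e) z))"
  unfolding degree_density_def end_trace_Lambda_F tr_curvature[OF assms] by simp

text \<open>This is where the hypothesis on the curvature of \<open>K\<close> acts: it makes the
  degree density of \<open>E\<close> integrable.\<close>

lemma degree_density_le: "\<bar>degree_density E H z\<bar> \<le> real rk * norm_F E H z"
proof -
  let ?t = "end_trace E z (curvature_dzdzbar E H z)"
  have "\<bar>degree_density E H z\<bar> \<le> 2 * norm ?t"
    unfolding degree_density_def end_trace_Lambda_F
    using abs_Re_le_cmod[of "\<i> * (- 2 * \<i> * ?t)"] by (simp add: norm_mult)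
  also have "norm ?t \<le> real (length (ev (frame_at E z) z)) * end_norm E H z (curvature_dzdzbar E H z)"
    unfolding end_trace_eq end_norm_eq by (rule norm_tr_le[OF basis_frame_at herm_fibre endo_curvature])
  finally show ?thesis using length_frame[OF basis_frame_at[of z]] by (simp add: norm_F_def mult_ac)
qed

text \<open>A multiple of the identity is recovered from its trace, which by
  \<open>mtrace_theta\<close> depends on the determinant only.\<close>

lemma hermitian_einstein_theta:
  assumes he: "hermitian_einstein E H" and U: "(U, e) \<in> frames E" and z: "z \<in> U" and ij: "i < rk" "j < rk"
  shows "theta rk (GM H e) z $$ (i, j) = (if i = j then mtrace (theta rk (GM H e) z) / of_nat rk else 0)"
proof -
  note e = frames_hol_frame[OF U z]
  note b = hol_frameD(4)[OF e z] and l = hol_frameD(2)[OF e]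
  let ?m = "mtrace (theta rk (GM H e) z)"
  have ei: "(e ! i) z \<in> fibre E z" by (rule hol_frame_nth[OF e z ij(1)])
  have "Lambda_F_perp E H z ((e ! i) z) = 0" using he ei by (simp add: hermitian_einstein_def)
  then have eq: "scl E (- 2 * \<i>) (curvature_dzdzbar E H z ((e ! i) z)) = scl E (2 * \<i> * ?m / of_nat rk) ((e ! i) z)"
    unfolding Lambda_F_perp_def end_trace_Lambda_F tr_curvature[OF U z] rk_def[symmetric]
    by (simp add: Lambda_F_def)
  have "cf (ev e z) j (curvature_dzdzbar E H z ((e ! i) z)) = (\<Sum>k<rk. cf (ev e z) k ((e ! i) z) * - theta rk (GM H e) z $$ (k, j))"
    unfolding curvature_frame[OF U z ei] using ij l by (intro cf_comb[OF b]) simp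
  also have "\<dots> = (\<Sum>k<rk. if k = i then - theta rk (GM H e) z $$ (k, j) else 0)"
    using cf_nth[OF b, of _ i] ij l by (intro sum.cong) auto
  finally have "cf (ev e z) j (curvature_dzdzbar E H z ((e ! i) z)) = - theta rk (GM H e) z $$ (i, j)"
    using ij by simp
  then have "2 * \<i> * theta rk (GM H e) z $$ (i, j) = - 2 * \<i> * cf (ev e z) j (curvature_dzdzbar E H z ((e ! i) z))"
    by simp
  also have "\<dots> = cf (ev e z) j (scl E (- 2 * \<i>) (curvature_dzdzbar E H z ((e ! i) z)))"
    by (rule cf_scale[OF b endo_in[OF endo_curvature ei], symmetric])
  also have "\<dots> = 2 * \<i> * ?m / of_nat rk * cf (ev e z) j ((e ! i) z)"
    unfolding eq by (rule cf_scale[OF b ei])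
  also have "\<dots> = 2 * \<i> * (?m / of_nat rk * (if j = i then 1 else 0))"
    using cf_nth[OF b, of j i] ij l by simp
  finally have "theta rk (GM H e) z $$ (i, j) = ?m / of_nat rk * (if j = i then 1 else 0)"
    by (subst (asm) mult_left_cancel) auto
  then show ?thesis by simp
qed

end

section \<open>Holomorphy of the quotient of two Hermitian-Einstein metrics\<close>

lemma has_dir_deriv_Re:
  assumes "\<And>z. F differentiable (at z)"
  shows "has_dir_deriv (\<lambda>z. Re (F z)) v (\<lambda>z. Re (frechet_derivative F (at z) v))"
  unfolding has_dir_deriv_def
proof
  fix z
  let ?D = "frechet_derivative F (at z)"
  have F: "(F has_derivative ?D) (at (z + of_real 0 * v))" using assms[of z] unfolding frechet_derivative_works by simp
  interpret bounded_linear ?D using F has_derivative_bounded_linear by blast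
  have "((\<lambda>t::real. z + of_real t * v) has_derivative (\<lambda>h. of_real h * v)) (at 0)"
    by (auto intro!: derivative_eq_intros)
  from has_derivative_compose[OF this F]
  have "((\<lambda>t. F (z + of_real t * v)) has_derivative (\<lambda>h. ?D (of_real h * v))) (at 0)" .
  then have "((\<lambda>t. Re (F (z + of_real t * v))) has_derivative (\<lambda>h. Re (?D (of_real h * v)))) (at 0)"
    by (rule has_derivative_Re)
  moreover have "Re (?D (of_real h * v)) = Re (?D v) * h" for h
    using scaleR[of h v] by (simp add: scaleR_conv_of_real)
  ultimately show "((\<lambda>t. Re (F (z + of_real t * v))) has_real_derivative Re (?D v)) (at 0)"
    by (simp add: has_field_derivative_def)
qed

text \<open>Expanding both operators leaves the mixed second derivatives multiplied by
  \<open>\<i>\<close>. They are real because \<open>F\<close> is, so they do not contribute to the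
  real part, and what remains is a quarter of the Laplacian.\<close>

lemma Re_dbar_d:
  assumes F: "smooth_on UNIV F" and real: "\<And>z. F z \<in> \<real>"
  shows "4 * Re (d_zbar (d_z F) z) =
    Re (frechet_derivative (\<lambda>w. frechet_derivative F (at w) 1) (at z) 1) +
    Re (frechet_derivative (\<lambda>w. frechet_derivative F (at w) \<i>) (at z) \<i>)"
proof -
  let ?P = "\<lambda>w. frechet_derivative F (at w) 1" and ?Q = "\<lambda>w. frechet_derivative F (at w) \<i>"
  have dP: "?P differentiable (at z)" and dQ: "?Q differentiable (at z)" for z
    using smooth_on_imp_differentiable[OF smooth_on_frechet(1)[OF F]]
      smooth_on_imp_differentiable[OF smooth_on_frechet(2)[OF F]] by auto
  have im: "Im (frechet_derivative G (at z) v) = 0" if "G differentiable (at z)" "\<And>w. Im (G w) = 0" for G z v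
  proof -
    have "((\<lambda>w. Im (G w)) has_derivative (\<lambda>v. Im (frechet_derivative G (at z) v))) (at z)"
      using that(1) by (intro has_derivative_Im) (simp add: frechet_derivative_works[symmetric])
    moreover have "((\<lambda>w. Im (G w)) has_derivative (\<lambda>v. 0)) (at z)" using that(2) by simp
    ultimately have "(\<lambda>v. Im (frechet_derivative G (at z) v)) = (\<lambda>v. 0)" by (rule has_derivative_unique)
    then show ?thesis by (rule fun_cong)
  qed
  have "Im (F w) = 0" for w using real[of w] by (simp add: complex_is_Real_iff)
  then have "Im (?P w) = 0" "Im (?Q w) = 0" for w
    using im[of F w] smooth_on_imp_differentiable[OF F] by auto
  then have 0: "Im (frechet_derivative ?P (at z) \<i>) = 0" "Im (frechet_derivative ?Q (at z) 1) = 0"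
    using im[OF dP] im[OF dQ] by auto
  have "(d_z F has_derivative (\<lambda>v. (frechet_derivative ?P (at z) v - \<i> * frechet_derivative ?Q (at z) v) / 2)) (at z)"
    unfolding d_z_def[abs_def]
    using dP[of z] dQ[of z] unfolding frechet_derivative_works
    by (auto intro!: derivative_eq_intros)
  from has_derivative_d_z(2)[OF this] show ?thesis
    using 0 by (simp only:) (simp add: field_simps)
qed

theorem parabolic_smooth:
  assumes F: "smooth_on UNIV F" and real: "\<And>z. F z \<in> \<real>" and bdd: "AE z in lborel. norm (F z) \<le> C"
    and neg: "(\<integral>\<^sup>+z. ennreal (- Re (d_zbar (d_z F) z)) \<partial>lborel) < \<infinity>"
  shows "(\<integral>\<^sup>+z. ennreal (Re (d_zbar (d_z F) z)) \<partial>lborel) \<le> (\<integral>\<^sup>+z. ennreal (- Re (d_zbar (d_z F) z)) \<partial>lborel)"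
proof -
  let ?P = "\<lambda>w. frechet_derivative F (at w) 1" and ?Q = "\<lambda>w. frechet_derivative F (at w) \<i>"
  let ?xx = "\<lambda>z. Re (frechet_derivative ?P (at z) 1)" and ?yy = "\<lambda>z. Re (frechet_derivative ?Q (at z) \<i>)"
  let ?w = "\<lambda>z. Re (d_zbar (d_z F) z)"
  have sP: "smooth_on UNIV ?P" and sQ: "smooth_on UNIV ?Q" by (rule smooth_on_frechet[OF F])+
  have dF: "F differentiable (at z)" and dP: "?P differentiable (at z)" and dQ: "?Q differentiable (at z)" for z
    using smooth_on_imp_differentiable[OF F] smooth_on_imp_differentiable[OF sP] smooth_on_imp_differentiable[OF sQ] by auto
  have cont: "continuous_on UNIV (\<lambda>z. Re (G z))" if "smooth_on UNIV G" for G
    using smooth_on_imp_continuous_on[OF that] by (intro continuous_intros)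
  have w: "?xx z + ?yy z = 4 * ?w z" for z using Re_dbar_d[OF F real] by simp
  have [measurable]: "?w \<in> borel_measurable borel"
    by (intro borel_measurable_continuous_onI cont smooth_on_d_zbar smooth_on_d_z F) auto
  have scale: "(\<integral>\<^sup>+z. ennreal (4 * g z) \<partial>lborel) = 4 * (\<integral>\<^sup>+z. ennreal (g z) \<partial>lborel)"
    if [measurable]: "g \<in> borel_measurable borel" for g :: "complex \<Rightarrow> real"
    by (subst nn_integral_cmult[symmetric]) (auto simp: ennreal_mult'[of 4])
  have "(\<integral>\<^sup>+z. ennreal (?xx z + ?yy z) \<partial>lborel) \<le> (\<integral>\<^sup>+z. ennreal (- (?xx z + ?yy z)) \<partial>lborel)"
  proof (rule parabolic_plane[OF has_dir_deriv_Re[of F, OF dF] has_dir_deriv_Re[of ?P, OF dP]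
        has_dir_deriv_Re[of F, OF dF] has_dir_deriv_Re[of ?Q, OF dQ]])
    show "continuous_on UNIV (\<lambda>z. Re (F z))" "continuous_on UNIV (\<lambda>z. Re (?P z))" "continuous_on UNIV (\<lambda>z. Re (?Q z))"
      "continuous_on UNIV ?xx" "continuous_on UNIV ?yy"
      by (rule cont[OF F] cont[OF sP] cont[OF sQ] cont[OF smooth_on_frechet(1)[OF sP]] cont[OF smooth_on_frechet(2)[OF sQ]])+
    show "AE z in lborel. \<bar>Re (F z)\<bar> \<le> C"
      using bdd by eventually_elim (use abs_Re_le_cmod order_trans in blast)
    have "(\<integral>\<^sup>+z. ennreal (- (?xx z + ?yy z)) \<partial>lborel) = 4 * (\<integral>\<^sup>+z. ennreal (- ?w z) \<partial>lborel)"
      unfolding w using scale[of "\<lambda>z. - ?w z"] by simp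
    then show "(\<integral>\<^sup>+z. ennreal (- (?xx z + ?yy z)) \<partial>lborel) < \<infinity>"
      using neg by (simp add: ennreal_mult_less_top)
  qed
  then have "4 * (\<integral>\<^sup>+z. ennreal (?w z) \<partial>lborel) \<le> 4 * (\<integral>\<^sup>+z. ennreal (- ?w z) \<partial>lborel)"
    unfolding w using scale[of ?w] scale[of "\<lambda>z. - ?w z"] by simp
  then show ?thesis by (subst (asm) ennreal_mult_le_mult_iff) auto
qed

text \<open>The negative part is 0, so parabolicity forces the integral of the nonnegative Laplacian
  to be 0. The set where it is positive is then open and null, hence empty.\<close>

lemma bounded_subharmonic_plane:
  assumes F: "smooth_on UNIV F" and real: "\<And>z. F z \<in> \<real>" and bdd: "AE z in lborel. norm (F z) \<le> C"
    and nonneg: "\<And>z. Re (d_zbar (d_z F) z) \<ge> 0"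
  shows "Re (d_zbar (d_z F) z) = 0"
proof -
  let ?w = "\<lambda>z. Re (d_zbar (d_z F) z)"
  have cont: "continuous_on UNIV ?w"
    using smooth_on_imp_continuous_on[OF smooth_on_d_zbar[OF _ smooth_on_d_z[OF _ F]]] by (auto intro: continuous_intros)
  then have [measurable]: "?w \<in> borel_measurable borel" by (rule borel_measurable_continuous_onI)
  have neg: "(\<integral>\<^sup>+z. ennreal (- ?w z) \<partial>lborel) = 0" using nonneg by (simp add: ennreal_neg)
  then have "(\<integral>\<^sup>+z. ennreal (?w z) \<partial>lborel) = 0" using parabolic_smooth[OF F real bdd] by simp
  then have "AE z in lborel. ennreal (?w z) = 0" by (subst (asm) nn_integral_0_iff_AE) auto
  then have ae: "AE z in lborel. \<not> ?w z > 0" by eventually_elim auto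
  have op: "open {z. ?w z > 0}" using cont by (intro open_Collect_less) auto
  have "emeasure lborel {z. ?w z > 0} = 0" using ae by (subst (asm) AE_iff_measurable[OF _ refl]) (use op in auto)
  then have "{z. ?w z > 0} \<in> null_sets lborel" using op by (simp add: null_sets_def borel_open)
  then have "negligible {z. ?w z > 0}" unfolding negligible_iff_null_sets by (rule null_sets_completionI)
  then have "{z. ?w z > 0} = {}" using open_not_negligible[OF op] by blast
  then have "\<not> ?w z > 0" by blast
  then show ?thesis using nonneg[of z] by linarith
qed

context cvs begin

lemma quot_matrix:
  assumes b: "basis_list V b" and H1: "herm_on V H1" and H2: "herm_on V H2"
    and ik: "i < length b" "k < length b"
  shows "cf b k (quot V H1 H2 (b ! i)) = (gram H2 b * minv (gram H1 b)) $$ (i, k)"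
proof -
  let ?n = "length b" and ?A = "gram H1 b" and ?B = "gram H2 b"
  let ?M = "?B * minv ?A"
  note sub = basis_list_subspace[OF b] and bs = basis_list_set[OF b]
  note A = gram_carrier[of H1 b] and B = gram_carrier[of H2 b]
  note Ai = minv_carrier[OF A]
  have M: "?M \<in> carrier_mat ?n ?n" by (rule mult_carrier_mat[OF B Ai])
  obtain d where "d > 0" "Determinant.det ?A = of_real d" using det_gram_pos[OF H1 b] by blast
  then have det: "Determinant.det ?A \<noteq> 0" by simp
  have MA: "?M * ?A = ?B"
    unfolding assoc_mult_mat[OF B Ai A] minv_mult(2)[OF A det] by (rule right_mult_one_mat[OF B])
  let ?m = "comb (\<lambda>k. ?M $$ (i, k)) b"
  have m: "?m \<in> V" by (rule comb_in[OF sub bs])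
  have "quot V H1 H2 (b ! i) = ?m"
  proof (rule quot_eqI[OF b H1 H2 basis_list_nth[OF b ik(1)] m])
    fix v assume v: "v \<in> V"
    have "H1 ?m (b ! j) = H2 (b ! i) (b ! j)" if j: "j < ?n" for j
    proof -
      have "H1 ?m (b ! j) = (\<Sum>k<?n. ?M $$ (i, k) * H1 (b ! k) (b ! j))"
        by (rule herm_comb(1)[OF sub H1 bs basis_list_nth[OF b j]])
      also have "\<dots> = (\<Sum>k<?n. ?M $$ (i, k) * ?A $$ (k, j))"
        using j by (intro sum.cong) (auto simp: gram_def)
      also have "\<dots> = (?M * ?A) $$ (i, j)" by (rule mat_mult_index[OF M A ik(1) j, symmetric])
      also have "\<dots> = H2 (b ! i) (b ! j)" unfolding MA using ik j by (simp add: gram_def)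
      finally show ?thesis .
    qed
    then have "(\<Sum>j<?n. cnj (cf b j v) * H2 (b ! i) (b ! j)) = (\<Sum>j<?n. cnj (cf b j v) * H1 ?m (b ! j))"
      by (intro sum.cong) auto
    then have "H2 (b ! i) (comb (\<lambda>j. cf b j v) b) = H1 ?m (comb (\<lambda>j. cf b j v) b)"
      unfolding herm_comb(2)[OF sub H2 bs basis_list_nth[OF b ik(1)]] herm_comb(2)[OF sub H1 bs m] .
    then show "H2 (b ! i) v = H1 ?m v" by (simp only: comb_cf[OF b v])
  qed
  then show ?thesis using cf_comb[OF b ik(2), of "\<lambda>k. ?M $$ (i, k)"] by simp
qed

end

section \<open>The quotient of two Hermitian-Einstein metrics\<close>

locale he_pair = hvb E + K: hvb_metric E K + H1: hvb_metric E H1 + H2: hvb_metric E H2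
  for E :: "('v::ab_group_add) hol_bundle" and K H1 H2 :: "'v metric" +
  assumes he: "hermitian_einstein E H1" "hermitian_einstein E H2"
    and comp: "compatible E K H1" "compatible E K H2"
begin

text \<open>Almost everywhere only, because compatibility bounds the endomorphism in the essential
  supremum. Constants are at least 1 so that they can enter
  \<open>herm_reverse_bound\<close>.\<close>

definition dominated :: "'v metric \<Rightarrow> 'v metric \<Rightarrow> bool" where
  "dominated A B \<longleftrightarrow> (\<exists>C\<ge>1. AE z in lborel. \<forall>v\<in>fibre E z. Re (A z v v) \<le> C * Re (B z v v))"

lemma dominated_trans:
  assumes "dominated A B" "dominated B D" shows "dominated A D"
proof -
  obtain C1 where C1: "C1 \<ge> 1" "AE z in lborel. \<forall>v\<in>fibre E z. Re (A z v v) \<le> C1 * Re (B z v v)"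
    using assms(1) by (auto simp: dominated_def)
  obtain C2 where C2: "C2 \<ge> 1" "AE z in lborel. \<forall>v\<in>fibre E z. Re (B z v v) \<le> C2 * Re (D z v v)"
    using assms(2) by (auto simp: dominated_def)
  have "AE z in lborel. \<forall>v\<in>fibre E z. Re (A z v v) \<le> (C1 * C2) * Re (D z v v)"
    using C1(2) C2(2)
  proof eventually_elim
    case (elim z)
    show ?case
    proof
      fix v assume v: "v \<in> fibre E z"
      have "C1 * Re (B z v v) \<le> C1 * (C2 * Re (D z v v))"
        using elim(2) v C1(1) by (intro mult_left_mono) auto
      then show "Re (A z v v) \<le> (C1 * C2) * Re (D z v v)" using elim(1) v by (fastforce simp: mult.assoc)
    qed
  qed
  moreover have "C1 * C2 \<ge> 1" using C1(1) C2(1) mult_mono[of 1 C1 1 C2] by simp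
  ultimately show ?thesis unfolding dominated_def by blast
qed

lemma dominated_by_background:
  assumes "hvb_metric E H" "compatible E K H" shows "dominated H K" "dominated K H"
proof -
  interpret H: hvb_metric E H by (rule assms(1))
  obtain C where C: "AE z in lborel. \<bar>end_norm E K z (metric_quotient E K H z)\<bar> \<le> C"
    using assms(2) by (auto simp: compatible_def Let_def)
  \<comment> \<open>The inner maximum supplies the nonnegative bound that
    \<open>herm_le_of_quot_norm\<close> expects; the factor \<open>rk\<close> is the loss in that
    lemma, and the outer maximum prepares the reverse bound.\<close>
  define C' where "C' = max 1 (max C 0 * real rk)"
  have le: "AE z in lborel. \<forall>v\<in>fibre E z. Re (H z v v) \<le> C' * Re (K z v v)"
    using C
  proof eventually_elim
    case (elim z)
    show ?case
    proof
      fix v assume v: "v \<in> fibre E z"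
      note b = basis_frame_at[of z]
      have "sqrt (Re (tr (ev (frame_at E z) z) (quot (fibre E z) (K z) (H z) \<circ> adj (fibre E z) (K z) (quot (fibre E z) (K z) (H z))))) \<le> max C 0"
        using elim unfolding end_norm_eq metric_quotient_eq by linarith
      from herm_le_of_quot_norm[OF b K.herm_fibre H.herm_fibre _ this v]
      have "Re (H z v v) \<le> max C 0 * real rk * Re (K z v v)"
        using length_frame[OF b] by simp
      also have "\<dots> \<le> C' * Re (K z v v)"
        using herm_self(2)[OF subspace_fibre K.herm_fibre v] unfolding C'_def by (intro mult_right_mono) auto
      finally show "Re (H z v v) \<le> C' * Re (K z v v)" .
    qed
  qed
  have C': "C' \<ge> 1" by (simp add: C'_def)
  show "dominated H K" unfolding dominated_def using le C' by blast
  have "AE z in lborel. \<forall>v\<in>fibre E z. Re (K z v v) \<le> (fact rk * C' ^ rk)\<^sup>2 * Re (H z v v)"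
    using le
  proof eventually_elim
    case (elim z)
    show ?case
    proof
      fix v assume v: "v \<in> fibre E z"
      define e where "e = frame_at E z"
      obtain U where U: "(U, e) \<in> frames E" "z \<in> U" using frame_at_frame e_def by blast
      have b: "basis_list (fibre E z) (ev e z)" by (rule framesD(2)[OF U])
      have "gram_det K e z = gram_det H e z"
        using assms(2) U unfolding compatible_def by blast
      then have det: "Determinant.det (gram (H z) (ev e z)) = Determinant.det (gram (K z) (ev e z))"
        by (simp add: gram_det_eq GM_def)
      show "Re (K z v v) \<le> (fact rk * C' ^ rk)\<^sup>2 * Re (H z v v)"
        using herm_reverse_bound[OF H.herm_fibre K.herm_fibre b _ C' det v] elim length_frame[OF b] by simp
    qed
  qed
  moreover have "(1::real) \<le> (fact rk * C' ^ rk)\<^sup>2"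
    using mult_mono[OF fact_ge_1[where 'a = real] one_le_power[OF C', of rk], of rk] by (intro one_le_power) simp
  ultimately show "dominated K H" unfolding dominated_def by blast
qed

lemma dominated_metrics:
  "dominated H1 K" "dominated K H1" "dominated H2 K" "dominated K H2" "dominated H2 H1"
  using dominated_by_background[OF H1.hvb_metric_axioms comp(1)] dominated_by_background[OF H2.hvb_metric_axioms comp(2)]
    dominated_trans by blast+

text \<open>The endomorphism \<open>h\<close> of the overview.\<close>

definition quo :: "complex \<Rightarrow> 'v \<Rightarrow> 'v" where "quo z = quot (fibre E z) (H1 z) (H2 z)"

lemma endo_quo: "endo (fibre E z) (quo z)"
  unfolding quo_def by (rule endo_quot[OF basis_frame_at H1.herm_fibre H2.herm_fibre])

lemma quo_matrix:
  assumes "basis_list (fibre E z) (ev e z)" "i < rk" "j < rk"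
  shows "cf (ev e z) j (quo z ((e ! i) z)) = quot_mat (GM H1 e) (GM H2 e) z $$ (i, j)"
proof -
  have l: "length e = rk" using length_frame[OF assms(1)] by simp
  show ?thesis
    using quot_matrix[OF assms(1) H1.herm_fibre H2.herm_fibre, of i j] assms(2,3) l
    by (simp add: quo_def quot_mat_def GM_def)
qed

lemma det_GM_eq:
  assumes "(U, e) \<in> frames E" "z \<in> U"
  shows "Determinant.det (GM H1 e z) = Determinant.det (GM H2 e z)" "Determinant.det (GM H1 e z) = Determinant.det (GM K e z)"
proof -
  have "gram_det K e z = gram_det H1 e z" "gram_det K e z = gram_det H2 e z"
    using comp assms unfolding compatible_def by blast+
  then show "Determinant.det (GM H1 e z) = Determinant.det (GM H2 e z)" "Determinant.det (GM H1 e z) = Determinant.det (GM K e z)"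
    by (simp_all add: gram_det_eq)
qed

text \<open>Both metrics have the determinant of \<open>K\<close>, so the traces agree, and each
  \<open>theta\<close> is a multiple of the identity determined by its trace.\<close>

lemma theta_eq:
  assumes U: "(U, e) \<in> frames E" and z: "z \<in> U"
  shows "theta rk (GM H1 e) z = theta rk (GM H2 e) z"
proof -
  have ne: "U \<noteq> {}" using z by blast
  note G1 = H1.frame_GM[OF U ne] and G2 = H2.frame_GM[OF U ne]
  let ?L = "\<lambda>D z. d_zbar (\<lambda>w. d_z D w / D w) z :: complex"
  have "d_z (\<lambda>w. Determinant.det (GM H1 e w)) w / Determinant.det (GM H1 e w) =
      d_z (\<lambda>w. Determinant.det (GM H2 e w)) w / Determinant.det (GM H2 e w)" if w: "w \<in> U" for w
    unfolding det_GM_eq(1)[OF U w]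
    by (simp only: D_cong[OF wirtinger(1) G1(1) w det_GM_eq(1)[OF U]])
  from D_cong[OF wirtinger(2) G1(1) z this]
  have "mtrace (theta rk (GM H1 e) z) = mtrace (theta rk (GM H2 e) z)"
    unfolding mtrace_theta[OF G1(1,2,3) z] mtrace_theta[OF G2(1,2,3) z] .
  then have "theta rk (GM H1 e) z $$ (i, j) = theta rk (GM H2 e) z $$ (i, j)" if "i < rk" "j < rk" for i j
    unfolding H1.hermitian_einstein_theta[OF he(1) U z that] H2.hermitian_einstein_theta[OF he(2) U z that] by simp
  then show ?thesis by (intro eq_matI) (auto simp: theta_def dmat_def)
qed

definition tr_quo :: "complex \<Rightarrow> complex" where "tr_quo z = tr (ev (frame_at E z) z) (quo z)"

lemma tr_quo_frame:
  assumes b: "basis_list (fibre E z) (ev e z)"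
  shows "tr_quo z = mtrace (quot_mat (GM H1 e) (GM H2 e) z)"
proof -
  have l: "length e = rk" using length_frame[OF b] by simp
  have "tr_quo z = tr (ev e z) (quo z)" unfolding tr_quo_def by (rule tr_basis_indep[OF basis_frame_at b endo_quo])
  also have "\<dots> = (\<Sum>i<rk. quot_mat (GM H1 e) (GM H2 e) z $$ (i, i))"
    unfolding tr_def using quo_matrix[OF b] l by (intro sum.cong) auto
  also have "\<dots> = mtrace (quot_mat (GM H1 e) (GM H2 e) z)"
    using l by (simp add: mtrace_def quot_mat_def GM_def gram_def)
  finally show ?thesis .
qed

lemma quo_local:
  assumes U: "(U, e) \<in> frames E" and z: "z \<in> U"
  defines "T \<equiv> mtrace (conn_diff rk (GM H1 e) (GM H2 e) z * (GM H2 e z * ctranspose (conn_diff rk (GM H1 e) (GM H2 e) z) * minv (GM H1 e z)))"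
  shows "d_zbar (d_z tr_quo) z = T" "Re T \<ge> 0" "Re T = 0 \<Longrightarrow> dmat d_zbar rk (quot_mat (GM H1 e) (GM H2 e)) z = 0\<^sub>m rk rk"
proof -
  have ne: "U \<noteq> {}" using z by blast
  note G1 = H1.frame_GM[OF U ne] and G2 = H2.frame_GM[OF U ne]
  note b = framesD(2)[OF U]
  have l: "length (ev e z) = rk" using length_frame[OF b[OF z]] by simp
  let ?X = "conn_diff rk (GM H1 e) (GM H2 e) z"
  have X: "?X \<in> carrier_mat (length (ev e z)) (length (ev e z))"
    unfolding l by (rule smooth_matD(1)[OF smooth_conn_diff[OF G1 G2(2,3,4)] z])
  have "d_z tr_quo w = d_z (\<lambda>w. mtrace (quot_mat (GM H1 e) (GM H2 e) w)) w" if "w \<in> U" for w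
    by (rule D_cong[OF wirtinger(1) G1(1) that tr_quo_frame[OF b]])
  then have "d_zbar (d_z tr_quo) z = d_zbar (d_z (\<lambda>w. mtrace (quot_mat (GM H1 e) (GM H2 e) w))) z"
    by (rule D_cong[OF wirtinger(2) G1(1) z])
  also have "\<dots> = T"
    unfolding T_def by (rule laplacian_trace_quot_mat[OF G1 G2(2,3,4) theta_eq[OF U] z])
  finally show "d_zbar (d_z tr_quo) z = T" .
  note pos = mtrace_positive[OF b[OF z] H1.herm_fibre H2.herm_fibre X, folded GM_def, folded T_def]
  show "Re T \<ge> 0" by (rule pos(1))
  assume "Re T = 0"
  then have X0: "?X = 0\<^sub>m rk rk" using pos(2) l by simp
  have c0: "ctranspose (0\<^sub>m rk rk) = 0\<^sub>m rk rk" by (intro eq_matI) (auto simp: ctranspose_def)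
  have "GM H2 e z * 0\<^sub>m rk rk * minv (GM H1 e z) = 0\<^sub>m rk rk"
    unfolding right_mult_zero_mat[OF smooth_matD(1)[OF G2(2) z]]
    by (rule left_mult_zero_mat[OF minv_carrier[OF smooth_matD(1)[OF G1(2) z]]])
  then show "dmat d_zbar rk (quot_mat (GM H1 e) (GM H2 e)) z = 0\<^sub>m rk rk"
    unfolding dzbar_quot_mat[OF G1 G2(2,3,4) z] X0 c0 .
qed

lemma smooth_tr_quo: "smooth_on UNIV tr_quo"
proof (rule smooth_on_local)
  fix z :: complex
  obtain U e where U: "(U, e) \<in> frames E" "z \<in> U" using frame_ex by blast
  then have ne: "U \<noteq> {}" by blast
  note G1 = H1.frame_GM[OF U(1) ne] and G2 = H2.frame_GM[OF U(1) ne]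
  have "smooth_on U tr_quo"
    by (rule smooth_on_transform[OF G1(1) mtrace_smooth[OF G1(1) smooth_quot_mat[OF G1 G2(2,3,4)]]])
      (rule tr_quo_frame[OF framesD(2)[OF U(1)]])
  then show "\<exists>V. open V \<and> z \<in> V \<and> smooth_on V tr_quo" using G1(1) U by blast
qed

lemma tr_quo_real: "tr_quo z \<in> \<real>"
proof -
  note b = basis_frame_at[of z]
  obtain o' where o': "onb (fibre E z) (H1 z) o'" using onb_ex[OF subspace_fibre H1.herm_fibre b] by blast
  then have bo: "basis_list (fibre E z) o'" by (simp add: onb_def[OF subspace_fibre H1.herm_fibre])
  have "H1 z (quo z v) v \<in> \<real>" if v: "v \<in> fibre E z" for v
  proof -
    have "H1 z (quo z v) v = H2 z v v"
      unfolding quo_def by (rule quot(2)[OF b H1.herm_fibre H2.herm_fibre v v, symmetric])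
    moreover have "H2 z v v \<in> \<real>"
      by (subst herm_self(1)[OF subspace_fibre H2.herm_fibre v]) (rule Reals_of_real)
    ultimately show ?thesis by (simp only:)
  qed
  then have "(\<Sum>i<length o'. H1 z (quo z (o' ! i)) (o' ! i)) \<in> \<real>"
    using basis_list_nth[OF bo] by (intro sum_in_Reals) auto
  then show ?thesis
    unfolding tr_quo_def tr_basis_indep[OF b bo endo_quo] tr_onb[OF b H1.herm_fibre o' endo_quo] .
qed

lemma tr_quo_bounded: "\<exists>C. AE z in lborel. norm (tr_quo z) \<le> C"
proof -
  obtain C where C: "AE z in lborel. \<forall>v\<in>fibre E z. Re (H2 z v v) \<le> C * Re (H1 z v v)"
    using dominated_metrics(5) by (auto simp: dominated_def)
  have "AE z in lborel. norm (tr_quo z) \<le> real rk * C"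
    using C
  proof eventually_elim
    case (elim z)
    note t = tr_quot_le[OF basis_frame_at H1.herm_fibre H2.herm_fibre, of z C]
    have le: "Re (H2 z v v) \<le> C * Re (H1 z v v)" if "v \<in> fibre E z" for v using elim that by blast
    have "of_real (Re (tr_quo z)) = tr_quo z" using tr_quo_real by (rule of_real_Re)
    from arg_cong[OF this[symmetric], of norm] have "norm (tr_quo z) = \<bar>Re (tr_quo z)\<bar>" unfolding norm_of_real .
    then show ?case using t(2,3)[OF le] length_frame[OF basis_frame_at[of z]] by (simp add: tr_quo_def quo_def)
  qed
  then show ?thesis by blast
qed

text \<open>The trace is bounded and subharmonic, so its Laplacian vanishes identically. By the
  positivity in \<open>quo_local\<close> the difference of the connection forms is 0, and the
  \<open>d_zbar\<close> derivative of the quotient contains that difference as a factor.\<close>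

theorem quo_holomorphic:
  assumes U: "(U, e) \<in> frames E" and ij: "i < rk" "j < rk"
  shows "(\<lambda>z. cf (ev e z) j (quo z ((e ! i) z))) holomorphic_on U"
proof (cases "U = {}")
  case False
  note G1 = H1.frame_GM[OF U False] and G2 = H2.frame_GM[OF U False]
  obtain C where C: "AE z in lborel. norm (tr_quo z) \<le> C" using tr_quo_bounded by blast
  have nonneg: "Re (d_zbar (d_z tr_quo) z) \<ge> 0" for z
  proof -
    obtain V f where V: "(V, f) \<in> frames E" "z \<in> V" using frame_ex by blast
    show ?thesis using quo_local(1,2)[OF V] by simp
  qed
  have zero: "Re (d_zbar (d_z tr_quo) z) = 0" for z
    by (rule bounded_subharmonic_plane[OF smooth_tr_quo tr_quo_real C nonneg])
  have "(\<lambda>z. quot_mat (GM H1 e) (GM H2 e) z $$ (i, j)) holomorphic_on U"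
  proof (rule d_zbar_eq_0_imp_holomorphic[OF G1(1)])
    show "(\<lambda>z. quot_mat (GM H1 e) (GM H2 e) z $$ (i, j)) differentiable at z" if "z \<in> U" for z
      by (rule smooth_matD(3)[OF smooth_quot_mat[OF G1 G2(2,3,4)] ij that])
    fix z assume z: "z \<in> U"
    have "dmat d_zbar rk (quot_mat (GM H1 e) (GM H2 e)) z = 0\<^sub>m rk rk"
      using quo_local(3)[OF U z] zero[of z] unfolding quo_local(1)[OF U z] by blast
    then have "dmat d_zbar rk (quot_mat (GM H1 e) (GM H2 e)) z $$ (i, j) = 0" using ij by simp
    then show "d_zbar (\<lambda>z. quot_mat (GM H1 e) (GM H2 e) z $$ (i, j)) z = 0" using ij by (simp add: dmat_index)
  qed
  then show ?thesis
    by (rule holomorphic_transform) (rule quo_matrix[OF framesD(2)[OF U] ij, symmetric])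
qed (simp add: holomorphic_on_def)

end

section \<open>Spectral projections\<close>

text \<open>The imaginary part is constantly 0, so the imaginary part of \<open>f' v\<close>
  vanishes for \<open>v = 1\<close> and for \<open>v = \<i>\<close>, which forces
  \<open>f' = 0\<close>.\<close>

lemma holomorphic_real_constant:
  assumes f: "f holomorphic_on UNIV" and real: "\<And>z. f z \<in> \<real>"
  shows "f z = f w"
proof -
  have "(f has_field_derivative 0) (at z)" for z
  proof -
    have d: "(f has_field_derivative deriv f z) (at z)" using f holomorphic_derivI by blast
    then have "(f has_derivative (*) (deriv f z)) (at z)" by (simp add: has_field_derivative_def)
    then have "((\<lambda>w. Im (f w)) has_derivative (\<lambda>v. Im (deriv f z * v))) (at z)" by (rule has_derivative_Im)
    moreover have "(\<lambda>w. Im (f w)) = (\<lambda>w. 0)" using real by (simp add: complex_is_Real_iff)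
    ultimately have "((\<lambda>w. 0) has_derivative (\<lambda>v. Im (deriv f z * v))) (at z)" by simp
    then have "(\<lambda>v. Im (deriv f z * v)) = (\<lambda>v. 0)" using has_derivative_const by (rule has_derivative_unique)
    then have "Im (deriv f z * 1) = 0" "Im (deriv f z * \<i>) = 0" by (rule fun_cong)+
    then have "deriv f z = 0" by (simp add: complex_eq_iff)
    then show ?thesis using d by simp
  qed
  then show ?thesis using has_field_derivative_zero_constant[OF convex_UNIV, of f] by (metis UNIV_I)
qed

section \<open>Polynomials in a self-adjoint endomorphism\<close>

context cvs begin

text \<open>Horner's scheme applied to a vector. The recursion on coefficients uses only scaling,
  addition and \<open>T\<close>, so properties stable under these, such as sending holomorphic
  sections to holomorphic ones, follow by induction.\<close>

definition peval :: "('v \<Rightarrow> 'v) \<Rightarrow> complex poly \<Rightarrow> 'v \<Rightarrow> 'v" where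
  "peval T p = fold_coeffs (\<lambda>a S v. a *c v + T (S v)) p (\<lambda>v. 0)"

context
  fixes V T assumes sub: "subspace V" and T: "endo V T"
begin

lemma peval_0 [simp]: "peval T 0 v = 0"
  by (simp add: peval_def)

lemma peval_pCons: "peval T (pCons a p) v = a *c v + T (peval T p v)"
proof (cases "a = 0 \<and> p = 0")
  case True
  then show ?thesis using endo_zero[OF T sub] by (simp add: peval_def)
next
  case False
  then show ?thesis
    by (auto simp: peval_def fold_coeffs_pCons_coeff_not_0_eq fold_coeffs_pCons_not_0_0_eq)
qed

lemma endo_peval: "endo V (peval T p)"
proof (induction p)
  case 0
  then show ?case using subspace_0[OF sub] by (simp add: endo_def)
next
  case (pCons a p)
  have c: "a *c u + T w \<in> V" if "u \<in> V" "w \<in> V" for u w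
    using that subspace_add[OF sub] subspace_scale[OF sub] endo_in[OF T] by simp
  show ?case
    unfolding endo_def peval_pCons
  proof (intro conjI ballI allI)
    fix u v x y assume u: "u \<in> V" and v: "v \<in> V"
    have P: "peval T p (x *c u + y *c v) = x *c peval T p u + y *c peval T p v"
      using pCons.IH u v by (simp add: endo_def)
    have T': "T (x *c peval T p u + y *c peval T p v) = x *c T (peval T p u) + y *c T (peval T p v)"
      using T endo_in[OF pCons.IH u] endo_in[OF pCons.IH v] by (simp add: endo_def)
    show "a *c (x *c u + y *c v) + T (peval T p (x *c u + y *c v)) =
        x *c (a *c u + T (peval T p u)) + y *c (a *c v + T (peval T p v))"
      unfolding P T' by (simp add: scale_right_distrib mult.commute)
  qed (use c endo_in[OF pCons.IH] in blast)
qed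

lemma peval_in: "v \<in> V \<Longrightarrow> peval T p v \<in> V"
  by (rule endo_in[OF endo_peval])

lemma peval_add: "v \<in> V \<Longrightarrow> peval T (p + r) v = peval T p v + peval T r v"
proof (induction p arbitrary: r)
  case (pCons a p)
  obtain b r' where r: "r = pCons b r'" by (rule pCons_cases)
  have "peval T (pCons a p + r) v = (a + b) *c v + T (peval T p v + peval T r' v)"
    unfolding r using pCons by (simp add: peval_pCons)
  also have "\<dots> = (a + b) *c v + (T (peval T p v) + T (peval T r' v))"
    using endo_add[OF T peval_in peval_in] pCons.prems by simp
  finally show ?case unfolding r by (simp add: peval_pCons scale_left_distrib)
qed simp

lemma peval_smult: "v \<in> V \<Longrightarrow> peval T (Polynomial.smult c p) v = c *c peval T p v"
proof (induction p)
  case (pCons a p)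
  then have "T (c *c peval T p v) = c *c T (peval T p v)" by (intro endo_scale[OF T] peval_in)
  then show ?case using pCons by (simp add: peval_pCons scale_right_distrib)
qed simp

lemma peval_mult: "v \<in> V \<Longrightarrow> peval T (p * r) v = peval T p (peval T r v)"
proof (induction p)
  case (pCons a p)
  then show ?case by (simp add: peval_add peval_smult peval_pCons)
qed simp

lemma peval_commute: "v \<in> V \<Longrightarrow> peval T p (peval T r v) = peval T r (peval T p v)"
  using peval_mult[of v p r] peval_mult[of v r p] by (simp add: mult.commute)

lemma peval_X: "v \<in> V \<Longrightarrow> peval T [:a, 1:] v = a *c v + T v"
  by (simp add: peval_pCons endo_zero[OF T sub])

lemma peval_const: "peval T [:a:] v = a *c v"
  by (simp add: peval_pCons endo_zero[OF T sub])

lemma peval_sum: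
  assumes "\<And>k. k \<ge> N \<Longrightarrow> coeff p k = 0" "v \<in> V"
  shows "peval T p v = (\<Sum>k<N. coeff p k *c (T ^^ k) v)"
  using assms(1)
proof (induction p arbitrary: N)
  case 0
  then show ?case by simp
next
  case (pCons a p)
  have it: "(T ^^ k) v \<in> V" for k using assms(2) by (induction k) (auto intro: endo_in[OF T])
  show ?case
  proof (cases N)
    case 0
    then have "pCons a p = 0" using pCons.prems by (intro poly_eqI) simp
    then show ?thesis using pCons.hyps by simp
  next
    case (Suc M)
    have "coeff p k = 0" if "k \<ge> M" for k using pCons.prems[of "Suc k"] that Suc by simp
    then have "peval T p v = (\<Sum>k<M. coeff p k *c (T ^^ k) v)" by (rule pCons.IH)
    then have "peval T (pCons a p) v = a *c v + T (\<Sum>k<M. coeff p k *c (T ^^ k) v)" by (simp add: peval_pCons)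
    also have "T (\<Sum>k<M. coeff p k *c (T ^^ k) v) = (\<Sum>k<M. T (coeff p k *c (T ^^ k) v))"
      by (rule endo_sum[OF T sub]) (intro subspace_scale[OF sub] it)
    also have "\<dots> = (\<Sum>k<M. coeff p k *c (T ^^ Suc k) v)"
      using endo_scale[OF T it] by (intro sum.cong) auto
    finally show ?thesis unfolding Suc by (simp add: sum.lessThan_Suc_shift del: sum.lessThan_Suc)
  qed
qed

text \<open>The powers of \<open>T\<close> from 0 to \<open>n^2\<close> are \<open>n^2 + 1\<close>
  vectors in a space of dimension \<open>n^2\<close>, hence linearly dependent.\<close>

lemma annihilating_poly:
  assumes b: "basis_list V b"
  shows "\<exists>p. p \<noteq> 0 \<and> (\<forall>v\<in>V. peval T p v = 0)"
proof -
  let ?n = "length b"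
  define m where "m = ?n * ?n"
  have it: "(T ^^ k) v \<in> V" if "v \<in> V" for k v using that by (induction k) (auto intro: endo_in[OF T])
  \<comment> \<open>Column \<open>k\<close> lists the \<open>n^2\<close> matrix entries of the
    \<open>k\<close>-th power of \<open>T\<close>, indexed by quotient and remainder modulo
    \<open>n\<close>. The last row of zeros makes the matrix square and singular, and a kernel
    vector gives the coefficients.\<close>
  define A where "A = Matrix.mat (Suc m) (Suc m) (\<lambda>(l, k). if l < m then cf b (l mod ?n) ((T ^^ k) (b ! (l div ?n))) else 0)"
  have A: "A \<in> carrier_mat (Suc m) (Suc m)" by (simp add: A_def)
  have "Determinant.det A = (\<Sum>j<Suc m. A $$ (m, j) * cofactor A m j)"
    by (rule laplace_expansion_row[OF A]) simp
  also have "\<dots> = 0" by (intro sum.neutral) (simp add: A_def)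
  finally obtain x where x: "x \<in> carrier_vec (Suc m)" "x \<noteq> 0\<^sub>v (Suc m)" "A *\<^sub>v x = 0\<^sub>v (Suc m)"
    using det_0_iff_vec_prod_zero[OF A] by blast
  define p where "p = Poly (map (\<lambda>k. x $ k) [0..<Suc m])"
  have cp: "coeff p k = (if k < Suc m then x $ k else 0)" for k
    by (simp add: p_def nth_default_def del: upt_Suc)
  have "p \<noteq> 0"
  proof
    assume "p = 0"
    then have "x $ k = 0" if "k < Suc m" for k using cp[of k] that by simp
    then have "x = 0\<^sub>v (Suc m)" using x(1) by (intro eq_vecI) auto
    then show False using x(2) by blast
  qed
  moreover have "peval T p v = 0" if v: "v \<in> V" for v
  proof -
    have bi: "peval T p (b ! i) = 0" if i: "i < ?n" for i
    proof (rule cf_eqI[OF b peval_in[OF basis_list_nth[OF b i]] subspace_0[OF sub]])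
      fix j assume j: "j < ?n"
      define l where "l = i * ?n + j"
      have "i * ?n + j < i * ?n + ?n" using j by simp
      also have "\<dots> = Suc i * ?n" by simp
      also have "\<dots> \<le> m" unfolding m_def using i by (intro mult_le_mono1) simp
      finally have l: "l < m" by (simp add: l_def)
      have dm: "(i * n + j) div n = i \<and> (i * n + j) mod n = j" if "j < n" for n using that by auto
      have ld: "l div ?n = i" "l mod ?n = j" using dm[OF j] by (simp_all add: l_def)
      have "(A *\<^sub>v x) $ l = (\<Sum>k<Suc m. A $$ (l, k) * x $ k)"
        using A x(1) l by (simp add: scalar_prod_def atLeast0LessThan)
      also have "\<dots> = (\<Sum>k<Suc m. x $ k * cf b j ((T ^^ k) (b ! i)))"
        using l ld by (intro sum.cong) (auto simp: A_def)
      finally have "(\<Sum>k<Suc m. x $ k * cf b j ((T ^^ k) (b ! i))) = 0" using x(3) l by simp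
      moreover have "cf b j (peval T p (b ! i)) = (\<Sum>k<Suc m. x $ k * cf b j ((T ^^ k) (b ! i)))"
      proof -
        have "peval T p (b ! i) = (\<Sum>k<Suc m. coeff p k *c (T ^^ k) (b ! i))"
          by (rule peval_sum[OF _ basis_list_nth[OF b i]]) (simp add: cp)
        also have "cf b j \<dots> = (\<Sum>k<Suc m. cf b j (coeff p k *c (T ^^ k) (b ! i)))"
          by (rule cf_sum[OF b]) (intro subspace_scale[OF sub] it basis_list_nth[OF b i])
        also have "\<dots> = (\<Sum>k<Suc m. x $ k * cf b j ((T ^^ k) (b ! i)))"
          by (intro sum.cong refl) (simp add: cf_scale[OF b it[OF basis_list_nth[OF b i]]] cp)
        finally show ?thesis .
      qed
      ultimately show "cf b j (peval T p (b ! i)) = cf b j 0" by simp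
    qed
    have "peval T p v = peval T p (comb (\<lambda>i. cf b i v) b)" by (simp only: comb_cf[OF b v])
    also have "\<dots> = (\<Sum>i<?n. cf b i v *c peval T p (b ! i))"
      by (rule endo_comb[OF endo_peval sub basis_list_set[OF b]])
    also have "\<dots> = 0" using bi by simp
    finally show ?thesis .
  qed
  ultimately show ?thesis by blast
qed

context
  fixes H assumes H: "herm_on V H" and sa: "\<And>u v. u \<in> V \<Longrightarrow> v \<in> V \<Longrightarrow> H (T u) v = H u (T v)"
begin

text \<open>Self-adjointness moves each \<open>T\<close> to the other side, and scalars are
  conjugated on the way.\<close>

lemma peval_adjoint: "u \<in> V \<Longrightarrow> v \<in> V \<Longrightarrow> H (peval T p u) v = H u (peval T (map_poly cnj p) v)"
proof (induction p arbitrary: u v)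
  case 0
  then show ?case using herm_zero[OF sub H] by simp
next
  case (pCons a p)
  note u = pCons.prems(1) and v = pCons.prems(2)
  note pu = peval_in[OF u, of p] and pv = peval_in[OF v, of "map_poly cnj p"]
  note Tu = endo_in[OF T pu] and Tv = endo_in[OF T pv]
  have X: "peval T (map_poly cnj p) (T v) = T (peval T (map_poly cnj p) v)"
    using peval_commute[OF v, of "map_poly cnj p" "[:0, 1:]"] peval_X[OF v, of 0] peval_X[OF pv, of 0] by simp
  have "H (peval T (pCons a p) u) v = a * H u v + H (T (peval T p u)) v"
    unfolding peval_pCons herm_add[OF sub H subspace_scale[OF sub u] Tu v] herm_scale[OF sub H u v] ..
  also have "H (T (peval T p u)) v = H u (T (peval T (map_poly cnj p) v))"
    unfolding sa[OF pu v] pCons.IH[OF u endo_in[OF T v]] X ..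
  also have "a * H u v + \<dots> = H u (cnj a *c v + T (peval T (map_poly cnj p) v))"
    unfolding herm_add_right[OF sub H subspace_scale[OF sub v] Tv u] herm_scale_right[OF sub H v u] by simp
  also have "cnj a *c v + T (peval T (map_poly cnj p) v) = peval T (map_poly cnj (pCons a p)) v"
    by (simp add: map_poly_pCons peval_pCons)
  finally show ?case .
qed

text \<open>The squared length of \<open>p(T) v\<close> is \<open>H v\<close> applied to the
  conjugate polynomial of \<open>T\<close> at \<open>p(T) v\<close>, which is 0.\<close>

lemma peval_self_square_0:
  assumes v: "v \<in> V" and z: "peval T (map_poly cnj p * p) v = 0" shows "peval T p v = 0"
proof -
  note pv = peval_in[OF v, of p]
  have "H (peval T p v) (peval T p v) = H v (peval T (map_poly cnj p) (peval T p v))" by (rule peval_adjoint[OF v pv])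
  also have "\<dots> = 0" using z herm_zero(2)[OF sub H v] unfolding peval_mult[OF v] by simp
  finally show ?thesis using herm_self(3)[OF sub H pv] by simp
qed

text \<open>With \<open>q\<close> the conjugate polynomial, the trace is the sum of the squared
  lengths of \<open>q(T) o_i\<close> over an orthonormal basis, hence real. If it is 0, then
  \<open>q(T) = 0\<close>, so \<open>q(T) p(T) = 0\<close>, and \<open>p(T) = 0\<close> by the
  previous lemma.\<close>

lemma trace_square:
  assumes b: "basis_list V b"
  shows "tr b (peval T (p * map_poly cnj p)) \<in> \<real>"
    "tr b (peval T (p * map_poly cnj p)) = 0 \<Longrightarrow> v \<in> V \<Longrightarrow> peval T p v = 0"
proof -
  let ?q = "map_poly cnj p"
  obtain o' where o': "onb V H o'" using onb_ex[OF sub H b] by blast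
  then have bo: "basis_list V o'" by (simp add: onb_def[OF sub H])
  note oi = basis_list_nth[OF bo]
  have eq: "H (peval T (p * ?q) u) u = H (peval T ?q u) (peval T ?q u)" if u: "u \<in> V" for u
    unfolding peval_mult[OF u] by (rule peval_adjoint[OF peval_in[OF u] u])
  have "tr b (peval T (p * ?q)) = (\<Sum>i<length o'. H (peval T (p * ?q) (o' ! i)) (o' ! i))"
    unfolding tr_basis_indep[OF b bo endo_peval] by (rule tr_onb[OF b H o' endo_peval])
  also have "\<dots> = (\<Sum>i<length o'. H (peval T ?q (o' ! i)) (peval T ?q (o' ! i)))"
    by (intro sum.cong refl eq oi) simp
  also have "\<dots> = (\<Sum>i<length o'. of_real (Re (H (peval T ?q (o' ! i)) (peval T ?q (o' ! i)))))"
    by (intro sum.cong refl herm_self(1)[OF sub H] peval_in oi) simp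
  finally have t: "tr b (peval T (p * ?q)) = of_real (\<Sum>i<length o'. Re (H (peval T ?q (o' ! i)) (peval T ?q (o' ! i))))"
    by simp
  show "tr b (peval T (p * ?q)) \<in> \<real>" unfolding t by (rule Reals_of_real)
  assume tr0: "tr b (peval T (p * ?q)) = 0" and v: "v \<in> V"
  have s0: "(\<Sum>i<length o'. Re (H (peval T ?q (o' ! i)) (peval T ?q (o' ! i)))) = 0" using tr0 unfolding t of_real_eq_0_iff .
  have q0: "peval T ?q (o' ! i) = 0" if i: "i < length o'" for i
  proof (rule ccontr)
    assume n: "peval T ?q (o' ! i) \<noteq> 0"
    have "Re (H (peval T ?q (o' ! i)) (peval T ?q (o' ! i))) \<le>
        (\<Sum>i<length o'. Re (H (peval T ?q (o' ! i)) (peval T ?q (o' ! i))))"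
      using i herm_self(2)[OF sub H peval_in[OF oi]] by (intro member_le_sum) auto
    then show False using herm_pos[OF sub H peval_in[OF oi[OF i]] n] s0 by linarith
  qed
  have Q0: "peval T ?q w = 0" if w: "w \<in> V" for w
  proof -
    have "peval T ?q w = peval T ?q (comb (\<lambda>i. cf o' i w) o')" by (simp only: comb_cf[OF bo w])
    also have "\<dots> = (\<Sum>i<length o'. cf o' i w *c peval T ?q (o' ! i))"
      by (rule endo_comb[OF endo_peval sub basis_list_set[OF bo]])
    also have "\<dots> = 0" using q0 by simp
    finally show ?thesis .
  qed
  have "peval T (?q * p) v = 0" unfolding peval_mult[OF v] by (rule Q0[OF peval_in[OF v]])
  then show "peval T p v = 0" by (rule peval_self_square_0[OF v])
qed

text \<open>The minimal polynomial of a self-adjoint endomorphism has a simple real root; dividing it by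
  the corresponding linear factor yields a multiple of the projection to an eigenspace.\<close>

lemma spectral_projection:
  assumes b: "basis_list V b" and ne: "V \<noteq> {0}"
  shows "\<exists>s a. (\<forall>v\<in>V. peval T (s * s - s) v = 0) \<and> (\<exists>v\<in>V. peval T s v \<noteq> 0) \<and>
    (\<forall>v\<in>V. T (peval T s v) = a *c peval T s v)"
proof -
  let ?P = "\<lambda>p. p \<noteq> 0 \<and> (\<forall>v\<in>V. peval T p v = 0)"
  define d where "d = (LEAST d. \<exists>p. ?P p \<and> degree p = d)"
  obtain p0 where "?P p0" using annihilating_poly[OF b] by blast
  then have "\<exists>d p. ?P p \<and> degree p = d" by blast
  then have "\<exists>p. ?P p \<and> degree p = d" unfolding d_def by (rule LeastI_ex)
  then obtain m where m: "m \<noteq> 0" "\<forall>v\<in>V. peval T m v = 0" "degree m = d" by blast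
  have least: "d \<le> degree p" if "?P p" for p unfolding d_def using that by (intro Least_le) blast
  have deg: "degree m \<noteq> 0"
  proof
    assume "degree m = 0"
    then obtain c where c: "m = [:c:]" by (rule degree_eq_zeroE)
    then have "c \<noteq> 0" using m(1) by auto
    obtain v where v: "v \<in> V" "v \<noteq> 0" using ne subspace_0[OF sub] by blast
    have "c *c v = 0" using m(2) v(1) unfolding c peval_const by blast
    then show False using \<open>c \<noteq> 0\<close> v(2) by simp
  qed
  then have "\<not> constant (poly m)" by (simp add: constant_degree)
  from fundamental_theorem_of_algebra[OF this] obtain a where a: "poly m a = 0" by (elim exE)
  then obtain g where g: "m = [:- a, 1:] * g" using poly_eq_0_iff_dvd by (metis dvdE)
  have g0: "g \<noteq> 0" using m(1) g by auto
  have "degree m = Suc (degree g)" unfolding g using g0 by (subst degree_mult_eq) auto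
  then have "\<not> ?P g" using least[of g] m(3) by auto
  then obtain v0 where v0: "v0 \<in> V" "peval T g v0 \<noteq> 0" using g0 by blast
  have ev: "T (peval T g v) = a *c peval T g v" if v: "v \<in> V" for v
  proof -
    have "- a *c peval T g v + T (peval T g v) = 0"
    proof -
      have "peval T ([:- a, 1:] * g) v = 0" using m(2) v unfolding g by blast
      then show ?thesis unfolding peval_mult[OF v] peval_X[OF peval_in[OF v]] .
    qed
    then show ?thesis by (simp add: scale_minus_left)
  qed
  have a_real: "cnj a = a"
  proof -
    note w = peval_in[OF v0(1), of g]
    have "a * H (peval T g v0) (peval T g v0) = cnj a * H (peval T g v0) (peval T g v0)"
      using sa[OF w w] unfolding ev[OF v0(1)] herm_scale[OF sub H w w] herm_scale_right[OF sub H w w] .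
    then show ?thesis using herm_self(3)[OF sub H w] v0(2) by simp
  qed
  \<comment> \<open>The root is simple: if \<open>m\<close> were \<open>(X - a)^2 k\<close>,
    self-adjointness of \<open>T - a\<close> would let \<open>(T - a) k(T)\<close> vanish already,
    which is \<open>g(T)\<close>, against the choice of \<open>v0\<close>.\<close>
  have ga: "poly g a \<noteq> 0"
  proof
    assume "poly g a = 0"
    then obtain k where k: "g = [:- a, 1:] * k" using poly_eq_0_iff_dvd by (metis dvdE)
    have cX: "map_poly cnj [:- a, 1:] = [:- a, 1:]" using a_real by (simp add: map_poly_pCons)
    have "peval T ([:- a, 1:] * k) v0 = 0"
    proof -
      note kv = peval_in[OF v0(1), of k]
      have "peval T (map_poly cnj [:- a, 1:] * [:- a, 1:]) (peval T k v0) = peval T m v0"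
        unfolding cX g k peval_mult[OF v0(1), symmetric] by (simp only: mult.assoc)
      also have "\<dots> = 0" using m(2) v0(1) by blast
      finally have "peval T [:- a, 1:] (peval T k v0) = 0" by (rule peval_self_square_0[OF kv])
      then show ?thesis by (simp only: peval_mult[OF v0(1)])
    qed
    then show False using v0(2) k by simp
  qed
  \<comment> \<open>Normalized to take the value 1 at \<open>a\<close>: then \<open>s - 1\<close> is
    divisible by \<open>X - a\<close> and \<open>s (s - 1)\<close> by \<open>m\<close>, so
    \<open>s(T)\<close> is idempotent.\<close>
  define s where "s = Polynomial.smult (inverse (poly g a)) g"
  have "poly (s - 1) a = 0" using ga by (simp add: s_def)
  then obtain r where r: "s - 1 = [:- a, 1:] * r" using poly_eq_0_iff_dvd by (metis dvdE)
  have "s * s - s = s * (s - 1)" by (simp add: algebra_simps)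
  also have "\<dots> = Polynomial.smult (inverse (poly g a)) (r * m)" by (subst r) (simp only: s_def g mult_smult_left mult_smult_right mult_ac)
  finally have ss: "s * s - s = Polynomial.smult (inverse (poly g a)) (r * m)" .
  have "peval T (s * s - s) v = 0" if v: "v \<in> V" for v
    using m(2) v endo_zero[OF endo_peval sub] unfolding ss peval_smult[OF v] peval_mult[OF v] by simp
  moreover have "peval T s v0 \<noteq> 0" unfolding s_def peval_smult[OF v0(1)] using v0(2) ga by simp
  moreover have "T (peval T s v) = a *c peval T s v" if v: "v \<in> V" for v
  proof -
    have "T (peval T s v) = inverse (poly g a) *c T (peval T g v)"
      unfolding s_def peval_smult[OF v] by (rule endo_scale[OF T peval_in[OF v]])
    also have "\<dots> = a *c (inverse (poly g a) *c peval T g v)"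
      by (subst ev[OF v]) (rule scale_left_commute)
    finally show ?thesis unfolding s_def peval_smult[OF v] .
  qed
  ultimately show ?thesis using v0(1) by (intro exI[of _ s] exI[of _ a] conjI bexI[of _ v0] ballI)
qed

end

end

end

section \<open>Holomorphic endomorphisms of the bundle\<close>

context hvb begin

lemma hol_section_cong:
  assumes "hol_section E W s" "\<And>z. z \<in> W \<Longrightarrow> t z = s z" shows "hol_section E W t"
  unfolding hol_section_def
proof (intro conjI ballI)
  show "open W" by (rule hol_sectionD(1)[OF assms(1)])
  show "t z \<in> fibre E z" if "z \<in> W" for z using hol_sectionD(2)[OF assms(1) that] assms(2)[OF that] by simp
  fix x assume x: "x \<in> frames E"
  obtain U e where Ue: "x = (U, e)" by (cases x)
  have "(\<lambda>z. coord E e i z (t z)) holomorphic_on U \<inter> W" if "i < length e" for i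
    by (rule holomorphic_transform[OF hol_sectionD(3)[OF assms(1) x[unfolded Ue] that]]) (simp add: coord_eq[OF that] assms(2))
  then show "case x of (U, e) \<Rightarrow> \<forall>i<length e. (\<lambda>z. coord E e i z (t z)) holomorphic_on U \<inter> W"
    by (simp add: Ue)
qed

lemma hol_sectionI:
  assumes "open W" "\<And>z. z \<in> W \<Longrightarrow> s z \<in> fibre E z"
    "\<And>U e i. (U, e) \<in> frames E \<Longrightarrow> i < length e \<Longrightarrow> (\<lambda>z. cf (ev e z) i (s z)) holomorphic_on (U \<inter> W)"
  shows "hol_section E W s"
  unfolding hol_section_def using assms coord_eq by fastforce

lemma hol_section_subset: "hol_section E W s \<Longrightarrow> open V \<Longrightarrow> V \<subseteq> W \<Longrightarrow> hol_section E V s"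
  by (rule hol_sectionI) (use hol_sectionD holomorphic_on_subset in \<open>blast+\<close>)

lemma hol_section_zero: "open W \<Longrightarrow> hol_section E W (\<lambda>z. 0)"
  by (rule hol_sectionI) (auto simp: subspace_0[OF subspace_fibre])

lemma hol_section_add:
  assumes s: "hol_section E W s" and t: "hol_section E W t" shows "hol_section E W (\<lambda>z. s z + t z)"
proof (rule hol_sectionI[OF hol_sectionD(1)[OF s]])
  fix U e i assume U: "(U, e) \<in> frames E" and i: "i < length e"
  have "(\<lambda>z. cf (ev e z) i (s z) + cf (ev e z) i (t z)) holomorphic_on (U \<inter> W)"
    by (intro holomorphic_on_add hol_sectionD(3)[OF s U i] hol_sectionD(3)[OF t U i])
  then show "(\<lambda>z. cf (ev e z) i (s z + t z)) holomorphic_on (U \<inter> W)"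
    by (rule holomorphic_transform)
      (use cf_add[OF framesD(2)[OF U]] hol_sectionD(2)[OF s] hol_sectionD(2)[OF t] in auto)
qed (use subspace_add[OF subspace_fibre] hol_sectionD(2)[OF s] hol_sectionD(2)[OF t] in blast)

lemma hol_section_scale:
  assumes s: "hol_section E W s" and f: "f holomorphic_on W" shows "hol_section E W (\<lambda>z. scl E (f z) (s z))"
proof (rule hol_sectionI[OF hol_sectionD(1)[OF s]])
  fix U e i assume U: "(U, e) \<in> frames E" and i: "i < length e"
  have "(\<lambda>z. f z * cf (ev e z) i (s z)) holomorphic_on (U \<inter> W)"
    by (intro holomorphic_on_mult hol_sectionD(3)[OF s U i] holomorphic_on_subset[OF f]) auto
  then show "(\<lambda>z. cf (ev e z) i (scl E (f z) (s z))) holomorphic_on (U \<inter> W)"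
    by (rule holomorphic_transform) (use cf_scale[OF framesD(2)[OF U]] hol_sectionD(2)[OF s] in auto)
qed (use subspace_scale[OF subspace_fibre] hol_sectionD(2)[OF s] in blast)

lemma hol_section_sum:
  assumes "open W" "\<And>k. k \<in> A \<Longrightarrow> hol_section E W (s k)" shows "hol_section E W (\<lambda>z. \<Sum>k\<in>A. s k z)"
  using assms(2)
  by (induction A rule: infinite_finite_induct) (auto intro: hol_section_zero hol_section_add assms(1))

definition hol_endo :: "(complex \<Rightarrow> 'v \<Rightarrow> 'v) \<Rightarrow> bool" where
  "hol_endo T \<longleftrightarrow> (\<forall>z. endo (fibre E z) (T z)) \<and>
     (\<forall>W s. hol_section E W s \<longrightarrow> hol_section E W (\<lambda>z. T z (s z)))"

lemma hol_endoD:
  assumes "hol_endo T" shows "endo (fibre E z) (T z)" "hol_section E W s \<Longrightarrow> hol_section E W (\<lambda>z. T z (s z))"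
  using assms by (auto simp: hol_endo_def)

text \<open>Expanding a section in a frame of the atlas writes its image as a combination of frame
  sections with holomorphic coefficients.\<close>

lemma hol_endoI:
  assumes T: "\<And>z. endo (fibre E z) (T z)"
    and hol: "\<And>U e i j. (U, e) \<in> frames E \<Longrightarrow> i < rk \<Longrightarrow> j < rk \<Longrightarrow> (\<lambda>z. cf (ev e z) j (T z ((e ! i) z))) holomorphic_on U"
  shows "hol_endo T"
  unfolding hol_endo_def
proof (intro conjI allI impI T)
  fix W s assume s: "hol_section E W s"
  show "hol_section E W (\<lambda>z. T z (s z))"
  proof (rule hol_section_local[OF hol_sectionD(1)[OF s]])
    fix z assume z: "z \<in> W"
    obtain U e where U: "(U, e) \<in> frames E" "z \<in> U" and e: "hol_frame U e" by (rule local_frame)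
    note le = hol_frameD(2)[OF e]
    have op: "open (U \<inter> W)" using hol_frameD(1)[OF e] hol_sectionD(1)[OF s] by blast
    have "hol_section E (U \<inter> W) (\<lambda>z. \<Sum>i<rk. \<Sum>j<rk. scl E (cf (ev e z) i (s z) * cf (ev e z) j (T z ((e ! i) z))) ((e ! j) z))"
    proof (intro hol_section_sum op hol_section_scale holomorphic_on_mult)
      fix i j assume "i \<in> {..<rk}" "j \<in> {..<rk}"
      then have ij: "i < rk" "j < rk" by auto
      show "hol_section E (U \<inter> W) (e ! j)" using hol_section_subset[OF hol_frameD(3)[OF e ij(2)] op] by blast
      show "(\<lambda>z. cf (ev e z) i (s z)) holomorphic_on U \<inter> W" by (rule hol_section_coord[OF e s ij(1)])
      show "(\<lambda>z. cf (ev e z) j (T z ((e ! i) z))) holomorphic_on U \<inter> W"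
        by (rule holomorphic_on_subset[OF hol[OF U(1) ij]]) auto
    qed
    then have "hol_section E (U \<inter> W) (\<lambda>z. T z (s z))"
    proof (rule hol_section_cong)
      fix w assume w: "w \<in> U \<inter> W"
      then have b: "basis_list (fibre E w) (ev e w)" using hol_frameD(4)[OF e] by blast
      have wU: "w \<in> U" using w by blast
      have sw: "s w \<in> fibre E w" using hol_sectionD(2)[OF s] w by blast
      have "T w (s w) = T w (comb (\<lambda>i. cf (ev e w) i (s w)) (ev e w))" by (simp only: comb_cf[OF b sw])
      also have "\<dots> = (\<Sum>i<rk. scl E (cf (ev e w) i (s w)) (T w ((e ! i) w)))"
        using endo_comb[OF T subspace_fibre basis_list_set[OF b]] le by simp
      also have "\<dots> = (\<Sum>i<rk. \<Sum>j<rk. scl E (cf (ev e w) i (s w) * cf (ev e w) j (T w ((e ! i) w))) ((e ! j) w))"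
      proof (rule sum.cong)
        fix i assume "i \<in> {..<rk}"
        then have i: "i < rk" by simp
        have "T w ((e ! i) w) = comb (\<lambda>j. cf (ev e w) j (T w ((e ! i) w))) (ev e w)"
          by (rule comb_cf[OF b endo_in[OF T hol_frame_nth[OF e wU i]], symmetric])
        also have "\<dots> = (\<Sum>j<rk. scl E (cf (ev e w) j (T w ((e ! i) w))) ((e ! j) w))"
          unfolding comb_eq le ..
        finally have t: "T w ((e ! i) w) = (\<Sum>j<rk. scl E (cf (ev e w) j (T w ((e ! i) w))) ((e ! j) w))" .
        show "scl E (cf (ev e w) i (s w)) (T w ((e ! i) w)) =
            (\<Sum>j<rk. scl E (cf (ev e w) i (s w) * cf (ev e w) j (T w ((e ! i) w))) ((e ! j) w))"
          by (subst t) (simp only: scale_sum_right scale_scale)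
      qed simp
      finally show "T w (s w) = (\<Sum>i<rk. \<Sum>j<rk. scl E (cf (ev e w) i (s w) * cf (ev e w) j (T w ((e ! i) w))) ((e ! j) w))" .
    qed
    then show "\<exists>V. z \<in> V \<and> V \<subseteq> W \<and> hol_section E V (\<lambda>z. T z (s z))"
      using z U(2) by (intro exI[of _ "U \<inter> W"] conjI IntI Int_lower2)
  qed
qed

lemma hol_endo_peval:
  assumes T: "hol_endo T" shows "hol_endo (\<lambda>z. peval (T z) p)"
  unfolding hol_endo_def
proof (intro conjI allI impI)
  show "endo (fibre E z) (peval (T z) p)" for z by (rule endo_peval[OF subspace_fibre hol_endoD(1)[OF T]])
  fix W s assume s: "hol_section E W s"
  show "hol_section E W (\<lambda>z. peval (T z) p (s z))"
  proof (induction p)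
    case 0
    show ?case unfolding peval_0[OF subspace_fibre hol_endoD(1)[OF T]] by (rule hol_section_zero[OF hol_sectionD(1)[OF s]])
  next
    case (pCons a p)
    show ?case unfolding peval_pCons[OF subspace_fibre hol_endoD(1)[OF T]]
      by (intro hol_section_add hol_section_scale s hol_endoD(2)[OF T pCons.IH]) simp
  qed
qed

lemma holomorphic_trace:
  assumes T: "hol_endo T" shows "(\<lambda>z. tr (ev (frame_at E z) z) (T z)) holomorphic_on UNIV"
proof (rule holomorphic_onI)
  fix z :: complex
  obtain U e where U: "(U, e) \<in> frames E" "z \<in> U" and e: "hol_frame U e" by (rule local_frame)
  have "(\<lambda>z. \<Sum>i<rk. cf (ev e z) i (T z ((e ! i) z))) holomorphic_on U"
  proof (intro holomorphic_on_sum)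
    fix i assume "i \<in> {..<rk}"
    then have i: "i < rk" by simp
    show "(\<lambda>z. cf (ev e z) i (T z ((e ! i) z))) holomorphic_on U"
      using hol_sectionD(3)[OF hol_endoD(2)[OF T hol_frameD(3)[OF e i]] U(1)] i hol_frameD(2)[OF e] by simp
  qed
  then have "(\<lambda>z. tr (ev (frame_at E z) z) (T z)) holomorphic_on U"
  proof (rule holomorphic_transform)
    fix w assume w: "w \<in> U"
    have "tr (ev (frame_at E w) w) (T w) = tr (ev e w) (T w)"
      by (rule tr_basis_indep[OF basis_frame_at hol_frameD(4)[OF e w] hol_endoD(1)[OF T]])
    then show "(\<Sum>i<rk. cf (ev e w) i (T w ((e ! i) w))) = tr (ev (frame_at E w) w) (T w)"
      using hol_frameD(2)[OF e] by (simp add: tr_def)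
  qed
  then show "(\<lambda>z. tr (ev (frame_at E z) z) (T z)) field_differentiable at z within UNIV"
    using hol_frameD(1)[OF e] U(2) holomorphic_on_imp_differentiable_at field_differentiable_at_within by blast
qed

end

section \<open>Either the metrics agree or the bundle splits\<close>

context he_pair begin

lemma hol_endo_quo: "hol_endo quo"
  by (rule hol_endoI[OF endo_quo quo_holomorphic])

lemma quo_H1: "u \<in> fibre E z \<Longrightarrow> v \<in> fibre E z \<Longrightarrow> H2 z u v = H1 z (quo z u) v"
  unfolding quo_def by (rule quot(2)[OF basis_frame_at H1.herm_fibre H2.herm_fibre])

lemma quo_self_adjoint: "u \<in> fibre E z \<Longrightarrow> v \<in> fibre E z \<Longrightarrow> H1 z (quo z u) v = H1 z u (quo z v)"
  unfolding quo_def by (rule quot_self_adjoint[OF basis_frame_at H1.herm_fibre H2.herm_fibre])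

text \<open>The reason is that the trace of \<open>p(h) p(h)\<^sup>*\<close>, where \<open>h = H\<^sub>1\<^sup>-\<^sup>1 H\<^sub>2\<close>, is holomorphic and real, hence constant.\<close>

lemma peval_quo_zero:
  assumes 0: "\<forall>v\<in>fibre E z0. peval (quo z0) p v = 0" and v: "v \<in> fibre E z"
  shows "peval (quo z) p v = 0"
proof -
  let ?q = "p * map_poly cnj p"
  let ?t = "\<lambda>z. tr (ev (frame_at E z) z) (peval (quo z) ?q)"
  have real: "?t z \<in> \<real>" for z
    by (rule trace_square(1)[OF subspace_fibre endo_quo H1.herm_fibre _ basis_frame_at]) (rule quo_self_adjoint)
  have hol: "?t holomorphic_on UNIV" by (rule holomorphic_trace[OF hol_endo_peval[OF hol_endo_quo]])
  have "?t z = ?t z0" by (rule holomorphic_real_constant[OF hol real])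
  also have "\<dots> = 0"
    unfolding tr_def
  proof (rule sum.neutral, rule ballI)
    fix i assume "i \<in> {..<length (ev (frame_at E z0) z0)}"
    then have b: "ev (frame_at E z0) z0 ! i \<in> fibre E z0" using basis_list_nth[OF basis_frame_at] by blast
    have "peval (quo z0) (map_poly cnj p * p) (ev (frame_at E z0) z0 ! i) = 0"
      unfolding peval_mult[OF subspace_fibre endo_quo b] bspec[OF 0 b]
      by (rule endo_zero[OF endo_peval[OF subspace_fibre endo_quo] subspace_fibre])
    then show "cf (ev (frame_at E z0) z0) i (peval (quo z0) ?q (ev (frame_at E z0) z0 ! i)) = 0"
      by (simp add: mult.commute)
  qed
  finally have 0: "?t z = 0" .
  show ?thesis
    by (rule trace_square(2)[OF subspace_fibre endo_quo H1.herm_fibre _ basis_frame_at 0 v]) (rule quo_self_adjoint)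
qed

lemma det_scalar_gram:
  assumes b: "basis_list (fibre E z) (ev e z)" and a: "\<forall>v\<in>fibre E z. quo z v = scl E a v"
  shows "GM H2 e z = a \<cdot>\<^sub>m GM H1 e z"
proof (rule eq_matI)
  fix i j assume "i < dim_row (a \<cdot>\<^sub>m GM H1 e z)" "j < dim_col (a \<cdot>\<^sub>m GM H1 e z)"
  then have ij: "i < length e" "j < length e" by (auto simp: GM_def gram_def)
  then have m: "(e ! i) z \<in> fibre E z" "(e ! j) z \<in> fibre E z"
    using basis_list_nth[OF b, of i] basis_list_nth[OF b, of j] by simp_all
  show "GM H2 e z $$ (i, j) = (a \<cdot>\<^sub>m GM H1 e z) $$ (i, j)"
    using ij quo_H1[OF m] bspec[OF a m(1)] herm_scale[OF subspace_fibre H1.herm_fibre m] by (simp add: GM_def gram_def)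
qed (auto simp: GM_def gram_def)

text \<open>Comparing determinants gives \<open>a ^ rk = 1\<close>. As a quotient of two squared
  lengths \<open>a\<close> is a positive real number, so \<open>a = 1\<close>; the rank is positive
  because the fibre contains a nonzero vector.\<close>

lemma scalar_quo_eq:
  assumes a: "\<forall>z. \<forall>v\<in>fibre E z. quo z v = scl E a v" and u: "u \<in> fibre E z" and v: "v \<in> fibre E z"
  shows "H1 z u v = H2 z u v"
proof (cases "u = 0")
  case True
  then show ?thesis
    using herm_zero(1)[OF subspace_fibre H1.herm_fibre v] herm_zero(1)[OF subspace_fibre H2.herm_fibre v] by simp
next
  case False
  define e where "e = frame_at E z"
  obtain U where U: "(U, e) \<in> frames E" "z \<in> U" using frame_at_frame e_def by blast
  note b = framesD(2)[OF U]
  have l: "length e = rk" using length_frame[OF b] by simp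
  have rk0: "rk \<noteq> 0"
  proof
    assume "rk = 0"
    then have "u = 0" using comb_cf[OF b u] l by (simp add: comb_def)
    then show False using False by simp
  qed
  have s: "H2 z x y = a * H1 z x y" if "x \<in> fibre E z" "y \<in> fibre E z" for x y
    using quo_H1[OF that] a that(1) herm_scale[OF subspace_fibre H1.herm_fibre that] by simp
  have "Determinant.det (GM H2 e z) = a ^ rk * Determinant.det (GM H1 e z)"
    unfolding det_scalar_gram[OF b spec[OF a]]
    by (subst det_smult) (simp add: l GM_def gram_def)
  then have "a ^ rk = 1" using det_GM_eq(1)[OF U] H1.det_GM(1)[OF b] by simp
  moreover define x where "x = Re (H2 z u u) / Re (H1 z u u)"
  have p: "Re (H1 z u u) > 0" "Re (H2 z u u) > 0"
    using herm_pos[OF subspace_fibre H1.herm_fibre u False] herm_pos[OF subspace_fibre H2.herm_fibre u False] by auto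
  have "complex_of_real (Re (H2 z u u)) = a * of_real (Re (H1 z u u))"
    using s[OF u u] herm_self(1)[OF subspace_fibre H1.herm_fibre u] herm_self(1)[OF subspace_fibre H2.herm_fibre u]
    by (simp only:)
  then have ax: "a = of_real x" using p(1) by (simp add: x_def field_simps)
  ultimately have "complex_of_real (x ^ rk) = of_real 1" by simp
  then have "x ^ rk = 1" unfolding of_real_eq_iff .
  moreover have "x > 0" using p by (simp add: x_def)
  ultimately have "x = 1" using rk0 power_eq_1_iff[of x rk] by (metis power_eq_imp_eq_base power_one less_imp_le zero_le_one gr0I)
  then have "a = 1" by (simp only: ax of_real_1)
  then show ?thesis unfolding s[OF u v] by simp
qed

text \<open>The polynomial \<open>s\<close> is found in the fibre over 0 only. Its relations with
  \<open>quo\<close>, and the failure of such relations, carry over to all fibres by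
  \<open>peval_quo_zero\<close>, so the same \<open>s\<close> gives a nonzero projection everywhere,
  and one that is the identity either in every fibre or in none.\<close>

theorem equal_or_projection:
  "(\<forall>z. \<forall>u\<in>fibre E z. \<forall>v\<in>fibre E z. H1 z u v = H2 z u v) \<or>
   (\<exists>\<pi>. hol_endo \<pi> \<and> (\<forall>z. \<forall>v\<in>fibre E z. \<pi> z (\<pi> z v) = \<pi> z v) \<and>
     (\<forall>z. \<forall>u\<in>fibre E z. \<forall>w\<in>fibre E z. \<pi> z u = u \<longrightarrow> \<pi> z w = 0 \<longrightarrow> H1 z u w = 0) \<and>
     (\<forall>z. \<exists>v\<in>fibre E z. \<pi> z v \<noteq> 0) \<and> (\<forall>z. \<exists>v\<in>fibre E z. \<pi> z v \<noteq> v))"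
proof (cases "fibre E 0 = {0}")
  case True
  have "dim {0} = length ([] :: 'v list)" by (rule dim_basis_list) (simp add: basis_list_def independent_empty)
  then have "rk = 0" using dim_fibre[of 0] True by simp
  then have "quo z v = scl E 1 v" if "v \<in> fibre E z" for z v
    using comb_cf[OF basis_frame_at that] comb_cf[OF basis_frame_at endo_in[OF endo_quo that]]
      length_frame[OF basis_frame_at[of z]] by (simp add: comb_def)
  then have "\<forall>z. \<forall>v\<in>fibre E z. quo z v = scl E 1 v" by blast
  then show ?thesis by (intro disjI1 allI ballI) (rule scalar_quo_eq)
next
  case False
  note T = endo_quo and sub = subspace_fibre
  have "\<exists>s a. (\<forall>v\<in>fibre E 0. peval (quo 0) (s * s - s) v = 0) \<and> (\<exists>v\<in>fibre E 0. peval (quo 0) s v \<noteq> 0) \<and>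
      (\<forall>v\<in>fibre E 0. quo 0 (peval (quo 0) s v) = scl E a (peval (quo 0) s v))"
    by (rule spectral_projection[OF sub T H1.herm_fibre _ basis_frame_at False]) (rule quo_self_adjoint)
  then obtain s a where s: "\<forall>v\<in>fibre E 0. peval (quo 0) (s * s - s) v = 0" "\<exists>v\<in>fibre E 0. peval (quo 0) s v \<noteq> 0"
      "\<forall>v\<in>fibre E 0. quo 0 (peval (quo 0) s v) = scl E a (peval (quo 0) s v)" by (elim exE conjE)
  let ?Q = "\<lambda>z. peval (quo z) s"
  have id: "?Q z (?Q z v) = ?Q z v" if v: "v \<in> fibre E z" for z v
  proof -
    have "peval (quo z) (s * s - s + s) v = peval (quo z) (s * s - s) v + ?Q z v" by (rule peval_add[OF sub T v])
    then show ?thesis using peval_quo_zero[OF s(1) v] peval_mult[OF sub T v, of s s] by simp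
  qed
  have nz: "\<exists>v\<in>fibre E z. ?Q z v \<noteq> 0" for z using peval_quo_zero[of z s _ 0] s(2) by blast
  \<comment> \<open>\<open>s(h)\<close> commutes with its adjoint, so the adjoint annihilates the
    kernel of \<open>s(h)\<close> as well; moving \<open>s(h)\<close> from \<open>u\<close> to
    \<open>w\<close> then gives 0.\<close>
  have orth: "H1 z u w = 0" if u: "u \<in> fibre E z" and w: "w \<in> fibre E z" and Q: "?Q z u = u" "?Q z w = 0" for z u w
  proof -
    have "map_poly cnj (map_poly cnj s) = s" by (simp add: map_poly_map_poly o_def)
    then have "peval (quo z) (map_poly cnj (map_poly cnj s) * map_poly cnj s) w = peval (quo z) (map_poly cnj s * s) w"
      by (simp add: mult.commute)
    also have "\<dots> = 0"
      unfolding peval_mult[OF sub T w] Q(2) by (rule endo_zero[OF endo_peval[OF sub T] sub])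
    finally have 0: "peval (quo z) (map_poly cnj (map_poly cnj s) * map_poly cnj s) w = 0" .
    have 0: "peval (quo z) (map_poly cnj s) w = 0"
      by (rule peval_self_square_0[OF sub T H1.herm_fibre _ w 0]) (rule quo_self_adjoint)
    have "H1 z (?Q z u) w = H1 z u (peval (quo z) (map_poly cnj s) w)"
      by (rule peval_adjoint[OF sub T H1.herm_fibre _ u w]) (rule quo_self_adjoint)
    then have "H1 z (?Q z u) w = H1 z u 0" unfolding 0 .
    then show ?thesis using herm_zero(2)[OF sub H1.herm_fibre u] Q(1) by simp
  qed
  show ?thesis
  \<comment> \<open>If the projection is the identity in one fibre, then \<open>s - 1\<close>
    annihilates \<open>quo\<close> everywhere. Over 0 the image of the projection is an eigenspace,
    so there \<open>quo\<close> is the scalar \<open>a\<close>, and hence everywhere.\<close>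
  proof (cases "\<exists>z. \<forall>v\<in>fibre E z. ?Q z v = v")
    case True
    then obtain z1 where z1: "\<forall>v\<in>fibre E z1. ?Q z1 v = v" by blast
    have "peval (quo z1) (s + [:-1:]) v = 0" if v: "v \<in> fibre E z1" for v
      unfolding peval_add[OF sub T v] peval_const[OF sub T] using z1 v by simp
    then have z1': "\<forall>v\<in>fibre E z1. peval (quo z1) (s + [:-1:]) v = 0" by blast
    have Q0: "?Q 0 v = v" if v: "v \<in> fibre E 0" for v
      using peval_quo_zero[OF z1' v] unfolding peval_add[OF sub T v] peval_const[OF sub T] by simp
    have "peval (quo 0) [:- a, 1:] v = 0" if v: "v \<in> fibre E 0" for v
    proof -
      have "quo 0 v = scl E a v" using bspec[OF s(3) v] unfolding Q0[OF v] .
      then show ?thesis unfolding peval_X[OF sub T v] by simp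
    qed
    then have a0: "\<forall>v\<in>fibre E 0. peval (quo 0) [:- a, 1:] v = 0" by blast
    have "quo z v = scl E a v" if v: "v \<in> fibre E z" for z v
      using peval_quo_zero[OF a0 v] unfolding peval_X[OF sub T v] by simp
    then have "\<forall>z. \<forall>v\<in>fibre E z. quo z v = scl E a v" by blast
    then show ?thesis by (intro disjI1 allI ballI) (rule scalar_quo_eq)
  next
    case False
    then have nid': "\<exists>v\<in>fibre E z. ?Q z v \<noteq> v" for z by blast
    show ?thesis
      by (intro disjI2 exI[of _ ?Q] conjI hol_endo_peval[OF hol_endo_quo] allI ballI impI id nz nid')
        (assumption | (rule orth, assumption+))+
  qed
qed

end

section \<open>Holomorphic splittings\<close>

context cvs begin

text \<open>A linear relation among the vectors of \<open>b'\<close> is a kernel vector of the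
  transposed transition matrix. Since the determinant is continuous in families, this yields frames
  near a point from a frame at the point.\<close>

lemma basis_list_of_det:
  assumes b: "basis_list V b" and s: "set b' \<subseteq> V" and l: "length b' = length b"
    and det: "Determinant.det (trans_mat b b') \<noteq> 0"
  shows "basis_list V b'"
proof (rule basis_list_of_independent[OF b s l])
  let ?n = "length b" and ?M = "trans_mat b b'"
  have M: "?M \<in> carrier_mat ?n ?n" using l by (simp add: trans_mat_def)
  have ind: "\<forall>i<length b'. c i = 0" if c: "comb c b' = 0" for c
  proof -
    have nth: "b' ! i \<in> V" if "i < ?n" for i using s l that nth_mem[of i b'] by auto
    let ?x = "Matrix.vec ?n c"
    have "transpose_mat ?M *\<^sub>v ?x = 0\<^sub>v ?n"
    proof (rule eq_vecI)
      fix j assume "j < dim_vec (0\<^sub>v ?n)"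
      then have j: "j < ?n" by simp
      have "(transpose_mat ?M *\<^sub>v ?x) $ j = (\<Sum>i<?n. cf b j (b' ! i) * c i)"
        using M j l by (simp add: scalar_prod_def atLeast0LessThan trans_mat_def)
      also have "\<dots> = (\<Sum>i<?n. cf b j (c i *c b' ! i))"
        by (intro sum.cong refl) (simp add: cf_scale[OF b nth] mult.commute)
      also have "\<dots> = cf b j (\<Sum>i<?n. c i *c b' ! i)"
        by (rule cf_sum[OF b, symmetric]) (simp add: subspace_scale[OF basis_list_subspace[OF b]] nth)
      also have "(\<Sum>i<?n. c i *c b' ! i) = 0" using c l by (simp add: comb_def)
      finally show "(transpose_mat ?M *\<^sub>v ?x) $ j = 0\<^sub>v ?n $ j" using j by simp
    qed (use M in simp)
    moreover have "Determinant.det (transpose_mat ?M) \<noteq> 0" using det det_transpose[OF M] by simp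
    moreover have "transpose_mat ?M \<in> carrier_mat ?n ?n" "?x \<in> carrier_vec ?n" using M by auto
    ultimately have "?x = 0\<^sub>v ?n" using det_0_iff_vec_prod_zero[of "transpose_mat ?M" ?n] by blast
    then have "?x $ i = 0" if "i < ?n" for i using that by simp
    then show ?thesis using l by simp
  qed
  show "distinct b'" "independent (set b')" by (rule independent_list[OF ind], assumption)+
qed

lemma subspace_basis_list:
  assumes b: "basis_list V b" and W: "subspace W" "W \<subseteq> V"
  shows "\<exists>a. basis_list W a"
proof -
  obtain B where B: "B \<subseteq> W" "independent B" "W \<subseteq> span B" using basis_exists by metis
  have "B \<subseteq> span (set b)" using B(1) W(2) b by (auto simp: basis_list_def)
  then have "finite B" using independent_span_bound[OF _ B(2)] by blast
  then obtain a where a: "set a = B" "distinct a" using finite_distinct_list by blast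
  have "span B = W" using B W span_minimal by blast
  then show ?thesis using a B(2) by (auto simp: basis_list_def)
qed

lemma comb_append: "comb c (a @ b) = comb c a + comb (\<lambda>i. c (length a + i)) b"
proof -
  have "comb c (a @ b) = (\<Sum>i<length a. c i *c (a @ b) ! i) + (\<Sum>i=length a..<length a + length b. c i *c (a @ b) ! i)"
    unfolding comb_def by (simp add: atLeast0LessThan[symmetric] sum.atLeastLessThan_concat)
  also have "(\<Sum>i=length a..<length a + length b. c i *c (a @ b) ! i) = comb (\<lambda>i. c (length a + i)) b"
    using sum.shift_bounds_nat_ivl[of "\<lambda>i. c i *c (a @ b) ! i" 0 "length a" "length b"]
    by (simp add: comb_def atLeast0LessThan nth_append add.commute)
  also have "(\<Sum>i<length a. c i *c (a @ b) ! i) = comb c a" by (simp add: comb_def nth_append)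
  finally show ?thesis .
qed

lemma comb_span: "comb c b \<in> span (set b)"
  unfolding comb_def by (intro span_sum span_scale span_base nth_mem) simp

context
  fixes V P assumes sub: "subspace V" and P: "endo V P" and idem: "\<forall>v\<in>V. P (P v) = P v"
begin

lemma subspace_image: "subspace {v\<in>V. P v = v}" and subspace_kernel: "subspace {v\<in>V. P v = 0}"
  unfolding subspace_def
  using endo_zero[OF P sub] endo_add[OF P] endo_scale[OF P] subspace_0[OF sub] subspace_add[OF sub] subspace_scale[OF sub]
  by auto

lemma projection_comb:
  assumes a: "set a \<subseteq> {v\<in>V. P v = v}" and b: "set b \<subseteq> {v\<in>V. P v = 0}"
  shows "P (comb c (a @ b)) = comb c a"
proof -
  have ca: "comb c a \<in> {v\<in>V. P v = v}" by (rule comb_in[OF subspace_image a])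
  have cb: "comb (\<lambda>i. c (length a + i)) b \<in> {v\<in>V. P v = 0}" by (rule comb_in[OF subspace_kernel b])
  show ?thesis unfolding comb_append using endo_add[OF P] ca cb by simp
qed

lemma basis_list_append:
  assumes a: "basis_list {v\<in>V. P v = v} a" and b: "basis_list {v\<in>V. P v = 0} b"
  shows "basis_list V (a @ b)"
proof -
  note sa = basis_list_set[OF a] and sb = basis_list_set[OF b]
  have "\<forall>i<length (a @ b). c i = 0" if c: "comb c (a @ b) = 0" for c
  proof -
    have ca: "comb c a = 0" using projection_comb[OF sa sb, of c] c endo_zero[OF P sub] by simp
    then have cb: "comb (\<lambda>i. c (length a + i)) b = 0" using c unfolding comb_append by simp
    have "c i = 0" if "i < length a" for i using cf_comb[OF a that, of c] ca by simp
    moreover have "c (length a + i) = 0" if "i < length b" for i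
      using cf_comb[OF b that, of "\<lambda>i. c (length a + i)"] cb by simp
    ultimately show ?thesis
      by (metis add_less_cancel_left le_add_diff_inverse length_append not_less)
  qed
  note i = independent_list[OF this]
  have "span (set (a @ b)) \<subseteq> V" by (rule span_minimal[OF _ sub]) (use sa sb in auto)
  moreover have "v \<in> span (set (a @ b))" if v: "v \<in> V" for v
  proof -
    have "P v \<in> {v\<in>V. P v = v}" "v - P v \<in> {v\<in>V. P v = 0}"
      using v idem endo_in[OF P v] subspace_diff[OF sub v] endo_add[OF P, of "v - P v" "P v"] by auto
    then have "P v \<in> span (set a)" "v - P v \<in> span (set b)" using a b by (auto simp: basis_list_def)
    then have "P v \<in> span (set (a @ b))" "v - P v \<in> span (set (a @ b))"
      using span_mono[of "set a" "set (a @ b)"] span_mono[of "set b" "set (a @ b)"] by auto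
    from span_add[OF this] show ?thesis by simp
  qed
  ultimately show ?thesis using i by (auto simp: basis_list_def)
qed

lemma basis_list_appendD:
  assumes ab: "basis_list V (a @ b)" and a: "set a \<subseteq> {v\<in>V. P v = v}" and b: "set b \<subseteq> {v\<in>V. P v = 0}"
  shows "basis_list {v\<in>V. P v = v} a" "basis_list {v\<in>V. P v = 0} b"
proof -
  have d: "distinct a" "distinct b" using ab by (auto simp: basis_list_def)
  have i: "independent (set a)" "independent (set b)"
    using ab independent_mono[of "set (a @ b)"] by (auto simp: basis_list_def)
  have "v \<in> span (set a)" if v: "v \<in> {v\<in>V. P v = v}" for v
  proof -
    have "v = comb (\<lambda>i. cf (a @ b) i v) (a @ b)" using comb_cf[OF ab, of v] v by simp
    from arg_cong[OF this, of P] have "P v = comb (\<lambda>i. cf (a @ b) i v) a" unfolding projection_comb[OF a b] .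
    then show ?thesis using v comb_span[of "\<lambda>i. cf (a @ b) i v" a] by simp
  qed
  then show "basis_list {v\<in>V. P v = v} a"
    using d(1) i(1) span_minimal[OF a subspace_image] unfolding basis_list_def by blast
  have "v \<in> span (set b)" if v: "v \<in> {v\<in>V. P v = 0}" for v
  proof -
    let ?c = "\<lambda>i. cf (a @ b) i v"
    have e: "comb ?c (a @ b) = v" using comb_cf[OF ab, of v] v by simp
    from arg_cong[OF this, of P] have "comb ?c a = 0" unfolding projection_comb[OF a b] using v by simp
    then have "v = comb (\<lambda>i. ?c (length a + i)) b" using e unfolding comb_append by simp
    then show ?thesis using comb_span[of "\<lambda>i. ?c (length a + i)" b] by simp
  qed
  then show "basis_list {v\<in>V. P v = 0} b"
    using d(2) i(2) span_minimal[OF b subspace_kernel] unfolding basis_list_def by blast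
qed

lemma cf_append:
  assumes a: "basis_list {v\<in>V. P v = v} a" and b: "basis_list {v\<in>V. P v = 0} b"
    and v: "v \<in> V" "P v = v" and i: "i < length a"
  shows "cf (a @ b) i v = cf a i v"
proof -
  note ab = basis_list_append[OF a b]
  let ?c = "\<lambda>i. cf (a @ b) i v"
  have "comb ?c (a @ b) = v" by (rule comb_cf[OF ab v(1)])
  from arg_cong[OF this, of P] have "comb ?c a = v"
    unfolding projection_comb[OF basis_list_set[OF a] basis_list_set[OF b]] v(2) .
  then show ?thesis using cf_comb[OF a i, of ?c] by simp
qed

lemma tr_projection:
  assumes a: "basis_list {v\<in>V. P v = v} a" and b: "basis_list {v\<in>V. P v = 0} b"
  shows "tr (a @ b) P = of_nat (length a)"
proof -
  note ab = basis_list_append[OF a b]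
  have "cf (a @ b) i (P ((a @ b) ! i)) = (if i < length a then 1 else 0)" if i: "i < length (a @ b)" for i
  proof (cases "i < length a")
    case True
    then have "P ((a @ b) ! i) = (a @ b) ! i" using basis_list_nth[OF a True] by (simp add: nth_append)
    then show ?thesis using cf_nth[OF ab i i] True by simp
  next
    case False
    then have "P ((a @ b) ! i) = 0" using basis_list_nth[OF b, of "i - length a"] i by (simp add: nth_append)
    then show ?thesis using False by simp
  qed
  then have "tr (a @ b) P = (\<Sum>i<length a + length b. if i < length a then 1 else 0)"
    unfolding tr_def by (intro sum.cong) auto
  also have "\<dots> = (\<Sum>i<length a. 1)" by (rule sum.mono_neutral_cong_right) auto
  finally show ?thesis by simp
qed

end

end

section \<open>The subbundle defined by a holomorphic projection\<close>

locale hvb_proj = hvb E for E :: "('v::ab_group_add) hol_bundle" +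
  fixes \<pi> :: "complex \<Rightarrow> 'v \<Rightarrow> 'v"
  assumes proj: "hol_endo \<pi>" and idem: "\<forall>v\<in>fibre E z. \<pi> z (\<pi> z v) = \<pi> z v"
begin

lemmas endo_proj = hol_endoD(1)[OF proj]

definition im :: "complex \<Rightarrow> 'v set" where "im z = {v\<in>fibre E z. \<pi> z v = v}"
definition ker :: "complex \<Rightarrow> 'v set" where "ker z = {v\<in>fibre E z. \<pi> z v = 0}"

definition sheaf :: "complex set \<Rightarrow> (complex \<Rightarrow> 'v) set" where
  "sheaf W = {s. hol_section E W s \<and> (\<forall>z\<in>W. \<pi> z (s z) = s z)}"

text \<open>Through this interpretation every result about the image applies to the kernel, so the
  two summands are treated alike.\<close>

lemma compl: "hvb_proj E (\<lambda>z v. v - \<pi> z v)"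
proof unfold_locales
  show "hol_endo (\<lambda>z v. v - \<pi> z v)"
    unfolding hol_endo_def endo_def
  proof (intro conjI allI ballI impI)
    fix z u v x y assume u: "u \<in> fibre E z" and v: "v \<in> fibre E z"
    have "\<pi> z (scl E x u + scl E y v) = scl E x (\<pi> z u) + scl E y (\<pi> z v)"
      using endo_proj[of z] u v by (simp add: endo_def)
    then show "scl E x u + scl E y v - \<pi> z (scl E x u + scl E y v) = scl E x (u - \<pi> z u) + scl E y (v - \<pi> z v)"
      by (simp add: scale_right_diff_distrib)
  next
    fix z u assume "u \<in> fibre E z"
    then show "u - \<pi> z u \<in> fibre E z" by (intro subspace_diff[OF subspace_fibre] endo_in[OF endo_proj])
  next
    fix W s assume s: "hol_section E W s"
    have "hol_section E W (\<lambda>z. s z + scl E (-1) (\<pi> z (s z)))"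
      by (intro hol_section_add hol_section_scale s hol_endoD(2)[OF proj s]) simp
    then show "hol_section E W (\<lambda>z. s z - \<pi> z (s z))" by (rule hol_section_cong) (simp add: scale_minus_left)
  qed
  show "\<forall>v\<in>fibre E z. v - \<pi> z v - \<pi> z (v - \<pi> z v) = v - \<pi> z v" for z
  proof
    fix v assume v: "v \<in> fibre E z"
    have "\<pi> z (v - \<pi> z v) + \<pi> z (\<pi> z v) = \<pi> z v"
      using endo_add[OF endo_proj, of "v - \<pi> z v" z "\<pi> z v"] v endo_in[OF endo_proj v]
        subspace_diff[OF subspace_fibre v endo_in[OF endo_proj v]] by simp
    then show "v - \<pi> z v - \<pi> z (v - \<pi> z v) = v - \<pi> z v" using bspec[OF idem v] by simp
  qed
qed

lemma compl_im: "hvb_proj.im E (\<lambda>z v. v - \<pi> z v) z = ker z"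
  unfolding hvb_proj.im_def[OF compl] ker_def by auto

lemma sheafD: "s \<in> sheaf W \<Longrightarrow> hol_section E W s" "s \<in> sheaf W \<Longrightarrow> z \<in> W \<Longrightarrow> s z \<in> im z"
  using hol_sectionD(2) by (auto simp: sheaf_def im_def)

lemma sheafI: "hol_section E W s \<Longrightarrow> (\<And>z. z \<in> W \<Longrightarrow> \<pi> z (s z) = s z) \<Longrightarrow> s \<in> sheaf W"
  by (simp add: sheaf_def)

lemma sheaf_proj: "hol_section E W s \<Longrightarrow> (\<lambda>z. \<pi> z (s z)) \<in> sheaf W"
  using idem hol_sectionD(2) by (intro sheafI hol_endoD(2)[OF proj]) blast+

lemma subsheaf: "subsheaf E sheaf"
  unfolding subsheaf_def
proof (intro allI impI conjI ballI)
  fix W :: "complex set" assume W: "open W"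
  show "hol_section E W s" if "s \<in> sheaf W" for s by (rule sheafD(1)[OF that])
  show "t \<in> sheaf W" if s: "s \<in> sheaf W" and t: "\<forall>z\<in>W. t z = s z" for s t
    by (rule sheafI) (use hol_section_cong[OF sheafD(1)[OF s], of t] t s in \<open>auto simp: sheaf_def\<close>)
  show "(\<lambda>z. 0) \<in> sheaf W" by (rule sheafI[OF hol_section_zero[OF W]]) (rule endo_zero[OF endo_proj subspace_fibre])
  show "(\<lambda>z. s z + t z) \<in> sheaf W" if s: "s \<in> sheaf W" and t: "t \<in> sheaf W" for s t
    by (rule sheafI[OF hol_section_add[OF sheafD(1)[OF s] sheafD(1)[OF t]]])
      (use sheafD(2)[OF s] sheafD(2)[OF t] endo_add[OF endo_proj] in \<open>simp add: im_def\<close>)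
  show "(\<lambda>z. scl E (f z) (s z)) \<in> sheaf W" if s: "s \<in> sheaf W" and f: "f holomorphic_on W" for s f
    by (rule sheafI[OF hol_section_scale[OF sheafD(1)[OF s] f]])
      (use sheafD(2)[OF s] endo_scale[OF endo_proj] in \<open>simp add: im_def\<close>)
  show "s \<in> sheaf V" if "open V \<and> V \<subseteq> W \<and> s \<in> sheaf W" for V s
    using that hol_section_subset[of W s V] by (auto simp: sheaf_def)
  fix s assume loc: "\<forall>z\<in>W. \<exists>V. open V \<and> z \<in> V \<and> V \<subseteq> W \<and> s \<in> sheaf V"
  show "s \<in> sheaf W"
  proof (rule sheafI[OF hol_section_local[OF W]])
    fix z assume z: "z \<in> W"
    obtain V where V: "z \<in> V" "V \<subseteq> W" "s \<in> sheaf V" using bspec[OF loc z] by (elim exE conjE)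
    show "\<exists>V. z \<in> V \<and> V \<subseteq> W \<and> hol_section E V s" by (intro exI[of _ V] conjI V(1,2) sheafD(1)[OF V(3)])
    show "\<pi> z (s z) = s z" using sheafD(2)[OF V(3,1)] by (simp add: im_def)
  qed
qed

text \<open>The projections of the frame sections generate: a section fixed by the projection equals
  the projection of its expansion in the frame.\<close>

lemma coherent: "coherent_subsheaf E sheaf"
  unfolding coherent_subsheaf_def
proof (intro conjI allI subsheaf)
  fix z
  obtain U e where e: "(U, e) \<in> frames E" "z \<in> U" "hol_frame U e" by (rule local_frame)
  note e = this(2,3)
  define p where "p i = (\<lambda>w. \<pi> w ((e ! i) w))" for i
  define G where "G = p ` {..<rk}"
  have fin: "finite G" by (simp add: G_def)
  have G: "G \<subseteq> sheaf U" unfolding G_def p_def using sheaf_proj[OF hol_frameD(3)[OF e(2)]] by auto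
  have gen: "\<exists>V' f. open V' \<and> w \<in> V' \<and> V' \<subseteq> V \<and> (\<forall>g\<in>G. f g holomorphic_on V') \<and>
      (\<forall>y\<in>V'. s y = (\<Sum>g\<in>G. scl E (f g y) (g y)))" if V: "open V" "V \<subseteq> U" and s: "s \<in> sheaf V" and w: "w \<in> V" for V s w
  proof -
    \<comment> \<open>Generators form a set, and different frame indices may give the same projected
      section; the coefficient of \<open>g\<close> collects all of them.\<close>
    define f where "f g y = (\<Sum>i\<in>{i\<in>{..<rk}. p i = g}. cf (ev e y) i (s y))" for g y
    have "f g holomorphic_on V" for g
    proof -
      have "(\<lambda>y. cf (ev e y) i (s y)) holomorphic_on V" if "i < rk" for i
        by (rule holomorphic_on_subset[OF hol_section_coord[OF e(2) sheafD(1)[OF s] that]]) (use V in auto)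
      then show ?thesis unfolding f_def[abs_def] by (intro holomorphic_on_sum) auto
    qed
    moreover have "s y = (\<Sum>g\<in>G. scl E (f g y) (g y))" if y: "y \<in> V" for y
    proof -
      have yU: "y \<in> U" using y V by blast
      note b = hol_frameD(4)[OF e(2) yU]
      have sy: "s y \<in> fibre E y" "\<pi> y (s y) = s y" using sheafD(2)[OF s y] by (auto simp: im_def)
      have "s y = \<pi> y (comb (\<lambda>i. cf (ev e y) i (s y)) (ev e y))" by (simp only: comb_cf[OF b sy(1)] sy(2))
      also have "\<dots> = (\<Sum>i<rk. scl E (cf (ev e y) i (s y)) (p i y))"
        using endo_comb[OF endo_proj subspace_fibre basis_list_set[OF b]] hol_frameD(2)[OF e(2)] by (simp add: p_def)
      also have "\<dots> = (\<Sum>g\<in>G. \<Sum>i\<in>{i\<in>{..<rk}. p i = g}. scl E (cf (ev e y) i (s y)) (p i y))"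
        unfolding G_def by (rule sum.image_gen) simp
      also have "\<dots> = (\<Sum>g\<in>G. scl E (f g y) (g y))"
        unfolding f_def scale_sum_left by (intro sum.cong refl) auto
      finally show ?thesis .
    qed
    ultimately show ?thesis using V(1) w by (intro exI[of _ V] exI[of _ f] conjI ballI) auto
  qed
  show "\<exists>W G. open W \<and> z \<in> W \<and> finite G \<and> G \<subseteq> sheaf W \<and>
      (\<forall>V s. open V \<and> V \<subseteq> W \<and> s \<in> sheaf V \<longrightarrow>
         (\<forall>w\<in>V. \<exists>V' f. open V' \<and> w \<in> V' \<and> V' \<subseteq> V \<and> (\<forall>g\<in>G. f g holomorphic_on V') \<and>
            (\<forall>y\<in>V'. s y = (\<Sum>g\<in>G. scl E (f g y) (g y)))))"
    by (rule exI[of _ U], rule exI[of _ G], intro conjI hol_frameD(1)[OF e(2)] e(1) fin G allI impI ballI,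
        elim conjE, rule gen)
qed

text \<open>Where \<open>f\<close> is nonzero, \<open>s\<close> is fixed by the projection. The
  zeros of \<open>f\<close> are isolated, so the coordinates of \<open>s - \<pi> s\<close> vanish on
  a punctured neighbourhood of every point and, being continuous, at the point itself.\<close>

lemma torsion_free: "torsion_free_quotient E sheaf"
  unfolding torsion_free_quotient_def
proof (intro allI impI, elim conjE bexE)
  fix W f s w assume W: "open W" "connected W" and f: "f holomorphic_on W" and w: "w \<in> W" "f w \<noteq> 0"
    and s: "hol_section E W s" and fs: "(\<lambda>z. scl E (f z) (s z)) \<in> sheaf W"
  show "s \<in> sheaf W"
  proof (rule sheafI[OF s])
    fix z assume z: "z \<in> W"
    obtain U e where U: "(U, e) \<in> frames E" "z \<in> U" and e: "hol_frame U e" by (rule local_frame)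
    have UW: "open (U \<inter> W)" "z \<in> U \<inter> W" using W(1) hol_frameD(1)[OF e] U(2) z by auto
    have d: "hol_section E W (\<lambda>y. s y - \<pi> y (s y))" by (rule hol_endoD(2)[OF hvb_proj.proj[OF compl] s])
    have nz: "s y - \<pi> y (s y) = 0" if y: "y \<in> W" "f y \<noteq> 0" for y
    proof -
      have "scl E (f y) (\<pi> y (s y)) = scl E (f y) (s y)"
        using sheafD(2)[OF fs y(1)] endo_scale[OF endo_proj hol_sectionD(2)[OF s y(1)]] by (simp add: im_def)
      then show ?thesis using y(2) by simp
    qed
    have "cf (ev e z) i (s z - \<pi> z (s z)) = 0" if i: "i < length (ev e z)" for i
    proof -
      let ?c = "\<lambda>y. cf (ev e y) i (s y - \<pi> y (s y))"
      have "?c holomorphic_on U \<inter> W" using hol_section_coord[OF e d] i hol_frameD(2)[OF e] by simp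
      then have "continuous_on (U \<inter> W) ?c" by (rule holomorphic_on_imp_continuous_on)
      then have "isCont ?c z" unfolding continuous_on_eq_continuous_at[OF UW(1)] using UW(2) by (rule bspec)
      then have lim: "(?c \<longlongrightarrow> ?c z) (at z)" by (simp add: isCont_def)
      have "eventually (\<lambda>y. f y \<noteq> 0 \<and> y \<in> W) (at z)" by (rule non_zero_neighbour_alt[OF f W z w])
      then have "eventually (\<lambda>y. ?c y = 0) (at z)" by eventually_elim (simp add: nz)
      then have "(?c \<longlongrightarrow> 0) (at z)" by (rule tendsto_eventually)
      from tendsto_unique[OF at_neq_bot lim this] show ?thesis .
    qed
    then have "s z - \<pi> z (s z) = 0"
      using hol_frameD(4)[OF e U(2)] hol_sectionD(2)[OF d z] subspace_0[OF subspace_fibre] by (intro cf_eqI) auto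
    then show "\<pi> z (s z) = s z" by simp
  qed
qed

theorem saturated: "saturated_subsheaf E sheaf"
  using coherent torsion_free by (simp add: saturated_subsheaf_def)

lemma im_bases:
  "\<exists>a. basis_list (im z) a"
  unfolding im_def by (rule subspace_basis_list[OF basis_frame_at subspace_image[OF subspace_fibre endo_proj idem]]) auto

lemma section_through:
  assumes e: "hol_frame U e" and z: "z \<in> U" and v: "v \<in> im z"
  shows "\<exists>s\<in>sheaf U. s z = v"
proof -
  let ?t = "\<lambda>w. \<Sum>i<rk. scl E (cf (ev e z) i v) ((e ! i) w)"
  have vf: "v \<in> fibre E z" "\<pi> z v = v" using v by (auto simp: im_def)
  have "hol_section E U ?t"
    by (intro hol_section_sum hol_frameD(1)[OF e] hol_section_scale hol_frameD(3)[OF e]) auto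
  then have "(\<lambda>w. \<pi> w (?t w)) \<in> sheaf U" by (rule sheaf_proj)
  moreover have "?t z = v" using comb_cf[OF hol_frameD(4)[OF e z] vf(1)] hol_frameD(2)[OF e] by (simp add: comb_eq)
  ultimately show ?thesis using vf(2) by (intro bexI[of _ "\<lambda>w. \<pi> w (?t w)"]) simp_all
qed

lemma sections_through:
  assumes e: "hol_frame U e" and z: "z \<in> U" and A: "set A \<subseteq> im z"
  shows "\<exists>a. set a \<subseteq> sheaf U \<and> ev a z = A"
  using A
proof (induction A)
  case Nil
  then show ?case by (intro exI[of _ "[]"]) (simp add: ev_def)
next
  case (Cons v A)
  then obtain a where "set a \<subseteq> sheaf U" "ev a z = A" by auto
  moreover obtain s where "s \<in> sheaf U" "s z = v" using section_through[OF e z, of v] Cons.prems by auto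
  ultimately show ?case by (intro exI[of _ "s # a"]) (simp add: ev_def)
qed

text \<open>Bases of image and kernel at \<open>z\<close> extend to holomorphic sections of the two
  summands, by projecting sections with constant coordinates. Their determinant relative to a frame
  is holomorphic and nonzero at \<open>z\<close>, hence nonzero nearby.\<close>

lemma adapted_frame:
  "\<exists>N a b. open N \<and> z \<in> N \<and> set a \<subseteq> sheaf N \<and> set b \<subseteq> hvb_proj.sheaf E (\<lambda>z v. v - \<pi> z v) N \<and>
     (\<forall>w\<in>N. basis_list (im w) (ev a w) \<and> basis_list (ker w) (ev b w)) \<and> hol_frame N (a @ b)"
proof -
  interpret C: hvb_proj E "\<lambda>z v. v - \<pi> z v" by (rule compl)
  obtain U e where U: "(U, e) \<in> frames E" "z \<in> U" and e: "hol_frame U e" by (rule local_frame)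
  obtain A where A: "basis_list (im z) A" using im_bases by blast
  obtain B where B: "basis_list (ker z) B" using C.im_bases[of z] unfolding compl_im by blast
  obtain a where a: "set a \<subseteq> sheaf U" "ev a z = A" using sections_through[OF e U(2) basis_list_set[OF A]] by blast
  obtain b where b: "set b \<subseteq> C.sheaf U" "ev b z = B"
    using C.sections_through[OF e U(2), of B] basis_list_set[OF B] unfolding compl_im by blast
  have ev_app: "ev (a @ b) w = ev a w @ ev b w" for w by (simp add: ev_def)
  have AB: "basis_list (fibre E z) (ev (a @ b) z)"
    unfolding ev_app a(2) b(2) by (rule basis_list_append[OF subspace_fibre endo_proj idem A[unfolded im_def] B[unfolded ker_def]])
  have le: "length e = rk" "length (a @ b) = rk" using hol_frameD(2)[OF e] length_frame[OF AB] by auto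
  have sec: "hol_section E U s" if "s \<in> set (a @ b)" for s using that a(1) b(1) sheafD(1) C.sheafD(1) by auto
  let ?D = "\<lambda>w. Determinant.det (trm e (a @ b) w)"
  have "?D holomorphic_on U"
  proof (rule holomorphic_det)
    show "\<forall>w\<in>U. trm e (a @ b) w \<in> carrier_mat rk rk" using trm_carrier[OF le(2,1)] by blast
    show "\<forall>i<rk. \<forall>j<rk. (\<lambda>w. trm e (a @ b) w $$ (i, j)) holomorphic_on U"
    proof (intro allI impI)
      fix i j assume ij: "i < rk" "j < rk"
      have "(\<lambda>w. cf (ev e w) j (((a @ b) ! i) w)) holomorphic_on U \<inter> U"
        by (rule hol_section_coord[OF e sec ij(2)]) (rule nth_mem, simp only: le ij)
      then show "(\<lambda>w. trm e (a @ b) w $$ (i, j)) holomorphic_on U" using ij le by (simp add: trm_index)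
    qed
  qed
  then have cont: "continuous_on U ?D" by (rule holomorphic_on_imp_continuous_on)
  define N where "N = {w\<in>U. ?D w \<noteq> 0}"
  have "open N"
    using continuous_open_preimage[OF cont hol_frameD(1)[OF e] open_Compl[OF closed_singleton[of 0]]]
    by (simp add: N_def vimage_def Int_def)
  moreover have "z \<in> N" using det_trm[OF hol_frameD(4)[OF e U(2)] AB] U(2) by (simp add: N_def)
  ultimately have N: "open N" "z \<in> N" "N \<subseteq> U" by (auto simp: N_def)
  have secN: "set a \<subseteq> sheaf N" "set b \<subseteq> C.sheaf N"
  proof -
    have "s \<in> sheaf N" if "s \<in> sheaf U" for s
      using hol_section_subset[OF sheafD(1)[OF that] N(1,3)] that N(3) by (auto simp: sheaf_def)
    then show "set a \<subseteq> sheaf N" using a(1) by blast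
    have "s \<in> C.sheaf N" if "s \<in> C.sheaf U" for s
      using hol_section_subset[OF C.sheafD(1)[OF that] N(1,3)] that N(3) by (auto simp: C.sheaf_def)
    then show "set b \<subseteq> C.sheaf N" using b(1) by blast
  qed
  have bas: "basis_list (fibre E w) (ev (a @ b) w)" if w: "w \<in> N" for w
  proof (rule basis_list_of_det[OF hol_frameD(4)[OF e]])
    show "w \<in> U" using w N by blast
    then show "set (ev (a @ b) w) \<subseteq> fibre E w" using sec hol_sectionD(2) by auto
    show "length (ev (a @ b) w) = length (ev e w)" using le by simp
    show "Determinant.det (trans_mat (ev e w) (ev (a @ b) w)) \<noteq> 0" using w by (simp add: N_def trm_def)
  qed
  have "basis_list (im w) (ev a w) \<and> basis_list (ker w) (ev b w)" if w: "w \<in> N" for w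
  proof -
    have "set (ev a w) \<subseteq> im w" using secN(1) sheafD(2) w by auto
    moreover have "set (ev b w) \<subseteq> ker w" using secN(2) C.sheafD(2) w unfolding compl_im by auto
    ultimately show ?thesis
      using basis_list_appendD[OF subspace_fibre endo_proj idem bas[OF w, unfolded ev_app]]
      unfolding im_def[symmetric] ker_def[symmetric] by simp
  qed
  moreover have "hol_frame N (a @ b)"
    unfolding hol_frame_def by (intro conjI ballI N(1) le(2) bas hol_section_subset[OF sec N(1,3)])
  ultimately show ?thesis by (intro exI[of _ N] exI[of _ a] exI[of _ b] conjI ballI N secN) simp_all
qed

abbreviation "SB \<equiv> subbundle E sheaf"

lemma subbundle_simps:
  "scl SB = scl E" "fibre SB z = im z"
  "(U, e) \<in> frames SB \<longleftrightarrow> open U \<and> set e \<subseteq> sheaf U \<and> (\<forall>z\<in>U. basis_list (im z) (ev e z))"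
proof -
  have F: "{s z | s W. open W \<and> z \<in> W \<and> s \<in> sheaf W} = im z" for z
  proof
    show "{s z | s W. open W \<and> z \<in> W \<and> s \<in> sheaf W} \<subseteq> im z" using sheafD(2) by auto
    obtain U e where U: "(U, e) \<in> frames E" "z \<in> U" and e: "hol_frame U e" by (rule local_frame)
    show "im z \<subseteq> {s z | s W. open W \<and> z \<in> W \<and> s \<in> sheaf W}"
    proof
      fix v assume "v \<in> im z"
      then obtain s where "s \<in> sheaf U" "s z = v" using section_through[OF e U(2)] by blast
      then show "v \<in> {s z | s W. open W \<and> z \<in> W \<and> s \<in> sheaf W}" using hol_frameD(1)[OF e] U(2) by blast
    qed
  qed
  show "scl SB = scl E" by (simp add: subbundle_def Let_def)
  show "fibre SB z = im z" using F by (simp add: subbundle_def Let_def)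
  have fb: "fibre_basis \<lparr>scl = scl E, fibre = im, frames = {}\<rparr> e z \<longleftrightarrow> basis_list (im z) (ev e z)" for e z
    by (simp add: fibre_basis_def basis_list_def) (simp add: ev_def)
  show "(U, e) \<in> frames SB \<longleftrightarrow> open U \<and> set e \<subseteq> sheaf U \<and> (\<forall>z\<in>U. basis_list (im z) (ev e z))"
    unfolding subbundle_def Let_def F by (simp add: fb)
qed

text \<open>The rank is the trace of the projection, hence holomorphic and real.\<close>

lemma rank_im: "basis_list (im z) a \<Longrightarrow> basis_list (im w) b \<Longrightarrow> length a = length b"
proof -
  assume a: "basis_list (im z) a" and b: "basis_list (im w) b"
  let ?t = "\<lambda>z. tr (ev (frame_at E z) z) (\<pi> z)"
  have t: "?t z = of_nat (length a)" if a: "basis_list (im z) a" for z a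
  proof -
    obtain B where B: "basis_list (ker z) B" using hvb_proj.im_bases[OF compl, of z] unfolding compl_im by blast
    note s = subspace_fibre endo_proj idem a[unfolded im_def] B[unfolded ker_def]
    have "?t z = tr (a @ B) (\<pi> z)" by (rule tr_basis_indep[OF basis_frame_at basis_list_append[OF s] endo_proj])
    then show ?thesis unfolding tr_projection[OF s] .
  qed
  have real: "?t z \<in> \<real>" for z
  proof -
    obtain A where "basis_list (im z) A" using im_bases by blast
    from t[OF this] show ?thesis by simp
  qed
  have "?t z = ?t w" by (rule holomorphic_real_constant[OF holomorphic_trace[OF proj] real])
  then show ?thesis unfolding t[OF a] t[OF b] by simp
qed

lemma bundle_base_subbundle: "bundle_base SB = UNIV"
proof -
  have "\<exists>U e. (U, e) \<in> frames SB \<and> z \<in> U" for z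
    using adapted_frame[of z] unfolding subbundle_simps by blast
  then show ?thesis unfolding bundle_base_def by fast
qed

text \<open>For the transition functions, a frame of the subbundle is completed by the kernel part
  of an adapted frame to a holomorphic frame of \<open>E\<close>. On sections of the image the
  leading coordinates in that frame are the coordinates in the given one.\<close>

theorem hol_vector_bundle_subbundle: "hol_vector_bundle SB"
  unfolding hol_vector_bundle_def
proof (intro conjI)
  show "vector_space (scl SB)" unfolding subbundle_simps by (rule vector_space_axioms)
  show "\<forall>z. module.subspace (scl SB) (fibre SB z)"
    unfolding subbundle_simps im_def by (intro allI subspace_image[OF subspace_fibre endo_proj idem])
  obtain A where A: "basis_list (im 0) A" using im_bases by blast
  have "dim (im z) = length A" for z
  proof -
    obtain B where B: "basis_list (im z) B" using im_bases by blast
    show ?thesis unfolding dim_basis_list[OF B] by (rule rank_im[OF B A])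
  qed
  then show "\<exists>r. \<forall>z. vector_space.dim (scl SB) (fibre SB z) = r" unfolding subbundle_simps by blast
  show "bundle_base SB = UNIV" by (rule bundle_base_subbundle)
  have fb: "fibre_basis SB e z \<longleftrightarrow> basis_list (im z) (ev e z)" for e z
    by (simp add: fibre_basis_def basis_list_def subbundle_simps) (simp add: ev_def)
  show "\<forall>(U, e)\<in>frames SB. open U \<and> (\<forall>z\<in>U. fibre_basis SB e z)"
    using subbundle_simps(3) fb by auto
  have crd: "coord SB e i z v = cf (ev e z) i v" if "i < length e" for e i z v
    using that by (simp add: coord_def cf_def subbundle_simps)
  have tr: "(\<lambda>z. cf (ev e z) i ((f ! j) z)) holomorphic_on (U \<inter> V)"
    if U: "(U, e) \<in> frames SB" and V: "(V, f) \<in> frames SB" and i: "i < length e" and j: "j < length f" for U e V f i j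
  proof (rule holomorphic_onI)
    fix z assume z: "z \<in> U \<inter> V"
    note U' = U[unfolded subbundle_simps] and V' = V[unfolded subbundle_simps]
    obtain N a b where N: "open N" "z \<in> N" "\<forall>w\<in>N. basis_list (im w) (ev a w) \<and> basis_list (ker w) (ev b w)"
      "hol_frame N (a @ b)" using adapted_frame[of z] by (elim exE conjE)
    have ev_app: "ev (e @ b) w = ev e w @ ev b w" for w by (simp add: ev_def)
    have bas: "basis_list (im w) (ev e w)" "basis_list (ker w) (ev b w)" "basis_list (fibre E w) (ev (e @ b) w)"
      if w: "w \<in> U \<inter> N" for w
    proof -
      show 1: "basis_list (im w) (ev e w)" "basis_list (ker w) (ev b w)" using U' N(3) w by auto
      show "basis_list (fibre E w) (ev (e @ b) w)" unfolding ev_app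
        by (rule basis_list_append[OF subspace_fibre endo_proj idem 1[unfolded im_def ker_def]])
    qed
    have UN: "open (U \<inter> N)" using U' N(1) by blast
    have "hol_section E (U \<inter> N) s" if s: "s \<in> set (e @ b)" for s
    proof (cases "s \<in> set e")
      case True
      then have "hol_section E U s" using U' sheafD(1) by blast
      then show ?thesis by (rule hol_section_subset[OF _ UN]) simp
    next
      case False
      then have "s \<in> set (a @ b)" using s by simp
      then have "hol_section E N s" using N(4) by (simp add: hol_frame_def)
      then show ?thesis by (rule hol_section_subset[OF _ UN]) simp
    qed
    moreover have "length (e @ b) = rk" using length_frame[OF bas(3), of z] z N(2) by simp
    ultimately have fr: "hol_frame (U \<inter> N) (e @ b)" unfolding hol_frame_def using UN bas(3) by blast
    have ir: "i < rk" using i hol_frameD(2)[OF fr] by simp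
    have fs: "f ! j \<in> sheaf V" using V' j nth_mem by blast
    have "(\<lambda>w. cf (ev (e @ b) w) i ((f ! j) w)) holomorphic_on (U \<inter> N) \<inter> V"
      by (rule hol_section_coord[OF fr sheafD(1)[OF fs] ir])
    then have h: "(\<lambda>w. cf (ev e w) i ((f ! j) w)) holomorphic_on (U \<inter> N) \<inter> V"
    proof (rule holomorphic_transform)
      fix w assume w: "w \<in> U \<inter> N \<inter> V"
      then have "(f ! j) w \<in> im w" using sheafD(2)[OF fs] by blast
      then have v: "(f ! j) w \<in> fibre E w" "\<pi> w ((f ! j) w) = (f ! j) w" by (auto simp: im_def)
      have w': "w \<in> U \<inter> N" using w by blast
      show "cf (ev (e @ b) w) i ((f ! j) w) = cf (ev e w) i ((f ! j) w)"
        unfolding ev_app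
        by (rule cf_append[OF subspace_fibre endo_proj idem bas(1,2)[OF w', unfolded im_def ker_def] v]) (simp add: i)
    qed
    have "open (U \<inter> N \<inter> V)" "z \<in> U \<inter> N \<inter> V" using UN V' z N(2) by auto
    then show "(\<lambda>z. cf (ev e z) i ((f ! j) z)) field_differentiable at z within U \<inter> V"
      using h holomorphic_on_imp_differentiable_at field_differentiable_at_within by blast
  qed
  show "\<forall>(U, e)\<in>frames SB. \<forall>(V, f)\<in>frames SB. \<forall>i<length e. \<forall>j<length f.
      (\<lambda>z. coord SB e i z ((f ! j) z)) holomorphic_on (U \<inter> V)"
    using tr crd by fastforce
qed

end

section \<open>Degrees of the summands\<close>

text \<open>The second derivative of \<open>log f\<close> written without a logarithm, so that no
  branch has to be chosen for functions that are merely nonvanishing.\<close>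

definition dbar_dlog :: "(complex \<Rightarrow> complex) \<Rightarrow> complex \<Rightarrow> complex" where
  "dbar_dlog f = d_zbar (\<lambda>w. d_z f w / f w)"

lemma dbar_dlog_cong:
  assumes U: "open U" and z: "z \<in> U" and eq: "\<forall>w\<in>U. f w = g w"
  shows "dbar_dlog f z = dbar_dlog g z"
  unfolding dbar_dlog_def
proof (rule D_cong[OF wirtinger(2) U z])
  fix w assume w: "w \<in> U"
  have "d_z f w = d_z g w" by (rule D_cong[OF wirtinger(1) U w]) (use eq in blast)
  then show "d_z f w / f w = d_z g w / g w" using eq w by simp
qed

lemma dbar_dlog_smooth:
  assumes U: "open U" and f: "smooth_on U f" "\<forall>w\<in>U. f w \<noteq> 0"
  shows "smooth_on U (\<lambda>w. d_z f w / f w)" "smooth_on U (dbar_dlog f)"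
proof -
  show 1: "smooth_on U (\<lambda>w. d_z f w / f w)" using f by (intro smooth_on_divide U smooth_on_d_z) auto
  show "smooth_on U (dbar_dlog f)" unfolding dbar_dlog_def by (rule smooth_on_d_zbar[OF U 1])
qed

lemma dbar_dlog_mult:
  assumes U: "open U" and z: "z \<in> U" and f: "smooth_on U f" "\<forall>w\<in>U. f w \<noteq> 0"
    and g: "smooth_on U g" "\<forall>w\<in>U. g w \<noteq> 0"
  shows "dbar_dlog (\<lambda>w. f w * g w) z = dbar_dlog f z + dbar_dlog g z"
proof -
  have "dbar_dlog (\<lambda>w. f w * g w) z = d_zbar (\<lambda>w. d_z f w / f w + d_z g w / g w) z"
    unfolding dbar_dlog_def
  proof (rule D_cong[OF wirtinger(2) U z])
    fix w assume w: "w \<in> U"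
    have "d_z (\<lambda>w. f w * g w) w = d_z f w * g w + f w * d_z g w"
      using smooth_on_imp_differentiable[OF f(1) w] smooth_on_imp_differentiable[OF g(1) w] by (rule D_mult[OF wirtinger(1)])
    then show "d_z (\<lambda>w. f w * g w) w / (f w * g w) = d_z f w / f w + d_z g w / g w"
      using f(2) g(2) w by (simp add: field_simps)
  qed
  also have "\<dots> = dbar_dlog f z + dbar_dlog g z"
    unfolding dbar_dlog_def
    by (intro D_add[OF wirtinger(2)] smooth_on_imp_differentiable[OF dbar_dlog_smooth(1)[OF U] z] f g)
  finally show ?thesis .
qed

lemma dbar_dlog_divide:
  assumes U: "open U" and z: "z \<in> U" and f: "smooth_on U f" "\<forall>w\<in>U. f w \<noteq> 0"
    and g: "smooth_on U g" "\<forall>w\<in>U. g w \<noteq> 0"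
  shows "dbar_dlog (\<lambda>w. f w / g w) z = dbar_dlog f z - dbar_dlog g z"
proof -
  have q: "smooth_on U (\<lambda>w. f w / g w)" "\<forall>w\<in>U. f w / g w \<noteq> 0"
    using f g by (auto intro!: smooth_on_divide U)
  have "dbar_dlog f z = dbar_dlog (\<lambda>w. f w / g w * g w) z"
    by (rule dbar_dlog_cong[OF U z]) (use g(2) in simp)
  then show ?thesis unfolding dbar_dlog_mult[OF U z q g] by simp
qed

text \<open>The logarithmic derivative of \<open>h\<close> is holomorphic, and \<open>d_z\<close>
  kills the conjugate of \<open>h\<close>. A change of holomorphic frame therefore leaves the
  curvature of the determinant unchanged.\<close>

lemma dbar_dlog_norm_holomorphic:
  assumes U: "open U" and z: "z \<in> U" and h: "h holomorphic_on U" "\<forall>w\<in>U. h w \<noteq> 0"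
  shows "dbar_dlog (\<lambda>w. h w * cnj (h w)) z = 0"
proof -
  note sh = holomorphic_imp_smooth_on[OF U h(1)]
  have "dbar_dlog h z = d_zbar (\<lambda>w. deriv h w / h w) z"
    unfolding dbar_dlog_def
    by (rule D_cong[OF wirtinger(2) U z]) (simp add: holomorphic_d_z[OF U h(1)])
  also have "\<dots> = 0"
    by (rule holomorphic_d_zbar[OF U _ z]) (intro holomorphic_on_divide holomorphic_deriv h U bspec[OF h(2)])
  finally have 1: "dbar_dlog h z = 0" .
  have "dbar_dlog (\<lambda>w. cnj (h w)) z = d_zbar (\<lambda>w. 0) z"
    unfolding dbar_dlog_def
  proof (rule D_cong[OF wirtinger(2) U z])
    fix w assume w: "w \<in> U"
    have "d_z (\<lambda>w. cnj (h w)) w = cnj (d_zbar h w)" by (rule d_z_cnj(1)[OF smooth_on_imp_differentiable[OF sh w]])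
    then show "d_z (\<lambda>w. cnj (h w)) w / cnj (h w) = 0" using holomorphic_d_zbar[OF U h(1) w] by simp
  qed
  then have 2: "dbar_dlog (\<lambda>w. cnj (h w)) z = 0" by simp
  have "dbar_dlog (\<lambda>w. h w * cnj (h w)) z = dbar_dlog h z + dbar_dlog (\<lambda>w. cnj (h w)) z"
    by (rule dbar_dlog_mult[OF U z sh h(2) smooth_on_cnj[OF U sh]]) (use h(2) in simp)
  then show ?thesis using 1 2 by simp
qed

lemma dbar_d_Ln:
  assumes U: "open U" and z: "z \<in> U" and f: "smooth_on U f" "\<forall>w\<in>U. f w \<in> \<real> \<and> Re (f w) > 0"
  shows "d_zbar (d_z (\<lambda>w. Ln (f w))) z = dbar_dlog f z" "smooth_on U (\<lambda>w. Ln (f w))"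
proof -
  have slit: "f w \<notin> \<real>\<^sub>\<le>\<^sub>0" if "w \<in> U" for w
    using f(2) that by (auto simp: complex_nonpos_Reals_iff)
  show "smooth_on U (\<lambda>w. Ln (f w))"
  proof (rule smooth_on_compose_holomorphic[OF U _ f(1)])
    show "open (- \<real>\<^sub>\<le>\<^sub>0 :: complex set)" by (simp add: open_Compl)
    show "Ln holomorphic_on - \<real>\<^sub>\<le>\<^sub>0" by (rule holomorphic_on_Ln) auto
  qed (use slit in blast)
  show "d_zbar (d_z (\<lambda>w. Ln (f w))) z = dbar_dlog f z"
    unfolding dbar_dlog_def
  proof (rule D_cong[OF wirtinger(2) U z])
    fix w assume w: "w \<in> U"
    show "d_z (\<lambda>w. Ln (f w)) w = d_z f w / f w"
      using d_z_compose(1)[OF has_field_derivative_Ln[OF slit[OF w]] smooth_on_imp_differentiable[OF f(1) w]]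
      by (simp add: field_simps)
  qed
qed

context hvb_metric begin

lemma gram_det_frame:
  assumes U: "(U, e) \<in> frames E" and z: "z \<in> U"
  shows "open U" "smooth_on U (gram_det H e)"
    "\<forall>w\<in>U. gram_det H e w \<noteq> 0" "\<forall>w\<in>U. gram_det H e w \<in> \<real> \<and> Re (gram_det H e w) > 0"
proof -
  show op: "open U" by (rule framesD(1)[OF U])
  show "smooth_on U (gram_det H e)"
    unfolding gram_det_eq[abs_def] by (rule smooth_on_det[OF op smooth_GM[OF U]]) (use z in blast)
  show "\<forall>w\<in>U. gram_det H e w \<noteq> 0" "\<forall>w\<in>U. gram_det H e w \<in> \<real> \<and> Re (gram_det H e w) > 0"
    unfolding gram_det_eq using det_GM[OF framesD(2)[OF U]] by auto
qed

lemma degree_density_gram: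
  assumes U: "(U, e) \<in> frames E" and z: "z \<in> U"
  shows "degree_density E H z = - 2 * Re (dbar_dlog (gram_det H e) z)"
proof -
  have "U \<noteq> {}" using z by blast
  from frame_GM[OF U this] show ?thesis
    unfolding degree_density_frame[OF U z] dbar_dlog_def gram_det_eq[abs_def] by (simp add: mtrace_theta[OF _ _ _ z])
qed

lemma continuous_degree_density: "continuous_on UNIV (degree_density E H)"
proof (rule continuous_at_imp_continuous_on, rule ballI)
  fix z
  obtain U e where U: "(U, e) \<in> frames E" "z \<in> U" using frame_ex by blast
  note G = gram_det_frame[OF U]
  have "continuous_on U (\<lambda>w. - 2 * Re (dbar_dlog (gram_det H e) w))"
    by (intro continuous_intros smooth_on_imp_continuous_on dbar_dlog_smooth(2) G)
  then have "continuous_on U (degree_density E H)"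
    by (rule continuous_on_cong[THEN iffD1, rotated 2]) (simp_all add: degree_density_gram[OF U(1)])
  then show "isCont (degree_density E H) z" using continuous_on_eq_continuous_at[OF G(1)] U(2) by blast
qed

text \<open>A Hermitian metric is assumed smooth on frames of the atlas; the frames of a subbundle
  consist of other holomorphic sections, which are expanded here.\<close>

lemma metric_smooth:
  assumes s: "hol_section E W s" and t: "hol_section E W t"
  shows "smooth_on W (\<lambda>z. H z (s z) (t z))"
proof (rule smooth_on_local)
  fix z assume z: "z \<in> W"
  obtain U e where U: "(U, e) \<in> frames E" "z \<in> U" and e: "hol_frame U e" by (rule local_frame)
  note le = hol_frameD(2)[OF e]
  have UW: "open (U \<inter> W)" using hol_frameD(1)[OF e] hol_sectionD(1)[OF s] by blast
  have ne: "U \<noteq> {}" using U(2) by blast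
  have c: "smooth_on (U \<inter> W) (\<lambda>z. cf (ev e z) i (r z))" if "hol_section E W r" "i < rk" for r i
    by (rule holomorphic_imp_smooth_on[OF UW hol_section_coord[OF e that]])
  have G: "smooth_on (U \<inter> W) (\<lambda>z. GM H e z $$ (i, j))" if "i < rk" "j < rk" for i j
    by (rule smooth_on_subset[OF smooth_matD(2)[OF smooth_GM[OF U(1) ne] that]]) auto
  have "smooth_on (U \<inter> W) (\<lambda>z. \<Sum>i<rk. \<Sum>j<rk. cf (ev e z) i (s z) * cnj (cf (ev e z) j (t z)) * GM H e z $$ (i, j))"
    by (intro smooth_on_sum smooth_on_mult smooth_on_cnj UW c s t G) auto
  then have "smooth_on (U \<inter> W) (\<lambda>z. H z (s z) (t z))"
  proof (rule smooth_on_transform[OF UW])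
    fix w assume w: "w \<in> U \<inter> W"
    then have b: "basis_list (fibre E w) (ev e w)" using hol_frameD(4)[OF e] by blast
    have sw: "s w \<in> fibre E w" "t w \<in> fibre E w" using hol_sectionD(2)[OF s] hol_sectionD(2)[OF t] w by auto
    have "H w (s w) (t w) = H w (comb (\<lambda>i. cf (ev e w) i (s w)) (ev e w)) (comb (\<lambda>i. cf (ev e w) i (t w)) (ev e w))"
      by (simp only: comb_cf[OF b sw(1)] comb_cf[OF b sw(2)])
    also have "\<dots> = (\<Sum>i<rk. \<Sum>j<rk. cf (ev e w) i (s w) * cnj (cf (ev e w) j (t w)) * GM H e w $$ (i, j))"
      unfolding herm_comb2[OF subspace_fibre herm_fibre basis_list_set[OF b]]
      using le by (intro sum.cong) (auto simp: GM_def gram_def)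
    finally show "H w (s w) (t w) = (\<Sum>i<rk. \<Sum>j<rk. cf (ev e w) i (s w) * cnj (cf (ev e w) j (t w)) * GM H e w $$ (i, j))" .
  qed
  then show "\<exists>V. open V \<and> z \<in> V \<and> smooth_on V (\<lambda>z. H z (s z) (t z))"
    using z U(2) UW by (intro exI[of _ "U \<inter> W"] conjI IntI)
qed

end

lemma (in hvb_proj) hvb_metric_subbundle:
  assumes "hvb_metric E H" shows "hvb_metric SB H"
proof -
  interpret H: hvb_metric E H by (rule assms)
  have h: "herm_on (im z) (H z)" for z by (rule herm_on_subset[OF H.herm_fibre]) (auto simp: im_def)
  have sub: "subspace (im z)" for z unfolding im_def by (rule subspace_image[OF subspace_fibre endo_proj idem])
  have lin: "H z (scl SB a u + scl SB b v) w = a * H z u w + b * H z v w"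
    if "u \<in> fibre SB z" "v \<in> fibre SB z" "w \<in> fibre SB z" for z u v w a b
    using that unfolding subbundle_simps by (rule herm_lin[OF sub h])
  have cnj: "H z v u = cnj (H z u v)" if "u \<in> fibre SB z" "v \<in> fibre SB z" for z u v
    using that unfolding subbundle_simps by (rule herm_cnj[OF sub h])
  have pos: "0 < Re (H z u u)" if "u \<in> fibre SB z" "u \<noteq> 0" for z u
    using that unfolding subbundle_simps by (rule herm_pos[OF sub h])
  have "smooth_on U (\<lambda>z. H z ((e ! i) z) ((e ! j) z))"
    if e: "set e \<subseteq> sheaf U" and i: "i < length e" and j: "j < length e" for U e i j
  proof -
    have "e ! i \<in> sheaf U" "e ! j \<in> sheaf U" using e i j nth_mem by blast+
    then show ?thesis by (intro H.metric_smooth sheafD(1))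
  qed
  then have smooth: "\<forall>(U, e)\<in>frames SB. \<forall>i<length e. \<forall>j<length e. smooth_on U (\<lambda>z. H z ((e ! i) z) ((e ! j) z))"
    using subbundle_simps(3) by auto
  have "hermitian_metric SB H"
    unfolding hermitian_metric_def by (intro conjI smooth) (intro allI ballI impI lin cnj pos; assumption)+
  then show ?thesis using hol_vector_bundle_subbundle by (simp add: hvb_metric_def hvb_metric_axioms_def hvb_def)
qed

context cvs begin

text \<open>Orthogonality makes the Gram matrix block triangular.\<close>

lemma det_gram_orthogonal:
  assumes "\<And>u w. u \<in> set a \<Longrightarrow> w \<in> set b \<Longrightarrow> H u w = 0"
  shows "Determinant.det (gram H (a @ b)) = Determinant.det (gram H a) * Determinant.det (gram H b)"
proof -
  define C where "C = Matrix.mat (length b) (length a) (\<lambda>(i, j). H (b ! i) (a ! j))"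
  have "gram H (a @ b) = four_block_mat (gram H a) (0\<^sub>m (length a) (length b)) C (gram H b)"
  proof (rule eq_matI)
    fix i j assume "i < dim_row (four_block_mat (gram H a) (0\<^sub>m (length a) (length b)) C (gram H b))"
      "j < dim_col (four_block_mat (gram H a) (0\<^sub>m (length a) (length b)) C (gram H b))"
    then have ij: "i < length a + length b" "j < length a + length b" by (auto simp: gram_def)
    have o: "H (a ! i) (b ! (j - length a)) = 0" if "i < length a" "\<not> j < length a"
      using that ij by (intro assms nth_mem) auto
    show "gram H (a @ b) $$ (i, j) = four_block_mat (gram H a) (0\<^sub>m (length a) (length b)) C (gram H b) $$ (i, j)"
      using ij o by (auto simp: gram_def C_def nth_append)
  qed (auto simp: gram_def)
  then show ?thesis
    using det_four_block_mat_upper_right_zero[OF gram_carrier refl _ gram_carrier, of C b a H H] by (simp add: C_def)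
qed

end

text \<open>The form that \<open>bundle_degree\<close> takes for a bundle over the whole
  plane.\<close>

definition ext_integral :: "(complex \<Rightarrow> real) \<Rightarrow> ereal" where
  "ext_integral f = enn2ereal (\<integral>\<^sup>+z. ennreal (f z) \<partial>lborel) - enn2ereal (\<integral>\<^sup>+z. ennreal (- f z) \<partial>lborel)"

lemma ext_integral_integrable:
  assumes "integrable lborel f" shows "ext_integral f = ereal (\<integral>z. f z \<partial>lborel)"
proof -
  have fin: "(\<integral>\<^sup>+z. ennreal (f z) \<partial>lborel) \<noteq> \<infinity>" "(\<integral>\<^sup>+z. ennreal (- f z) \<partial>lborel) \<noteq> \<infinity>"
    using assms unfolding real_integrable_def by auto
  have e: "enn2ereal x = ereal (enn2real x)" if "x \<noteq> \<infinity>" for x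
    using that by (cases x) (auto simp: enn2ereal_ennreal)
  show ?thesis
    unfolding ext_integral_def e[OF fin(1)] e[OF fin(2)] real_lebesgue_integral_def[OF assms] by simp
qed

text \<open>Here \<open>f\<close> and \<open>g\<close> are the densities of the summands of ranks
  \<open>s\<close> and \<open>t\<close>, \<open>e\<close> is that of \<open>E\<close>, and
  \<open>- 2 w\<close> is the defect. The slope inequalities keep the positive parts of
  \<open>f\<close> and \<open>g\<close> finite, which bounds the negative part of \<open>w\<close>;
  the assumption \<open>par\<close> then makes \<open>w\<close> integrable with integral at most 0.
  Now \<open>f\<close> and \<open>g\<close> are integrable and their integrals add up to at least
  that of \<open>e\<close>, whereas the slope inequalities, weighted by the ranks, say that they add
  up to less.\<close>

lemma degree_contradiction:
  fixes f g e w :: "complex \<Rightarrow> real"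
  assumes [measurable]: "f \<in> borel_measurable borel" "g \<in> borel_measurable borel" "w \<in> borel_measurable borel"
    and e: "integrable lborel e" and eq: "\<And>z. f z + g z - e z = - 2 * w z" and s: "s > 0" and t: "t > 0"
    and f: "ext_integral f / ereal s < ext_integral e / ereal (s + t)"
    and g: "ext_integral g / ereal t < ext_integral e / ereal (s + t)"
    and par: "(\<integral>\<^sup>+z. ennreal (- w z) \<partial>lborel) < \<infinity> \<Longrightarrow>
      (\<integral>\<^sup>+z. ennreal (w z) \<partial>lborel) \<le> (\<integral>\<^sup>+z. ennreal (- w z) \<partial>lborel)"
  shows False
proof -
  have [measurable]: "e \<in> borel_measurable borel" using borel_measurable_integrable[OF e] by simp
  have m: "ennreal (max 0 x) = ennreal x" for x :: real by (simp add: max_def ennreal_neg)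
  \<comment> \<open>In \<open>ereal\<close>, infinity minus anything is infinity, also when the
    subtrahend is infinite; so an infinite positive part would make the slope infinite, and it could
    not be less than \<open>C\<close>.\<close>
  have top: "(\<integral>\<^sup>+z. ennreal (f z) \<partial>lborel) < \<infinity>" if "ext_integral f / ereal s < C" "s > 0" for f s C
  proof (rule ccontr)
    assume "\<not> (\<integral>\<^sup>+z. ennreal (f z) \<partial>lborel) < \<infinity>"
    then have "(\<integral>\<^sup>+z. ennreal (f z) \<partial>lborel) = \<infinity>" by (simp add: less_top[symmetric])
    then have "ext_integral f = \<infinity>" by (simp add: ext_integral_def)
    then show False using that by (simp add: divide_ereal_def)
  qed
  note pf = top[OF f s] and pg = top[OF g t]
  have ne: "(\<integral>\<^sup>+z. ennreal (- e z) \<partial>lborel) < \<infinity>" using e unfolding real_integrable_def by (simp add: less_top)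
  have "(\<integral>\<^sup>+z. ennreal (- w z) \<partial>lborel) \<le> (\<integral>\<^sup>+z. ennreal (f z) + ennreal (g z) + ennreal (- e z) \<partial>lborel)"
  proof (rule nn_integral_mono)
    fix z
    have "- w z \<le> max 0 (f z) + max 0 (g z) + max 0 (- e z)" using eq[of z] by linarith
    then have "ennreal (- w z) \<le> ennreal (max 0 (f z) + max 0 (g z) + max 0 (- e z))" by (rule ennreal_leI)
    also have "\<dots> = ennreal (f z) + ennreal (g z) + ennreal (- e z)" by (simp add: m add_nonneg_nonneg)
    finally show "ennreal (- w z) \<le> ennreal (f z) + ennreal (g z) + ennreal (- e z)" .
  qed
  also have "\<dots> = (\<integral>\<^sup>+z. ennreal (f z) \<partial>lborel) + (\<integral>\<^sup>+z. ennreal (g z) \<partial>lborel) + (\<integral>\<^sup>+z. ennreal (- e z) \<partial>lborel)"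
    by (simp add: nn_integral_add)
  also have "\<dots> < \<infinity>" using pf pg ne by simp
  finally have nw: "(\<integral>\<^sup>+z. ennreal (- w z) \<partial>lborel) < \<infinity>" .
  note le = par[OF nw]
  have iw: "integrable lborel w" unfolding real_integrable_def using le_less_trans[OF le nw] nw by (simp add: less_top)
  have w0: "(\<integral>z. w z \<partial>lborel) \<le> 0"
    unfolding real_lebesgue_integral_def[OF iw] using enn2real_mono[OF le] nw by simp
  \<comment> \<open>\<open>k\<close> is the sum \<open>f + g\<close>. It is known to be integrable
    before its two summands are, and with the finite positive part of \<open>g\<close> it controls
    the negative part of \<open>f\<close>.\<close>
  define k where "k z = e z - 2 * w z" for z
  have ik: "integrable lborel k" unfolding k_def by (intro Bochner_Integration.integrable_diff integrable_mult_right e iw)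
  have fg: "g z = k z - f z" for z using eq[of z] by (simp add: k_def)
  have [measurable]: "k \<in> borel_measurable borel" using borel_measurable_integrable[OF ik] by simp
  have nk: "(\<integral>\<^sup>+z. ennreal (- k z) \<partial>lborel) < \<infinity>" using ik unfolding real_integrable_def by (simp add: less_top)
  have "(\<integral>\<^sup>+z. ennreal (- f z) \<partial>lborel) \<le> (\<integral>\<^sup>+z. ennreal (g z) + ennreal (- k z) \<partial>lborel)"
  proof (rule nn_integral_mono)
    fix z
    have "- f z \<le> max 0 (g z) + max 0 (- k z)" using fg[of z] by linarith
    then have "ennreal (- f z) \<le> ennreal (max 0 (g z) + max 0 (- k z))" by (rule ennreal_leI)
    also have "\<dots> = ennreal (g z) + ennreal (- k z)" by (simp add: m add_nonneg_nonneg)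
    finally show "ennreal (- f z) \<le> ennreal (g z) + ennreal (- k z)" .
  qed
  also have "\<dots> = (\<integral>\<^sup>+z. ennreal (g z) \<partial>lborel) + (\<integral>\<^sup>+z. ennreal (- k z) \<partial>lborel)" by (simp add: nn_integral_add)
  also have "\<dots> < \<infinity>" using pg nk by simp
  finally have "integrable lborel f" unfolding real_integrable_def using pf by (simp add: less_top)
  note i_f = this
  have i_g: "integrable lborel g"
    using Bochner_Integration.integrable_diff[OF ik i_f] unfolding fg[symmetric] .
  let ?x = "\<integral>z. f z \<partial>lborel" and ?y = "\<integral>z. g z \<partial>lborel" and ?e = "\<integral>z. e z \<partial>lborel"
  have "?y = (\<integral>z. k z \<partial>lborel) - ?x" unfolding fg[abs_def] by (rule Bochner_Integration.integral_diff[OF ik i_f])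
  moreover have "(\<integral>z. k z \<partial>lborel) = ?e - 2 * (\<integral>z. w z \<partial>lborel)"
    unfolding k_def using e iw by simp
  ultimately have sum: "?x + ?y \<ge> ?e" using w0 by simp
  have "?x / s < ?e / (s + t)" "?y / t < ?e / (s + t)"
    using f g s t unfolding ext_integral_integrable[OF e] ext_integral_integrable[OF i_f] ext_integral_integrable[OF i_g] by simp_all
  then have "?x < ?e / (s + t) * s" "?y < ?e / (s + t) * t" using s t by (simp_all add: pos_divide_less_eq)
  then have "?x + ?y < ?e / (s + t) * (s + t)" by (simp add: distrib_left)
  then show False using sum s t by simp
qed

section \<open>Determinant ratios on the summands and the failure of stability\<close>

context he_pair begin

text \<open>The ratio of the metrics induced by \<open>K\<close> and \<open>H\<^sub>1\<close> on the determinant line of \<open>V\<close>; by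
  \<open>det_gram_ratio\<close> it does not depend on the chosen basis.\<close>

definition rho :: "complex \<Rightarrow> 'v set \<Rightarrow> complex" where
  "rho z V = (let b = (SOME b. basis_list V b) in
     Determinant.det (gram (K z) b) / Determinant.det (gram (H1 z) b))"

lemma rho_eq:
  assumes V: "V \<subseteq> fibre E z" and b: "basis_list V b"
  shows "rho z V = Determinant.det (gram (K z) b) / Determinant.det (gram (H1 z) b)"
proof -
  let ?b = "SOME b. basis_list V b"
  have b': "basis_list V ?b" using b by (rule someI)
  from det_gram_ratio[OF b b'] obtain c where c: "c > 0"
    "\<forall>H. herm_on V H \<longrightarrow> Determinant.det (gram H ?b) = of_real c * Determinant.det (gram H b)" by (elim exE conjE)
  note k = c(2)[rule_format, OF herm_on_subset[OF K.herm_fibre V]] and h = c(2)[rule_format, OF herm_on_subset[OF H1.herm_fibre V]]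
  show ?thesis unfolding rho_def Let_def k h using c(1) by simp
qed

lemma rho_real:
  assumes V: "V \<subseteq> fibre E z" and b: "basis_list V b"
  shows "\<exists>x>0. rho z V = of_real x"
proof -
  obtain x where x: "x > 0" "Determinant.det (gram (K z) b) = of_real x"
    using det_gram_pos[OF herm_on_subset[OF K.herm_fibre V] b] by (elim exE conjE)
  obtain y where y: "y > 0" "Determinant.det (gram (H1 z) b) = of_real y"
    using det_gram_pos[OF herm_on_subset[OF H1.herm_fibre V] b] by (elim exE conjE)
  show ?thesis unfolding rho_eq[OF V b] x(2) y(2) using x(1) y(1) by (intro exI[of _ "x / y"]) simp
qed

lemma rho_bounded:
  assumes V: "V \<subseteq> fibre E z" "subspace V" and b: "basis_list V b" and C: "C \<ge> 1"
    and KH: "\<forall>v\<in>fibre E z. Re (K z v v) \<le> C * Re (H1 z v v)"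
    and HK: "\<forall>v\<in>fibre E z. Re (H1 z v v) \<le> C * Re (K z v v)"
  shows "Re (rho z V) \<le> fact rk * C ^ rk" "inverse (fact rk * C ^ rk) \<le> Re (rho z V)"
proof -
  let ?M = "fact rk * C ^ rk"
  note hK = herm_on_subset[OF K.herm_fibre V(1)] and hH = herm_on_subset[OF H1.herm_fibre V(1)]
  obtain x where x: "x > 0" "Determinant.det (gram (K z) b) = of_real x" using det_gram_pos[OF hK b] by (elim exE conjE)
  obtain y where y: "y > 0" "Determinant.det (gram (H1 z) b) = of_real y" using det_gram_pos[OF hH b] by (elim exE conjE)
  have "finite (set (ev (frame_at E z) z))" "independent (set b)" using b by (auto simp: basis_list_def)
  moreover have "set b \<subseteq> span (set (ev (frame_at E z) z))"
    using basis_list_set[OF b] V(1) basis_frame_at[of z] by (auto simp: basis_list_def)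
  ultimately have "card (set b) \<le> card (set (ev (frame_at E z) z))" using independent_span_bound by blast
  moreover have "card (set (ev (frame_at E z) z)) = rk"
    using basis_frame_at[of z] length_frame[OF basis_frame_at[of z]] distinct_card[of "ev (frame_at E z) z"]
    unfolding basis_list_def by metis
  moreover have "card (set b) = length b" using b distinct_card unfolding basis_list_def by blast
  ultimately have "length b \<le> rk" by metis
  \<comment> \<open>The dimension of \<open>V\<close> is at most \<open>rk\<close> and
    \<open>C \<ge> 1\<close>, so one constant serves both summands at every point.\<close>
  then have M: "fact (length b) * C ^ length b \<le> ?M"
    using C by (intro mult_mono fact_mono power_increasing) auto
  have "x \<le> fact (length b) * C ^ length b * y"
    using det_gram_le[OF hK hH b, of C] KH V(1) C unfolding x(2) y(2) Re_complex_of_real by (auto simp: subset_iff)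
  also have "\<dots> \<le> ?M * y" using M y(1) by (intro mult_right_mono) auto
  finally have xy: "x \<le> ?M * y" .
  have "y \<le> fact (length b) * C ^ length b * x"
    using det_gram_le[OF hH hK b, of C] HK V(1) C unfolding x(2) y(2) Re_complex_of_real by (auto simp: subset_iff)
  also have "\<dots> \<le> ?M * x" using M x(1) by (intro mult_right_mono) auto
  finally have yx: "y \<le> ?M * x" .
  have "rho z V = of_real (x / y)" unfolding rho_eq[OF V(1) b] x(2) y(2) by simp
  then have r: "Re (rho z V) = x / y" by (simp only: Re_complex_of_real)
  have M0: "?M > 0" using C by simp
  show "Re (rho z V) \<le> ?M" unfolding r using xy y(1) by (simp add: pos_divide_le_eq)
  show "inverse ?M \<le> Re (rho z V)" unfolding r using yx y(1) M0 by (simp add: field_simps)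
qed

end

locale split_pair = he_pair E K H1 H2 + hvb_proj E \<pi>
  for E :: "('v::ab_group_add) hol_bundle" and K H1 H2 \<pi> +
  assumes orth: "u \<in> im z \<Longrightarrow> w \<in> ker z \<Longrightarrow> H1 z u w = 0"
begin

sublocale C: hvb_proj E "\<lambda>z v. v - \<pi> z v" by (rule compl)

lemma im_subset: "im z \<subseteq> fibre E z" "ker z \<subseteq> fibre E z" by (auto simp: im_def ker_def)

lemma im_subspace: "subspace (im z)" "subspace (ker z)"
  unfolding im_def ker_def by (rule subspace_image[OF subspace_fibre endo_proj idem] subspace_kernel[OF subspace_fibre endo_proj idem])+

lemma ker_bases: "\<exists>b. basis_list (ker z) b" using C.im_bases[of z] unfolding compl_im .

text \<open>Its logarithm is the bounded function whose Laplacian measures by how much the degree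
  densities fail to add up.\<close>

definition ratio :: "complex \<Rightarrow> complex" where "ratio z = rho z (im z) * rho z (ker z)"

lemma ratio_real: "\<exists>x>0. ratio z = of_real x"
proof -
  obtain a b where "basis_list (im z) a" "basis_list (ker z) b" using im_bases ker_bases by metis
  note r = rho_real[OF im_subset(1) this(1)] rho_real[OF im_subset(2) this(2)]
  obtain x y where "x > 0" "rho z (im z) = of_real x" "y > 0" "rho z (ker z) = of_real y" using r by (elim exE conjE)
  then show ?thesis by (intro exI[of _ "x * y"]) (simp add: ratio_def)
qed

lemma ratio_pos: "ratio z \<in> \<real> \<and> Re (ratio z) > 0"
proof -
  obtain x where "x > 0" "ratio z = of_real x" using ratio_real[of z] by (elim exE conjE)
  then show ?thesis by simp
qed

text \<open>Mutual domination of \<open>K\<close> and \<open>H1\<close> confines each of the two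
  factors to the interval from \<open>1 / M\<close> to \<open>M\<close>, so the logarithm of the
  product has modulus at most \<open>ln (M * M)\<close>.\<close>

lemma ln_ratio_bounded: "\<exists>C. AE z in lborel. norm (Ln (ratio z)) \<le> C"
proof -
  obtain C1 where C1: "C1 \<ge> 1" "AE z in lborel. \<forall>v\<in>fibre E z. Re (K z v v) \<le> C1 * Re (H1 z v v)"
    using dominated_metrics(2) unfolding dominated_def by (elim exE conjE)
  obtain C2 where C2: "C2 \<ge> 1" "AE z in lborel. \<forall>v\<in>fibre E z. Re (H1 z v v) \<le> C2 * Re (K z v v)"
    using dominated_metrics(1) unfolding dominated_def by (elim exE conjE)
  define C where "C = max C1 C2"
  have C: "C \<ge> 1" "C1 \<le> C" "C2 \<le> C" using C1(1) by (auto simp: C_def)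
  define M where "M = fact rk * C ^ rk"
  have M0: "M > 0" using C by (simp add: M_def)
  have "AE z in lborel. norm (Ln (ratio z)) \<le> ln (M * M)"
    using C1(2) C2(2)
  proof eventually_elim
    case (elim z)
    have KH: "\<forall>v\<in>fibre E z. Re (K z v v) \<le> C * Re (H1 z v v)"
    proof
      fix v assume v: "v \<in> fibre E z"
      have "C1 * Re (H1 z v v) \<le> C * Re (H1 z v v)"
        using C(2) herm_self(2)[OF subspace_fibre H1.herm_fibre v] by (rule mult_right_mono)
      then show "Re (K z v v) \<le> C * Re (H1 z v v)" using elim(1) v by fastforce
    qed
    have HK: "\<forall>v\<in>fibre E z. Re (H1 z v v) \<le> C * Re (K z v v)"
    proof
      fix v assume v: "v \<in> fibre E z"
      have "C2 * Re (K z v v) \<le> C * Re (K z v v)"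
        using C(3) herm_self(2)[OF subspace_fibre K.herm_fibre v] by (rule mult_right_mono)
      then show "Re (H1 z v v) \<le> C * Re (K z v v)" using elim(2) v by fastforce
    qed
    obtain a b where a: "basis_list (im z) a" and b: "basis_list (ker z) b" using im_bases ker_bases by metis
    note ra = rho_bounded[OF im_subset(1) im_subspace(1) a C(1) KH HK, folded M_def]
    note rb = rho_bounded[OF im_subset(2) im_subspace(2) b C(1) KH HK, folded M_def]
    obtain x where x: "x > 0" "rho z (im z) = of_real x" using rho_real[OF im_subset(1) a] by (elim exE conjE)
    obtain y where y: "y > 0" "rho z (ker z) = of_real y" using rho_real[OF im_subset(2) b] by (elim exE conjE)
    have xM: "x \<le> M" "inverse M \<le> x" "y \<le> M" "inverse M \<le> y" using ra rb unfolding x(2) y(2) by simp_all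
    have "ratio z = of_real (x * y)" by (simp add: ratio_def x(2) y(2))
    then have "Ln (ratio z) = of_real (ln (x * y))" using x(1) y(1) by (simp only: Ln_of_real mult_pos_pos)
    then have n: "norm (Ln (ratio z)) = \<bar>ln (x * y)\<bar>" by (simp only: norm_of_real)
    have "x * y \<le> M * M" using xM x(1) y(1) M0 by (intro mult_mono) auto
    then have "ln (x * y) \<le> ln (M * M)" using x(1) y(1) M0 by simp
    moreover have "inverse M * inverse M \<le> x * y" using xM x(1) y(1) M0 by (intro mult_mono) auto
    then have "inverse (M * M) \<le> x * y" by simp
    then have "ln (inverse (M * M)) \<le> ln (x * y)" using x(1) y(1) M0 by (subst ln_le_cancel_iff) auto
    then have "- ln (M * M) \<le> ln (x * y)" using M0 by (subst (asm) ln_inverse) auto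
    ultimately show ?case unfolding n by simp
  qed
  then show ?thesis by blast
qed

text \<open>In adapted frames \<open>log ratio\<close> is the sum of the logarithmic Gram
  determinants of \<open>K\<close> on the two summands minus those of \<open>H1\<close>. The former
  give the two densities. The latter combine, by \<open>H1\<close>-orthogonality, into a single
  determinant that differs from the one of \<open>K\<close> on \<open>E\<close> by a harmonic
  logarithm, and so give the density of \<open>E\<close>.\<close>

lemma degree_density_split:
  shows "\<exists>N. open N \<and> z \<in> N \<and> smooth_on N (\<lambda>w. Ln (ratio w))"
    and "degree_density SB K z + degree_density C.SB K z - degree_density E K z =
      - 2 * Re (d_zbar (d_z (\<lambda>w. Ln (ratio w))) z)"
proof -
  interpret SK: hvb_metric SB K by (rule hvb_metric_subbundle[OF K.hvb_metric_axioms])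
  interpret SH: hvb_metric SB H1 by (rule hvb_metric_subbundle[OF H1.hvb_metric_axioms])
  interpret TK: hvb_metric C.SB K by (rule C.hvb_metric_subbundle[OF K.hvb_metric_axioms])
  interpret TH: hvb_metric C.SB H1 by (rule C.hvb_metric_subbundle[OF H1.hvb_metric_axioms])
  obtain N0 a b where N0: "open N0" "z \<in> N0" "set a \<subseteq> sheaf N0" "set b \<subseteq> C.sheaf N0"
    "\<forall>w\<in>N0. basis_list (im w) (ev a w) \<and> basis_list (ker w) (ev b w)" "hol_frame N0 (a @ b)"
    using adapted_frame[of z] by (elim exE conjE)
  obtain U e where U: "(U, e) \<in> frames E" "z \<in> U" and e: "hol_frame U e" by (rule local_frame)
  define N where "N = N0 \<inter> U"
  have N: "open N" "z \<in> N" "N \<subseteq> N0" "N \<subseteq> U" using N0(1,2) U(2) hol_frameD(1)[OF e] by (auto simp: N_def)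
  have fa: "(N0, a) \<in> frames SB" unfolding subbundle_simps using N0 by blast
  have fb: "(N0, b) \<in> frames C.SB" unfolding C.subbundle_simps compl_im using N0 by blast
  note Ka = SK.gram_det_frame[OF fa N0(2)] and Ha = SH.gram_det_frame[OF fa N0(2)]
  note Kb = TK.gram_det_frame[OF fb N0(2)] and Hb = TH.gram_det_frame[OF fb N0(2)]
  note Ke = K.gram_det_frame[OF U]
  have gd: "gram_det H f w = Determinant.det (gram (H w) (ev f w))" for H and f :: "(complex \<Rightarrow> 'v) list" and w
    by (simp add: gram_det_eq GM_def)
  have rat: "ratio w = gram_det K a w / gram_det H1 a w * (gram_det K b w / gram_det H1 b w)" if w: "w \<in> N0" for w
    unfolding ratio_def gd using N0(5) w rho_eq[OF im_subset(1), of w "ev a w"] rho_eq[OF im_subset(2), of w "ev b w"] by simp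
  have qa: "smooth_on N0 (\<lambda>w. gram_det K a w / gram_det H1 a w)" "\<forall>w\<in>N0. gram_det K a w / gram_det H1 a w \<noteq> 0"
    using Ka Ha by (auto intro!: smooth_on_divide)
  have qb: "smooth_on N0 (\<lambda>w. gram_det K b w / gram_det H1 b w)" "\<forall>w\<in>N0. gram_det K b w / gram_det H1 b w \<noteq> 0"
    using Kb Hb by (auto intro!: smooth_on_divide)
  have sr: "smooth_on N0 ratio"
    by (rule smooth_on_transform[OF N0(1) smooth_on_mult[OF N0(1) qa(1) qb(1)] rat])
  have rp: "\<forall>w\<in>N0. ratio w \<in> \<real> \<and> Re (ratio w) > 0" using ratio_pos by blast
  note Lr = dbar_d_Ln[OF N0(1,2) sr rp]
  show "\<exists>N. open N \<and> z \<in> N \<and> smooth_on N (\<lambda>w. Ln (ratio w))" using N0(1,2) Lr(2) by (intro exI[of _ N0] conjI)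
  have "dbar_dlog ratio z = dbar_dlog (\<lambda>w. gram_det K a w / gram_det H1 a w * (gram_det K b w / gram_det H1 b w)) z"
    by (rule dbar_dlog_cong[OF N0(1,2)]) (use rat in blast)
  also have "\<dots> = dbar_dlog (gram_det K a) z - dbar_dlog (gram_det H1 a) z +
      (dbar_dlog (gram_det K b) z - dbar_dlog (gram_det H1 b) z)"
    unfolding dbar_dlog_mult[OF N0(1,2) qa qb]
      dbar_dlog_divide[OF N0(1,2) Ka(2,3) Ha(2,3)] dbar_dlog_divide[OF N0(1,2) Kb(2,3) Hb(2,3)] ..
  finally have 1: "dbar_dlog ratio z = dbar_dlog (gram_det K a) z + dbar_dlog (gram_det K b) z -
      (dbar_dlog (gram_det H1 a) z + dbar_dlog (gram_det H1 b) z)" by simp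
  let ?h = "\<lambda>w. Determinant.det (trm e (a @ b) w)"
  have le: "length e = rk" "length (a @ b) = rk" using hol_frameD(2)[OF e] hol_frameD(2)[OF N0(6)] by auto
  have h: "?h holomorphic_on N"
  proof (rule holomorphic_det)
    show "\<forall>w\<in>N. trm e (a @ b) w \<in> carrier_mat rk rk" using trm_carrier[OF le(2,1)] by blast
    show "\<forall>i<rk. \<forall>j<rk. (\<lambda>w. trm e (a @ b) w $$ (i, j)) holomorphic_on N"
    proof (intro allI impI)
      fix i j assume ij: "i < rk" "j < rk"
      have "(\<lambda>w. cf (ev e w) j (((a @ b) ! i) w)) holomorphic_on N"
        by (rule holomorphic_on_subset[OF hol_frame_trans[OF N0(6) e ij]]) (use N in blast)
      then show "(\<lambda>w. trm e (a @ b) w $$ (i, j)) holomorphic_on N" using ij le by (simp add: trm_index)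
    qed
  qed
  have h0: "\<forall>w\<in>N. ?h w \<noteq> 0"
    using det_trm[OF hol_frameD(4)[OF e] hol_frameD(4)[OF N0(6)]] N(3,4) by blast
  \<comment> \<open>Orthogonality merges the two factors into the determinant of the adapted frame;
    passing to the frame \<open>e\<close> costs the squared modulus of \<open>?h\<close>, and in
    \<open>e\<close> the determinants of \<open>H1\<close> and \<open>K\<close> agree by
    compatibility.\<close>
  have prod: "gram_det H1 a w * gram_det H1 b w = ?h w * cnj (?h w) * gram_det K e w" if w: "w \<in> N" for w
  proof -
    have w0: "w \<in> N0" and wU: "w \<in> U" using w N by auto
    have "set (ev a w) \<subseteq> im w" "set (ev b w) \<subseteq> ker w" using N0(5) w0 basis_list_set by blast+
    then have "Determinant.det (gram (H1 w) (ev a w @ ev b w)) = gram_det H1 a w * gram_det H1 b w"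
      unfolding gd by (intro det_gram_orthogonal orth) auto
    then have "gram_det H1 a w * gram_det H1 b w = Determinant.det (gram (H1 w) (ev (a @ b) w))" by (simp add: ev_def)
    also have "\<dots> = of_real ((norm (?h w))\<^sup>2) * gram_det H1 e w"
      unfolding gd trm_def
      by (rule det_gram_change[OF H1.herm_fibre hol_frameD(4)[OF e wU] basis_list_set[OF hol_frameD(4)[OF N0(6) w0]]])
        (simp only: ev_simps le)
    also have "gram_det H1 e w = gram_det K e w" using det_GM_eq(2)[OF U(1) wU] by (simp add: gram_det_eq)
    finally show ?thesis by (simp only: complex_norm_square)
  qed
  note sub = smooth_on_subset[OF _ N(3)]
  have "dbar_dlog (gram_det H1 a) z + dbar_dlog (gram_det H1 b) z = dbar_dlog (\<lambda>w. gram_det H1 a w * gram_det H1 b w) z"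
    by (rule dbar_dlog_mult[OF N0(1,2) Ha(2,3) Hb(2,3), symmetric])
  also have "\<dots> = dbar_dlog (\<lambda>w. ?h w * cnj (?h w) * gram_det K e w) z"
    by (rule dbar_dlog_cong[OF N(1,2)]) (use prod in blast)
  also have "\<dots> = dbar_dlog (\<lambda>w. ?h w * cnj (?h w)) z + dbar_dlog (gram_det K e) z"
  proof (rule dbar_dlog_mult[OF N(1,2)])
    note sh = holomorphic_imp_smooth_on[OF N(1) h]
    show "smooth_on N (\<lambda>w. ?h w * cnj (?h w))" by (rule smooth_on_mult[OF N(1) sh smooth_on_cnj[OF N(1) sh]])
    show "\<forall>w\<in>N. ?h w * cnj (?h w) \<noteq> 0" using h0 by simp
    show "smooth_on N (gram_det K e)" by (rule smooth_on_subset[OF Ke(2) N(4)])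
    show "\<forall>w\<in>N. gram_det K e w \<noteq> 0" using Ke(3) N(4) by blast
  qed
  also have "dbar_dlog (\<lambda>w. ?h w * cnj (?h w)) z = 0" by (rule dbar_dlog_norm_holomorphic[OF N(1,2) h h0])
  finally have 2: "dbar_dlog (gram_det H1 a) z + dbar_dlog (gram_det H1 b) z = dbar_dlog (gram_det K e) z" by simp
  show "degree_density SB K z + degree_density C.SB K z - degree_density E K z =
      - 2 * Re (d_zbar (d_z (\<lambda>w. Ln (ratio w))) z)"
    unfolding Lr(1) 1 2 SK.degree_density_gram[OF fa N0(2)] TK.degree_density_gram[OF fb N0(2)] K.degree_density_gram[OF U]
    by simp
qed

text \<open>Both summands are tested, since only the sum of their degrees is controlled. Nonzero
  fibres of image and kernel at one point suffice, as the ranks are constant.\<close>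

lemma not_stable:
  assumes int: "integrable lborel (norm_F E K)" and stable: "stable_bundle E K"
    and ne: "im z0 \<noteq> {0}" "ker z0 \<noteq> {0}"
  shows False
proof -
  interpret SK: hvb_metric SB K by (rule hvb_metric_subbundle[OF K.hvb_metric_axioms])
  interpret TK: hvb_metric C.SB K by (rule C.hvb_metric_subbundle[OF K.hvb_metric_axioms])
  obtain a b where a: "basis_list (im z0) a" and b: "basis_list (ker z0) b" using im_bases ker_bases by metis
  have pos: "length a > 0" "length b > 0"
    using a b ne by (auto simp: basis_list_def)
  have sum: "length a + length b = rk"
    using length_frame[OF basis_list_append[OF subspace_fibre endo_proj idem a[unfolded im_def] b[unfolded ker_def]]] by simp
  have lt: "length a < rk" "length b < rk" using pos sum by linarith+
  have rS: "bundle_rank SB = length a"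
    using SK.dim_fibre[of z0] dim_basis_list[OF a] unfolding SK.rk_def subbundle_simps by simp
  have rT: "bundle_rank C.SB = length b"
    using TK.dim_fibre[of z0] dim_basis_list[OF b] unfolding TK.rk_def C.subbundle_simps compl_im by simp
  have base: "bundle_base E = UNIV" using hol_vb by (simp add: hol_vector_bundle_def)
  have deg: "bundle_degree B K = ext_integral (degree_density B K)" if "bundle_base B = UNIV" for B :: "'v hol_bundle"
    using that by (simp add: bundle_degree_def ext_integral_def)
  note st = stable[unfolded stable_bundle_def rk_def[symmetric], rule_format]
  have s1: "slope SB K < slope E K"
    by (rule st) (unfold rS, intro conjI saturated pos lt)
  have s2: "slope C.SB K < slope E K"
    by (rule st) (unfold rT, intro conjI C.saturated pos lt)
  have slopes: "ext_integral (degree_density SB K) / ereal (real (length a)) <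
      ext_integral (degree_density E K) / ereal (real (length a) + real (length b))"
    "ext_integral (degree_density C.SB K) / ereal (real (length b)) <
      ext_integral (degree_density E K) / ereal (real (length a) + real (length b))"
    using s1 s2 sum unfolding slope_def deg[OF base] deg[OF bundle_base_subbundle] deg[OF C.bundle_base_subbundle] rS rT
      rk_def[symmetric] of_nat_add[symmetric] by simp_all
  let ?f = "\<lambda>w. Ln (ratio w)" let ?w = "\<lambda>z. Re (d_zbar (d_z ?f) z)"
  have f: "smooth_on UNIV ?f" by (rule smooth_on_local) (rule degree_density_split(1))
  have freal: "?f z \<in> \<real>" for z
  proof -
    obtain x where "x > 0" "ratio z = of_real x" using ratio_real[of z] by (elim exE conjE)
    then show ?thesis by (simp add: Ln_of_real)
  qed
  obtain C where C: "AE z in lborel. norm (?f z) \<le> C" using ln_ratio_bounded by (elim exE)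
  have meas: "degree_density B K \<in> borel_measurable borel" if "hvb_metric B K" for B :: "'v hol_bundle"
    using hvb_metric.continuous_degree_density[OF that] by (rule borel_measurable_continuous_onI)
  have "integrable lborel (degree_density E K)"
  proof (rule Bochner_Integration.integrable_bound[OF integrable_mult_right[OF int, of "real rk"]])
    show "degree_density E K \<in> borel_measurable lborel" using meas[OF K.hvb_metric_axioms] by simp
    show "AE z in lborel. norm (degree_density E K z) \<le> norm (real rk * norm_F E K z)"
      using K.degree_density_le by (intro AE_I2) (metis abs_ge_self order_trans real_norm_def)
  qed
  moreover have "?w \<in> borel_measurable borel"
    by (intro borel_measurable_continuous_onI continuous_intros smooth_on_imp_continuous_on smooth_on_d_zbar smooth_on_d_z f) auto
  ultimately show False
    using pos meas[OF SK.hvb_metric_axioms] meas[OF TK.hvb_metric_axioms] slopes parabolic_smooth[OF f freal C]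
    by (intro degree_contradiction[where s = "real (length a)" and t = "real (length b)", OF _ _ _ _ degree_density_split(2)]) auto
qed

end

theorem theorem4p7:
  fixes E :: "('v::ab_group_add) hol_bundle" and K H1 H2 :: "'v metric"
  assumes "hol_vector_bundle E"
    and "hermitian_metric E K"
    and "integrable lborel (norm_F E K)"
    and "stable_bundle E K"
    and "hermitian_einstein E H1" and "compatible E K H1"
    and "hermitian_einstein E H2" and "compatible E K H2"
  shows "\<forall>z. \<forall>u\<in>fibre E z. \<forall>v\<in>fibre E z. H1 z u v = H2 z u v"
proof -
  have herm: "hermitian_metric E H1" "hermitian_metric E H2"
    using assms(5,7) by (simp_all only: hermitian_einstein_def)
  interpret he_pair E K H1 H2
    by unfold_locales (fact assms herm)+
  show ?thesis
    using equal_or_projection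
  proof (elim disjE exE conjE)
    fix \<pi> assume proj: "hol_endo \<pi>" and idem: "\<forall>z. \<forall>v\<in>fibre E z. \<pi> z (\<pi> z v) = \<pi> z v"
      and orth: "\<forall>z. \<forall>u\<in>fibre E z. \<forall>w\<in>fibre E z. \<pi> z u = u \<longrightarrow> \<pi> z w = 0 \<longrightarrow> H1 z u w = 0"
      and ne: "\<forall>z. \<exists>v\<in>fibre E z. \<pi> z v \<noteq> 0" "\<forall>z. \<exists>v\<in>fibre E z. \<pi> z v \<noteq> v"
    interpret hvb_proj E \<pi> by unfold_locales (rule proj, rule spec[OF idem])
    interpret split_pair E K H1 H2 \<pi>
      by unfold_locales (rule orth[rule_format], simp_all add: im_def ker_def)
    obtain v where v: "v \<in> fibre E 0" "\<pi> 0 v \<noteq> 0" using spec[OF ne(1)] by (rule bexE)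
    obtain w where w: "w \<in> fibre E 0" "\<pi> 0 w \<noteq> w" using spec[OF ne(2)] by (rule bexE)
    have "\<pi> 0 v \<in> im 0" using bspec[OF idem v(1)] endo_in[OF endo_proj v(1)] by (simp add: im_def)
    then have i: "im 0 \<noteq> {0}" using v(2) by auto
    have k: "w - \<pi> 0 w \<in> C.im 0"
      using bspec[OF C.idem w(1)] endo_in[OF C.endo_proj w(1)] unfolding C.im_def by simp
    have "ker 0 \<noteq> {0}"
    proof
      assume "ker 0 = {0}"
      with k have "w - \<pi> 0 w = 0" unfolding compl_im by simp
      then show False using w(2) by simp
    qed
    from not_stable[OF assms(3,4) i this] show ?thesis ..
  qed
qed

end
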